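(* Let $f:S^n\to S^m$ be an LOMSE of $(n,p,k)$-type with $(n,p)=(3,2)$, $k\ge4$, or $(n,p)=(5,4)$, $k\ge6$. Then there exist infinitely many analytic solutions to the Dirichlet problem for the minimal surface equations on the open unit disk $\mathbb D^{n+1}\subset\mathbb R^{n+1}$ with boundary data $f_{\varphi_0}:=\varphi_0\cdot f$ on $\partial\mathbb D^{n+1}=S^n$, where $$\varphi_0=\sqrt{\frac{p-n\lambda^{-2}}{n-p}},\qquad \lambda^2=\frac{k(k+n-1)}{p}.$$
   Context: $S^d\subset\mathbb R^{d+1}$ is the unit sphere with its canonical metric $g_d$. For a smooth map $f:S^n\to S^m$ and $\theta\in(0,\pi/2)$ put $M_{f,\theta}=\{(\cos\theta\cdot x,\ \sin\theta\cdot f(x)):x\in S^n\}\subset S^{n+m+1}$. The map $f$ is a Lawson-Osserman map (LOM) if there is some $\theta\in(0,\pi/2)$ such that $M_{f,\theta}$ is a minimal submanifold of $S^{n+m+1}$. An LOMSE is an LOM which is not a totally geodesic isometric embedding and such that for each $x\in S^n$ all nonzero singular values of $(f_* )_x:(T_xS^n,g_n)\to(T_{f(x)}S^m,g_m)$ are equal. It is a fact that for an LOMSE the common nonzero singular value $\lambda$ and its multiplicity $p$ are constant, that there is an integer $k\ge2$ such that all components of $f$ are spherical harmonics of degree $k$ on $S^n$, that $\lambda^2=k(k+n-1)/p$, and that $\theta$ is unique, with $\tan\theta=\varphi_0$; such $f$ is said to be of $(n,p,k)$-type. An analytic solution to the Dirichlet problem with boundary data $b:\partial\mathbb D^{n+1}\to\mathbb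 R^{m+1}$ is a map $F\in C^0(\overline{\mathbb D^{n+1}};\mathbb R^{m+1})$, real analytic in $\mathbb D^{n+1}$, with $F=b$ on $\partial\mathbb D^{n+1}$, whose graph over $\mathbb D^{n+1}$ is a minimal submanifold of $\mathbb R^{n+1}\times\mathbb R^{m+1}$. *)

theory Defs
  imports "HOL-Analysis.Analysis"
begin

section \<open>Smooth and real analytic maps\<close>

primrec Ck_on :: "nat \<Rightarrow> 'a::euclidean_space set \<Rightarrow> ('a \<Rightarrow> 'b::euclidean_space) \<Rightarrow> bool" where
  "Ck_on 0 U f \<longleftrightarrow> continuous_on U f"
| "Ck_on (Suc k) U f \<longleftrightarrow>
     (\<forall>x\<in>U. f differentiable (at x)) \<and>
     (\<forall>v. Ck_on k U (\<lambda>x. frechet_derivative f (at x) v))"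

text \<open>\<^const>\<open>Ck_on\<close> is meant for open sets only. On an arbitrary set, smooth means that there are
  local smooth extensions to open sets of the surrounding Euclidean space.\<close>

definition smooth_on :: "'a::euclidean_space set \<Rightarrow> ('a \<Rightarrow> 'b::euclidean_space) \<Rightarrow> bool" where
  "smooth_on S f \<longleftrightarrow>
     (\<forall>x\<in>S. \<exists>U g. open U \<and> x \<in> U \<and> (\<forall>k. Ck_on k U g) \<and> (\<forall>y\<in>S \<inter> U. g y = f y))"

text \<open>The multi-indices are the functions \<open>\<alpha>\<close> from the standard basis to the natural numbers.\<close>

definition real_analytic_on :: "'a::euclidean_space set \<Rightarrow> ('a \<Rightarrow> 'b::euclidean_space) \<Rightarrow> bool" where
  "real_analytic_on U f \<longleftrightarrow>
     (\<forall>a\<in>U. \<exists>r>0. \<exists>c :: ('a \<Rightarrow> nat) \<Rightarrow> 'b. ball a r \<subseteq> U \<and>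
        (\<forall>x\<in>ball a r.
           ((\<lambda>\<alpha>. (\<Prod>b\<in>Basis. ((x - a) \<bullet> b) ^ \<alpha> b) *\<^sub>R c \<alpha>) has_sum f x) (Basis \<rightarrow>\<^sub>E UNIV)))"

section \<open>Submanifolds of Euclidean space and their extrinsic geometry\<close>

definition smooth_submanifold :: "nat \<Rightarrow> 'e::euclidean_space set \<Rightarrow> bool" where
  "smooth_submanifold d M \<longleftrightarrow>
     (\<forall>p\<in>M. \<exists>W \<Phi> \<Psi> V. open W \<and> p \<in> W \<and> open (\<Phi> ` W) \<and>
        smooth_on W \<Phi> \<and> smooth_on (\<Phi> ` W) \<Psi> \<and> (\<forall>x\<in>W. \<Psi> (\<Phi> x) = x) \<and>
        subspace (V :: 'e set) \<and> dim V = d \<and> \<Phi> ` (M \<inter> W) = \<Phi> ` W \<inter> V)"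

definition tangent_space :: "'e::euclidean_space set \<Rightarrow> 'e \<Rightarrow> 'e set" where
  "tangent_space M p = {v. \<exists>c \<epsilon>. \<epsilon> > 0 \<and> smooth_on {-\<epsilon><..<\<epsilon>} c \<and> c ` {-\<epsilon><..<\<epsilon>} \<subseteq> M \<and>
     c (0::real) = p \<and> (c has_vector_derivative v) (at 0)}"

text \<open>In the following, \<open>N\<close> is the surrounding submanifold of a Euclidean space (for instance the whole
  space or a round sphere), with the induced metric, and \<open>M\<close> is a submanifold contained in \<open>N\<close>.\<close>

definition normal_space :: "'e::euclidean_space set \<Rightarrow> 'e set \<Rightarrow> 'e \<Rightarrow> 'e set" where
  "normal_space N M p = {w \<in> tangent_space N p. \<forall>v\<in>tangent_space M p. w \<bullet> v = 0}"

text \<open>A derivative within \<open>M\<close> at \<open>p\<close> is uniquely determined on the tangent space of \<open>M\<close> at \<open>p\<close>,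
  and only there.\<close>

definition differential_on ::
    "'e::euclidean_space set \<Rightarrow> ('e \<Rightarrow> 'f::euclidean_space) \<Rightarrow> 'e \<Rightarrow> 'e \<Rightarrow> 'f" where
  "differential_on M f p = frechet_derivative f (at p within M)"

definition local_tangent_field :: "'e::euclidean_space set \<Rightarrow> 'e \<Rightarrow> ('e \<Rightarrow> 'e) \<Rightarrow> bool" where
  "local_tangent_field M p Y \<longleftrightarrow>
     (\<exists>W. open W \<and> p \<in> W \<and> smooth_on (M \<inter> W) Y \<and> (\<forall>q\<in>M \<inter> W. Y q \<in> tangent_space M q))"

text \<open>\<open>B(u, v)\<close> is the normal part of the covariant derivative in \<open>N\<close>, in direction \<open>u\<close>, of a local
  tangent field \<open>Y\<close> with \<open>Y(p) = v\<close>; it does not depend on \<open>Y\<close>. The covariant derivative is the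
  projection of the flat derivative to the tangent space of \<open>N\<close>, and \<^const>\<open>closest_point\<close> of a linear
  subspace is the orthogonal projection, so one projection to the normal space of \<open>M\<close> in \<open>N\<close> suffices.\<close>

definition second_fundamental_form ::
    "'e::euclidean_space set \<Rightarrow> 'e set \<Rightarrow> 'e \<Rightarrow> 'e \<Rightarrow> 'e \<Rightarrow> 'e" where
  "second_fundamental_form N M p u v =
     (THE w. \<exists>Y. local_tangent_field M p Y \<and> Y p = v \<and>
        w = closest_point (normal_space N M p) (differential_on M Y p u))"

definition orthonormal_basis_of :: "'e::euclidean_space set \<Rightarrow> 'e set \<Rightarrow> bool" where
  "orthonormal_basis_of V E \<longleftrightarrow> pairwise orthogonal E \<and> (\<forall>e\<in>E. norm e = 1) \<and> span E = V"

definition mean_curvature_vector :: "'e::euclidean_space set \<Rightarrow> 'e set \<Rightarrow> 'e \<Rightarrow> 'e" where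
  "mean_curvature_vector N M p =
     (let E = (SOME E. orthonormal_basis_of (tangent_space M p) E)
      in \<Sum>e\<in>E. second_fundamental_form N M p e e)"

definition minimal_submanifold :: "'e::euclidean_space set \<Rightarrow> 'e set \<Rightarrow> bool" where
  "minimal_submanifold N M \<longleftrightarrow>
     (\<exists>d. smooth_submanifold d M) \<and> M \<subseteq> N \<and> (\<forall>p\<in>M. mean_curvature_vector N M p = 0)"

definition totally_geodesic :: "'e::euclidean_space set \<Rightarrow> 'e set \<Rightarrow> bool" where
  "totally_geodesic N M \<longleftrightarrow>
     (\<exists>d. smooth_submanifold d M) \<and> M \<subseteq> N \<and>
     (\<forall>p\<in>M. \<forall>u\<in>tangent_space M p. \<forall>v\<in>tangent_space M p. second_fundamental_form N M p u v = 0)"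

section \<open>Maps between spheres\<close>

abbreviation unit_sphere :: "'a::euclidean_space set" where
  "unit_sphere \<equiv> sphere 0 1"

abbreviation sphere_differential ::
    "('a::euclidean_space \<Rightarrow> 'b::euclidean_space) \<Rightarrow> 'a \<Rightarrow> 'a \<Rightarrow> 'b" where
  "sphere_differential f x \<equiv> differential_on unit_sphere f x"

definition smooth_sphere_map :: "('a::euclidean_space \<Rightarrow> 'b::euclidean_space) \<Rightarrow> bool" where
  "smooth_sphere_map f \<longleftrightarrow> f ` unit_sphere \<subseteq> unit_sphere \<and> smooth_on unit_sphere f"

text \<open>The image lies in the unit sphere of the product space, whose norm is the Euclidean one.\<close>

definition LO_submanifold ::
    "('a::euclidean_space \<Rightarrow> 'b::euclidean_space) \<Rightarrow> real \<Rightarrow> ('a \<times> 'b) set" where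
  "LO_submanifold f \<theta> = (\<lambda>x. (cos \<theta> *\<^sub>R x, sin \<theta> *\<^sub>R f x)) ` unit_sphere"

definition LOM :: "('a::euclidean_space \<Rightarrow> 'b::euclidean_space) \<Rightarrow> bool" where
  "LOM f \<longleftrightarrow> smooth_sphere_map f \<and>
     (\<exists>\<theta>\<in>{0<..<pi/2}. minimal_submanifold unit_sphere (LO_submanifold f \<theta>))"

text \<open>The first two conditions make \<open>f\<close> an isometric immersion; as the sphere is compact, such an
  \<open>f\<close> is an embedding as soon as it is injective.\<close>

definition totally_geodesic_isometric_embedding ::
    "('a::euclidean_space \<Rightarrow> 'b::euclidean_space) \<Rightarrow> bool" where
  "totally_geodesic_isometric_embedding f \<longleftrightarrow>
     smooth_sphere_map f \<and>
     (\<forall>x\<in>unit_sphere. \<forall>u\<in>tangent_space unit_sphere x. \<forall>v\<in>tangent_space unit_sphere x.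
        sphere_differential f x u \<bullet> sphere_differential f x v = u \<bullet> v) \<and>
     inj_on f unit_sphere \<and> totally_geodesic unit_sphere (f ` unit_sphere)"

text \<open>For a linear map \<open>A\<close> on a subspace \<open>V\<close>, this is the eigenspace of \<open>A\<^sup>*A\<close> for the eigenvalue
  \<open>\<sigma>\<^sup>2\<close>, where the adjoint is taken with respect to \<open>V\<close>.\<close>

definition singular_space ::
    "'a::euclidean_space set \<Rightarrow> ('a \<Rightarrow> 'b::euclidean_space) \<Rightarrow> real \<Rightarrow> 'a set" where
  "singular_space V A \<sigma> = {v \<in> V. \<forall>w\<in>V. A v \<bullet> A w = \<sigma>\<^sup>2 * (v \<bullet> w)}"

definition singular_value ::
    "'a::euclidean_space set \<Rightarrow> ('a \<Rightarrow> 'b::euclidean_space) \<Rightarrow> real \<Rightarrow> bool" where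
  "singular_value V A \<sigma> \<longleftrightarrow> \<sigma> \<ge> 0 \<and> singular_space V A \<sigma> \<noteq> {0}"

definition singular_multiplicity ::
    "'a::euclidean_space set \<Rightarrow> ('a \<Rightarrow> 'b::euclidean_space) \<Rightarrow> real \<Rightarrow> nat" where
  "singular_multiplicity V A \<sigma> = dim (singular_space V A \<sigma>)"

definition LOMSE :: "('a::euclidean_space \<Rightarrow> 'b::euclidean_space) \<Rightarrow> bool" where
  "LOMSE f \<longleftrightarrow> LOM f \<and> \<not> totally_geodesic_isometric_embedding f \<and>
     (\<forall>x\<in>unit_sphere. \<forall>\<sigma> \<tau>.
        singular_value (tangent_space unit_sphere x) (sphere_differential f x) \<sigma> \<longrightarrow> \<sigma> \<noteq> 0 \<longrightarrow>
        singular_value (tangent_space unit_sphere x) (sphere_differential f x) \<tau> \<longrightarrow> \<tau> \<noteq> 0 \<longrightarrow>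
        \<sigma> = \<tau>)"

definition laplacian :: "('a::euclidean_space \<Rightarrow> real) \<Rightarrow> 'a \<Rightarrow> real" where
  "laplacian P x =
     (\<Sum>b\<in>Basis. frechet_derivative (\<lambda>y. frechet_derivative P (at y) b) (at x) b)"

definition spherical_harmonic :: "nat \<Rightarrow> ('a::euclidean_space \<Rightarrow> real) \<Rightarrow> bool" where
  "spherical_harmonic k h \<longleftrightarrow>
     (\<exists>P. real_polynomial_function P \<and> (\<forall>t x. P (t *\<^sub>R x) = t ^ k * P x) \<and>
        (\<forall>x. laplacian P x = 0) \<and> (\<forall>x\<in>unit_sphere. h x = P x))"

text \<open>Being of \<open>(n, p, k)\<close>-type, where \<open>n\<close> is the dimension of the domain sphere: \<open>p\<close> is the
  multiplicity of the nonzero singular value and \<open>k\<close> the degree of the components.\<close>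

definition LOMSE_of_type ::
    "nat \<Rightarrow> nat \<Rightarrow> nat \<Rightarrow> ('a::euclidean_space \<Rightarrow> 'b::euclidean_space) \<Rightarrow> bool" where
  "LOMSE_of_type n p k (f :: 'a \<Rightarrow> 'b) \<longleftrightarrow> DIM('a) = n + 1 \<and> LOMSE f \<and>
     (\<forall>x\<in>unit_sphere. \<exists>\<sigma>>0.
        singular_value (tangent_space unit_sphere x) (sphere_differential f x) \<sigma> \<and>
        singular_multiplicity (tangent_space unit_sphere x) (sphere_differential f x) \<sigma> = p) \<and>
     (\<forall>b\<in>Basis. spherical_harmonic k (\<lambda>x. f x \<bullet> b))"

section \<open>The Dirichlet problem for the minimal surface equations\<close>

text \<open>A solution lives on the closed unit ball. Membership in \<^const>\<open>extensional\<close> fixes the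
  meaningless values outside it, so that different functions here are different solutions.\<close>

definition analytic_Dirichlet_solutions ::
    "('a::euclidean_space \<Rightarrow> 'b::euclidean_space) \<Rightarrow> ('a \<Rightarrow> 'b) set" where
  "analytic_Dirichlet_solutions b =
     {F \<in> extensional (cball 0 1).
        continuous_on (cball 0 1) F \<and> real_analytic_on (ball 0 1) F \<and>
        (\<forall>x\<in>sphere 0 1. F x = b x) \<and>
        minimal_submanifold (UNIV :: ('a \<times> 'b) set) ((\<lambda>x. (x, F x)) ` ball 0 1)}"

end

theory Submission
  imports Defs
begin

text \<open>An LOMSE is the restriction of a homogeneous harmonic polynomial map \<open>P\<close> of degree \<open>k\<close>, and minimality
of the Lawson-Osserman sphere together with harmonicity determines the traces of the second derivatives
of \<open>P\<close> that occur in the mean curvature of the graph of \<open>x \<mapsto> \<rho>(|x|) f(x/|x|)\<close>. That graph is minimal iff \<open>\<rho>\<close>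
solves a second order ODE. With \<open>\<phi> = \<rho>/r\<close>, \<open>\<sigma> = \<rho>'\<close> and \<open>t = ln r\<close> this becomes an autonomous planar system,
whose equilibrium \<open>\<phi> = \<sigma> = \<phi>\<^sub>0\<close> (the cone over the Lawson-Osserman sphere) is a spiral for the listed
dimensions and degrees. The orbit leaving the origin corresponds to \<open>\<rho> = r\<^sup>k G(r\<^sup>2)\<close> with \<open>G\<close> given by a convergent
power series; the profile curve is a geodesic of a conformal metric in the plane, which yields a Lyapunov
function and forces the orbit to exist for all times and to stay bounded. If \<open>\<phi>\<close> were eventually on one side
of \<open>\<phi>\<^sub>0\<close>, the orbit would converge to the equilibrium, contradicting the spiral. Hence \<open>\<phi>\<close> takes the value \<open>\<phi>\<^sub>0\<close> at infinitely many times, and rescaling each of the corresponding radii to \<open>1\<close> gives a different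
solution with boundary data \<open>\<phi>\<^sub>0 f\<close>.\<close>

section \<open>Differential calculus of smooth maps\<close>

text \<open>Both pairs (n, p) satisfy n = p + 1 with p even. The linearization of the planar system
  at the equilibrium is z'' + (n + 1) z' + 2 n (1 - n / (p L)) z = 0 with p L = k (k + n - 1), so a
  spiral means (n + 1)^2 < 8 n (1 - n / (p L)). For large k this tends to n^2 - 6 n + 1 < 0, which
  forces n \<le> 5; for n = 5, k = 6 it reads 36 < 110/3. Two obstacles shape the proof. The second
  fundamental form and the mean curvature are defined through choice operators (a derivative within
  a set, a definite description, an arbitrary basis), so they have to become explicit sums for
  parametrized images before any equation appears; one computation serves both for reading
  information off the Lawson-Osserman sphere and for verifying that graphs are minimal. And the
  radial equation is singular at r = 0, where the solutions still have to be real analytic; hence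
  power series are used with explicit norms: coefficient majorants for the equation in one variable,
  weighted l1 norms for compositions in several variables.\<close>

lemma frechet_derivative_eqI:
  "(f has_derivative f') (at x) \<Longrightarrow> frechet_derivative f (at x) = f'"
  using frechet_derivative_at by metis

lemma Ck_on_cong:
  assumes "open U" "\<And>x. x \<in> U \<Longrightarrow> f x = g x"
  shows "Ck_on k U f \<longleftrightarrow> Ck_on k U g"
  using assms(2)
proof (induction k arbitrary: f g)
  case 0
  then show ?case by (simp cong: continuous_on_cong)
next
  case (Suc k)
  have tr: "(f has_derivative D) (at x) \<longleftrightarrow> (g has_derivative D) (at x)" if "x \<in> U" for x D
    using has_derivative_transform_within_open[OF _ assms(1) that] Suc.prems by metis
  have d: "f differentiable (at x) \<longleftrightarrow> g differentiable (at x)" if "x \<in> U" for x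
    using tr[OF that] by (auto simp: differentiable_def)
  have e: "frechet_derivative f (at x) = frechet_derivative g (at x)" if "x \<in> U" for x
    unfolding frechet_derivative_def using tr[OF that] by simp
  have "Ck_on k U (\<lambda>x. frechet_derivative f (at x) v) \<longleftrightarrow>
        Ck_on k U (\<lambda>x. frechet_derivative g (at x) v)" for v
    by (rule Suc.IH) (simp add: e)
  then show ?case using d by auto
qed

lemma Ck_on_subset: "Ck_on k U f \<Longrightarrow> V \<subseteq> U \<Longrightarrow> Ck_on k V f"
  by (induction k arbitrary: f) (auto intro: continuous_on_subset)

lemma Ck_on_SucD: "Ck_on (Suc k) U f \<Longrightarrow> Ck_on k U f"
proof (induction k arbitrary: f)
  case 0
  then show ?case
    by (auto intro!: continuous_at_imp_continuous_on differentiable_imp_continuous_within)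
next
  case (Suc k)
  then show ?case by (metis Ck_on.simps(2))
qed

lemma Ck_on_SucI:
  assumes "open U" "\<And>x. x \<in> U \<Longrightarrow> (f has_derivative f' x) (at x)"
    and "\<And>v. Ck_on k U (\<lambda>x. f' x v)"
  shows "Ck_on (Suc k) U f"
proof -
  have "Ck_on k U (\<lambda>x. frechet_derivative f (at x) v)" for v
    using Ck_on_cong[OF assms(1), of "\<lambda>x. frechet_derivative f (at x) v" "\<lambda>x. f' x v"]
      assms(2,3) frechet_derivative_eqI by metis
  then show ?thesis using assms(2) by (auto simp: differentiable_def)
qed

lemma Ck_on_SucE:
  assumes "Ck_on (Suc k) U f" "x \<in> U"
  shows "(f has_derivative frechet_derivative f (at x)) (at x)"
  using assms frechet_derivative_works by (metis Ck_on.simps(2))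

lemma Ck_on_const [simp]: "Ck_on k U (\<lambda>x. c)"
  by (induction k arbitrary: c) auto

lemma Ck_on_bounded_linear:
  assumes "bounded_linear L"
  shows "Ck_on k U L"
proof -
  have "Ck_on k UNIV L"
  proof (cases k)
    case 0
    then show ?thesis using assms by (simp add: linear_continuous_on)
  next
    case (Suc j)
    show ?thesis unfolding Suc
      by (rule Ck_on_SucI[where f'="\<lambda>x. L"]) (use assms bounded_linear_imp_has_derivative in auto)
  qed
  then show ?thesis by (rule Ck_on_subset) auto
qed

lemma Ck_on_add:
  assumes "open U"
  shows "Ck_on k U f \<Longrightarrow> Ck_on k U g \<Longrightarrow> Ck_on k U (\<lambda>x. f x + g x)"
proof (induction k arbitrary: f g)
  case 0
  then show ?case by (simp add: continuous_on_add)
next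
  case (Suc k)
  show ?case
    by (rule Ck_on_SucI[where f'="\<lambda>x v. frechet_derivative f (at x) v + frechet_derivative g (at x) v"])
      (use assms Suc in \<open>auto intro!: has_derivative_add simp: frechet_derivative_works[symmetric]\<close>)
qed

lemma Ck_on_sum:
  assumes "open U" "\<And>i. i \<in> I \<Longrightarrow> Ck_on k U (f i)"
  shows "Ck_on k U (\<lambda>x. \<Sum>i\<in>I. f i x)"
  using assms(2) by (induction I rule: infinite_finite_induct) (auto intro: Ck_on_add[OF assms(1)])

lemma Ck_on_bilinear:
  assumes "bounded_bilinear B" "open U"
  shows "Ck_on k U f \<Longrightarrow> Ck_on k U g \<Longrightarrow> Ck_on k U (\<lambda>x. B (f x) (g x))"
proof (induction k arbitrary: f g)
  case 0
  then show ?case by (simp add: bounded_bilinear.continuous_on[OF assms(1)])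
next
  case (Suc k)
  have fk: "Ck_on k U f" "Ck_on k U g" using Suc.prems Ck_on_SucD by blast+
  show ?case
  proof (rule Ck_on_SucI[where f'="\<lambda>x v. B (f x) (frechet_derivative g (at x) v) +
        B (frechet_derivative f (at x) v) (g x)"])
    show "open U" by fact
    show "((\<lambda>x. B (f x) (g x)) has_derivative (\<lambda>v. B (f x) (frechet_derivative g (at x) v) +
        B (frechet_derivative f (at x) v) (g x))) (at x)" if "x \<in> U" for x
      by (rule bounded_bilinear.FDERIV[OF assms(1)]) (use Suc.prems that Ck_on_SucE in blast)+
    show "Ck_on k U (\<lambda>x. B (f x) (frechet_derivative g (at x) v) +
        B (frechet_derivative f (at x) v) (g x))" for v
      by (intro Ck_on_add assms(2) Suc.IH fk) (use Suc.prems in auto)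
  qed
qed

text \<open>Expanding the chain rule over \<open>Basis\<close> writes the derivative of the
  composite as a sum of products: a component of the derivative of \<open>f\<close>, times a
  directional derivative of \<open>g\<close> evaluated at \<open>f x\<close>. The first factor has
  order \<open>k\<close> by assumption, the second by the induction hypothesis, which therefore
  needs \<open>g\<close> arbitrary.\<close>

lemma Ck_on_compose:
  assumes "open U" "open V"
  shows "Ck_on k U f \<Longrightarrow> Ck_on k V g \<Longrightarrow> f ` U \<subseteq> V \<Longrightarrow> Ck_on k U (\<lambda>x. g (f x))"
proof (induction k arbitrary: g)
  case 0
  then show ?case by (auto intro: continuous_on_compose2)
next
  case (Suc k)
  have fk: "Ck_on k U f" using Suc.prems Ck_on_SucD by blast
  show ?case
  proof (rule Ck_on_SucI[where f'="\<lambda>x v. \<Sum>b\<in>Basis. (frechet_derivative f (at x) v \<bullet> b) *\<^sub>R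
        frechet_derivative g (at (f x)) b"])
    show "open U" by fact
    show "((\<lambda>x. g (f x)) has_derivative (\<lambda>v. \<Sum>b\<in>Basis. (frechet_derivative f (at x) v \<bullet> b) *\<^sub>R
        frechet_derivative g (at (f x)) b)) (at x)" if "x \<in> U" for x
    proof -
      let ?Dg = "frechet_derivative g (at (f x))" and ?Df = "frechet_derivative f (at x)"
      have 1: "(f has_derivative ?Df) (at x)" using Suc.prems(1) that Ck_on_SucE by blast
      have 2: "(g has_derivative ?Dg) (at (f x))"
        using Suc.prems(2,3) that Ck_on_SucE by blast
      have "(\<lambda>v. \<Sum>b\<in>Basis. (?Df v \<bullet> b) *\<^sub>R ?Dg b) = ?Dg \<circ> ?Df"
      proof
        fix v
        have "?Dg (?Df v) = ?Dg (\<Sum>b\<in>Basis. (?Df v \<bullet> b) *\<^sub>R b)" by (simp add: euclidean_representation)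
        also have "\<dots> = (\<Sum>b\<in>Basis. (?Df v \<bullet> b) *\<^sub>R ?Dg b)"
          using has_derivative_linear[OF 2] by (simp add: linear_sum linear_cmul)
        finally show "(\<Sum>b\<in>Basis. (?Df v \<bullet> b) *\<^sub>R ?Dg b) = (?Dg \<circ> ?Df) v" by simp
      qed
      then show ?thesis using diff_chain_at[OF 1 2] by (simp add: o_def)
    qed
    show "Ck_on k U (\<lambda>x. \<Sum>b\<in>Basis. (frechet_derivative f (at x) v \<bullet> b) *\<^sub>R
        frechet_derivative g (at (f x)) b)" for v
    proof (intro Ck_on_sum assms(1) Ck_on_bilinear[OF bounded_bilinear_scaleR])
      fix b :: 'b
      have "Ck_on k U (\<lambda>x. frechet_derivative f (at x) v)" using Suc.prems by simp
      then show "Ck_on k U (\<lambda>x. frechet_derivative f (at x) v \<bullet> b)"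
        by (rule Ck_on_bilinear[OF bounded_bilinear_inner assms(1)]) simp
      show "Ck_on k U (\<lambda>x. frechet_derivative g (at (f x)) b)"
        by (rule Suc.IH[OF fk]) (use Suc.prems in auto)
    qed
  qed
qed

text \<open>Openness belongs to the predicate because \<open>Ck_on\<close> takes derivatives at
  points and not within \<open>U\<close>; changing a function outside \<open>U\<close> is harmless
  only on open sets.\<close>

definition Cinf :: "'a::euclidean_space set \<Rightarrow> ('a \<Rightarrow> 'b::euclidean_space) \<Rightarrow> bool" where
  "Cinf U f \<longleftrightarrow> open U \<and> (\<forall>k. Ck_on k U f)"

lemma Cinf_open: "Cinf U f \<Longrightarrow> open U"
  by (simp add: Cinf_def)

lemma Cinf_subset: "Cinf U f \<Longrightarrow> open V \<Longrightarrow> V \<subseteq> U \<Longrightarrow> Cinf V f"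
  by (auto simp: Cinf_def intro: Ck_on_subset)

lemma Cinf_cong: "(\<And>x. x \<in> U \<Longrightarrow> f x = g x) \<Longrightarrow> Cinf U f \<longleftrightarrow> Cinf U g"
  using Ck_on_cong[of U f g] by (auto simp: Cinf_def)

lemma Cinf_deriv:
  assumes "Cinf U f" "x \<in> U"
  shows "(f has_derivative frechet_derivative f (at x)) (at x)"
  using assms Ck_on_SucE unfolding Cinf_def by blast

lemma Cinf_frechet_derivative: "Cinf U f \<Longrightarrow> Cinf U (\<lambda>x. frechet_derivative f (at x) v)"
  unfolding Cinf_def by (metis Ck_on.simps(2))

lemma Cinf_const: "open U \<Longrightarrow> Cinf U (\<lambda>x. c)"
  by (simp add: Cinf_def)

lemma Cinf_bounded_linear: "bounded_linear f \<Longrightarrow> open U \<Longrightarrow> Cinf U f"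
  by (simp add: Cinf_def Ck_on_bounded_linear)

lemma Cinf_id: "open U \<Longrightarrow> Cinf U (\<lambda>x. x)"
  by (simp add: Cinf_bounded_linear bounded_linear_ident)

lemma Cinf_fst: "open U \<Longrightarrow> Cinf U fst"
  by (simp add: Cinf_bounded_linear bounded_linear_fst)

lemma Cinf_snd: "open U \<Longrightarrow> Cinf U snd"
  by (simp add: Cinf_bounded_linear bounded_linear_snd)

lemma Cinf_add: "Cinf U f \<Longrightarrow> Cinf U g \<Longrightarrow> Cinf U (\<lambda>x. f x + g x)"
  by (simp add: Cinf_def Ck_on_add)

lemma Cinf_sum: "open U \<Longrightarrow> (\<And>i. i \<in> I \<Longrightarrow> Cinf U (f i)) \<Longrightarrow> Cinf U (\<lambda>x. \<Sum>i\<in>I. f i x)"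
  by (simp add: Cinf_def Ck_on_sum)

lemma Cinf_bilinear:
  "bounded_bilinear B \<Longrightarrow> Cinf U f \<Longrightarrow> Cinf U g \<Longrightarrow> Cinf U (\<lambda>x. B (f x) (g x))"
  by (simp add: Cinf_def Ck_on_bilinear)

lemmas Cinf_scaleR = Cinf_bilinear[OF bounded_bilinear_scaleR]
lemmas Cinf_inner = Cinf_bilinear[OF bounded_bilinear_inner]
lemmas Cinf_mult = Cinf_bilinear[OF bounded_bilinear_mult]

lemma Cinf_compose:
  assumes "Cinf U f" "Cinf V g" "f ` U \<subseteq> V"
  shows "Cinf U (\<lambda>x. g (f x))"
  using assms Ck_on_compose[of U V _ f g] by (auto simp: Cinf_def)

lemma Cinf_minus: "Cinf U f \<Longrightarrow> Cinf U (\<lambda>x. - f x)"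
  using Cinf_compose[of U f UNIV uminus] by (auto simp: Cinf_bounded_linear bounded_linear_minus bounded_linear_ident)

lemma Cinf_diff: "Cinf U f \<Longrightarrow> Cinf U g \<Longrightarrow> Cinf U (\<lambda>x. f x - g x)"
  using Cinf_add[OF _ Cinf_minus, of U f g] by simp

lemma Cinf_power:
  fixes f :: "'a::euclidean_space \<Rightarrow> real"
  shows "Cinf U f \<Longrightarrow> Cinf U (\<lambda>x. f x ^ n)"
  by (induction n) (auto intro: Cinf_mult Cinf_const Cinf_open)

lemma Cinf_Pair:
  assumes "Cinf U f" "Cinf U g"
  shows "Cinf U (\<lambda>x. (f x, g x))"
proof -
  have "Cinf U (\<lambda>x. (f x, 0) + (0, g x))"
  proof (rule Cinf_add)
    show "Cinf U (\<lambda>x. (f x, 0))"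
      by (rule Cinf_compose[OF assms(1), where V=UNIV])
        (auto intro!: Cinf_bounded_linear bounded_linear_Pair bounded_linear_ident bounded_linear_zero)
    show "Cinf U (\<lambda>x. (0, g x))"
      by (rule Cinf_compose[OF assms(2), where V=UNIV])
        (auto intro!: Cinf_bounded_linear bounded_linear_Pair bounded_linear_ident bounded_linear_zero)
  qed
  then show ?thesis by simp
qed

lemma Cinf_real_polynomial:
  assumes "real_polynomial_function (P :: 'a::euclidean_space \<Rightarrow> real)"
  shows "Cinf UNIV P"
  using assms
  by (induction rule: real_polynomial_function.induct)
    (auto intro: Cinf_bounded_linear Cinf_const Cinf_add Cinf_mult)

text \<open>A sequence closed under differentiation is the right shape for induction: the order of
  smoothness drops while the index rises. Instances are \<open>sin\<close> shifted by quarter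
  periods, iterated \<open>deriv\<close>, and evaluations of iterated formal derivatives.\<close>

lemma Cinf_has_real_derivative:
  assumes "\<And>k x. x \<in> U \<Longrightarrow> (g k has_real_derivative g (Suc k) x) (at x)" "open U"
  shows "Cinf U (g j)"
proof -
  have "Ck_on k U (g j)" for k
  proof (induction k arbitrary: j)
    case 0
    then show ?case
      using assms(1) by (auto intro!: continuous_at_imp_continuous_on DERIV_isCont)
  next
    case (Suc k)
    show ?case
      by (rule Ck_on_SucI[where f'="\<lambda>x v. g (Suc j) x * v"])
        (use assms Suc in \<open>auto simp: has_field_derivative_def intro!: Ck_on_bilinear[OF bounded_bilinear_mult]\<close>)
  qed
  then show ?thesis using assms(2) by (simp add: Cinf_def)
qed

lemma Cinf_sin: "Cinf UNIV (sin :: real \<Rightarrow> real)"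
proof -
  define g :: "nat \<Rightarrow> real \<Rightarrow> real" where "g k = (\<lambda>x. sin (x + real k * (pi / 2)))" for k
  have "Cinf UNIV (g 0)"
  proof (rule Cinf_has_real_derivative)
    fix k x
    have "(g k has_real_derivative cos (x + real k * (pi / 2))) (at x)"
      unfolding g_def by (auto intro!: derivative_eq_intros)
    also have "cos (x + real k * (pi / 2)) = sin ((x + real k * (pi / 2)) + pi / 2)"
      by (simp add: sin_add)
    also have "\<dots> = g (Suc k) x" by (simp add: g_def algebra_simps add_divide_distrib)
    finally show "(g k has_real_derivative g (Suc k) x) (at x)" .
  qed simp
  then show ?thesis by (simp add: g_def)
qed

lemma Cinf_cos: "Cinf UNIV (cos :: real \<Rightarrow> real)"
proof -
  have "Cinf UNIV (\<lambda>x::real. sin (pi / 2 - x))"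
    by (rule Cinf_compose[OF _ Cinf_sin]) (auto intro!: Cinf_diff Cinf_const Cinf_id)
  moreover have "(\<lambda>x::real. sin (pi / 2 - x)) = cos" by (auto simp: cos_sin_eq)
  ultimately show ?thesis by simp
qed

text \<open>Having a power series expansion at every point of \<open>U\<close> passes to the
  derivative, so all iterated derivatives exist.\<close>

lemma Cinf_locally_power_series:
  fixes g :: "real \<Rightarrow> real"
  assumes "open U" "\<And>y. y \<in> U \<Longrightarrow> \<exists>A. (\<lambda>s. g (y + s)) has_fps_expansion A"
  shows "Cinf U g"
proof -
  define ana where "ana g \<longleftrightarrow> (\<forall>y\<in>U. \<exists>A. (\<lambda>s. g (y + s)) has_fps_expansion A)" for g :: "real \<Rightarrow> real"
  have step: "ana (deriv g) \<and> (\<forall>y\<in>U. (g has_real_derivative deriv g y) (at y))" if g: "ana g" for g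
  proof -
    have "\<exists>A. (\<lambda>s. deriv g (y + s)) has_fps_expansion A \<and> (g has_real_derivative deriv g y) (at y)"
      if y: "y \<in> U" for y
    proof -
      obtain A where A: "(\<lambda>s. g (y + s)) has_fps_expansion A" using g y by (auto simp: ana_def)
      have "deriv (\<lambda>s. g (y + s)) = (\<lambda>s. deriv g (y + s))"
        unfolding deriv_def
      proof
        fix s
        have "((\<lambda>s. g (y + s)) has_field_derivative D) (at s) \<longleftrightarrow> (g has_field_derivative D) (at (y + s))" for D
          using DERIV_shift[of g D s y] by (simp add: add.commute)
        then show "(SOME D. ((\<lambda>s. g (y + s)) has_field_derivative D) (at s)) =
          (SOME D. (g has_field_derivative D) (at (y + s)))" by simp
      qed
      then have 1: "(\<lambda>s. deriv g (y + s)) has_fps_expansion fps_deriv A"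
        using has_fps_expansion_deriv[OF A] by simp
      have R: "fps_conv_radius A > 0" and ev: "eventually (\<lambda>s. eval_fps A s = g (y + s)) (nhds 0)"
        using A by (auto simp: has_fps_expansion_def)
      have "(eval_fps A has_field_derivative eval_fps (fps_deriv A) 0) (at 0)"
        by (rule has_field_derivative_eval_fps) (use R in \<open>auto simp: zero_ereal_def\<close>)
      then have "((\<lambda>s. g (y + s)) has_field_derivative eval_fps (fps_deriv A) 0) (at 0)"
        using DERIV_cong_ev[OF refl ev refl] by simp
      then have "(g has_field_derivative eval_fps (fps_deriv A) 0) (at y)"
        using DERIV_shift[of g _ 0 y] by (simp add: add.commute)
      then have "(g has_field_derivative deriv g y) (at y)" using DERIV_imp_deriv by metis
      with 1 show ?thesis by blast
    qed
    then show ?thesis unfolding ana_def by blast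
  qed
  have an: "ana ((deriv ^^ k) g)" for k
    by (induction k) (use assms step in \<open>auto simp: ana_def[of g]\<close>)
  have "Cinf U ((deriv ^^ 0) g)"
    by (rule Cinf_has_real_derivative) (use an step assms in auto)
  then show ?thesis by simp
qed

section \<open>Smoothness on arbitrary subsets\<close>

lemma Cinf_imp_smooth_on: "Cinf U f \<Longrightarrow> S \<subseteq> U \<Longrightarrow> smooth_on S f"
  unfolding smooth_on_def Cinf_def by blast

lemma smooth_on_cong: "(\<And>x. x \<in> S \<Longrightarrow> f x = g x) \<Longrightarrow> smooth_on S f \<longleftrightarrow> smooth_on S g"
  unfolding smooth_on_def by (smt (verit) IntD1)

lemma Cinf_compose_smooth_on:
  assumes "Cinf V h" "smooth_on I g" "g ` I \<subseteq> V"
  shows "smooth_on I (\<lambda>x. h (g x))"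
  unfolding smooth_on_def
proof
  fix x assume x: "x \<in> I"
  obtain U g' where U: "open U" "x \<in> U" "\<forall>k. Ck_on k U g'" "\<forall>y\<in>I \<inter> U. g' y = g y"
    using assms(2) x unfolding smooth_on_def by blast
  let ?U = "U \<inter> g' -` V"
  have "continuous_on U g'" using U(3)[rule_format, of 0] by simp
  then have o: "open ?U" using U(1) Cinf_open[OF assms(1)]
    by (metis continuous_open_preimage)
  have "Cinf ?U g'" using U(3) o by (auto simp: Cinf_def intro: Ck_on_subset)
  then have "Cinf ?U (\<lambda>x. h (g' x))" by (rule Cinf_compose[OF _ assms(1)]) auto
  moreover have "x \<in> ?U" using U x assms(3) by auto
  moreover have "\<forall>y\<in>I \<inter> ?U. h (g' y) = h (g y)" using U(4) by auto
  ultimately show "\<exists>U g'. open U \<and> x \<in> U \<and> (\<forall>k. Ck_on k U g') \<and> (\<forall>y\<in>I \<inter> U. g' y = h (g y))"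
    using o unfolding Cinf_def by (intro exI[of _ ?U] exI[of _ "\<lambda>x. h (g' x)"]) auto
qed

lemma smooth_on_differentiable:
  assumes "smooth_on S f" "x \<in> S"
  shows "f differentiable (at x within S)"
proof -
  obtain U g where U: "open U" "x \<in> U" "\<forall>k. Ck_on k U g" "\<forall>y\<in>S \<inter> U. g y = f y"
    using assms unfolding smooth_on_def by blast
  have "(g has_derivative frechet_derivative g (at x)) (at x)"
    using U Ck_on_SucE by blast
  then have "(g has_derivative frechet_derivative g (at x)) (at x within S)"
    by (rule has_derivative_at_withinI)
  moreover obtain e where "e > 0" "ball x e \<subseteq> U" using U openE by blast
  ultimately have "(f has_derivative frechet_derivative g (at x)) (at x within S)"
    using has_derivative_transform_within[where d=e and f=g and g=f] U assms(2)
    by (metis IntI dist_commute mem_ball subsetD)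
  then show ?thesis by (auto simp: differentiable_def)
qed

section \<open>Mean curvature of parametrized submanifolds and cones\<close>

lemma closest_point_subspace_eqI:
  fixes V :: "'a::euclidean_space set"
  assumes "subspace V" "y \<in> V" "\<And>v. v \<in> V \<Longrightarrow> (w - y) \<bullet> v = 0"
  shows "closest_point V w = y"
proof (rule sym, rule closest_point_unique)
  show "convex V" "closed V" using assms(1) by (auto simp: subspace_imp_convex closed_subspace)
  show "\<forall>z\<in>V. dist w y \<le> dist w z"
  proof
    fix z assume "z \<in> V"
    then have "(w - y) \<bullet> (y - z) = 0" using assms by (simp add: subspace_diff)
    then have "(norm (w - z))\<^sup>2 = (norm (w - y))\<^sup>2 + (norm (y - z))\<^sup>2"
      by (simp add: power2_norm_eq_inner algebra_simps inner_commute)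
    then have "(norm (w - y))\<^sup>2 \<le> (norm (w - z))\<^sup>2" by simp
    then show "dist w y \<le> dist w z" by (simp add: dist_norm norm_le_square power2_norm_eq_inner)
  qed
qed fact

lemma closest_point_subspace:
  fixes V :: "'a::euclidean_space set"
  assumes "subspace V"
  shows "closest_point V w \<in> V" "v \<in> V \<Longrightarrow> (w - closest_point V w) \<bullet> v = 0"
proof -
  obtain y z where "y \<in> span V" "\<And>v. v \<in> span V \<Longrightarrow> orthogonal z v" "w = y + z"
    using orthogonal_subspace_decomp_exists[of V w] by blast
  then have "y \<in> V" and *: "\<And>v. v \<in> V \<Longrightarrow> (w - y) \<bullet> v = 0"
    using assms by (auto simp: span_eq_iff[THEN iffD2] orthogonal_def)
  moreover have "closest_point V w = y" by (rule closest_point_subspace_eqI) fact+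
  ultimately show "closest_point V w \<in> V" "v \<in> V \<Longrightarrow> (w - closest_point V w) \<bullet> v = 0" by auto
qed

lemma linear_closest_point:
  fixes V :: "'a::euclidean_space set"
  assumes "subspace V"
  shows "linear (closest_point V)"
proof (rule linearI)
  note cp = closest_point_subspace[OF assms]
  show "closest_point V (x + y) = closest_point V x + closest_point V y" for x y
  proof (rule closest_point_subspace_eqI[OF assms])
    show "closest_point V x + closest_point V y \<in> V" using cp assms by (simp add: subspace_add)
    fix v assume "v \<in> V"
    from cp(2)[OF this, of x] cp(2)[OF this, of y]
    show "(x + y - (closest_point V x + closest_point V y)) \<bullet> v = 0"
      by (simp add: algebra_simps)
  qed
  show "closest_point V (r *\<^sub>R x) = r *\<^sub>R closest_point V x" for r x
  proof (rule closest_point_subspace_eqI[OF assms])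
    show "r *\<^sub>R closest_point V x \<in> V" using cp assms by (simp add: subspace_scale)
    fix v assume "v \<in> V"
    from cp(2)[OF this, of x]
    show "(r *\<^sub>R x - r *\<^sub>R closest_point V x) \<bullet> v = 0"
      by (simp add: algebra_simps)
  qed
qed

lemma orthonormal_basis_of_finite:
  assumes "orthonormal_basis_of V E"
  shows "finite E" "independent E"
proof -
  have "0 \<notin> E" using assms by (auto simp: orthonormal_basis_of_def)
  then show "independent E"
    using assms pairwise_orthogonal_independent by (auto simp: orthonormal_basis_of_def)
  then show "finite E" by (rule independent_imp_finite)
qed

lemma orthonormal_basis_of_exists:
  fixes V :: "'a::euclidean_space set"
  assumes "subspace V"
  obtains E where "orthonormal_basis_of V E" "card E = dim V" "E \<subseteq> V"
  using orthonormal_basis_subspace[OF assms] by (metis orthonormal_basis_of_def)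

lemma orthonormal_basis_of_expand:
  assumes "orthonormal_basis_of V E" "v \<in> V"
  shows "v = (\<Sum>e\<in>E. (v \<bullet> e) *\<^sub>R e)"
proof -
  note fin = orthonormal_basis_of_finite[OF assms(1)]
  obtain u where u: "v = (\<Sum>e\<in>E. u e *\<^sub>R e)"
    using assms span_finite[OF fin(1)] by (auto simp: orthonormal_basis_of_def)
  have "v \<bullet> e = u e" if "e \<in> E" for e
  proof -
    have "v \<bullet> e = (\<Sum>e'\<in>E. u e' * (e' \<bullet> e))" by (simp add: u inner_sum_left)
    also have "\<dots> = (\<Sum>e'\<in>E. if e' = e then u e else 0)"
    proof (rule sum.cong[OF refl])
      fix e' assume "e' \<in> E"
      then show "u e' * (e' \<bullet> e) = (if e' = e then u e else 0)"
        using assms(1) that by (auto simp: orthonormal_basis_of_def pairwise_def orthogonal_def norm_eq_1)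
    qed
    also have "\<dots> = u e" using fin that by simp
    finally show ?thesis .
  qed
  with u show ?thesis by simp
qed

text \<open>The mean curvature vector is defined with a basis picked by \<open>SOME\<close>.
  Expanding each of two bases in the other shows that the trace of a bilinear map does not see the
  choice.\<close>

lemma orthonormal_basis_of_trace:
  fixes q :: "'a::euclidean_space \<Rightarrow> 'a \<Rightarrow> 'b::real_vector"
  assumes E: "orthonormal_basis_of V E" and E': "orthonormal_basis_of V E'"
    and l: "\<And>a. linear (\<lambda>b. q a b)" and r: "\<And>b. linear (\<lambda>a. q a b)"
  shows "(\<Sum>e\<in>E. q e e) = (\<Sum>e\<in>E'. q e e)"
proof -
  have sub: "E \<subseteq> V" "E' \<subseteq> V"
    using E E' span_superset[of E] span_superset[of E'] by (simp_all add: orthonormal_basis_of_def)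
  have "(\<Sum>e\<in>E. q e e) = (\<Sum>e\<in>E. \<Sum>e'\<in>E'. (e \<bullet> e') *\<^sub>R q e e')"
  proof (rule sum.cong[OF refl])
    fix e assume "e \<in> E"
    then have "e = (\<Sum>e'\<in>E'. (e \<bullet> e') *\<^sub>R e')" using orthonormal_basis_of_expand[OF E'] sub by auto
    then have "q e e = q e (\<Sum>e'\<in>E'. (e \<bullet> e') *\<^sub>R e')" by simp
    also have "\<dots> = (\<Sum>e'\<in>E'. (e \<bullet> e') *\<^sub>R q e e')"
      by (simp add: linear_sum[OF l] linear_cmul[OF l])
    finally show "q e e = (\<Sum>e'\<in>E'. (e \<bullet> e') *\<^sub>R q e e')" .
  qed
  also have "\<dots> = (\<Sum>e'\<in>E'. \<Sum>e\<in>E. (e' \<bullet> e) *\<^sub>R q e e')"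
    by (subst sum.swap) (simp add: inner_commute)
  also have "\<dots> = (\<Sum>e'\<in>E'. q e' e')"
  proof (rule sum.cong[OF refl])
    fix e' assume "e' \<in> E'"
    then have "e' = (\<Sum>e\<in>E. (e' \<bullet> e) *\<^sub>R e)" using orthonormal_basis_of_expand[OF E] sub by auto
    then have "q e' e' = q (\<Sum>e\<in>E. (e' \<bullet> e) *\<^sub>R e) e'" by simp
    also have "\<dots> = (\<Sum>e\<in>E. (e' \<bullet> e) *\<^sub>R q e e')"
      by (simp add: linear_sum[OF r] linear_cmul[OF r])
    finally show "(\<Sum>e\<in>E. (e' \<bullet> e) *\<^sub>R q e e') = q e' e'" by simp
  qed
  finally show ?thesis .
qed

text \<open>The derivative within \<open>M\<close> is a chosen one and is determined only on tangent
  vectors. Composing with a curve inside \<open>M\<close> turns its value on the velocity into an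
  ordinary derivative at an interior parameter, and that one is unique.\<close>

lemma differential_on_along_curve:
  fixes \<gamma> :: "real \<Rightarrow> 'e::euclidean_space"
  assumes Y: "Y differentiable (at (\<gamma> 0) within M)"
    and "\<epsilon> > 0" "\<gamma> ` {-\<epsilon><..<\<epsilon>} \<subseteq> M" "(\<gamma> has_vector_derivative u) (at 0)"
  shows "((\<lambda>s. Y (\<gamma> s)) has_vector_derivative differential_on M Y (\<gamma> 0) u) (at 0)"
proof -
  let ?I = "{-\<epsilon><..<\<epsilon>}"
  have "(Y has_derivative differential_on M Y (\<gamma> 0)) (at (\<gamma> 0) within M)"
    using Y by (simp add: differential_on_def frechet_derivative_works[symmetric])
  then have 1: "(Y has_derivative differential_on M Y (\<gamma> 0)) (at (\<gamma> 0) within \<gamma> ` ?I)"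
    by (rule has_derivative_subset) fact
  have 2: "(\<gamma> has_vector_derivative u) (at 0 within ?I)"
    using assms(4) by (rule has_vector_derivative_at_within)
  have "((Y \<circ> \<gamma>) has_derivative differential_on M Y (\<gamma> 0) \<circ> (\<lambda>s. s *\<^sub>R u)) (at 0 within ?I)"
    by (rule diff_chain_within[OF 2[unfolded has_vector_derivative_def] 1])
  moreover have "differential_on M Y (\<gamma> 0) \<circ> (\<lambda>s. s *\<^sub>R u) = (\<lambda>s. s *\<^sub>R differential_on M Y (\<gamma> 0) u)"
    using has_derivative_linear[OF 1] by (auto simp: linear_cmul)
  moreover have "at (0::real) within ?I = at 0"
    by (rule at_within_open) (use assms(2) in auto)
  ultimately show ?thesis by (simp add: has_vector_derivative_def o_def)
qed

text \<open>The product rule for a moving linear map applied to a moving vector, in coordinates, so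
  that no derivative in a space of linear maps is needed.\<close>

lemma has_vector_derivative_sum_basis:
  fixes \<zeta> :: "real \<Rightarrow> 'e::euclidean_space"
  assumes "(\<zeta> has_vector_derivative \<zeta>') (at 0)"
    and "\<And>i. i \<in> Basis \<Longrightarrow> ((\<lambda>s. A s i) has_vector_derivative A' i) (at 0)"
  shows "((\<lambda>s. \<Sum>i\<in>Basis. (\<zeta> s \<bullet> i) *\<^sub>R A s i) has_vector_derivative
     (\<Sum>i\<in>Basis. (\<zeta> 0 \<bullet> i) *\<^sub>R A' i + (\<zeta>' \<bullet> i) *\<^sub>R A 0 i)) (at 0)"
proof (rule has_vector_derivative_sum)
  fix i :: 'e assume i: "i \<in> Basis"
  have "((\<lambda>s. \<zeta> s \<bullet> i) has_vector_derivative \<zeta>' \<bullet> i) (at 0)"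
    by (rule bounded_linear.has_vector_derivative[OF bounded_linear_inner_left assms(1)])
  then have "((\<lambda>s. \<zeta> s \<bullet> i) has_field_derivative \<zeta>' \<bullet> i) (at 0)"
    by (simp add: has_real_derivative_iff_has_vector_derivative)
  from has_vector_derivative_scaleR[OF this assms(2)[OF i]]
  show "((\<lambda>s. (\<zeta> s \<bullet> i) *\<^sub>R A s i) has_vector_derivative (\<zeta> 0 \<bullet> i) *\<^sub>R A' i + (\<zeta>' \<bullet> i) *\<^sub>R A 0 i) (at 0)" .
qed

lemma linear_sum_Basis:
  assumes "linear f"
  shows "f v = (\<Sum>i\<in>Basis. (v \<bullet> i) *\<^sub>R f i)"
proof -
  have "f v = f (\<Sum>i\<in>Basis. (v \<bullet> i) *\<^sub>R i)" by (simp add: euclidean_representation)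
  then show ?thesis using assms by (simp add: linear_sum linear_cmul)
qed

lemma linear_fst_scaled: "linear (\<lambda>u. fst u /\<^sub>R c)"
  by (rule linearI) (auto simp: algebra_simps)

lemma tangent_space_curve:
  assumes "v \<in> tangent_space M x"
  obtains \<gamma> \<epsilon> where "\<epsilon> > 0" "smooth_on {-\<epsilon><..<\<epsilon>} \<gamma>" "\<gamma> ` {-\<epsilon><..<\<epsilon>} \<subseteq> M"
    "\<gamma> (0::real) = x" "(\<gamma> has_vector_derivative v) (at 0)"
  using assms unfolding tangent_space_def by blast

lemma vector_derivative_cong_near:
  assumes "(f has_vector_derivative f') (at (0::real))" "(g has_vector_derivative g') (at 0)"
    and "\<epsilon> > 0" "\<And>s. s \<in> {-\<epsilon><..<\<epsilon>} \<Longrightarrow> f s = g s"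
  shows "f' = g'"
proof -
  have "(g has_vector_derivative f') (at 0)"
    by (rule has_vector_derivative_transform_within_open[OF assms(1), of "{-\<epsilon><..<\<epsilon>}"]) (use assms in auto)
  then show ?thesis using assms(2) vector_derivative_unique_at by blast
qed

section \<open>First and second directional derivatives\<close>

definition dd :: "('a::euclidean_space \<Rightarrow> 'b::euclidean_space) \<Rightarrow> 'a \<Rightarrow> 'a \<Rightarrow> 'b" where
  "dd f x = frechet_derivative f (at x)"

definition dd2 :: "('a::euclidean_space \<Rightarrow> 'b::euclidean_space) \<Rightarrow> 'a \<Rightarrow> 'a \<Rightarrow> 'a \<Rightarrow> 'b" where
  "dd2 f x a b = dd (\<lambda>y. dd f y b) x a"

lemma dd_deriv: "Cinf U f \<Longrightarrow> x \<in> U \<Longrightarrow> (f has_derivative dd f x) (at x)"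
  using Cinf_deriv by (simp add: dd_def)

lemma dd_eqI: "(f has_derivative f') (at x) \<Longrightarrow> dd f x = f'"
  by (simp add: dd_def frechet_derivative_eqI)

lemma dd_Cinf: "Cinf U f \<Longrightarrow> Cinf U (\<lambda>y. dd f y b)"
  using Cinf_frechet_derivative by (simp add: dd_def)

lemma dd2_deriv: "Cinf U f \<Longrightarrow> x \<in> U \<Longrightarrow> ((\<lambda>y. dd f y b) has_derivative (\<lambda>a. dd2 f x a b)) (at x)"
  using dd_deriv[OF dd_Cinf] by (simp add: dd2_def)

lemma linear_dd: "Cinf U f \<Longrightarrow> x \<in> U \<Longrightarrow> linear (dd f x)"
  using dd_deriv has_derivative_linear by blast

lemma linear_dd2_left: "Cinf U f \<Longrightarrow> x \<in> U \<Longrightarrow> linear (\<lambda>a. dd2 f x a b)"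
  using dd2_deriv has_derivative_linear by blast

lemma linear_dd2_right:
  assumes f: "Cinf U f" and x: "x \<in> U"
  shows "linear (\<lambda>b. dd2 f x a b)"
proof (rule linearI)
  have o: "open U" using f Cinf_open by blast
  fix b b' and r :: real
  have "((\<lambda>y. dd f y (b + b')) has_derivative (\<lambda>a. dd2 f x a b + dd2 f x a b')) (at x)"
    by (rule has_derivative_transform_within_open[OF has_derivative_add[OF dd2_deriv[OF f x] dd2_deriv[OF f x]] o x])
      (simp add: linear_add[OF linear_dd[OF f]])
  from has_derivative_unique[OF this dd2_deriv[OF f x]] show "dd2 f x a (b + b') = dd2 f x a b + dd2 f x a b'"
    by metis
  have "((\<lambda>y. dd f y (r *\<^sub>R b)) has_derivative (\<lambda>a. r *\<^sub>R dd2 f x a b)) (at x)"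
    by (rule has_derivative_transform_within_open[OF has_derivative_scaleR_right[OF dd2_deriv[OF f x]] o x])
      (simp add: linear_cmul[OF linear_dd[OF f]])
  from has_derivative_unique[OF this dd2_deriv[OF f x]] show "dd2 f x a (r *\<^sub>R b) = r *\<^sub>R dd2 f x a b"
    by metis
qed

text \<open>The image of \<open>S\<close> under \<open>x \<mapsto> (c x, Q x)\<close>, where \<open>\<pi> x\<close> projects onto the tangent space
  of \<open>S\<close> at \<open>x\<close>: the case of a sphere gives the Lawson-Osserman submanifolds, the case of an open set
  (with \<open>\<pi> x\<close> the identity) gives graphs.\<close>

locale graph_parametrization =
  fixes S U :: "'e::euclidean_space set" and \<pi> :: "'e \<Rightarrow> 'e \<Rightarrow> 'e" and c :: real
    and Q :: "'e \<Rightarrow> 'f::euclidean_space"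
  assumes c: "c \<noteq> 0" and SU: "S \<subseteq> U" and Q: "Cinf U Q"
    and tangent: "x \<in> S \<Longrightarrow> tangent_space S x = {v. \<pi> x v = v}"
    and linear_proj: "linear (\<pi> x)"
    and smooth_proj: "Cinf UNIV (\<lambda>x. \<pi> x b)"
    and proj_idem: "x \<in> S \<Longrightarrow> \<pi> x (\<pi> x b) = \<pi> x b"
begin

definition X :: "'e \<Rightarrow> 'e \<times> 'f" where "X x = (c *\<^sub>R x, Q x)"
abbreviation "DQ \<equiv> dd Q"
abbreviation "D2Q \<equiv> dd2 Q"
definition Dproj :: "'e \<Rightarrow> 'e \<Rightarrow> 'e \<Rightarrow> 'e" where
  "Dproj x a b = dd (\<lambda>y. \<pi> y b) x a"
definition dX :: "'e \<Rightarrow> 'e \<Rightarrow> 'e \<times> 'f" where "dX x v = (c *\<^sub>R v, DQ x v)"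
text \<open>For \<open>b\<close> with \<open>\<pi> x b = b\<close> this is the derivative, in
  direction \<open>a\<close>, of the tangent field \<open>dX y (\<pi> y b)\<close>: the second
  derivative of \<open>Q\<close> plus the contribution of the turning tangent space.\<close>

definition hess :: "'e \<Rightarrow> 'e \<Rightarrow> 'e \<Rightarrow> 'e \<times> 'f" where
  "hess x a b = (0, D2Q x a b) + dX x (Dproj x a b)"

lemmas Q_deriv = dd_deriv[OF Q]
lemmas DQ_Cinf = dd_Cinf[OF Q]
lemmas DQ_deriv = dd2_deriv[OF Q]
lemmas linear_DQ = linear_dd[OF Q]
lemmas linear_D2Q_left = linear_dd2_left[OF Q]
lemmas linear_D2Q_right = linear_dd2_right[OF Q]

lemma proj_deriv: "((\<lambda>y. \<pi> y b) has_derivative (\<lambda>a. Dproj x a b)) (at x)"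
  using dd_deriv[OF smooth_proj] by (simp add: Dproj_def)

lemma linear_dX: "x \<in> U \<Longrightarrow> linear (dX x)"
  using linear_DQ[of x] by (intro linearI) (auto simp: dX_def linear_add linear_cmul algebra_simps)

lemma linear_Dproj_left: "linear (\<lambda>a. Dproj x a b)"
  using proj_deriv has_derivative_linear by blast

lemma linear_Dproj_right: "linear (\<lambda>b. Dproj x a b)"
proof (rule linearI)
  fix b b' :: 'e and r :: real
  have "((\<lambda>y. \<pi> y (b + b')) has_derivative (\<lambda>a. Dproj x a b + Dproj x a b')) (at x)"
    using has_derivative_add[OF proj_deriv proj_deriv] by (simp add: linear_add[OF linear_proj])
  from has_derivative_unique[OF this proj_deriv] show "Dproj x a (b + b') = Dproj x a b + Dproj x a b'"
    by metis
  have "((\<lambda>y. \<pi> y (r *\<^sub>R b)) has_derivative (\<lambda>a. r *\<^sub>R Dproj x a b)) (at x)"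
    using has_derivative_scaleR_right[OF proj_deriv] by (simp add: linear_cmul[OF linear_proj])
  from has_derivative_unique[OF this proj_deriv] show "Dproj x a (r *\<^sub>R b) = r *\<^sub>R Dproj x a b"
    by metis
qed

lemma linear_hess:
  assumes x: "x \<in> U"
  shows "linear (\<lambda>a. hess x a b)" "linear (\<lambda>b. hess x a b)"
  by (auto intro!: linearI simp: hess_def algebra_simps linear_add[OF linear_D2Q_left[OF x]]
      linear_cmul[OF linear_D2Q_left[OF x]] linear_add[OF linear_D2Q_right[OF x]]
      linear_cmul[OF linear_D2Q_right[OF x]] linear_add[OF linear_Dproj_left]
      linear_cmul[OF linear_Dproj_left] linear_add[OF linear_Dproj_right]
      linear_cmul[OF linear_Dproj_right] linear_add[OF linear_dX[OF x]] linear_cmul[OF linear_dX[OF x]])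

lemma X_deriv: "x \<in> U \<Longrightarrow> (X has_derivative dX x) (at x)"
  unfolding X_def[abs_def] dX_def[abs_def]
  by (intro has_derivative_Pair Q_deriv has_derivative_scaleR_right has_derivative_ident)

lemma X_Cinf: "Cinf U X"
  unfolding X_def[abs_def] using Q Cinf_open[OF Q]
  by (intro Cinf_Pair Cinf_bounded_linear[OF bounded_linear_scaleR_right])

lemma fst_X: "fst (X x) /\<^sub>R c = x"
  using c by (simp add: X_def)

lemma fst_dX: "fst (dX x v) /\<^sub>R c = v"
  using c by (simp add: dX_def)

lemma has_vector_derivative_along:
  assumes "(f has_derivative f') (at (\<gamma> 0))" "(\<gamma> has_vector_derivative a) (at (0::real))"
  shows "((\<lambda>s. f (\<gamma> s)) has_vector_derivative f' a) (at 0)"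
proof -
  have "(f \<circ> \<gamma> has_derivative f' \<circ> (\<lambda>s. s *\<^sub>R a)) (at 0)"
    by (rule diff_chain_at) (use assms in \<open>auto simp: has_vector_derivative_def\<close>)
  moreover have "f' \<circ> (\<lambda>s. s *\<^sub>R a) = (\<lambda>s. s *\<^sub>R f' a)"
    using has_derivative_linear[OF assms(1)] by (auto simp: linear_cmul)
  ultimately show ?thesis by (simp add: has_vector_derivative_def o_def)
qed

text \<open>The first component divided by \<open>c\<close> is a smooth left inverse of
  \<open>X\<close>, so curves in the image and curves in \<open>S\<close> correspond to each
  other.\<close>

lemma tangent_space_image:
  assumes x: "x \<in> S"
  shows "tangent_space (X ` S) (X x) = dX x ` {v. \<pi> x v = v}"
proof (intro set_eqI iffI)
  fix v assume "v \<in> tangent_space (X ` S) (X x)"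
  then obtain \<gamma> \<epsilon> where g: "\<epsilon> > 0" "smooth_on {-\<epsilon><..<\<epsilon>} \<gamma>" "\<gamma> ` {-\<epsilon><..<\<epsilon>} \<subseteq> X ` S"
    "\<gamma> (0::real) = X x" "(\<gamma> has_vector_derivative v) (at 0)" by (rule tangent_space_curve)
  define g where "g s = fst (\<gamma> s) /\<^sub>R c" for s
  have bl: "bounded_linear (\<lambda>u::'e\<times>'f. fst u /\<^sub>R c)"
    using linear_fst_scaled linear_conv_bounded_linear by blast
  have 1: "smooth_on {-\<epsilon><..<\<epsilon>} g"
    unfolding g_def by (rule Cinf_compose_smooth_on[OF Cinf_bounded_linear[OF bl, of UNIV] g(2)]) auto
  have gs: "g s \<in> S \<and> \<gamma> s = X (g s)" if "s \<in> {-\<epsilon><..<\<epsilon>}" for s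
    using g(3) that fst_X by (fastforce simp: g_def)
  have 2: "(g has_vector_derivative fst v /\<^sub>R c) (at 0)"
    unfolding g_def by (rule bounded_linear.has_vector_derivative[OF bl g(5)])
  have g0: "g 0 = x" using g(4) fst_X by (simp add: g_def)
  have "fst v /\<^sub>R c \<in> tangent_space S x"
    unfolding tangent_space_def using g(1) 1 2 gs g0 by blast
  then have "\<pi> x (fst v /\<^sub>R c) = fst v /\<^sub>R c" using tangent[OF x] by simp
  moreover have "((\<lambda>s. X (g s)) has_vector_derivative dX x (fst v /\<^sub>R c)) (at 0)"
    by (rule has_vector_derivative_along[OF _ 2]) (use X_deriv x SU g0 in auto)
  then have "v = dX x (fst v /\<^sub>R c)"
    using vector_derivative_cong_near[OF g(5) _ g(1)] gs by blast
  ultimately show "v \<in> dX x ` {v. \<pi> x v = v}" by blast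
next
  fix v assume "v \<in> dX x ` {v. \<pi> x v = v}"
  then obtain a where a: "v = dX x a" "a \<in> tangent_space S x" using tangent[OF x] by auto
  obtain \<gamma> \<epsilon> where g: "\<epsilon> > 0" "smooth_on {-\<epsilon><..<\<epsilon>} \<gamma>" "\<gamma> ` {-\<epsilon><..<\<epsilon>} \<subseteq> S"
    "\<gamma> (0::real) = x" "(\<gamma> has_vector_derivative a) (at 0)" using a(2) by (rule tangent_space_curve)
  have 1: "smooth_on {-\<epsilon><..<\<epsilon>} (\<lambda>s. X (\<gamma> s))"
    by (rule Cinf_compose_smooth_on[OF X_Cinf g(2)]) (use g(3) SU in auto)
  have 2: "((\<lambda>s. X (\<gamma> s)) has_vector_derivative v) (at 0)"
    unfolding a(1) by (rule has_vector_derivative_along[OF _ g(5)]) (use X_deriv x SU g(4) in auto)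
  show "v \<in> tangent_space (X ` S) (X x)"
    unfolding tangent_space_def mem_Collect_eq
    by (intro exI[of _ "\<lambda>s. X (\<gamma> s)"] exI[of _ \<epsilon>]) (use 1 2 g in auto)
qed

text \<open>The definite description needs a witness and independence of the field. The witness
  projects \<open>b\<close> to the moving tangent spaces. Two tangent fields that agree at the point
  differ by \<open>dX\<close> of a vector \<zeta> vanishing there, so their derivatives differ by a
  tangent vector, and the projection to the normal space kills it.\<close>

lemma second_fundamental_form_image:
  assumes x: "x \<in> S" and a: "\<pi> x a = a" and b: "\<pi> x b = b"
    and N: "subspace (tangent_space N (X x))"
  shows "second_fundamental_form N (X ` S) (X x) (dX x a) (dX x b) =
    closest_point (normal_space N (X ` S) (X x)) (hess x a b)"
proof -
  let ?M = "X ` S" and ?p = "X x"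
  let ?\<nu> = "normal_space N ?M ?p"
  have xU: "x \<in> U" using x SU by auto
  have sub: "subspace ?\<nu>"
    using N by (auto simp: subspace_def normal_space_def inner_add_left)
  obtain \<gamma> \<epsilon> where g: "\<epsilon> > 0" "smooth_on {-\<epsilon><..<\<epsilon>} \<gamma>" "\<gamma> ` {-\<epsilon><..<\<epsilon>} \<subseteq> S"
    "\<gamma> (0::real) = x" "(\<gamma> has_vector_derivative a) (at 0)"
  proof -
    have "a \<in> tangent_space S x" using a tangent[OF x] by simp
    then show ?thesis using that by (rule tangent_space_curve)
  qed
  have Xg: "((\<lambda>s. X (\<gamma> s)) has_vector_derivative dX x a) (at 0)"
    by (rule has_vector_derivative_along[OF _ g(5)]) (use X_deriv xU g(4) in auto)
  have DQg: "((\<lambda>s. DQ (\<gamma> s) i) has_vector_derivative D2Q x a i) (at 0)" for i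
    by (rule has_vector_derivative_along[OF _ g(5)]) (use DQ_deriv xU g(4) in auto)
  have prg: "((\<lambda>s. \<pi> (\<gamma> s) i) has_vector_derivative Dproj x a i) (at 0)" for i
    by (rule has_vector_derivative_along[OF _ g(5)]) (use proj_deriv g(4) in auto)
  define Z where "Z y = dX y (\<pi> y b)" for y
  \<comment> \<open>Reading the base point off the first component gives a field that is smooth on
    an open subset of the product space, not only along the image.\<close>
  define Y0 where "Y0 q = Z (fst q /\<^sub>R c)" for q :: "'e \<times> 'f"
  have Y0X: "Y0 (X y) = Z y" for y by (simp add: Y0_def fst_X)
  have Z_Cinf: "Cinf U Z"
  proof -
    have "Cinf U (\<lambda>y. (c *\<^sub>R \<pi> y b, \<Sum>i\<in>Basis. (\<pi> y b \<bullet> i) *\<^sub>R DQ y i))"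
    proof (intro Cinf_Pair Cinf_sum)
      have o: "open U" using Cinf_open[OF Q] .
      have p: "Cinf U (\<lambda>y. \<pi> y b)" by (rule Cinf_subset[OF smooth_proj o]) simp
      show "Cinf U (\<lambda>y. c *\<^sub>R \<pi> y b)" by (rule Cinf_scaleR[OF Cinf_const[OF o] p])
      show "Cinf U (\<lambda>y. (\<pi> y b \<bullet> i) *\<^sub>R DQ y i)" for i
        by (rule Cinf_scaleR[OF Cinf_inner[OF p Cinf_const[OF o]] DQ_Cinf])
    qed (rule Cinf_open[OF Q])
    moreover have "(c *\<^sub>R \<pi> y b, \<Sum>i\<in>Basis. (\<pi> y b \<bullet> i) *\<^sub>R DQ y i) = Z y" if "y \<in> U" for y
      using linear_sum_Basis[OF linear_DQ[OF that], of "\<pi> y b"] by (simp add: Z_def dX_def)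
    ultimately show ?thesis using Cinf_cong by (metis (no_types, lifting))
  qed
  have field0: "local_tangent_field ?M ?p Y0"
    unfolding local_tangent_field_def
  proof (intro exI conjI)
    show "open (UNIV :: ('e\<times>'f) set)" "?p \<in> UNIV" by auto
    have bl: "bounded_linear (\<lambda>u::'e\<times>'f. fst u /\<^sub>R c)"
      using linear_fst_scaled linear_conv_bounded_linear by blast
    have o: "open ((\<lambda>u::'e\<times>'f. fst u /\<^sub>R c) -` U)"
      using Cinf_open[OF Q] linear_continuous_on[OF bl]
      by (metis continuous_open_vimage continuous_on_eq_continuous_at UNIV_I open_UNIV)
    have "Cinf ((\<lambda>u::'e\<times>'f. fst u /\<^sub>R c) -` U) Y0"
      unfolding Y0_def
      by (rule Cinf_compose[OF Cinf_bounded_linear[OF bl o] Z_Cinf]) auto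
    then show "smooth_on (?M \<inter> UNIV) Y0"
      by (rule Cinf_imp_smooth_on) (use SU fst_X in auto)
    show "\<forall>q\<in>?M \<inter> UNIV. Y0 q \<in> tangent_space ?M q"
      using tangent_space_image proj_idem by (auto simp: Y0X Z_def)
  qed
  have Y0p: "Y0 ?p = dX x b" using b by (simp add: Y0X Z_def)
  have diff: "((\<lambda>s. Y (X (\<gamma> s))) has_vector_derivative differential_on ?M Y ?p (dX x a)) (at 0)"
    if Y: "local_tangent_field ?M ?p Y" for Y
  proof -
    obtain W where W: "open W" "?p \<in> W" "smooth_on (?M \<inter> W) Y"
      using Y unfolding local_tangent_field_def by blast
    have "Y differentiable (at ?p within ?M \<inter> W)"
      by (rule smooth_on_differentiable[OF W(3)]) (use W(2) x in blast)
    moreover have "at ?p within ?M \<inter> W = at ?p within ?M"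
      by (rule at_within_nhd[OF W(2,1)]) auto
    ultimately have "Y differentiable (at (X (\<gamma> 0)) within ?M)" using g(4) by simp
    then have "((\<lambda>s. Y (X (\<gamma> s))) has_vector_derivative differential_on ?M Y (X (\<gamma> 0)) (dX x a)) (at 0)"
      by (rule differential_on_along_curve[where \<gamma>="\<lambda>s. X (\<gamma> s)", OF _ g(1) _ Xg]) (use g(3) in auto)
    then show ?thesis by (simp only: g(4))
  qed
  have D0: "differential_on ?M Y0 ?p (dX x a) = hess x a b"
  proof -
    have "((\<lambda>s. Z (\<gamma> s)) has_vector_derivative hess x a b) (at 0)"
    proof -
      have "((\<lambda>s. \<Sum>i\<in>Basis. (\<pi> (\<gamma> s) b \<bullet> i) *\<^sub>R DQ (\<gamma> s) i) has_vector_derivative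
          (\<Sum>i\<in>Basis. (\<pi> (\<gamma> 0) b \<bullet> i) *\<^sub>R D2Q x a i + (Dproj x a b \<bullet> i) *\<^sub>R DQ (\<gamma> 0) i)) (at 0)"
        by (rule has_vector_derivative_sum_basis[OF prg DQg])
      also have "(\<Sum>i\<in>Basis. (\<pi> (\<gamma> 0) b \<bullet> i) *\<^sub>R D2Q x a i + (Dproj x a b \<bullet> i) *\<^sub>R DQ (\<gamma> 0) i) =
          D2Q x a b + DQ x (Dproj x a b)"
        using linear_sum_Basis[OF linear_D2Q_right[OF xU, of a], of b]
          linear_sum_Basis[OF linear_DQ[OF xU], of "Dproj x a b"] g(4) b
        by (simp add: sum.distrib)
      finally have "((\<lambda>s. (c *\<^sub>R \<pi> (\<gamma> s) b, \<Sum>i\<in>Basis. (\<pi> (\<gamma> s) b \<bullet> i) *\<^sub>R DQ (\<gamma> s) i))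
          has_vector_derivative hess x a b) (at 0)"
        by (auto simp: hess_def dX_def intro!: has_vector_derivative_Pair
            bounded_linear.has_vector_derivative[OF bounded_linear_scaleR_right prg])
      then show ?thesis
      proof (rule has_vector_derivative_transform_within_open[of _ _ _ "{-\<epsilon><..<\<epsilon>}"])
        fix s assume "s \<in> {-\<epsilon><..<\<epsilon>}"
        then have "\<gamma> s \<in> U" using g(3) SU by blast
        from linear_sum_Basis[OF linear_DQ[OF this], of "\<pi> (\<gamma> s) b"]
        show "(c *\<^sub>R \<pi> (\<gamma> s) b, \<Sum>i\<in>Basis. (\<pi> (\<gamma> s) b \<bullet> i) *\<^sub>R DQ (\<gamma> s) i) = Z (\<gamma> s)"
          by (simp add: Z_def dX_def)
      qed (use g(1) in auto)
    qed
    then show ?thesis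
      using vector_derivative_unique_at[OF diff[OF field0, unfolded Y0X]] by blast
  qed
  have key: "closest_point ?\<nu> (differential_on ?M Y ?p (dX x a)) = closest_point ?\<nu> (hess x a b)"
    if Y: "local_tangent_field ?M ?p Y" "Y ?p = dX x b" for Y
  proof -
    obtain W where W: "open W" "?p \<in> W" "\<forall>q\<in>?M \<inter> W. Y q \<in> tangent_space ?M q"
      using Y unfolding local_tangent_field_def by blast
    have "((\<lambda>s. X (\<gamma> s)) \<longlongrightarrow> X (\<gamma> 0)) (nhds 0)"
      using has_vector_derivative_continuous[OF Xg] by (simp add: continuous_within tendsto_at_iff_tendsto_nhds[of "\<lambda>s. X (\<gamma> s)"])
    then have "eventually (\<lambda>s. X (\<gamma> s) \<in> W) (nhds 0)"
      using W(1,2) g(4) by (auto dest: topological_tendstoD)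
    then obtain d where d: "d > 0" "\<And>s. \<bar>s\<bar> < d \<Longrightarrow> X (\<gamma> s) \<in> W"
      by (auto simp: eventually_nhds_metric dist_real_def)
    define e where "e = min d \<epsilon>"
    have e: "e > 0" "e \<le> \<epsilon>" "e \<le> d" using d g(1) by (auto simp: e_def)
    define \<Delta> where "\<Delta> s = Y (X (\<gamma> s)) - Z (\<gamma> s)" for s
    define \<delta> where "\<delta> = differential_on ?M Y ?p (dX x a) - hess x a b"
    define \<zeta> where "\<zeta> s = fst (\<Delta> s) /\<^sub>R c" for s
    have D\<Delta>: "(\<Delta> has_vector_derivative \<delta>) (at 0)"
      unfolding \<Delta>_def \<delta>_def D0[symmetric]
      using has_vector_derivative_diff[OF diff[OF Y(1)] diff[OF field0]] by (simp add: Y0X)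
    have "bounded_linear (\<lambda>u::'e\<times>'f. fst u /\<^sub>R c)"
      using linear_fst_scaled linear_conv_bounded_linear by blast
    then have D\<zeta>: "(\<zeta> has_vector_derivative fst \<delta> /\<^sub>R c) (at 0)"
      unfolding \<zeta>_def by (rule bounded_linear.has_vector_derivative[OF _ D\<Delta>])
    have \<zeta>0: "\<zeta> 0 = 0" using Y(2) g(4) b by (simp add: \<zeta>_def \<Delta>_def Z_def)
    \<comment> \<open>Both fields are tangent near the point, so their difference is
      \<open>dX\<close> of a vector fixed by the projection, and the first component divided by
      \<open>c\<close> recovers that vector.\<close>
    have rep: "\<pi> (\<gamma> s) (\<zeta> s) = \<zeta> s \<and> \<Delta> s = dX (\<gamma> s) (\<zeta> s)" if s: "s \<in> {-e<..<e}" for s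
    proof -
      have "s \<in> {-\<epsilon><..<\<epsilon>}" using s e by auto
      then have S: "\<gamma> s \<in> S" using g(3) by blast
      have "Y (X (\<gamma> s)) \<in> tangent_space ?M (X (\<gamma> s))"
        using W(3) d(2)[of s] s e S by auto
      then obtain v where v: "Y (X (\<gamma> s)) = dX (\<gamma> s) v" "\<pi> (\<gamma> s) v = v"
        using tangent_space_image[OF S] by auto
      have l: "linear (dX (\<gamma> s))" using linear_dX S SU by auto
      have "\<Delta> s = dX (\<gamma> s) (v - \<pi> (\<gamma> s) b)"
        by (simp add: \<Delta>_def Z_def v(1) linear_diff[OF l])
      moreover have "\<zeta> s = v - \<pi> (\<gamma> s) b" unfolding \<zeta>_def calculation fst_dX ..
      moreover have "\<pi> (\<gamma> s) (v - \<pi> (\<gamma> s) b) = v - \<pi> (\<gamma> s) b"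
        using v(2) proj_idem[OF S] linear_diff[OF linear_proj] by simp
      ultimately show ?thesis by simp
    qed
    \<comment> \<open>Differentiate \<open>\<pi> (\<gamma> s) (\<zeta> s) = \<zeta> s\<close> at 0.
      The term with the derivative of the projection drops out because \<open>\<zeta> 0 = 0\<close>;
      the same happens below with the second derivative of \<open>Q\<close>.\<close>
    have "\<pi> x (fst \<delta> /\<^sub>R c) = fst \<delta> /\<^sub>R c"
    proof -
      have "((\<lambda>s. \<Sum>i\<in>Basis. (\<zeta> s \<bullet> i) *\<^sub>R \<pi> (\<gamma> s) i) has_vector_derivative
          (\<Sum>i\<in>Basis. (\<zeta> 0 \<bullet> i) *\<^sub>R Dproj x a i + ((fst \<delta> /\<^sub>R c) \<bullet> i) *\<^sub>R \<pi> (\<gamma> 0) i)) (at 0)"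
        by (rule has_vector_derivative_sum_basis[OF D\<zeta> prg])
      also have "(\<Sum>i\<in>Basis. (\<zeta> 0 \<bullet> i) *\<^sub>R Dproj x a i + ((fst \<delta> /\<^sub>R c) \<bullet> i) *\<^sub>R \<pi> (\<gamma> 0) i) = \<pi> x (fst \<delta> /\<^sub>R c)"
        unfolding \<zeta>0 g(4) linear_sum_Basis[OF linear_proj[of x], of "fst \<delta> /\<^sub>R c"] by simp
      also have "(\<lambda>s. \<Sum>i\<in>Basis. (\<zeta> s \<bullet> i) *\<^sub>R \<pi> (\<gamma> s) i) = (\<lambda>s. \<pi> (\<gamma> s) (\<zeta> s))"
        by (simp only: linear_sum_Basis[OF linear_proj, symmetric])
      finally show ?thesis
        using vector_derivative_cong_near[OF _ D\<zeta> e(1)] rep by blast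
    qed
    moreover have "\<delta> = dX x (fst \<delta> /\<^sub>R c)"
    proof -
      have "((\<lambda>s. \<Sum>i\<in>Basis. (\<zeta> s \<bullet> i) *\<^sub>R DQ (\<gamma> s) i) has_vector_derivative
          (\<Sum>i\<in>Basis. (\<zeta> 0 \<bullet> i) *\<^sub>R D2Q x a i + ((fst \<delta> /\<^sub>R c) \<bullet> i) *\<^sub>R DQ (\<gamma> 0) i)) (at 0)"
        by (rule has_vector_derivative_sum_basis[OF D\<zeta> DQg])
      also have "(\<Sum>i\<in>Basis. (\<zeta> 0 \<bullet> i) *\<^sub>R D2Q x a i + ((fst \<delta> /\<^sub>R c) \<bullet> i) *\<^sub>R DQ (\<gamma> 0) i) = DQ x (fst \<delta> /\<^sub>R c)"
        unfolding \<zeta>0 g(4) linear_sum_Basis[OF linear_DQ[OF xU], of "fst \<delta> /\<^sub>R c"] by simp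
      finally have h1: "((\<lambda>s. (c *\<^sub>R \<zeta> s, \<Sum>i\<in>Basis. (\<zeta> s \<bullet> i) *\<^sub>R DQ (\<gamma> s) i)) has_vector_derivative
          dX x (fst \<delta> /\<^sub>R c)) (at 0)"
        unfolding dX_def
        by (intro has_vector_derivative_Pair bounded_linear.has_vector_derivative[OF bounded_linear_scaleR_right D\<zeta>])
      have h2: "(c *\<^sub>R \<zeta> s, \<Sum>i\<in>Basis. (\<zeta> s \<bullet> i) *\<^sub>R DQ (\<gamma> s) i) = \<Delta> s" if s: "s \<in> {-e<..<e}" for s
      proof -
        have "s \<in> {-\<epsilon><..<\<epsilon>}" using s e by auto
        then have "\<gamma> s \<in> U" using g(3) SU by blast
        then show ?thesis using rep[OF s] linear_sum_Basis[OF linear_DQ, of "\<gamma> s" "\<zeta> s"] by (simp add: dX_def)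
      qed
      show ?thesis by (rule vector_derivative_cong_near[OF D\<Delta> h1 e(1)]) (simp only: h2)
    qed
    ultimately have "\<delta> \<in> tangent_space ?M ?p" using tangent_space_image[OF x] by blast
    then have "closest_point ?\<nu> \<delta> = 0"
      by (intro closest_point_subspace_eqI[OF sub subspace_0[OF sub]]) (simp add: normal_space_def inner_commute)
    then show ?thesis
      using linear_diff[OF linear_closest_point[OF sub]] by (simp add: \<delta>_def)
  qed
  show ?thesis
    unfolding second_fundamental_form_def
  proof (rule the_equality)
    show "\<exists>Y. local_tangent_field ?M ?p Y \<and> Y ?p = dX x b \<and>
        closest_point ?\<nu> (hess x a b) = closest_point ?\<nu> (differential_on ?M Y ?p (dX x a))"
      by (intro exI[of _ Y0] conjI field0 Y0p) (simp only: D0)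
    fix w assume "\<exists>Y. local_tangent_field ?M ?p Y \<and> Y ?p = dX x b \<and>
        w = closest_point ?\<nu> (differential_on ?M Y ?p (dX x a))"
    then obtain Y where "local_tangent_field ?M ?p Y" "Y ?p = dX x b"
        "w = closest_point ?\<nu> (differential_on ?M Y ?p (dX x a))" by blast
    then show "w = closest_point ?\<nu> (hess x a b)" by (simp only: key)
  qed
qed

text \<open>A basis of the tangent space of \<open>S\<close> with orthogonal images suffices:
  normalizing the images gives an orthonormal basis, and the weights are the diagonal entries of the
  inverse metric. Invariance of the trace passes to it from the unknown basis in the
  definition.\<close>

lemma mean_curvature_vector_image:
  assumes x: "x \<in> S" and N: "subspace (tangent_space N (X x))"
    and B: "finite B" "span B = {v. \<pi> x v = v}" "0 \<notin> B"
    and orth: "\<And>b b'. b \<in> B \<Longrightarrow> b' \<in> B \<Longrightarrow> b \<noteq> b' \<Longrightarrow> dX x b \<bullet> dX x b' = 0"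
  shows "mean_curvature_vector N (X ` S) (X x) =
    closest_point (normal_space N (X ` S) (X x)) (\<Sum>b\<in>B. (1 / (dX x b \<bullet> dX x b)) *\<^sub>R hess x b b)"
proof -
  let ?M = "X ` S" and ?p = "X x"
  let ?\<nu> = "normal_space N ?M ?p" and ?T = "tangent_space ?M ?p"
  have xU: "x \<in> U" using x SU by auto
  have sub: "subspace ?\<nu>"
    using N by (auto simp: subspace_def normal_space_def inner_add_left)
  have T: "?T = dX x ` span B" using tangent_space_image[OF x] B(2) by simp
  have subT: "subspace ?T" unfolding T by (rule linear_subspace_image[OF linear_dX[OF xU]]) simp
  define E where "E = (SOME E. orthonormal_basis_of ?T E)"
  have E: "orthonormal_basis_of ?T E"
    unfolding E_def using orthonormal_basis_of_exists[OF subT] someI_ex by metis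
  define nm where "nm b = dX x b /\<^sub>R norm (dX x b)" for b
  have pos: "norm (dX x b) > 0" if "b \<in> B" for b
  proof -
    have "b \<noteq> 0" using that B(3) by blast
    then show ?thesis using c by (simp add: dX_def prod_eq_iff)
  qed
  have E': "orthonormal_basis_of ?T (nm ` B)"
    unfolding orthonormal_basis_of_def
  proof (intro conjI)
    show "pairwise orthogonal (nm ` B)"
      using orth by (force simp: pairwise_def orthogonal_def nm_def)
    show "\<forall>e\<in>nm ` B. norm e = 1" using pos by (force simp: nm_def)
    have "span (nm ` B) = span (dX x ` B)"
    proof -
      have "nm ` B \<subseteq> span (dX x ` B)"
        unfolding nm_def by (intro image_subsetI span_scale span_base imageI)
      moreover have "dX x b \<in> span (nm ` B)" if "b \<in> B" for b
      proof -
        have "nm b \<in> span (nm ` B)" using that by (simp add: span_base)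
        then have "norm (dX x b) *\<^sub>R nm b \<in> span (nm ` B)" by (rule span_scale)
        then show ?thesis using pos[OF that] by (simp add: nm_def)
      qed
      ultimately show ?thesis by (auto simp: span_eq)
    qed
    then show "span (nm ` B) = ?T" unfolding T by (simp add: linear_span_image[OF linear_dX[OF xU]])
  qed
  \<comment> \<open>Pulling back along the first component gives a map bilinear on the whole product
    space, as the trace lemma wants; on tangent vectors its normal part is the second fundamental
    form.\<close>
  define q where "q u v = hess x (fst u /\<^sub>R c) (fst v /\<^sub>R c)" for u v :: "'e \<times> 'f"
  have lq: "linear (\<lambda>v. q u v)" "linear (\<lambda>u. q u v)" for u v
    unfolding q_def
    using linear_compose[OF linear_fst_scaled linear_hess(1)[OF xU]]
      linear_compose[OF linear_fst_scaled linear_hess(2)[OF xU]] by (auto simp: o_def)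
  have "second_fundamental_form N ?M ?p e e = closest_point ?\<nu> (q e e)" if "e \<in> E" for e
  proof -
    have "e \<in> ?T" using E that span_base by (auto simp: orthonormal_basis_of_def)
    then obtain v where v: "e = dX x v" "\<pi> x v = v" using tangent_space_image[OF x] by auto
    show ?thesis unfolding q_def using second_fundamental_form_image[OF x v(2) v(2) N]
      by (simp add: v(1) fst_dX)
  qed
  then have "mean_curvature_vector N ?M ?p = (\<Sum>e\<in>E. closest_point ?\<nu> (q e e))"
    unfolding mean_curvature_vector_def Let_def E_def[symmetric] by simp
  also have "\<dots> = closest_point ?\<nu> (\<Sum>e\<in>E. q e e)"
    using linear_sum[OF linear_closest_point[OF sub]] by metis
  also have "(\<Sum>e\<in>E. q e e) = (\<Sum>e\<in>nm ` B. q e e)"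
    by (rule orthonormal_basis_of_trace[OF E E' lq])
  also have "\<dots> = (\<Sum>b\<in>B. q (nm b) (nm b))"
  proof (rule sum.reindex_cong[where l=nm])
    show "inj_on nm B"
    proof (rule inj_onI, rule ccontr)
      fix b b' assume h: "b \<in> B" "b' \<in> B" "nm b = nm b'" "b \<noteq> b'"
      have "nm b \<bullet> nm b = 1" using pos[OF h(1)] by (simp add: norm_eq_1[symmetric]) (simp add: nm_def)
      moreover have "nm b \<bullet> nm b' = 0" using orth[OF h(1,2,4)] by (simp add: nm_def)
      ultimately show False using h(3) by simp
    qed
  qed auto
  also have "\<dots> = (\<Sum>b\<in>B. (1 / (dX x b \<bullet> dX x b)) *\<^sub>R hess x b b)"
  proof (rule sum.cong[OF refl])
    fix b assume "b \<in> B"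
    have "fst (nm b) /\<^sub>R c = b /\<^sub>R norm (dX x b)"
      using c by (simp add: nm_def dX_def)
    then have "q (nm b) (nm b) = (1 / norm (dX x b)) *\<^sub>R (1 / norm (dX x b)) *\<^sub>R hess x b b"
      unfolding q_def using linear_cmul[OF linear_hess(1)[OF xU]] linear_cmul[OF linear_hess(2)[OF xU]]
      by (simp add: divide_inverse)
    then show "q (nm b) (nm b) = (1 / (dX x b \<bullet> dX x b)) *\<^sub>R hess x b b"
      by (simp add: norm_eq_sqrt_inner power_divide flip: power2_eq_square)
  qed
  finally show ?thesis .
qed

end

section \<open>Traces of the Hessian of a Lawson-Osserman map\<close>

lemma tangent_space_open:
  assumes "open S" "x \<in> S"
  shows "tangent_space S x = UNIV"
proof -
  have "v \<in> tangent_space S x" for v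
  proof -
    obtain e where e: "e > 0" "ball x e \<subseteq> S" using assms openE by blast
    define d where "d = e / (norm v + 1)"
    have d: "d > 0" using e by (simp add: d_def add_nonneg_pos)
    have "x + s *\<^sub>R v \<in> S" if "s \<in> {-d<..<d}" for s
    proof -
      have "\<bar>s\<bar> * norm v \<le> d * norm v" using that by (intro mult_right_mono) auto
      also have "\<dots> < d * (norm v + 1)" using d by simp
      also have "\<dots> = e" using norm_ge_zero[of v] by (simp add: d_def add_nonneg_eq_0_iff)
      finally show ?thesis using e by (auto simp: dist_norm subset_iff)
    qed
    moreover have "smooth_on {-d<..<d} (\<lambda>s. x + s *\<^sub>R v)"
      by (rule Cinf_imp_smooth_on[OF Cinf_add[OF Cinf_const
              Cinf_bounded_linear[OF bounded_linear_scaleR_left]], of UNIV]) auto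
    moreover have "((\<lambda>s. x + s *\<^sub>R v) has_vector_derivative v) (at 0)"
      by (auto intro!: derivative_eq_intros)
    ultimately show ?thesis
      unfolding tangent_space_def mem_Collect_eq
      by (intro exI[of _ "\<lambda>s. x + s *\<^sub>R v"] exI[of _ d]) (use d in auto)
  qed
  then show ?thesis by blast
qed

lemma tangent_space_sphere:
  fixes x :: "'a::euclidean_space"
  assumes "x \<in> sphere 0 1"
  shows "tangent_space (sphere 0 1) x = {v. x \<bullet> v = 0}"
proof (intro set_eqI iffI)
  fix v assume "v \<in> tangent_space (sphere 0 1) x"
  then obtain \<gamma> \<epsilon> where g: "\<epsilon> > 0" "smooth_on {-\<epsilon><..<\<epsilon>} \<gamma>" "\<gamma> ` {-\<epsilon><..<\<epsilon>} \<subseteq> sphere 0 1"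
    "\<gamma> (0::real) = x" "(\<gamma> has_vector_derivative v) (at 0)" by (rule tangent_space_curve)
  have 1: "((\<lambda>s. \<gamma> s \<bullet> \<gamma> s) has_vector_derivative \<gamma> 0 \<bullet> v + v \<bullet> \<gamma> 0) (at 0)"
    using bounded_bilinear.has_vector_derivative[OF bounded_bilinear_inner g(5) g(5)] .
  have 2: "\<gamma> s \<bullet> \<gamma> s = 1" if "s \<in> {-\<epsilon><..<\<epsilon>}" for s
  proof -
    have "\<gamma> s \<in> sphere 0 1" using g(3) that by blast
    then show ?thesis by (simp add: norm_eq_1[symmetric])
  qed
  have "\<gamma> 0 \<bullet> v + v \<bullet> \<gamma> 0 = 0"
    by (rule vector_derivative_cong_near[OF 1 has_vector_derivative_const g(1) 2])
  then show "v \<in> {v. x \<bullet> v = 0}" using g(4) by (simp add: inner_commute)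
next
  fix v assume "v \<in> {v. x \<bullet> v = 0}"
  then have xv: "x \<bullet> v = 0" "v \<bullet> x = 0" by (auto simp: inner_commute)
  have xx: "x \<bullet> x = 1" using assms by (simp add: norm_eq_1[symmetric])
  define m where "m = norm v"
  \<comment> \<open>A great circle with velocity \<open>v\<close> at 0. For \<open>v = 0\<close> the
    division by zero yields 0 and the curve is constant, so the formula covers this case
    too.\<close>
  define \<gamma> where "\<gamma> s = cos (m * s) *\<^sub>R x + (sin (m * s) / m) *\<^sub>R v" for s
  have nrm: "\<gamma> s \<bullet> \<gamma> s = 1" for s
  proof (cases "m = 0")
    case True
    then show ?thesis by (simp add: \<gamma>_def xx)
  next
    case False
    have "\<gamma> s \<bullet> \<gamma> s = (cos (m * s))\<^sup>2 + (sin (m * s) / m)\<^sup>2 * (v \<bullet> v)"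
      by (simp add: \<gamma>_def inner_add_left inner_add_right xx xv power2_eq_square)
    also have "v \<bullet> v = m\<^sup>2" by (simp add: m_def power2_norm_eq_inner)
    finally show ?thesis using False by (simp add: power_divide)
  qed
  have Cm: "Cinf UNIV (\<lambda>s::real. m * s)" by (intro Cinf_bounded_linear) (auto intro: bounded_linear_mult_right)
  have "Cinf UNIV (\<lambda>s. cos (m * s) *\<^sub>R x + (sin (m * s) * (1 / m)) *\<^sub>R v)"
    by (rule Cinf_add[OF Cinf_scaleR[OF Cinf_compose[OF Cm Cinf_cos] Cinf_const]
          Cinf_scaleR[OF Cinf_mult[OF Cinf_compose[OF Cm Cinf_sin] Cinf_const] Cinf_const]]) auto
  then have "Cinf UNIV \<gamma>" by (simp add: \<gamma>_def[abs_def])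
  then have 1: "smooth_on {-1<..<1} \<gamma>" by (rule Cinf_imp_smooth_on) auto
  have "(\<gamma> has_vector_derivative (m / m) *\<^sub>R v) (at 0)"
    unfolding \<gamma>_def by (auto intro!: derivative_eq_intros)
  moreover have "(m / m) *\<^sub>R v = v" by (simp add: m_def)
  ultimately have 2: "(\<gamma> has_vector_derivative v) (at 0)" by simp
  show "v \<in> tangent_space (sphere 0 1) x"
    unfolding tangent_space_def mem_Collect_eq
    by (intro exI[of _ \<gamma>] exI[of _ 1]) (use 1 2 nrm in \<open>auto simp: norm_eq_1 \<gamma>_def\<close>)
qed

section \<open>Singular spaces of a linear map\<close>

lemma singular_space_subspace:
  assumes "subspace V" "linear A"
  shows "subspace (singular_space V A \<sigma>)"
  using assms
  by (auto simp: subspace_def singular_space_def linear_0 linear_add linear_cmul inner_add_left algebra_simps)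

lemma singular_space_zero:
  assumes "linear A"
  shows "singular_space V A 0 = {v \<in> V. A v = 0}"
  by (auto simp: singular_space_def)

text \<open>A first-order condition: for small \<open>t\<close> of the right sign a linear term
  would outweigh the quadratic one. It replaces Lagrange multipliers for a maximum on a
  sphere.\<close>

lemma nonneg_quadratic_imp_linear_zero:
  fixes \<beta> \<gamma> :: real
  assumes "\<And>t. 0 \<le> 2 * t * \<beta> + t\<^sup>2 * \<gamma>"
  shows "\<beta> = 0"
proof (rule ccontr)
  assume "\<beta> \<noteq> 0"
  define m where "m = \<bar>\<gamma>\<bar> + 1"
  define t where "t = - \<beta> / m"
  have p: "m > 0" by (simp add: m_def)
  have "2 * t * \<beta> + t\<^sup>2 * \<gamma> \<le> 2 * t * \<beta> + t\<^sup>2 * m" by (intro add_left_mono mult_left_mono) (auto simp: m_def)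
  also have "\<dots> = - (\<beta>\<^sup>2 / m)" using p by (simp add: t_def power2_eq_square)
  also have "\<dots> < 0" using \<open>\<beta> \<noteq> 0\<close> p by simp
  finally show False using assms[of t] by simp
qed

text \<open>A maximiser of \<open>|A w|\<^sup>2\<close> on the unit sphere of the orthogonal complement of the two singular
  spaces would be a further singular vector.\<close>

lemma singular_spaces_span:
  fixes A :: "'a::euclidean_space \<Rightarrow> 'b::euclidean_space"
  assumes T: "subspace T" and A: "linear A"
    and uniq: "\<And>\<tau>. singular_value T A \<tau> \<Longrightarrow> \<tau> \<noteq> 0 \<Longrightarrow> \<tau> = \<sigma>"
  shows "span (singular_space T A 0 \<union> singular_space T A \<sigma>) = T"
proof -
  let ?V0 = "singular_space T A 0" and ?V1 = "singular_space T A \<sigma>"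
  have V0: "?V0 = {v \<in> T. A v = 0}" by (rule singular_space_zero[OF A])
  have sT: "?V0 \<subseteq> T" "?V1 \<subseteq> T" by (auto simp: singular_space_def)
  have spT: "span (?V0 \<union> ?V1) \<subseteq> T" using sT T by (simp add: span_minimal)
  define W where "W = {w \<in> T. \<forall>v\<in>span (?V0 \<union> ?V1). w \<bullet> v = 0}"
  have W: "subspace W" using T by (auto simp: W_def subspace_def inner_add_left)
  have W0: "W = {0}"
  proof (rule ccontr)
    assume "W \<noteq> {0}"
    then obtain w0 where w0: "w0 \<in> W" "w0 \<noteq> 0" using subspace_0[OF W] by blast
    let ?K = "W \<inter> sphere 0 1"
    have K: "compact ?K" using closed_subspace[OF W] by (simp add: closed_Int_compact)
    have ne: "?K \<noteq> {}"
    proof -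
      have "w0 /\<^sub>R norm w0 \<in> ?K" using w0 W by (auto simp: subspace_scale)
      then show ?thesis by blast
    qed
    have cont: "continuous_on ?K (\<lambda>w. A w \<bullet> A w)"
      using A by (intro continuous_intros linear_continuous_on) (auto simp: linear_conv_bounded_linear)
    obtain w where w: "w \<in> ?K" "\<And>v. v \<in> ?K \<Longrightarrow> A v \<bullet> A v \<le> A w \<bullet> A w"
      using continuous_attains_sup[OF K ne cont] by blast
    define \<mu> where "\<mu> = A w \<bullet> A w"
    have ww: "w \<bullet> w = 1" using w(1) by (simp add: norm_eq_1[symmetric])
    have le: "A v \<bullet> A v \<le> \<mu> * (v \<bullet> v)" if "v \<in> W" for v
    proof (cases "v = 0")
      case True
      then show ?thesis using A by (simp add: linear_0)
    next
      case False
      have "v /\<^sub>R norm v \<in> ?K" using that False W by (auto simp: subspace_scale)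
      then have "(A v \<bullet> A v) / (norm v)\<^sup>2 \<le> \<mu>"
        using w(2)[of "v /\<^sub>R norm v"] A
        by (simp add: \<mu>_def linear_cmul divide_inverse power2_eq_square algebra_simps)
      then show ?thesis using False by (simp add: power2_norm_eq_inner pos_divide_le_eq)
    qed
    \<comment> \<open>The variation w + t v stays in \<open>W\<close>, where |A .|^2 is at most
      \<mu> |.|^2 with equality at \<open>w\<close>; hence the first-order term of the difference
      vanishes.\<close>
    have eqW: "A w \<bullet> A v = \<mu> * (w \<bullet> v)" if v: "v \<in> W" for v
    proof -
      have "\<mu> * (w \<bullet> v) - A w \<bullet> A v = 0"
      proof (rule nonneg_quadratic_imp_linear_zero)
        fix t :: real
        have "w + t *\<^sub>R v \<in> W" using w(1) v W by (auto simp: subspace_add subspace_scale)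
        from le[OF this] show "0 \<le> 2 * t * (\<mu> * (w \<bullet> v) - A w \<bullet> A v) + t\<^sup>2 * (\<mu> * (v \<bullet> v) - A v \<bullet> A v)"
          using A ww by (simp add: linear_add linear_cmul inner_add_left inner_add_right inner_commute
              power2_eq_square algebra_simps \<mu>_def)
      qed
      then show ?thesis by simp
    qed
    have wT: "w \<in> T" "\<And>v. v \<in> span (?V0 \<union> ?V1) \<Longrightarrow> w \<bullet> v = 0" using w(1) by (auto simp: W_def)
    \<comment> \<open>On each singular space, \<open>A v \<bullet> A w\<close> is a multiple of
      \<open>v \<bullet> w\<close>, so orthogonality of \<open>w\<close> to these spaces carries
      over to the images.\<close>
    have eqV: "A w \<bullet> A v = 0" if "v \<in> span (?V0 \<union> ?V1)" for v
      using that
    proof (induction v rule: span_induct)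
      case base
      then show ?case using A by (auto simp: subspace_def linear_0 linear_add linear_cmul inner_add_right)
    next
      case (step v)
      then show ?case
      proof
        assume "v \<in> ?V0" then show ?thesis by (simp add: V0)
      next
        assume v: "v \<in> ?V1"
        then have "A v \<bullet> A w = \<sigma>\<^sup>2 * (v \<bullet> w)" using wT(1) by (auto simp: singular_space_def)
        moreover have "w \<bullet> v = 0" using wT(2) v span_base by blast
        ultimately show ?thesis by (simp add: inner_commute)
      qed
    qed
    have "A w \<bullet> A v = \<mu> * (w \<bullet> v)" if v: "v \<in> T" for v
    proof -
      obtain y z where yz: "y \<in> span (?V0 \<union> ?V1)" "\<And>u. u \<in> span (?V0 \<union> ?V1) \<Longrightarrow> orthogonal z u" "v = y + z"
        using orthogonal_subspace_decomp_exists[of "?V0 \<union> ?V1" v] by blast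
      have "v - y \<in> T" by (rule subspace_diff[OF T v]) (use yz(1) spT in blast)
      then have "z \<in> W" using yz(2,3) by (simp add: W_def orthogonal_def)
      then show ?thesis using eqW[of z] eqV[OF yz(1)] wT(2)[OF yz(1)] A
        by (simp add: yz(3) linear_add inner_add_right)
    qed
    moreover have \<mu>: "\<mu> \<ge> 0" by (simp add: \<mu>_def)
    ultimately have ws: "w \<in> singular_space T A (sqrt \<mu>)"
      using wT(1) by (simp add: singular_space_def)
    have "w \<noteq> 0" using ww by auto
    then have "singular_value T A (sqrt \<mu>)" using ws \<mu> by (auto simp: singular_value_def)
    then have "sqrt \<mu> = 0 \<or> sqrt \<mu> = \<sigma>" using uniq by blast
    then have "w \<in> ?V0 \<union> ?V1" using ws by auto
    then have "w \<bullet> w = 0" using wT(2) span_base by blast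
    then show False using ww by simp
  qed
  show ?thesis
  proof
    show "T \<subseteq> span (?V0 \<union> ?V1)"
    proof
      fix v assume v: "v \<in> T"
      obtain y z where yz: "y \<in> span (?V0 \<union> ?V1)" "\<And>u. u \<in> span (?V0 \<union> ?V1) \<Longrightarrow> orthogonal z u" "v = y + z"
        using orthogonal_subspace_decomp_exists[of "?V0 \<union> ?V1" v] by blast
      have "v - y \<in> T" by (rule subspace_diff[OF T v]) (use yz(1) spT in blast)
      then have "z \<in> W" using yz(2,3) by (simp add: W_def orthogonal_def)
      then show "v \<in> span (?V0 \<union> ?V1)" using yz W0 by simp
    qed
  qed (rule spT)
qed

section \<open>Homogeneous maps, Euler's relation, and homogeneous harmonic maps of spheres\<close>

lemma dd_homogeneous:
  assumes f: "Cinf UNIV f" and hom: "\<And>t x. t \<noteq> 0 \<Longrightarrow> f (t *\<^sub>R x) = t ^ Suc j *\<^sub>R f x"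
    and t: "t \<noteq> 0"
  shows "dd f (t *\<^sub>R x) v = t ^ j *\<^sub>R dd f x v"
proof -
  have "((\<lambda>y. f (t *\<^sub>R y)) has_derivative (\<lambda>v. dd f (t *\<^sub>R x) (t *\<^sub>R v))) (at x)"
    by (rule has_derivative_compose[OF has_derivative_scaleR_right[OF has_derivative_ident] dd_deriv[OF f]]) simp
  moreover have "((\<lambda>y. f (t *\<^sub>R y)) has_derivative (\<lambda>v. t ^ Suc j *\<^sub>R dd f x v)) (at x)"
    unfolding hom[OF t] by (rule has_derivative_scaleR_right[OF dd_deriv[OF f]]) simp
  ultimately have "dd f (t *\<^sub>R x) (t *\<^sub>R v) = t ^ Suc j *\<^sub>R dd f x v"
    using has_derivative_unique by metis
  then have "t *\<^sub>R dd f (t *\<^sub>R x) v = t *\<^sub>R (t ^ j *\<^sub>R dd f x v)"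
    by (simp add: linear_cmul[OF linear_dd[OF f]])
  then show ?thesis using t by (simp only: scaleR_left_imp_eq[OF t])
qed

lemma dd_euler:
  assumes f: "Cinf UNIV f" and hom: "\<And>t x. t \<noteq> 0 \<Longrightarrow> f (t *\<^sub>R x) = t ^ j *\<^sub>R f x"
  shows "dd f x x = real j *\<^sub>R f x"
proof -
  have "((\<lambda>t. f (t *\<^sub>R x)) has_derivative (\<lambda>h. dd f (1 *\<^sub>R x) (h *\<^sub>R x))) (at (1::real))"
    by (rule has_derivative_compose[OF _ dd_deriv[OF f]]) (auto intro!: derivative_eq_intros)
  moreover have "((\<lambda>t. f (t *\<^sub>R x)) has_derivative (\<lambda>h. (h * real j) *\<^sub>R f x)) (at (1::real))"
    by (rule has_derivative_transform_within_open[where f="\<lambda>t. t ^ j *\<^sub>R f x" and s="-{0}"])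
      (auto simp: hom intro!: derivative_eq_intros)
  ultimately have "dd f (1 *\<^sub>R x) (1 *\<^sub>R x) = (1 * real j) *\<^sub>R f x"
    using has_derivative_unique by metis
  then show ?thesis by simp
qed

lemma dd_inner: "Cinf U f \<Longrightarrow> x \<in> U \<Longrightarrow> dd (\<lambda>y. f y \<bullet> b) x v = dd f x v \<bullet> b"
  using dd_eqI[OF has_derivative_inner_left[OF dd_deriv]] by metis

lemma dd2_inner: "Cinf UNIV f \<Longrightarrow> dd2 (\<lambda>y. f y \<bullet> b) x u v = dd2 f x u v \<bullet> b"
  unfolding dd2_def using dd_inner[of UNIV f] dd_inner[OF dd_Cinf, of UNIV f] by simp

lemma orthonormal_basis_of_Basis: "orthonormal_basis_of UNIV (Basis :: 'a::euclidean_space set)"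
  by (auto simp: orthonormal_basis_of_def pairwise_def orthogonal_def inner_Basis span_Basis)

locale homogeneous_sphere_map =
  fixes P :: "'a::euclidean_space \<Rightarrow> 'b::euclidean_space" and k :: nat
  assumes P: "Cinf UNIV P"
    and hom: "P (t *\<^sub>R x) = t ^ k *\<^sub>R P x"
    and harmonic: "(\<Sum>i\<in>Basis. dd2 P x i i) = 0"
    and unit: "x \<in> sphere 0 1 \<Longrightarrow> P x \<in> sphere 0 1"
    and k: "k \<ge> 3"
begin

text \<open>Unit vectors go to unit vectors and both sides are homogeneous of degree 2 k.
  Differentiating this identity once and twice gives the two lemmas that follow.\<close>

lemma inner_P: "P x \<bullet> P x = (x \<bullet> x) ^ k"
proof (cases "x = 0")
  case True
  have zk: "(0::real) ^ k = 0" using k by simp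
  have "P (0 *\<^sub>R 0) = 0" unfolding hom zk by simp
  then have "P x = 0" using True by simp
  then show ?thesis using True k by simp
next
  case False
  define y where "y = x /\<^sub>R norm x"
  have x: "x = norm x *\<^sub>R y" using False by (simp add: y_def)
  have "P y \<bullet> P y = 1" using unit[of y] False by (simp add: y_def norm_eq_1[symmetric])
  then have "P x \<bullet> P x = (norm x ^ k)\<^sup>2" by (subst (1 2) x) (simp add: hom power2_eq_square)
  also have "\<dots> = (x \<bullet> x) ^ k" by (simp add: power2_norm_eq_inner[symmetric] power_mult[symmetric] mult.commute)
  finally show ?thesis .
qed

lemma inner_P_dd: "P x \<bullet> dd P x e = real k * (x \<bullet> x) ^ (k - 1) * (x \<bullet> e)"
proof -
  have 1: "((\<lambda>y. P y \<bullet> P y) has_derivative (\<lambda>e. P x \<bullet> dd P x e + dd P x e \<bullet> P x)) (at x)"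
    by (intro has_derivative_inner dd_deriv[OF P]) auto
  have 2: "((\<lambda>y. (y \<bullet> y) ^ k) has_derivative (\<lambda>e. real k * (x \<bullet> e + e \<bullet> x) * (x \<bullet> x) ^ (k - 1))) (at x)"
    by (auto intro!: derivative_eq_intros)
  have "P x \<bullet> dd P x e + dd P x e \<bullet> P x = real k * (x \<bullet> e + e \<bullet> x) * (x \<bullet> x) ^ (k - 1)"
    by (rule fun_cong[OF has_derivative_unique[OF 1[unfolded inner_P] 2]])
  then show ?thesis by (simp add: inner_commute)
qed

text \<open>This fixes the component of the second derivatives along \<open>P x\<close> by first
  derivatives: for unit vectors it is k in a kernel direction and k - \<sigma>^2 in a singular
  direction. The multiples of \<open>P x\<close> in the traces are identified this way.\<close>

lemma inner_P_dd2:
  assumes "x \<bullet> x = 1" "x \<bullet> e = 0"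
  shows "P x \<bullet> dd2 P x e e = real k * (e \<bullet> e) - dd P x e \<bullet> dd P x e"
proof -
  have 1: "((\<lambda>y. P y \<bullet> dd P y e) has_derivative (\<lambda>a. P x \<bullet> dd2 P x a e + dd P x a \<bullet> dd P x e)) (at x)"
    by (intro has_derivative_inner dd_deriv[OF P] dd2_deriv[OF P]) auto
  have 2: "((\<lambda>y. real k * (y \<bullet> y) ^ (k - 1) * (y \<bullet> e)) has_derivative
    (\<lambda>a. real k * (x \<bullet> x) ^ (k - 1) * (a \<bullet> e) + 
        real k * (real (k - 1) * (x \<bullet> a + a \<bullet> x) * (x \<bullet> x) ^ (k - 1 - 1)) * (x \<bullet> e))) (at x)"
    by (auto intro!: derivative_eq_intros)
  have "P x \<bullet> dd2 P x e e + dd P x e \<bullet> dd P x e = real k * (x \<bullet> x) ^ (k - 1) * (e \<bullet> e) + 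
        real k * (real (k - 1) * (x \<bullet> e + e \<bullet> x) * (x \<bullet> x) ^ (k - 1 - 1)) * (x \<bullet> e)"
    by (rule fun_cong[OF has_derivative_unique[OF 1[unfolded inner_P_dd] 2]])
  then show ?thesis using assms by simp
qed

lemma dd_hom: "t \<noteq> 0 \<Longrightarrow> dd P (t *\<^sub>R x) v = t ^ (k - 1) *\<^sub>R dd P x v"
  by (rule dd_homogeneous[OF P]) (use k in \<open>simp_all add: hom\<close>)

lemma dd2_hom: "t \<noteq> 0 \<Longrightarrow> dd2 P (t *\<^sub>R x) u v = t ^ (k - 2) *\<^sub>R dd2 P x u v"
  unfolding dd2_def
proof (rule dd_homogeneous[OF dd_Cinf[OF P]])
  have "Suc (k - 2) = k - 1" using k by simp
  then show "dd P (t *\<^sub>R x) v = t ^ Suc (k - 2) *\<^sub>R dd P x v" if "t \<noteq> 0" for t x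
    using dd_hom[OF that] by simp
qed

lemma dd_self: "dd P x x = real k *\<^sub>R P x"
  by (rule dd_euler[OF P]) (simp add: hom)

lemma dd2_self: "dd2 P x x x = (real k * (real k - 1)) *\<^sub>R P x"
proof -
  have "dd2 P x x x = real (k - 1) *\<^sub>R dd P x x"
    unfolding dd2_def by (rule dd_euler[OF dd_Cinf[OF P]]) (simp add: dd_hom)
  then show ?thesis using k by (simp add: dd_self of_nat_diff mult.commute)
qed

lemma trace_dd2: "orthonormal_basis_of UNIV E \<Longrightarrow> (\<Sum>e\<in>E. dd2 P x e e) = 0"
  using orthonormal_basis_of_trace[OF _ orthonormal_basis_of_Basis, where q="dd2 P x"]
    linear_dd2_left[OF P] linear_dd2_right[OF P] harmonic by (metis UNIV_I)

end

section \<open>Adapted frames and the two partial traces of the Hessian\<close>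

lemma sum_disjoint3:
  assumes "finite B" "finite C" "B \<inter> C = {}" "x \<notin> B" "x \<notin> C"
  shows "(\<Sum>b\<in>insert x (B \<union> C). g b) = g x + ((\<Sum>b\<in>B. g b) + (\<Sum>b\<in>C. g b))"
  using assms by (simp add: sum.union_disjoint)

text \<open>Pairing with a kernel vector through \<open>A\<close> gives 0, and for a
  \<sigma>-singular vector it also gives \<sigma>^2 times the inner product, so the two singular
  spaces are orthogonal. They span \<open>T\<close> because \<sigma> is the only nonzero singular
  value. Orthonormal bases of both, together with \<open>x\<close>, therefore diagonalize the first
  derivative.\<close>

lemma singular_frame:
  fixes A :: "'a::euclidean_space \<Rightarrow> 'b::euclidean_space"
  assumes x: "x \<bullet> x = 1" and A: "linear A" and T: "T = {v. x \<bullet> v = 0}" and \<sigma>: "\<sigma> > 0"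
    and uniq: "\<And>\<tau>. singular_value T A \<tau> \<Longrightarrow> \<tau> \<noteq> 0 \<Longrightarrow> \<tau> = \<sigma>"
  obtains B C where "finite B" "finite C" "B \<inter> C = {}" "x \<notin> B" "x \<notin> C"
    "orthonormal_basis_of UNIV (insert x (B \<union> C))" "span (B \<union> C) = T" "B \<union> C \<subseteq> T"
    "card C = singular_multiplicity T A \<sigma>" "card B + card C + 1 = DIM('a)"
    "\<forall>b\<in>B. A b = 0" "\<forall>b\<in>C. \<forall>w\<in>T. A b \<bullet> A w = \<sigma>\<^sup>2 * (b \<bullet> w)"
proof -
  let ?V0 = "singular_space T A 0" and ?V1 = "singular_space T A \<sigma>"
  have sT: "subspace T" by (auto simp: T subspace_def inner_add_right)
  have V0: "?V0 = {v \<in> T. A v = 0}" by (rule singular_space_zero[OF A])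
  obtain B where B: "orthonormal_basis_of ?V0 B" "card B = dim ?V0" "B \<subseteq> ?V0"
    using orthonormal_basis_of_exists[OF singular_space_subspace[OF sT A]] .
  obtain C where C: "orthonormal_basis_of ?V1 C" "card C = dim ?V1" "C \<subseteq> ?V1"
    using orthonormal_basis_of_exists[OF singular_space_subspace[OF sT A]] .
  note fin = orthonormal_basis_of_finite(1)[OF B(1)] orthonormal_basis_of_finite(1)[OF C(1)]
  have BT: "b \<in> T" "A b = 0" "b \<bullet> b = 1" if "b \<in> B" for b
    using that B V0 by (auto simp: orthonormal_basis_of_def norm_eq_1)
  have CT: "b \<in> T" "b \<bullet> b = 1" if "b \<in> C" for b
    using that C by (auto simp: orthonormal_basis_of_def norm_eq_1 singular_space_def)
  have CA: "A b \<bullet> A w = \<sigma>\<^sup>2 * (b \<bullet> w)" if "b \<in> C" "w \<in> T" for b w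
    using that C(3) by (auto simp: singular_space_def)
  have BC: "b \<bullet> b' = 0" "b' \<bullet> b = 0" if "b \<in> B" "b' \<in> C" for b b'
    using CA[OF that(2) BT(1)[OF that(1)]] BT(2)[OF that(1)] \<sigma> by (auto simp: inner_commute)
  have disj: "B \<inter> C = {}" using BC BT(3) by fastforce
  have xn: "x \<notin> B" "x \<notin> C" using BT(1) CT(1) x by (auto simp: T)
  have spBC: "span (B \<union> C) = T"
  proof -
    have "span (B \<union> C) = span (span B \<union> span C)" by (simp add: span_Un span_span)
    also have "\<dots> = T"
      using B(1) C(1) singular_spaces_span[OF sT A uniq] by (simp add: orthonormal_basis_of_def)
    finally show ?thesis .
  qed
  have onb: "orthonormal_basis_of UNIV (insert x (B \<union> C))"
    unfolding orthonormal_basis_of_def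
  proof (intro conjI)
    show "pairwise orthogonal (insert x (B \<union> C))"
    proof -
      have "orthogonal b b'" if "b \<in> insert x (B \<union> C)" "b' \<in> insert x (B \<union> C)" "b \<noteq> b'" for b b'
      proof -
        have "pairwise orthogonal B" "pairwise orthogonal C"
          using B C by (auto simp: orthonormal_basis_of_def)
        then show ?thesis using that BC BT(1) CT(1)
          by (auto simp: pairwise_def orthogonal_def T inner_commute[of _ x])
      qed
      then show ?thesis by (simp add: pairwise_def)
    qed
    show "\<forall>e\<in>insert x (B \<union> C). norm e = 1" using x BT(3) CT(2) by (auto simp: norm_eq_1)
    have "v \<in> span (insert x (B \<union> C))" for v
    proof -
      have "x \<bullet> (v - (x \<bullet> v) *\<^sub>R x) = 0" by (simp add: inner_diff_right x)
      then have "v - (x \<bullet> v) *\<^sub>R x \<in> span (B \<union> C)" unfolding spBC T by simp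
      then show ?thesis unfolding span_insert by blast
    qed
    then show "span (insert x (B \<union> C)) = UNIV" by blast
  qed
  have "card (insert x (B \<union> C)) = DIM('a)"
    using basis_card_eq_dim[of "insert x (B \<union> C)" UNIV] orthonormal_basis_of_finite(2)[OF onb] onb
    by (simp add: orthonormal_basis_of_def dim_UNIV)
  then have card: "card B + card C + 1 = DIM('a)"
    using fin disj xn by (simp add: card_Un_disjoint)
  show ?thesis
    by (rule that[OF fin disj xn onb spBC _ _ card])
      (use BT(1,2) CT(1) CA C(2) in \<open>auto simp: singular_multiplicity_def\<close>)
qed

text \<open>A subspace is its own double orthogonal complement. This turns a vanishing normal part
  into membership in a span of explicit vectors.\<close>

lemma mem_span_of_orthogonal_normal_space:
  assumes "\<And>z. (\<And>u. u \<in> span Z \<Longrightarrow> z \<bullet> u = 0) \<Longrightarrow> v \<bullet> z = 0"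
  shows "v \<in> span (Z :: 'a::euclidean_space set)"
proof -
  obtain y z where yz: "y \<in> span Z" "\<And>u. u \<in> span Z \<Longrightarrow> orthogonal z u" "v = y + z"
    using orthogonal_subspace_decomp_exists[of Z v] by blast
  have "v \<bullet> z = 0" by (rule assms) (use yz(2) in \<open>auto simp: orthogonal_def\<close>)
  moreover have "y \<bullet> z = 0" using yz(2)[OF yz(1)] by (simp add: orthogonal_def inner_commute)
  ultimately have "z \<bullet> z = 0" by (simp add: yz(3) inner_add_left)
  then show ?thesis using yz by simp
qed

context homogeneous_sphere_map
begin

lemma sphere_parametrization:
  assumes "c \<noteq> 0"
  shows "graph_parametrization (sphere 0 1) UNIV (\<lambda>x v. v - (x \<bullet> v) *\<^sub>R x) c (\<lambda>x. s *\<^sub>R P x)"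
proof (rule graph_parametrization.intro)
  show "Cinf UNIV (\<lambda>x. s *\<^sub>R P x)" by (rule Cinf_scaleR[OF Cinf_const P]) simp
  show "tangent_space (sphere 0 1) x = {v. v - (x \<bullet> v) *\<^sub>R x = v}" if "x \<in> sphere 0 1" for x :: 'a
  proof -
    have "x \<noteq> 0" using that by auto
    then show ?thesis by (auto simp: tangent_space_sphere[OF that])
  qed
  show "linear (\<lambda>v. v - (x \<bullet> v) *\<^sub>R x)" for x :: 'a
    by (rule linearI) (auto simp: algebra_simps)
  have o: "open (UNIV :: 'a set)" by simp
  show "Cinf UNIV (\<lambda>x. b - (x \<bullet> b) *\<^sub>R x)" for b :: 'a
    by (rule Cinf_diff[OF Cinf_const[OF o] Cinf_scaleR[OF Cinf_inner[OF Cinf_id[OF o] Cinf_const[OF o]] Cinf_id[OF o]]])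
  show "b - (x \<bullet> b) *\<^sub>R x - (x \<bullet> (b - (x \<bullet> b) *\<^sub>R x)) *\<^sub>R x = b - (x \<bullet> b) *\<^sub>R x"
    if "x \<in> sphere 0 1" for x b :: 'a
    using that by (simp add: norm_eq_1 inner_diff_right)
qed (use assms in auto)

text \<open>In the frame the inverse metric takes two values, \<open>w0\<close> on the kernel
  directions and \<open>w1 < w0\<close> on the singular ones. Minimality makes the weighted trace
  \<open>w0 *\<^sub>R T0 + w1 *\<^sub>R T1\<close> a multiple of \<open>P x\<close>, and harmonicity
  does so for \<open>T0 + T1\<close>; since the weights differ, \<open>T0\<close> and
  \<open>T1\<close> are both multiples. Pairing with \<open>P x\<close> yields the factors, and
  comparing the two values found for \<open>T1\<close> yields \<sigma>^2.\<close>

lemma traces_of_minimal: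
  assumes x: "x \<in> sphere 0 1" and cs: "c \<noteq> 0" "s \<noteq> 0" "c\<^sup>2 + s\<^sup>2 = 1"
    and H0: "mean_curvature_vector (sphere 0 1) ((\<lambda>x. (c *\<^sub>R x, s *\<^sub>R P x)) ` sphere 0 1) (c *\<^sub>R x, s *\<^sub>R P x) = 0"
    and fin: "finite B" "finite C" and disj: "B \<inter> C = {}" "x \<notin> B" "x \<notin> C"
    and onb: "orthonormal_basis_of UNIV (insert x (B \<union> C))"
    and span: "span (B \<union> C) = {v. x \<bullet> v = 0}"
    and \<sigma>: "\<sigma> > 0" and AB: "\<And>b. b \<in> B \<Longrightarrow> dd P x b = 0"
    and AC: "\<And>b w. b \<in> C \<Longrightarrow> x \<bullet> w = 0 \<Longrightarrow> dd P x b \<bullet> dd P x w = \<sigma>\<^sup>2 * (b \<bullet> w)"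
  shows "(\<Sum>b\<in>B. dd2 P x b b) = (real k * real (card B)) *\<^sub>R P x"
    and "(\<Sum>b\<in>C. dd2 P x b b) = - (real k * (real k - 1 + real (card B))) *\<^sub>R P x"
    and "real (card C) * \<sigma>\<^sup>2 = real k * (real k - 1 + real (card B) + real (card C))"
proof -
  interpret gp: graph_parametrization "sphere 0 1" UNIV "\<lambda>x v. v - (x \<bullet> v) *\<^sub>R x" c "\<lambda>x. s *\<^sub>R P x"
    by (rule sphere_parametrization[OF cs(1)])
  let ?N = "sphere 0 1 :: ('a \<times> 'b) set" and ?M = "gp.X ` sphere 0 1"
  have xx: "x \<bullet> x = 1" using x by (simp add: norm_eq_1)
  have PxPx: "P x \<bullet> P x = 1" by (simp add: inner_P xx)
  have B1: "b \<bullet> b = 1" "x \<bullet> b = 0" "b \<bullet> x = 0" if "b \<in> B \<union> C" for b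
  proof -
    show "b \<bullet> b = 1" using onb that by (auto simp: orthonormal_basis_of_def norm_eq_1)
    have "b \<in> span (B \<union> C)" using that by (rule span_base)
    then show "x \<bullet> b = 0" "b \<bullet> x = 0" using span by (auto simp: inner_commute)
  qed
  have borth: "b \<bullet> b' = 0" if "b \<in> B \<union> C" "b' \<in> B \<union> C" "b \<noteq> b'" for b b'
    using onb that by (auto simp: orthonormal_basis_of_def pairwise_def orthogonal_def)
  have ddQ: "dd (\<lambda>x. s *\<^sub>R P x) y v = s *\<^sub>R dd P y v" for y v
    using dd_eqI[OF has_derivative_scaleR_right[OF dd_deriv[OF P UNIV_I]]] by metis
  have dd2Q: "dd2 (\<lambda>x. s *\<^sub>R P x) y u v = s *\<^sub>R dd2 P y u v" for y u v
    unfolding dd2_def[of "\<lambda>x. s *\<^sub>R P x"] ddQ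
    using dd_eqI[OF has_derivative_scaleR_right[OF dd2_deriv[OF P UNIV_I]]] by metis
  have dX: "gp.dX y v = (c *\<^sub>R v, s *\<^sub>R dd P y v)" for y v by (simp add: gp.dX_def ddQ)
  have Dproj: "gp.Dproj x b b = - x" if "b \<in> B \<union> C" for b
  proof -
    have "((\<lambda>y. b - (y \<bullet> b) *\<^sub>R y) has_derivative (\<lambda>a. 0 - ((x \<bullet> b) *\<^sub>R a + (a \<bullet> b) *\<^sub>R x))) (at x)"
      by (intro has_derivative_diff has_derivative_const has_derivative_scaleR has_derivative_ident
          has_derivative_inner_left)
    from dd_eqI[OF this] show ?thesis using B1[OF that] by (simp add: gp.Dproj_def)
  qed
  have hess: "gp.hess x b b = (- c *\<^sub>R x, s *\<^sub>R dd2 P x b b - (s * real k) *\<^sub>R P x)" if "b \<in> B \<union> C" for b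
    by (simp add: gp.hess_def Dproj[OF that] dX dd2Q linear_neg[OF linear_dd[OF P UNIV_I]] dd_self)
  have XN: "gp.X x \<in> ?N"
    using cs(3) xx PxPx by (simp add: gp.X_def norm_eq_1 power2_eq_square)
  have tN: "tangent_space ?N (gp.X x) = {w. gp.X x \<bullet> w = 0}" by (rule tangent_space_sphere[OF XN])
  have sN: "subspace (tangent_space ?N (gp.X x))" unfolding tN by (auto simp: subspace_def inner_add_right)
  define wt where "wt b = 1 / (gp.dX x b \<bullet> gp.dX x b)" for b
  define V where "V = (\<Sum>b\<in>B \<union> C. wt b *\<^sub>R gp.hess x b b)"
  let ?\<nu> = "normal_space ?N ?M (gp.X x)"
  have dXorth: "gp.dX x b \<bullet> gp.dX x b' = 0" if "b \<in> B \<union> C" "b' \<in> B \<union> C" "b \<noteq> b'" for b b'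
  proof -
    have "dd P x b \<bullet> dd P x b' = 0"
    proof (cases "b \<in> C")
      case True
      then show ?thesis using AC[OF True B1(2)[OF that(2)]] borth[OF that] by simp
    next
      case False
      then show ?thesis using that AB by auto
    qed
    then show ?thesis using borth[OF that] by (simp add: dX)
  qed
  have "mean_curvature_vector ?N ?M (gp.X x) = closest_point ?\<nu> V"
    unfolding V_def wt_def
  proof (rule gp.mean_curvature_vector_image[OF x sN _ _ _ dXorth])
    show "span (B \<union> C) = {v. v - (x \<bullet> v) *\<^sub>R x = v}" using xx by (auto simp: span)
    show "0 \<notin> B \<union> C" using B1(1) by fastforce
  qed (use fin in auto)
  moreover have "gp.X = (\<lambda>x. (c *\<^sub>R x, s *\<^sub>R P x))" by (auto simp: gp.X_def)
  ultimately have cp0: "closest_point ?\<nu> V = 0" using H0 by simp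
  have sub\<nu>: "subspace ?\<nu>" using sN by (auto simp: subspace_def normal_space_def inner_add_left)
  have tM: "tangent_space ?M (gp.X x) = gp.dX x ` {v. x \<bullet> v = 0}"
    using gp.tangent_space_image[OF x] x by auto
  have sT: "subspace {v. x \<bullet> v = 0}" by (auto simp: subspace_def inner_add_right)
  \<comment> \<open>The mean curvature vector in the sphere is the part of \<open>V\<close>
    orthogonal both to the tangent space and to the position vector, which is the normal of the
    ambient sphere. As it vanishes, \<open>V\<close> is a combination of these.\<close>
  have "V \<in> span (insert (gp.X x) (gp.dX x ` {v. x \<bullet> v = 0}))"
  proof (rule mem_span_of_orthogonal_normal_space)
    fix z assume z: "\<And>u. u \<in> span (insert (gp.X x) (gp.dX x ` {v. x \<bullet> v = 0})) \<Longrightarrow> z \<bullet> u = 0"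
    have "z \<bullet> gp.X x = 0" by (rule z) (simp add: span_base)
    moreover have "z \<bullet> v = 0" if "v \<in> tangent_space ?M (gp.X x)" for v
      by (rule z) (use that tM in \<open>auto intro: span_base\<close>)
    ultimately have "z \<in> ?\<nu>" by (simp add: normal_space_def tN inner_commute)
    from closest_point_subspace(2)[OF sub\<nu> this, of V] show "V \<bullet> z = 0" by (simp add: cp0)
  qed
  then obtain a where "V - a *\<^sub>R gp.X x \<in> span (gp.dX x ` {v. x \<bullet> v = 0})"
    unfolding span_insert by blast
  also have "span (gp.dX x ` {v. x \<bullet> v = 0}) = gp.dX x ` {v. x \<bullet> v = 0}"
    using linear_subspace_image[OF gp.linear_dX sT] by (simp add: span_eq_iff[THEN iffD2])
  finally obtain v where v: "V = a *\<^sub>R gp.X x + gp.dX x v" "x \<bullet> v = 0"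
    by (auto simp: algebra_simps)
  define W where "W = (\<Sum>b\<in>B \<union> C. wt b)"
  have V_eq: "V = (- (c * W) *\<^sub>R x, s *\<^sub>R (\<Sum>b\<in>B \<union> C. wt b *\<^sub>R dd2 P x b b) - (s * real k * W) *\<^sub>R P x)"
  proof -
    have "V = (\<Sum>b\<in>B \<union> C. wt b *\<^sub>R (- c *\<^sub>R x, s *\<^sub>R dd2 P x b b - (s * real k) *\<^sub>R P x))"
      unfolding V_def by (rule sum.cong[OF refl]) (simp only: hess)
    also have "\<dots> = (- (c * W) *\<^sub>R x, s *\<^sub>R (\<Sum>b\<in>B \<union> C. wt b *\<^sub>R dd2 P x b b) - (s * real k * W) *\<^sub>R P x)"
      by (simp add: prod_eq_iff fst_sum snd_sum W_def scaleR_sum_right sum_distrib_left scaleR_sum_left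
          sum_subtractf sum_negf algebra_simps)
    finally show ?thesis .
  qed
  from v(1) have 1: "- (c * W) *\<^sub>R x = (a * c) *\<^sub>R x + c *\<^sub>R v"
    and 2: "s *\<^sub>R (\<Sum>b\<in>B \<union> C. wt b *\<^sub>R dd2 P x b b) - (s * real k * W) *\<^sub>R P x = (a * s) *\<^sub>R P x + s *\<^sub>R dd P x v"
    unfolding V_eq by (simp_all add: gp.X_def dX)
  \<comment> \<open>The first component shows that there is no tangential part: \<open>v\<close> is
    orthogonal to \<open>x\<close>, while every other term is a multiple of
    \<open>x\<close>.\<close>
  from arg_cong[OF 1, of "\<lambda>y. x \<bullet> y"] have "- (c * W) = a * c" using xx v(2) by (simp add: inner_add_right)
  with 1 have "c *\<^sub>R v = 0" by simp
  then have "v = 0" using cs(1) by simp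
  with 2 have "s *\<^sub>R (\<Sum>b\<in>B \<union> C. wt b *\<^sub>R dd2 P x b b) = s *\<^sub>R ((real k * W + a) *\<^sub>R P x)"
    by (simp add: linear_0[OF linear_dd[OF P UNIV_I]] algebra_simps)
  then have wsum: "(\<Sum>b\<in>B \<union> C. wt b *\<^sub>R dd2 P x b b) = (real k * W + a) *\<^sub>R P x"
    using scaleR_left_imp_eq[OF cs(2)] by blast
  define T0 T1 where "T0 = (\<Sum>b\<in>B. dd2 P x b b)" and "T1 = (\<Sum>b\<in>C. dd2 P x b b)"
  define w0 w1 where "w0 = 1 / c\<^sup>2" and "w1 = 1 / (c\<^sup>2 + s\<^sup>2 * \<sigma>\<^sup>2)"
  have wtB: "wt b = w0" if "b \<in> B" for b
    using AB[OF that] B1(1)[of b] that by (simp add: wt_def dX w0_def power2_eq_square)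
  have wtC: "wt b = w1" if "b \<in> C" for b
    using AC[OF that, of b] B1[of b] that by (simp add: wt_def dX w1_def power2_eq_square)
  have c2: "c\<^sup>2 < c\<^sup>2 + s\<^sup>2 * \<sigma>\<^sup>2" "c\<^sup>2 > 0" using cs \<sigma> by auto
  then have "c\<^sup>2 + s\<^sup>2 * \<sigma>\<^sup>2 > 0" by linarith
  with c2 have "w1 < w0" unfolding w0_def w1_def by (intro divide_strict_left_mono mult_pos_pos) auto
  then have w01: "w0 - w1 \<noteq> 0" by simp
  have e1: "w0 *\<^sub>R T0 + w1 *\<^sub>R T1 = (real k * W + a) *\<^sub>R P x"
    using wsum fin disj wtB wtC
    by (simp add: sum.union_disjoint T0_def T1_def scaleR_sum_right cong: sum.cong)
  have e2: "(real k * (real k - 1)) *\<^sub>R P x + (T0 + T1) = 0"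
    using trace_dd2[OF onb, of x] unfolding sum_disjoint3[OF fin disj] T0_def[symmetric] T1_def[symmetric] dd2_self .
  then have T1: "T1 = - (real k * (real k - 1)) *\<^sub>R P x - T0"
    by (simp add: add_eq_0_iff algebra_simps)
  define \<delta> where "\<delta> = real k * W + a + w1 * (real k * (real k - 1))"
  have "(w0 - w1) *\<^sub>R T0 = \<delta> *\<^sub>R P x"
    using e1 unfolding T1 \<delta>_def by (simp add: algebra_simps)
  also have "\<dots> = (w0 - w1) *\<^sub>R ((\<delta> / (w0 - w1)) *\<^sub>R P x)" using w01 by simp
  finally have "(w0 - w1) *\<^sub>R T0 = (w0 - w1) *\<^sub>R ((\<delta> / (w0 - w1)) *\<^sub>R P x)" .
  then obtain \<beta> where \<beta>: "T0 = \<beta> *\<^sub>R P x" using scaleR_left_imp_eq[OF w01] by blast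
  have "P x \<bullet> T0 = real k * real (card B)"
  proof -
    have "P x \<bullet> T0 = (\<Sum>b\<in>B. real k)" unfolding T0_def inner_sum_right
      by (rule sum.cong[OF refl]) (use inner_P_dd2[OF xx] B1 AB in simp)
    then show ?thesis by simp
  qed
  then have "\<beta> = real k * real (card B)" by (simp add: \<beta> PxPx)
  then show T0': "(\<Sum>b\<in>B. dd2 P x b b) = (real k * real (card B)) *\<^sub>R P x"
    using \<beta> by (simp add: T0_def)
  then show "(\<Sum>b\<in>C. dd2 P x b b) = - (real k * (real k - 1 + real (card B))) *\<^sub>R P x"
    using T1 by (simp add: T0_def T1_def algebra_simps)
  then have "P x \<bullet> T1 = - (real k * (real k - 1 + real (card B)))" by (simp add: T1_def PxPx)
  moreover have "P x \<bullet> T1 = real (card C) * (real k - \<sigma>\<^sup>2)"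
  proof -
    have "P x \<bullet> T1 = (\<Sum>b\<in>C. real k - \<sigma>\<^sup>2)" unfolding T1_def inner_sum_right
      by (rule sum.cong[OF refl]) (use inner_P_dd2[OF xx] B1 AC in simp)
    then show ?thesis by simp
  qed
  ultimately show "real (card C) * \<sigma>\<^sup>2 = real k * (real k - 1 + real (card B) + real (card C))"
    by (simp add: algebra_simps)
qed

end

section \<open>Minimality of rotational graphs\<close>

text \<open>The chosen derivative within the sphere and that of the extension \<open>P\<close> are
  compared along curves in the sphere, hence only on tangent vectors.\<close>

lemma sphere_differential_eq:
  assumes P: "Cinf UNIV P" and eq: "\<And>y. y \<in> sphere 0 1 \<Longrightarrow> f y = P y"
    and x: "x \<in> sphere 0 1" and v: "x \<bullet> v = 0"
  shows "differential_on (sphere 0 1) f x v = dd P x v"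
proof -
  have "v \<in> tangent_space (sphere 0 1) x" using tangent_space_sphere[OF x] v by simp
  then obtain \<gamma> \<epsilon> where g: "\<epsilon> > 0" "smooth_on {-\<epsilon><..<\<epsilon>} \<gamma>" "\<gamma> ` {-\<epsilon><..<\<epsilon>} \<subseteq> sphere 0 1"
    "\<gamma> (0::real) = x" "(\<gamma> has_vector_derivative v) (at 0)" by (rule tangent_space_curve)
  have "smooth_on (sphere 0 1) P" by (rule Cinf_imp_smooth_on[OF P]) simp
  then have "smooth_on (sphere 0 1) f" using smooth_on_cong eq by blast
  then have "f differentiable (at (\<gamma> 0) within sphere 0 1)"
    using x g(4) by (auto intro: smooth_on_differentiable)
  from differential_on_along_curve[OF this g(1,3,5)]
  have 1: "((\<lambda>s. f (\<gamma> s)) has_vector_derivative differential_on (sphere 0 1) f x v) (at 0)"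
    unfolding g(4) .
  have "((\<lambda>s. P (\<gamma> s)) has_derivative (\<lambda>h. dd P (\<gamma> 0) (h *\<^sub>R v))) (at 0)"
    by (rule has_derivative_compose[OF g(5)[unfolded has_vector_derivative_def] dd_deriv[OF P]]) simp
  then have 2: "((\<lambda>s. P (\<gamma> s)) has_vector_derivative dd P x v) (at 0)"
    by (simp add: has_vector_derivative_def g(4) linear_cmul[OF linear_dd[OF P]])
  show ?thesis
    by (rule vector_derivative_cong_near[OF 1 2 g(1)]) (use g(3) eq in blast)
qed

lemma LOMSE_of_type_polynomial:
  assumes type: "LOMSE_of_type n p k f" and k: "k \<ge> 3"
  obtains P where "homogeneous_sphere_map P k" "\<And>x. x \<in> sphere 0 1 \<Longrightarrow> f x = P x"
    "\<And>b. b \<in> Basis \<Longrightarrow> real_polynomial_function (\<lambda>x. P x \<bullet> b)"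
proof -
  have "\<forall>b\<in>Basis. \<exists>h. real_polynomial_function h \<and> (\<forall>t x. h (t *\<^sub>R x) = t ^ k * h x) \<and>
        (\<forall>x. laplacian h x = 0) \<and> (\<forall>x\<in>sphere 0 1. f x \<bullet> b = h x)"
    using type by (simp add: LOMSE_of_type_def spherical_harmonic_def)
  then obtain h where h: "\<And>b. b \<in> Basis \<Longrightarrow> real_polynomial_function (h b)"
    "\<And>b t x. b \<in> Basis \<Longrightarrow> h b (t *\<^sub>R x) = t ^ k * h b x"
    "\<And>b x. b \<in> Basis \<Longrightarrow> laplacian (h b) x = 0"
    "\<And>b x. b \<in> Basis \<Longrightarrow> x \<in> sphere 0 1 \<Longrightarrow> f x \<bullet> b = h b x" by metis
  define P where "P x = (\<Sum>b\<in>Basis. h b x *\<^sub>R b)" for x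
  have Pb: "P x \<bullet> b = h b x" if "b \<in> Basis" for x b using that by (simp add: P_def)
  have o: "open (UNIV :: 'a set)" by simp
  have P: "Cinf UNIV P"
    unfolding P_def by (intro Cinf_sum[OF o] Cinf_scaleR[OF Cinf_real_polynomial Cinf_const[OF o]] h(1))
  have fP: "f x = P x" if "x \<in> sphere 0 1" for x
    by (rule euclidean_eqI) (simp add: Pb h(4)[OF _ that])
  have "f ` sphere 0 1 \<subseteq> sphere 0 1"
    using type by (simp add: LOMSE_of_type_def LOMSE_def LOM_def smooth_sphere_map_def)
  then have unit: "P x \<in> sphere 0 1" if "x \<in> sphere 0 1" for x using that fP by force
  have "homogeneous_sphere_map P k"
  proof
    show "P (t *\<^sub>R x) = t ^ k *\<^sub>R P x" for t x
      by (rule euclidean_eqI) (simp add: Pb h(2))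
    show "(\<Sum>i\<in>Basis. dd2 P x i i) = 0" for x
    proof (rule euclidean_eqI)
      fix b :: 'b assume b: "b \<in> Basis"
      have "(\<Sum>i\<in>Basis. dd2 P x i i) \<bullet> b = (\<Sum>i\<in>Basis. dd2 (\<lambda>y. P y \<bullet> b) x i i)"
        by (simp add: inner_sum_left dd2_inner[OF P])
      also have "(\<lambda>y. P y \<bullet> b) = h b" using Pb[OF b] by auto
      also have "(\<Sum>i\<in>Basis. dd2 (h b) x i i) = laplacian (h b) x"
        by (simp add: laplacian_def dd2_def dd_def)
      finally show "(\<Sum>i\<in>Basis. dd2 P x i i) \<bullet> b = 0 \<bullet> b" using h(3)[OF b] by simp
    qed
  qed (use P unit k in auto)
  moreover have "real_polynomial_function (\<lambda>x. P x \<bullet> b)" if "b \<in> Basis" for b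
    using h(1)[OF that] Pb[OF that] by simp
  ultimately show ?thesis using fP that by blast
qed

text \<open>This collects what minimality of the Lawson-Osserman sphere contributes to the graph
  computation. \<open>B\<close> spans the kernel directions and \<open>C\<close> the singular ones;
  the angle and the singular value are already eliminated in favour of \<open>n\<close>,
  \<open>p\<close> and \<open>k\<close>.\<close>

definition adapted_frame :: "('a::euclidean_space \<Rightarrow> 'b::euclidean_space) \<Rightarrow> nat \<Rightarrow> nat \<Rightarrow> nat \<Rightarrow> 'a \<Rightarrow> 'a set \<Rightarrow> 'a set \<Rightarrow> bool" where
  "adapted_frame P n p k x B C \<longleftrightarrow>
     finite B \<and> finite C \<and> B \<inter> C = {} \<and> x \<notin> B \<and> x \<notin> C \<and> card B + p = n \<and> card C = p \<and>
     orthonormal_basis_of UNIV (insert x (B \<union> C)) \<and>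
     (\<forall>b\<in>B. dd P x b = 0) \<and>
     (\<forall>b\<in>C. \<forall>w. x \<bullet> w = 0 \<longrightarrow> dd P x b \<bullet> dd P x w = real k * (real k + real n - 1) / real p * (b \<bullet> w)) \<and>
     (\<Sum>b\<in>B. dd2 P x b b) = (real k * real (card B)) *\<^sub>R P x \<and>
     (\<Sum>b\<in>C. dd2 P x b b) = - (real k * (real k - 1 + real (card B))) *\<^sub>R P x"

text \<open>The type is stated with singular values of a chosen derivative within the sphere; they
  are first transferred to \<open>dd P x\<close>. A single angle with a minimal submanifold suffices
  for the traces, since it cancels from their values.\<close>

lemma LOMSE_of_type_frame:
  assumes type: "LOMSE_of_type n p k f" and p: "p > 0"
    and "homogeneous_sphere_map P k" and fP: "\<And>x. x \<in> sphere 0 1 \<Longrightarrow> f x = P x"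
    and x: "x \<in> sphere 0 1"
  obtains B C where "adapted_frame P n p k x B C"
proof -
  interpret homogeneous_sphere_map P k by fact
  let ?T = "tangent_space (sphere 0 1) x" and ?A = "sphere_differential f x"
  have T: "?T = {v. x \<bullet> v = 0}" by (rule tangent_space_sphere[OF x])
  have xx: "x \<bullet> x = 1" using x by (simp add: norm_eq_1)
  have A: "?A v = dd P x v" if "v \<in> ?T" for v
    using sphere_differential_eq[OF P fP x, of v] that T by simp
  have ss: "singular_space ?T ?A \<tau> = singular_space ?T (dd P x) \<tau>" for \<tau>
    using A by (auto simp: singular_space_def)
  have sv: "singular_value ?T ?A \<tau> = singular_value ?T (dd P x) \<tau>"
    "singular_multiplicity ?T ?A \<tau> = singular_multiplicity ?T (dd P x) \<tau>" for \<tau>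
    by (simp_all add: singular_value_def singular_multiplicity_def ss)
  have "\<exists>\<sigma>>0. singular_value ?T ?A \<sigma> \<and> singular_multiplicity ?T ?A \<sigma> = p"
    using type x unfolding LOMSE_of_type_def by blast
  then obtain \<sigma> where \<sigma>: "\<sigma> > 0" "singular_value ?T (dd P x) \<sigma>" "singular_multiplicity ?T (dd P x) \<sigma> = p"
    unfolding sv by blast
  have "\<forall>\<sigma> \<tau>. singular_value ?T ?A \<sigma> \<longrightarrow> \<sigma> \<noteq> 0 \<longrightarrow> singular_value ?T ?A \<tau> \<longrightarrow> \<tau> \<noteq> 0 \<longrightarrow> \<sigma> = \<tau>"
    using type x unfolding LOMSE_of_type_def LOMSE_def by blast
  then have uniq: "\<tau> = \<sigma>" if "singular_value ?T (dd P x) \<tau>" "\<tau> \<noteq> 0" for \<tau>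
    unfolding sv using that \<sigma>(1,2) by auto
  have dim: "DIM('a) = n + 1" using type by (simp add: LOMSE_of_type_def)
  obtain B C where fr: "finite B" "finite C" "B \<inter> C = {}" "x \<notin> B" "x \<notin> C"
    "orthonormal_basis_of UNIV (insert x (B \<union> C))" "span (B \<union> C) = ?T" "B \<union> C \<subseteq> ?T"
    "card C = singular_multiplicity ?T (dd P x) \<sigma>" "card B + card C + 1 = DIM('a)"
    "\<forall>b\<in>B. dd P x b = 0" "\<forall>b\<in>C. \<forall>w\<in>?T. dd P x b \<bullet> dd P x w = \<sigma>\<^sup>2 * (b \<bullet> w)"
    using singular_frame[OF xx linear_dd[OF P UNIV_I] T \<sigma>(1) uniq] .
  obtain \<theta> where \<theta>: "\<theta> \<in> {0<..<pi/2}" "minimal_submanifold (sphere 0 1) (LO_submanifold f \<theta>)"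
    using type by (auto simp: LOMSE_of_type_def LOMSE_def LOM_def)
  have cs: "cos \<theta> \<noteq> 0" "sin \<theta> \<noteq> 0" "(cos \<theta>)\<^sup>2 + (sin \<theta>)\<^sup>2 = 1"
    using \<theta>(1) cos_gt_zero[of \<theta>] sin_gt_zero[of \<theta>] by auto
  have LO: "LO_submanifold f \<theta> = (\<lambda>x. (cos \<theta> *\<^sub>R x, sin \<theta> *\<^sub>R P x)) ` sphere 0 1"
    unfolding LO_submanifold_def using fP by (intro image_cong) auto
  have H0: "mean_curvature_vector (sphere 0 1) ((\<lambda>x. (cos \<theta> *\<^sub>R x, sin \<theta> *\<^sub>R P x)) ` sphere 0 1)
      (cos \<theta> *\<^sub>R x, sin \<theta> *\<^sub>R P x) = 0"
    using \<theta>(2) x unfolding minimal_submanifold_def LO by blast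
  note tr = traces_of_minimal[OF x cs H0 fr(1-6) fr(7)[unfolded T] \<sigma>(1)
      bspec[OF fr(11)] bspec[OF bspec[OF fr(12)], unfolded T mem_Collect_eq]]
  have card: "card C = p" "card B + p = n" using fr(9,10) \<sigma>(3) dim by auto
  have "\<sigma>\<^sup>2 = real k * (real k + real n - 1) / real p"
  proof -
    have "real p * \<sigma>\<^sup>2 = real k * (real k + real n - 1)"
      using tr(3) card(1) card(2)[symmetric] by (simp add: algebra_simps)
    then show ?thesis using p by (simp add: field_simps)
  qed
  then have "adapted_frame P n p k x B C"
    unfolding adapted_frame_def using fr(1-6) card fr(11,12) tr(1,2) T by auto
  then show ?thesis using that by blast
qed

text \<open>Subtracting \<open>F\<close> in the second component is a shear that flattens the graph
  and maps the cylinder over \<open>U\<close> onto itself.\<close>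

lemma smooth_submanifold_graph:
  fixes F :: "'a::euclidean_space \<Rightarrow> 'b::euclidean_space"
  assumes F: "Cinf U F"
  shows "smooth_submanifold DIM('a) ((\<lambda>x. (x, F x)) ` U)"
  unfolding smooth_submanifold_def
proof
  fix p assume p: "p \<in> (\<lambda>x. (x, F x)) ` U"
  define W where "W = U \<times> (UNIV :: 'b set)"
  define V where "V = (UNIV :: 'a set) \<times> {0 :: 'b}"
  define \<Phi> \<Psi> where "\<Phi> q = (fst q, snd q - F (fst q))" and "\<Psi> q = (fst q, snd q + F (fst q))" for q :: "'a \<times> 'b"
  have U: "open U" using F Cinf_open by blast
  have W: "open W" unfolding W_def using U by (simp add: open_Times)
  have im: "\<Phi> ` W = W"
  proof (intro equalityI subsetI)
    fix q assume "q \<in> W"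
    then have "\<Phi> (\<Psi> q) = q" "\<Psi> q \<in> W" by (auto simp: \<Phi>_def \<Psi>_def W_def)
    then show "q \<in> \<Phi> ` W" by (metis imageI)
  qed (auto simp: \<Phi>_def W_def)
  have FW: "Cinf W (\<lambda>q. F (fst q))"
    by (rule Cinf_compose[OF Cinf_fst[OF W] F]) (auto simp: W_def)
  have "Cinf W \<Phi>" unfolding \<Phi>_def
    by (rule Cinf_Pair[OF Cinf_fst[OF W] Cinf_diff[OF Cinf_snd[OF W] FW]])
  moreover have "Cinf W \<Psi>" unfolding \<Psi>_def
    by (rule Cinf_Pair[OF Cinf_fst[OF W] Cinf_add[OF Cinf_snd[OF W] FW]])
  ultimately have sm: "smooth_on W \<Phi>" "smooth_on W \<Psi>" by (auto intro: Cinf_imp_smooth_on)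
  have V: "subspace V" by (auto simp: V_def subspace_def zero_prod_def)
  have dimV: "dim V = DIM('a)"
  proof -
    have "V = (\<lambda>x. (x, 0)) ` (UNIV :: 'a set)" by (auto simp: V_def)
    moreover have "linear (\<lambda>x::'a. (x, 0::'b))" by (rule linearI) auto
    moreover have "inj (\<lambda>x::'a. (x, 0::'b))" by (auto simp: inj_def)
    ultimately show ?thesis using dim_image_eq[of "\<lambda>x::'a. (x, 0::'b)" UNIV] by (simp add: dim_UNIV)
  qed
  have eq: "\<Phi> ` ((\<lambda>x. (x, F x)) ` U \<inter> W) = \<Phi> ` W \<inter> V"
  proof (intro equalityI subsetI)
    fix q assume "q \<in> \<Phi> ` W \<inter> V"
    then have "fst q \<in> U" "q = \<Phi> (fst q, F (fst q))" by (auto simp: im W_def V_def \<Phi>_def)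
    then show "q \<in> \<Phi> ` ((\<lambda>x. (x, F x)) ` U \<inter> W)" by (auto simp: W_def)
  qed (auto simp: im W_def V_def \<Phi>_def)
  show "\<exists>W \<Phi> \<Psi> V. open W \<and> p \<in> W \<and> open (\<Phi> ` W) \<and> smooth_on W \<Phi> \<and> smooth_on (\<Phi> ` W) \<Psi> \<and>
      (\<forall>x\<in>W. \<Psi> (\<Phi> x) = x) \<and> subspace (V :: ('a \<times> 'b) set) \<and> dim V = DIM('a) \<and>
      \<Phi> ` ((\<lambda>x. (x, F x)) ` U \<inter> W) = \<Phi> ` W \<inter> V"
  proof (intro exI conjI)
    show "p \<in> W" using p by (auto simp: W_def)
    show "open (\<Phi> ` W)" "smooth_on (\<Phi> ` W) \<Psi>" unfolding im by fact+
    show "\<forall>x\<in>W. \<Psi> (\<Phi> x) = x" by (simp add: \<Phi>_def \<Psi>_def)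
  qed fact+
qed

text \<open>With \<open>c = 1\<close> and the identity as projection, \<open>hess\<close> reduces to
  the second derivative of \<open>F\<close>. The condition is the nondivergence form of the minimal
  surface system, in a basis in which the induced metric is diagonal.\<close>

lemma minimal_graph:
  fixes F :: "'a::euclidean_space \<Rightarrow> 'b::euclidean_space"
  assumes F: "Cinf U F"
    and H: "\<And>x. x \<in> U \<Longrightarrow> \<exists>E. orthonormal_basis_of UNIV E \<and>
      (\<forall>b\<in>E. \<forall>b'\<in>E. b \<noteq> b' \<longrightarrow> dd F x b \<bullet> dd F x b' = 0) \<and>
      (\<Sum>b\<in>E. (1 / (1 + dd F x b \<bullet> dd F x b)) *\<^sub>R dd2 F x b b) = 0"
  shows "minimal_submanifold UNIV ((\<lambda>x. (x, F x)) ` U)"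
proof -
  have U: "open U" using F Cinf_open by blast
  interpret gp: graph_parametrization U U "\<lambda>x v. v" 1 F
  proof (rule graph_parametrization.intro)
    show "linear (\<lambda>v. v)" for x :: 'a by (rule linear_ident)
    show "Cinf UNIV (\<lambda>x. b)" for b :: 'a by (rule Cinf_const) simp
  qed (use F U tangent_space_open in auto)
  have X: "gp.X = (\<lambda>x. (x, F x))" by (auto simp: gp.X_def)
  have tU: "tangent_space UNIV q = UNIV" for q :: "'a \<times> 'b" by (rule tangent_space_open) auto
  have "mean_curvature_vector UNIV (gp.X ` U) (gp.X x) = 0" if x: "x \<in> U" for x
  proof -
    obtain E where E: "orthonormal_basis_of UNIV E"
      "\<And>b b'. b \<in> E \<Longrightarrow> b' \<in> E \<Longrightarrow> b \<noteq> b' \<Longrightarrow> dd F x b \<bullet> dd F x b' = 0"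
      "(\<Sum>b\<in>E. (1 / (1 + dd F x b \<bullet> dd F x b)) *\<^sub>R dd2 F x b b) = 0"
      using H[OF x] by blast
    have Dp: "gp.Dproj x a b = 0" for a b
      unfolding gp.Dproj_def by (simp add: dd_eqI[OF has_derivative_const])
    have dX0: "gp.dX x 0 = 0" using gp.linear_dX[OF x] by (rule linear_0)
    have hess: "gp.hess x b b = (0, dd2 F x b b)" for b
      by (simp add: gp.hess_def Dp dX0)
    have b1: "b \<bullet> b = 1" if "b \<in> E" for b using E(1) that by (auto simp: orthonormal_basis_of_def norm_eq_1)
    have "mean_curvature_vector UNIV (gp.X ` U) (gp.X x) =
      closest_point (normal_space UNIV (gp.X ` U) (gp.X x)) (\<Sum>b\<in>E. (1 / (gp.dX x b \<bullet> gp.dX x b)) *\<^sub>R gp.hess x b b)"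
    proof (rule gp.mean_curvature_vector_image[OF x])
      show "subspace (tangent_space UNIV (gp.X x))" unfolding tU by simp
      show "finite E" using orthonormal_basis_of_finite(1)[OF E(1)] .
      show "span E = {v. v = v}" using E(1) by (simp add: orthonormal_basis_of_def)
      show "0 \<notin> E" using b1 by fastforce
      fix b b' assume b: "b \<in> E" "b' \<in> E" "b \<noteq> b'"
      then have "b \<bullet> b' = 0" using E(1) by (auto simp: orthonormal_basis_of_def pairwise_def orthogonal_def)
      then show "gp.dX x b \<bullet> gp.dX x b' = 0" using E(2)[OF b] by (simp add: gp.dX_def)
    qed
    also have "(\<Sum>b\<in>E. (1 / (gp.dX x b \<bullet> gp.dX x b)) *\<^sub>R gp.hess x b b) =
        (\<Sum>b\<in>E. (0, (1 / (1 + dd F x b \<bullet> dd F x b)) *\<^sub>R dd2 F x b b))"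
      by (rule sum.cong[OF refl]) (simp add: hess gp.dX_def b1)
    also have "\<dots> = 0" using E(3) by (simp add: prod_eq_iff fst_sum snd_sum)
    also have "closest_point (normal_space UNIV (gp.X ` U) (gp.X x)) 0 = 0"
    proof -
      have "subspace (normal_space UNIV (gp.X ` U) (gp.X x))"
        by (auto simp: normal_space_def tU subspace_def inner_add_left)
      then show ?thesis using linear_0[OF linear_closest_point] by blast
    qed
    finally show ?thesis .
  qed
  then show ?thesis
    unfolding minimal_submanifold_def using smooth_submanifold_graph[OF F] X by auto
qed

context homogeneous_sphere_map
begin

text \<open>The maps are homogeneous of degrees \<open>k\<close>, \<open>k - 1\<close> and
  \<open>k - 2\<close>, all positive since \<open>k \<ge> 3\<close>. At the origin, where no adapted
  frame exists, this makes the minimal surface system trivial.\<close>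

lemma P_0: "P 0 = 0" "dd P 0 v = 0" "dd2 P 0 u v = 0"
proof -
  have *: "w = 0" if "w = (2::real) ^ j *\<^sub>R w" "j > 0" for w :: 'b and j
  proof -
    have "(1::real) < 2 ^ j" by (rule one_less_power[OF _ that(2)]) simp
    then have "(2::real) ^ j \<noteq> 1" by linarith
    then show ?thesis using that(1) scaleR_right_imp_eq[of w 1 "2 ^ j"] by auto
  qed
  show "P 0 = 0" by (rule *[of _ k]) (use hom[of 2 0] k in auto)
  show "dd P 0 v = 0" by (rule *[of _ "k - 1"]) (use dd_hom[of 2 0] k in auto)
  show "dd2 P 0 u v = 0" by (rule *[of _ "k - 2"]) (use dd2_hom[of 2 0] k in auto)
qed

text \<open>The frame at x/|x| diagonalizes the induced metric of the graph. The radial direction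
  contributes \<rho>''/(1 + \<rho>'^2), the kernel directions \<rho>'/r each, the singular
  directions the last term of the equation. All contributions are multiples of \<open>P e\<close>,
  so the system collapses to one scalar equation.\<close>

lemma minimal_radial_graph:
  fixes G G1 G2 :: "real \<Rightarrow> real" and n p :: nat
  defines "L \<equiv> real k * (real k + real n - 1) / real p"
  assumes frame: "\<And>x. x \<in> sphere 0 1 \<Longrightarrow> \<exists>B C. adapted_frame P n p k x B C"
    and p: "p > 0" and V: "{0..<1} \<subseteq> V" and G: "Cinf V G"
    and G1: "\<And>y. y \<in> V \<Longrightarrow> (G has_real_derivative G1 y) (at y)"
    and G2: "\<And>y. y \<in> V \<Longrightarrow> (G1 has_real_derivative G2 y) (at y)"
    and ode: "\<And>r \<rho> \<rho>1 \<rho>2. 0 < r \<Longrightarrow> r < 1 \<Longrightarrow> \<rho> = r ^ k * G (r\<^sup>2) \<Longrightarrow>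
      \<rho>1 = real k * r ^ (k - 1) * G (r\<^sup>2) + 2 * r ^ (k + 1) * G1 (r\<^sup>2) \<Longrightarrow>
      \<rho>2 = real k * (real k - 1) * r ^ (k - 2) * G (r\<^sup>2) + (4 * real k + 2) * r ^ k * G1 (r\<^sup>2)
        + 4 * r ^ (k + 2) * G2 (r\<^sup>2) \<Longrightarrow>
      \<rho>2 / (1 + \<rho>1\<^sup>2) + (real n - real p) * (\<rho>1 / r)
        + real p * (\<rho>1 / r - L * \<rho> / r\<^sup>2) / (1 + L * (\<rho> / r)\<^sup>2) = 0"
  shows "Cinf (ball 0 1) (\<lambda>x. G (x \<bullet> x) *\<^sub>R P x)"
    and "minimal_submanifold UNIV ((\<lambda>x. (x, G (x \<bullet> x) *\<^sub>R P x)) ` ball 0 1)"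
proof -
  let ?U = "ball 0 1 :: 'a set"
  let ?F = "\<lambda>x. G (x \<bullet> x) *\<^sub>R P x"
  have yV: "y \<bullet> y \<in> V" if "y \<in> ?U" for y
  proof -
    have "(norm y)\<^sup>2 < 1\<^sup>2" using that by (intro power_strict_mono) auto
    then show ?thesis using V by (auto simp: power2_norm_eq_inner)
  qed
  have o: "open ?U" by simp
  show F: "Cinf ?U ?F"
    by (rule Cinf_scaleR[OF Cinf_compose[OF Cinf_inner[OF Cinf_id[OF o] Cinf_id[OF o]] G] Cinf_subset[OF P o]])
      (use yV in auto)
  have dG: "((\<lambda>y. G (y \<bullet> y)) has_derivative (\<lambda>a. 2 * G1 (x \<bullet> x) * (x \<bullet> a))) (at x)" if "x \<in> ?U" for x
    by (rule has_derivative_eq_rhs[OF has_derivative_compose[OF has_derivative_inner[OF has_derivative_ident has_derivative_ident]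
        G1[OF yV[OF that], unfolded has_field_derivative_def]]]) (auto simp: inner_commute)
  have dG1: "((\<lambda>y. G1 (y \<bullet> y)) has_derivative (\<lambda>a. 2 * G2 (x \<bullet> x) * (x \<bullet> a))) (at x)" if "x \<in> ?U" for x
    by (rule has_derivative_eq_rhs[OF has_derivative_compose[OF has_derivative_inner[OF has_derivative_ident has_derivative_ident]
        G2[OF yV[OF that], unfolded has_field_derivative_def]]]) (auto simp: inner_commute)
  have ddF: "dd ?F x v = (2 * G1 (x \<bullet> x) * (x \<bullet> v)) *\<^sub>R P x + G (x \<bullet> x) *\<^sub>R dd P x v" if "x \<in> ?U" for x v
    using dd_eqI[OF has_derivative_scaleR[OF dG[OF that] dd_deriv[OF P UNIV_I]]] by (simp add: add.commute)
  have dd2F: "dd2 ?F x a v = (4 * G2 (x \<bullet> x) * (x \<bullet> a) * (x \<bullet> v) + 2 * G1 (x \<bullet> x) * (a \<bullet> v)) *\<^sub>R P x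
      + (2 * G1 (x \<bullet> x) * (x \<bullet> v)) *\<^sub>R dd P x a + (2 * G1 (x \<bullet> x) * (x \<bullet> a)) *\<^sub>R dd P x v
      + G (x \<bullet> x) *\<^sub>R dd2 P x a v" if x: "x \<in> ?U" for x a v
  proof -
    have "((\<lambda>y. (2 * G1 (y \<bullet> y) * (y \<bullet> v)) *\<^sub>R P y + G (y \<bullet> y) *\<^sub>R dd P y v) has_derivative
      (\<lambda>a. ((2 * G1 (x \<bullet> x) * (x \<bullet> v)) *\<^sub>R dd P x a
          + (2 * G1 (x \<bullet> x) * (a \<bullet> v) + 2 * (2 * G2 (x \<bullet> x) * (x \<bullet> a)) * (x \<bullet> v)) *\<^sub>R P x)
        + (G (x \<bullet> x) *\<^sub>R dd2 P x a v + (2 * G1 (x \<bullet> x) * (x \<bullet> a)) *\<^sub>R dd P x v))) (at x)"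
      by (intro has_derivative_add has_derivative_scaleR has_derivative_mult has_derivative_mult_right
          has_derivative_inner_left has_derivative_ident dG[OF x] dG1[OF x] dd_deriv[OF P UNIV_I] dd2_deriv[OF P UNIV_I])
    then have "((\<lambda>y. dd ?F y v) has_derivative
      (\<lambda>a. ((2 * G1 (x \<bullet> x) * (x \<bullet> v)) *\<^sub>R dd P x a
          + (2 * G1 (x \<bullet> x) * (a \<bullet> v) + 2 * (2 * G2 (x \<bullet> x) * (x \<bullet> a)) * (x \<bullet> v)) *\<^sub>R P x)
        + (G (x \<bullet> x) *\<^sub>R dd2 P x a v + (2 * G1 (x \<bullet> x) * (x \<bullet> a)) *\<^sub>R dd P x v))) (at x)"
      by (rule has_derivative_transform_within_open[OF _ o x]) (simp add: ddF)
    from dd_eqI[OF this] show ?thesis by (simp add: dd2_def algebra_simps)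
  qed
  show "minimal_submanifold UNIV ((\<lambda>x. (x, ?F x)) ` ?U)"
  proof (rule minimal_graph[OF F])
    fix x assume x: "x \<in> ?U"
    show "\<exists>E. orthonormal_basis_of UNIV E \<and>
      (\<forall>b\<in>E. \<forall>b'\<in>E. b \<noteq> b' \<longrightarrow> dd ?F x b \<bullet> dd ?F x b' = 0) \<and>
      (\<Sum>b\<in>E. (1 / (1 + dd ?F x b \<bullet> dd ?F x b)) *\<^sub>R dd2 ?F x b b) = 0"
    proof (cases "x = 0")
      case True
      show ?thesis
        using x by (intro exI[of _ Basis]) (auto simp: orthonormal_basis_of_Basis ddF dd2F True P_0)
    next
      case False
      define r where "r = norm x"
      define e where "e = x /\<^sub>R r"
      have r: "0 < r" "r < 1" using x False by (auto simp: r_def)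
      have xe: "x = r *\<^sub>R e" using r by (simp add: e_def)
      have e: "e \<in> sphere 0 1" using r by (simp add: e_def r_def)
      have ee: "e \<bullet> e = 1" using e by (simp add: norm_eq_1)
      have xx: "x \<bullet> x = r\<^sup>2" by (simp add: r_def power2_norm_eq_inner)
      obtain B C where "adapted_frame P n p k e B C" using frame[OF e] by blast
      then have fr: "finite B" "finite C" "B \<inter> C = {}" "e \<notin> B" "e \<notin> C" "card B + p = n" "card C = p"
        "orthonormal_basis_of UNIV (insert e (B \<union> C))" "\<And>b. b \<in> B \<Longrightarrow> dd P e b = 0"
        "\<And>b w. b \<in> C \<Longrightarrow> e \<bullet> w = 0 \<Longrightarrow> dd P e b \<bullet> dd P e w = L * (b \<bullet> w)"
        "(\<Sum>b\<in>B. dd2 P e b b) = (real k * real (card B)) *\<^sub>R P e"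
        "(\<Sum>b\<in>C. dd2 P e b b) = - (real k * (real k - 1 + real (card B))) *\<^sub>R P e"
        unfolding adapted_frame_def L_def by auto
      let ?E = "insert e (B \<union> C)"
      have bb: "b \<bullet> b = 1" if "b \<in> ?E" for b
        using fr(8) that by (auto simp: orthonormal_basis_of_def norm_eq_1)
      have orth: "b \<bullet> b' = 0" if "b \<in> ?E" "b' \<in> ?E" "b \<noteq> b'" for b b'
        using fr(8) that by (auto simp: orthonormal_basis_of_def pairwise_def orthogonal_def)
      have eb: "e \<bullet> b = 0" if "b \<in> B \<union> C" for b using orth[of e b] that fr(4,5) by auto
      obtain j where j: "k = Suc (Suc j)" using that[of "k - 2"] k by simp
      define \<rho> where "\<rho> = r ^ k * G (r\<^sup>2)"
      define \<rho>1 where "\<rho>1 = real k * r ^ (k - 1) * G (r\<^sup>2) + 2 * r ^ (k + 1) * G1 (r\<^sup>2)"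
      define \<rho>2 where "\<rho>2 = real k * (real k - 1) * r ^ (k - 2) * G (r\<^sup>2) + (4 * real k + 2) * r ^ k * G1 (r\<^sup>2)
        + 4 * r ^ (k + 2) * G2 (r\<^sup>2)"
      have Px: "P x = r ^ k *\<^sub>R P e" "dd P x v = r ^ (k - 1) *\<^sub>R dd P e v"
        "dd2 P x u v = r ^ (k - 2) *\<^sub>R dd2 P e u v" for u v
        using r unfolding xe by (simp_all add: hom dd_hom dd2_hom)
      have xe': "x \<bullet> e = r" by (simp add: xe ee)
      have xb: "x \<bullet> b = 0" if "b \<in> B \<union> C" for b using eb[OF that] by (simp add: xe)
      have Fe: "dd ?F x e = \<rho>1 *\<^sub>R P e"
        by (simp add: ddF[OF x] xx xe' Px dd_self \<rho>1_def j algebra_simps)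
      have Fb: "dd ?F x b = (\<rho> / r) *\<^sub>R dd P e b" if "b \<in> B \<union> C" for b
        using r by (simp add: ddF[OF x] xx xb[OF that] Px \<rho>_def j)
      have FFe: "dd2 ?F x e e = \<rho>2 *\<^sub>R P e"
      proof -
        have "dd2 ?F x e e = ((4 * G2 (r\<^sup>2) * r * r + 2 * G1 (r\<^sup>2)) * r ^ k
            + 2 * (2 * G1 (r\<^sup>2) * r * r ^ (k - 1) * real k)
            + G (r\<^sup>2) * r ^ (k - 2) * (real k * (real k - 1))) *\<^sub>R P e"
          unfolding dd2F[OF x] xx xe' Px dd_self dd2_self ee scaleR_scaleR scaleR_add_left[symmetric]
          by (simp add: algebra_simps)
        also have "(4 * G2 (r\<^sup>2) * r * r + 2 * G1 (r\<^sup>2)) * r ^ k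
            + 2 * (2 * G1 (r\<^sup>2) * r * r ^ (k - 1) * real k)
            + G (r\<^sup>2) * r ^ (k - 2) * (real k * (real k - 1)) = \<rho>2"
          by (simp add: \<rho>2_def j algebra_simps)
        finally show ?thesis .
      qed
      have FFb: "dd2 ?F x b b = (2 * r ^ k * G1 (r\<^sup>2)) *\<^sub>R P e + (r ^ (k - 2) * G (r\<^sup>2)) *\<^sub>R dd2 P e b b"
        if "b \<in> B \<union> C" for b
        using bb[of b] that by (simp add: dd2F[OF x] xx xb[OF that] Px mult.commute mult.left_commute)
      have Pe: "P e \<bullet> P e = 1" by (simp add: inner_P ee)
      have Peb: "P e \<bullet> dd P e b = 0" if "b \<in> B \<union> C" for b by (simp add: inner_P_dd eb[OF that])
      have Cb: "dd P e b \<bullet> dd P e b' = 0" if "b \<in> B \<union> C" "b' \<in> B \<union> C" "b \<noteq> b'" for b b'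
      proof (cases "b \<in> C")
        case True
        then show ?thesis using fr(10)[OF True eb[OF that(2)]] orth[of b b'] that by auto
      next
        case False
        then show ?thesis using that fr(9) by auto
      qed
      show ?thesis
      proof (intro exI[of _ ?E] conjI fr(8) ballI impI)
        fix b b' assume b: "b \<in> ?E" "b' \<in> ?E" "b \<noteq> b'"
        then consider "b = e" "b' \<in> B \<union> C" | "b' = e" "b \<in> B \<union> C" | "b \<in> B \<union> C" "b' \<in> B \<union> C" by blast
        then show "dd ?F x b \<bullet> dd ?F x b' = 0"
        proof cases
          case 1
          then show ?thesis using Peb[OF 1(2)] by (simp add: Fe Fb[OF 1(2)])
        next
          case 2
          then show ?thesis using Peb[OF 2(2)] by (simp add: Fe Fb[OF 2(2)] inner_commute)
        next
          case 3
          then show ?thesis using Cb[OF 3 b(3)] by (simp add: Fb[OF 3(1)] Fb[OF 3(2)])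
        qed
      next
        let ?g = "\<lambda>b. (1 / (1 + dd ?F x b \<bullet> dd ?F x b)) *\<^sub>R dd2 ?F x b b"
        define D where "D = 1 + L * (\<rho> / r)\<^sup>2"
        have ge: "?g e = (\<rho>2 / (1 + \<rho>1\<^sup>2)) *\<^sub>R P e"
          by (simp add: Fe FFe Pe power2_eq_square)
        \<comment> \<open>Single values \<open>dd2 P e b b\<close> are not known, only their sums
          over \<open>B\<close> and over \<open>C\<close>. That is enough because the metric factor
          is constant on each of the two sets.\<close>
        have "(\<Sum>b\<in>B. ?g b) = (\<Sum>b\<in>B. (2 * r ^ k * G1 (r\<^sup>2)) *\<^sub>R P e + (r ^ (k - 2) * G (r\<^sup>2)) *\<^sub>R dd2 P e b b)"
          by (rule sum.cong[OF refl]) (simp add: Fb FFb fr(9))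
        also have "\<dots> = (real (card B) * (2 * r ^ k * G1 (r\<^sup>2)) + (r ^ (k - 2) * G (r\<^sup>2)) * (real k * real (card B))) *\<^sub>R P e"
          by (simp add: sum.distrib fr(11) algebra_simps sum_constant_scaleR flip: scaleR_sum_right)
        also have "real (card B) * (2 * r ^ k * G1 (r\<^sup>2)) + (r ^ (k - 2) * G (r\<^sup>2)) * (real k * real (card B)) =
            (real n - real p) * (\<rho>1 / r)"
          using r fr(6) by (simp add: \<rho>1_def j field_simps flip: fr(6))
        finally have gB: "(\<Sum>b\<in>B. ?g b) = ((real n - real p) * (\<rho>1 / r)) *\<^sub>R P e" .
        have "(\<Sum>b\<in>C. ?g b) = (\<Sum>b\<in>C. (1 / D) *\<^sub>R ((2 * r ^ k * G1 (r\<^sup>2)) *\<^sub>R P e + (r ^ (k - 2) * G (r\<^sup>2)) *\<^sub>R dd2 P e b b))"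
        proof (rule sum.cong[OF refl])
          fix b assume b: "b \<in> C"
          then have "dd P e b \<bullet> dd P e b = L" using fr(10)[OF b eb] bb[of b] by auto
          then have "1 + dd ?F x b \<bullet> dd ?F x b = D" using b by (simp add: Fb D_def power2_eq_square)
          then show "?g b = (1 / D) *\<^sub>R ((2 * r ^ k * G1 (r\<^sup>2)) *\<^sub>R P e + (r ^ (k - 2) * G (r\<^sup>2)) *\<^sub>R dd2 P e b b)"
            using b by (simp only: FFb[of b] UnI2)
        qed
        also have "\<dots> = (1 / D) *\<^sub>R ((real p * (2 * r ^ k * G1 (r\<^sup>2)) - (r ^ (k - 2) * G (r\<^sup>2)) * (real k * (real k - 1 + real (card B)))) *\<^sub>R P e)"
          by (simp add: sum.distrib fr(7,12) algebra_simps sum_constant_scaleR flip: scaleR_sum_right)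
        also have "real p * (2 * r ^ k * G1 (r\<^sup>2)) - (r ^ (k - 2) * G (r\<^sup>2)) * (real k * (real k - 1 + real (card B))) =
            real p * (\<rho>1 / r - L * \<rho> / r\<^sup>2)"
        proof -
          have "real p * L = real k * (real k + real n - 1)" using p by (simp add: L_def)
          then have pL: "real p * L = real k * (real k - 1 + real (card B) + real p)" using fr(6) by (simp flip: fr(6) add: algebra_simps)
          have e0: "real p * (\<rho>1 / r - L * \<rho> / r\<^sup>2) = real p * (\<rho>1 / r) - (real p * L) * (\<rho> / r\<^sup>2)"
            by (simp add: algebra_simps)
          have e1: "\<rho>1 / r = real k * r ^ j * G (r\<^sup>2) + 2 * r ^ k * G1 (r\<^sup>2)" using r by (simp add: \<rho>1_def j field_simps)
          have e2: "\<rho> / r\<^sup>2 = r ^ j * G (r\<^sup>2)" using r by (simp add: \<rho>_def j power2_eq_square)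
          show ?thesis unfolding e0 unfolding e1 e2 pL by (simp add: j algebra_simps)
        qed
        finally have gC: "(\<Sum>b\<in>C. ?g b) = (real p * (\<rho>1 / r - L * \<rho> / r\<^sup>2) / D) *\<^sub>R P e" by simp
        have "(\<Sum>b\<in>?E. ?g b) = (\<rho>2 / (1 + \<rho>1\<^sup>2) + (real n - real p) * (\<rho>1 / r) + real p * (\<rho>1 / r - L * \<rho> / r\<^sup>2) / D) *\<^sub>R P e"
          unfolding sum_disjoint3[OF fr(1-5)] ge gB gC by (simp add: algebra_simps)
        also have "\<rho>2 / (1 + \<rho>1\<^sup>2) + (real n - real p) * (\<rho>1 / r) + real p * (\<rho>1 / r - L * \<rho> / r\<^sup>2) / D = 0"
          unfolding D_def by (rule ode[OF r \<rho>_def \<rho>1_def \<rho>2_def])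
        finally show "(\<Sum>b\<in>?E. ?g b) = 0" by simp
      qed
    qed
  qed
qed

end

section \<open>The profile equation near the origin\<close>

unbundle no vec_syntax
unbundle fps_syntax

text \<open>The factor 1/(j + 1)^2 makes these majorants closed under multiplication up to the
  constant 8. With a purely geometric majorant each Cauchy product would cost a factor growing with
  \<open>j\<close>.\<close>

definition fps_bounded :: "real \<Rightarrow> real \<Rightarrow> nat \<Rightarrow> real fps \<Rightarrow> bool" where
  "fps_bounded M R m X \<longleftrightarrow> (\<forall>j\<le>m. \<bar>X $ j\<bar> \<le> M * R ^ j / (real j + 1)\<^sup>2)"

text \<open>With a = i + 1 and b = j - i + 1, 1/(a b) = (1/a + 1/b)/(a + b) and a + b \<ge> j + 1.
  Squaring with (s + t)^2 \<le> 2 (s^2 + t^2), and bounding both sums of inverse squares by 2, gives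
  2 * 2 * 2 = 8.\<close>

lemma inverse_squares_convolution:
  "(\<Sum>i\<le>j. 1 / ((real i + 1)\<^sup>2 * (real (j - i) + 1)\<^sup>2)) \<le> 8 / (real j + 1)\<^sup>2"
proof -
  have S: "(\<Sum>i\<le>j. 1 / (real i + 1)\<^sup>2) \<le> 2 - 1 / (real j + 1)" for j
  proof (induction j)
    case (Suc j)
    have "1 / (real (Suc j) + 1)\<^sup>2 \<le> 1 / (real j + 1) - 1 / (real (Suc j) + 1)"
    proof -
      have "1 / (real j + 1) - 1 / (real (Suc j) + 1) = 1 / ((real j + 1) * (real (Suc j) + 1))"
        by (simp add: field_simps)
      moreover have "1 / (real (Suc j) + 1)\<^sup>2 \<le> 1 / ((real j + 1) * (real (Suc j) + 1))"
        unfolding power2_eq_square by (intro divide_left_mono mult_right_mono mult_pos_pos) auto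
      ultimately show ?thesis by linarith
    qed
    then show ?case using Suc by simp
  qed simp
  have S2: "(\<Sum>i\<le>j. 1 / (real i + 1)\<^sup>2) \<le> 2"
  proof -
    have "1 / (real j + 1) \<ge> 0" by simp
    then show ?thesis using S[of j] by linarith
  qed
  have rev: "(\<Sum>i\<le>j. 1 / (real (j - i) + 1)\<^sup>2) = (\<Sum>i\<le>j. 1 / (real i + 1)\<^sup>2)"
    by (rule sum.reindex_bij_witness[of _ "\<lambda>i. j - i" "\<lambda>i. j - i"]) auto
  have "(\<Sum>i\<le>j. 1 / ((real i + 1)\<^sup>2 * (real (j - i) + 1)\<^sup>2)) \<le>
      (\<Sum>i\<le>j. (2 / (real j + 1)\<^sup>2) * (1 / (real i + 1)\<^sup>2 + 1 / (real (j - i) + 1)\<^sup>2))"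
  proof (rule sum_mono)
    fix i assume i: "i \<in> {..j}"
    define a b where "a = real i + 1" and "b = real (j - i) + 1"
    have ab: "a > 0" "b > 0" "real j + 1 \<le> a + b" using i by (auto simp: a_def b_def of_nat_diff)
    have "1 / a + 1 / b = (a + b) / (a * b)" using ab by (simp add: field_simps)
    then have "1 / (a\<^sup>2 * b\<^sup>2) = (1 / a + 1 / b)\<^sup>2 / (a + b)\<^sup>2"
      using ab by (simp add: power_divide power_mult_distrib)
    also have "\<dots> \<le> (2 * (1 / a\<^sup>2 + 1 / b\<^sup>2)) / (a + b)\<^sup>2"
    proof (rule divide_right_mono)
      show "(1 / a + 1 / b)\<^sup>2 \<le> 2 * (1 / a\<^sup>2 + 1 / b\<^sup>2)"
        using sum_squares_bound[of "1 / a" "1 / b"] by (simp add: power2_sum power_divide)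
    qed simp
    also have "\<dots> \<le> (2 * (1 / a\<^sup>2 + 1 / b\<^sup>2)) / (real j + 1)\<^sup>2"
      using ab by (intro divide_left_mono power_mono mult_pos_pos) auto
    finally show "1 / ((real i + 1)\<^sup>2 * (real (j - i) + 1)\<^sup>2) \<le>
      (2 / (real j + 1)\<^sup>2) * (1 / (real i + 1)\<^sup>2 + 1 / (real (j - i) + 1)\<^sup>2)"
      by (simp add: a_def b_def)
  qed
  also have "\<dots> = (2 / (real j + 1)\<^sup>2) * (2 * (\<Sum>i\<le>j. 1 / (real i + 1)\<^sup>2))"
    by (simp only: sum_distrib_left[symmetric] sum.distrib rev mult_2)
  also have "\<dots> \<le> (2 / (real j + 1)\<^sup>2) * (2 * 2)"
    by (intro mult_left_mono S2) auto
  finally show ?thesis by simp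
qed

lemma fps_bounded_mult:
  assumes X: "fps_bounded M R m X" and Y: "fps_bounded M' R m Y" and nn: "M \<ge> 0" "M' \<ge> 0" "R \<ge> 0"
  shows "fps_bounded (8 * M * M') R m (X * Y)"
  unfolding fps_bounded_def
proof (intro allI impI)
  fix j assume j: "j \<le> m"
  have "\<bar>(X * Y) $ j\<bar> \<le> (\<Sum>i\<le>j. \<bar>X $ i\<bar> * \<bar>Y $ (j - i)\<bar>)"
    unfolding fps_mult_nth atLeast0AtMost using sum_abs[of "\<lambda>i. X $ i * Y $ (j - i)" "{..j}"]
    by (simp add: abs_mult)
  also have "\<dots> \<le> (\<Sum>i\<le>j. (M * M' * R ^ j) * (1 / ((real i + 1)\<^sup>2 * (real (j - i) + 1)\<^sup>2)))"
  proof (rule sum_mono)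
    fix i assume i: "i \<in> {..j}"
    have "\<bar>X $ i\<bar> * \<bar>Y $ (j - i)\<bar> \<le> (M * R ^ i / (real i + 1)\<^sup>2) * (M' * R ^ (j - i) / (real (j - i) + 1)\<^sup>2)"
    proof (rule mult_mono)
      have "i \<le> m" "j - i \<le> m" using i j by auto
      then show "\<bar>X $ i\<bar> \<le> M * R ^ i / (real i + 1)\<^sup>2" "\<bar>Y $ (j - i)\<bar> \<le> M' * R ^ (j - i) / (real (j - i) + 1)\<^sup>2"
        using X Y unfolding fps_bounded_def by blast+
    qed (use nn in auto)
    also have "\<dots> = (M * M' * (R ^ i * R ^ (j - i))) * (1 / ((real i + 1)\<^sup>2 * (real (j - i) + 1)\<^sup>2))"
      by simp
    also have "R ^ i * R ^ (j - i) = R ^ j" using i by (simp flip: power_add)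
    finally show "\<bar>X $ i\<bar> * \<bar>Y $ (j - i)\<bar> \<le> (M * M' * R ^ j) * (1 / ((real i + 1)\<^sup>2 * (real (j - i) + 1)\<^sup>2))" .
  qed
  also have "\<dots> \<le> (M * M' * R ^ j) * (8 / (real j + 1)\<^sup>2)"
    unfolding sum_distrib_left[symmetric] using nn by (intro mult_left_mono inverse_squares_convolution) auto
  finally show "\<bar>(X * Y) $ j\<bar> \<le> 8 * M * M' * R ^ j / (real j + 1)\<^sup>2" by (simp add: mult_ac)
qed

lemma fps_bounded_add:
  assumes "fps_bounded M R m X" "fps_bounded M' R m Y"
  shows "fps_bounded (M + M') R m (X + Y)"
  unfolding fps_bounded_def
proof (intro allI impI)
  fix j assume "j \<le> m"
  then have "\<bar>X $ j\<bar> \<le> M * R ^ j / (real j + 1)\<^sup>2" "\<bar>Y $ j\<bar> \<le> M' * R ^ j / (real j + 1)\<^sup>2"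
    using assms by (auto simp: fps_bounded_def)
  then show "\<bar>(X + Y) $ j\<bar> \<le> (M + M') * R ^ j / (real j + 1)\<^sup>2"
    by (simp add: distrib_right add_divide_distrib)
qed

lemma fps_bounded_uminus: "fps_bounded M R m X \<Longrightarrow> fps_bounded M R m (- X)"
  by (simp add: fps_bounded_def)

lemma fps_bounded_diff:
  "fps_bounded M R m X \<Longrightarrow> fps_bounded M' R m Y \<Longrightarrow> fps_bounded (M + M') R m (X - Y)"
  using fps_bounded_add[OF _ fps_bounded_uminus] by fastforce

lemma fps_bounded_cmult:
  assumes "fps_bounded M R m X" "M \<ge> 0"
  shows "fps_bounded (\<bar>c\<bar> * M) R m (fps_const c * X)"
  unfolding fps_bounded_def
proof (intro allI impI)
  fix j assume "j \<le> m"
  then have "\<bar>c\<bar> * \<bar>X $ j\<bar> \<le> \<bar>c\<bar> * (M * R ^ j / (real j + 1)\<^sup>2)"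
    using assms by (intro mult_left_mono) (auto simp: fps_bounded_def)
  then show "\<bar>(fps_const c * X) $ j\<bar> \<le> \<bar>c\<bar> * M * R ^ j / (real j + 1)\<^sup>2"
    by (simp add: abs_mult)
qed

lemma fps_bounded_1: "R \<ge> 0 \<Longrightarrow> fps_bounded 1 R m 1"
  by (auto simp: fps_bounded_def)

lemma fps_bounded_mono:
  assumes "fps_bounded M R m X" "M \<le> M'" "R \<ge> 0"
  shows "fps_bounded M' R m X"
  unfolding fps_bounded_def
proof (intro allI impI)
  fix j assume "j \<le> m"
  then have "\<bar>X $ j\<bar> \<le> M * R ^ j / (real j + 1)\<^sup>2" using assms by (auto simp: fps_bounded_def)
  also have "\<dots> \<le> M' * R ^ j / (real j + 1)\<^sup>2"
    using assms by (intro divide_right_mono mult_right_mono) auto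
  finally show "\<bar>X $ j\<bar> \<le> M' * R ^ j / (real j + 1)\<^sup>2" .
qed

lemma fps_bounded_imp_conv_radius:
  assumes "\<And>m. fps_bounded M R m X" "R > 0"
  shows "fps_conv_radius X \<ge> 1 / R"
proof -
  have "summable (\<lambda>n. X $ n * (1 / R) ^ n)"
  proof (rule summable_comparison_test')
    show "summable (\<lambda>n. M * (1 / (real n + 1)\<^sup>2))"
    proof (rule summable_mult)
      have "summable (\<lambda>n. 1 / (real n)\<^sup>2)" using inverse_power_summable[of 2, where ?'a=real] by (simp add: inverse_eq_divide)
      then show "summable (\<lambda>n. 1 / (real n + 1)\<^sup>2)" 
        using summable_Suc_iff[of "\<lambda>n. 1 / (real n)\<^sup>2"] by (simp add: add.commute)
    qed
    fix n :: nat assume "n \<ge> 0"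
    have "\<bar>X $ n\<bar> \<le> M * R ^ n / (real n + 1)\<^sup>2" using assms(1)[of n] by (simp add: fps_bounded_def)
    then have "\<bar>X $ n\<bar> * (1 / R) ^ n \<le> M * R ^ n / (real n + 1)\<^sup>2 * (1 / R) ^ n"
      using assms(2) by (intro mult_right_mono) auto
    then show "norm (X $ n * (1 / R) ^ n) \<le> M * (1 / (real n + 1)\<^sup>2)"
      using assms(2) by (simp add: abs_mult power_one_over)
  qed
  from conv_radius_geI[OF this] show ?thesis using assms(2) by (simp add: fps_conv_radius_def)
qed

section \<open>Recursive systems of power series\<close>

definition fps_agree :: "nat \<Rightarrow> real fps \<Rightarrow> real fps \<Rightarrow> bool" where
  "fps_agree j X Y \<longleftrightarrow> (\<forall>l\<le>j. X $ l = Y $ l)"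

lemma fps_agree_refl: "fps_agree j X X"
  by (simp add: fps_agree_def)

lemma fps_agree_add: "fps_agree j X Y \<Longrightarrow> fps_agree j X' Y' \<Longrightarrow> fps_agree j (X + X') (Y + Y')"
  and fps_agree_diff: "fps_agree j X Y \<Longrightarrow> fps_agree j X' Y' \<Longrightarrow> fps_agree j (X - X') (Y - Y')"
  and fps_agree_uminus: "fps_agree j X Y \<Longrightarrow> fps_agree j (- X) (- Y)"
  by (simp_all add: fps_agree_def)

lemma fps_agree_mult: "fps_agree j X Y \<Longrightarrow> fps_agree j X' Y' \<Longrightarrow> fps_agree j (X * X') (Y * Y')"
  by (auto simp: fps_agree_def fps_mult_nth intro!: sum.cong)

lemmas fps_agree_intros = fps_agree_refl fps_agree_add fps_agree_diff fps_agree_uminus fps_agree_mult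

text \<open>Coefficient j + 1 of every component depends only on coefficients up to j, so a
  well-founded recursion over j defines all components simultaneously.\<close>

lemma fps_system_exists:
  fixes \<Phi> :: "(nat \<Rightarrow> real fps) \<Rightarrow> nat \<Rightarrow> real fps"
  assumes local: "\<And>X Y i j. (\<And>i. fps_agree j (X i) (Y i)) \<Longrightarrow> fps_agree j (\<Phi> X i) (\<Phi> Y i)"
  shows "\<exists>X. (\<forall>i. X i $ 0 = x0 i) \<and> (\<forall>i j. X i $ Suc j = c i j * \<Phi> X i $ j)"
proof -
  define F where "F f j = (\<lambda>i. case j of 0 \<Rightarrow> x0 i |
      Suc l \<Rightarrow> c i l * \<Phi> (\<lambda>i. Abs_fps (\<lambda>j. f j i)) i $ l)" for f :: "nat \<Rightarrow> nat \<Rightarrow> real" and j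
  define g where "g = wfrec less_than F"
  have "adm_wf less_than F"
    unfolding adm_wf_def
  proof (intro allI impI)
    fix f g :: "nat \<Rightarrow> nat \<Rightarrow> real" and j
    assume fg: "\<forall>z. (z, j) \<in> less_than \<longrightarrow> f z = g z"
    show "F f j = F g j"
    proof (cases j)
      case 0
      then show ?thesis by (simp add: F_def)
    next
      case (Suc l)
      have "fps_agree l (\<Phi> (\<lambda>i. Abs_fps (\<lambda>j. f j i)) i) (\<Phi> (\<lambda>i. Abs_fps (\<lambda>j. g j i)) i)" for i
        by (rule local) (use fg Suc in \<open>auto simp: fps_agree_def\<close>)
      then show ?thesis by (simp add: F_def Suc fps_agree_def)
    qed
  qed
  then have g: "g = F g" unfolding g_def by (intro wfrec_fixpoint) auto
  show ?thesis
  proof (intro exI[of _ "\<lambda>i. Abs_fps (\<lambda>j. g j i)"] conjI allI)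
    show "Abs_fps (\<lambda>j. g j i) $ 0 = x0 i" for i by (simp, subst g) (simp add: F_def)
    show "Abs_fps (\<lambda>j. g j i) $ Suc j = c i j * \<Phi> (\<lambda>i. Abs_fps (\<lambda>j. g j i)) i $ j" for i j
      by (simp, subst g) (simp add: F_def)
  qed
qed

text \<open>In the applications \<open>K\<close> does not depend on \<open>R\<close>, so
  \<open>R\<close> can be chosen afterwards. Each step gains a factor \<open>R\<close>, which pays
  for \<open>K\<close> and for the 4 in (j + 2)^2 \<le> 4 (j + 1)^2.\<close>

lemma fps_system_bounded:
  fixes \<Phi> :: "(nat \<Rightarrow> real fps) \<Rightarrow> nat \<Rightarrow> real fps"
  assumes X0: "\<And>i. \<bar>X i $ 0\<bar> \<le> C" and XS: "\<And>i j. X i $ Suc j = c i j * \<Phi> X i $ j"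
    and c: "\<And>i j. \<bar>c i j\<bar> \<le> 1" and C: "C > 0" and R: "R > 0" "4 * K \<le> C * R"
    and bdd: "\<And>m i. (\<And>i. fps_bounded C R m (X i)) \<Longrightarrow> fps_bounded K R m (\<Phi> X i)"
  shows "fps_bounded C R m (X i)"
proof (induction m arbitrary: i)
  case 0
  then show ?case using X0 by (simp add: fps_bounded_def)
next
  case (Suc m)
  have "\<bar>X i $ Suc m\<bar> \<le> C * R ^ Suc m / (real (Suc m) + 1)\<^sup>2"
  proof -
    have b: "\<bar>\<Phi> X i $ m\<bar> \<le> K * R ^ m / (real m + 1)\<^sup>2"
      using bdd[OF Suc] by (simp add: fps_bounded_def)
    have "\<bar>X i $ Suc m\<bar> \<le> 1 * \<bar>\<Phi> X i $ m\<bar>"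
      unfolding XS abs_mult using c by (intro mult_right_mono) auto
    also have "\<dots> \<le> K * R ^ m / (real m + 1)\<^sup>2" using b by simp
    also have "\<dots> \<le> (C * R / 4) * R ^ m / (real m + 1)\<^sup>2"
      using R by (intro divide_right_mono mult_right_mono) auto
    also have "\<dots> = C * R ^ Suc m / (4 * (real m + 1)\<^sup>2)" by simp
    also have "\<dots> \<le> C * R ^ Suc m / (real (Suc m) + 1)\<^sup>2"
    proof (rule divide_left_mono)
      show "(real (Suc m) + 1)\<^sup>2 \<le> 4 * (real m + 1)\<^sup>2" by (simp add: power2_eq_square algebra_simps)
    qed (use C R in auto)
    finally show ?thesis .
  qed
  then show ?case using Suc[of i] by (auto simp: fps_bounded_def le_Suc_eq)
qed

text \<open>Convergence and value in one relation, so that an identity between polynomial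
  expressions in series is evaluated by introduction rules alone.\<close>

definition fps_value :: "real fps \<Rightarrow> real \<Rightarrow> real \<Rightarrow> bool" where
  "fps_value X s v \<longleftrightarrow> ereal \<bar>s\<bar> < fps_conv_radius X \<and> eval_fps X s = v"

lemma fps_value_add: "fps_value X s u \<Longrightarrow> fps_value Y s v \<Longrightarrow> fps_value (X + Y) s (u + v)"
  unfolding fps_value_def using fps_conv_radius_add[of X Y] eval_fps_add[of s X Y]
  by (auto intro: less_le_trans simp: min_def split: if_splits)

lemma fps_value_diff: "fps_value X s u \<Longrightarrow> fps_value Y s v \<Longrightarrow> fps_value (X - Y) s (u - v)"
  unfolding fps_value_def using fps_conv_radius_diff[of X Y] eval_fps_diff[of s X Y]
  by (auto intro: less_le_trans simp: min_def split: if_splits)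

lemma fps_value_mult: "fps_value X s u \<Longrightarrow> fps_value Y s v \<Longrightarrow> fps_value (X * Y) s (u * v)"
  unfolding fps_value_def using fps_conv_radius_mult[of X Y] eval_fps_mult[of s X Y]
  by (auto intro: less_le_trans simp: min_def split: if_splits)

lemma fps_value_uminus: "fps_value X s u \<Longrightarrow> fps_value (- X) s (- u)"
  by (simp add: fps_value_def eval_fps_minus)

lemma fps_value_const: "fps_value (fps_const c) s c" and fps_value_1: "fps_value 1 s 1"
  and fps_value_X: "fps_value fps_X s s"
  by (simp_all add: fps_value_def)

lemmas fps_value_intros = fps_value_add fps_value_diff fps_value_mult fps_value_uminus
  fps_value_const fps_value_1 fps_value_X

lemma fps_value_unique: "fps_value X s u \<Longrightarrow> fps_value X s v \<Longrightarrow> u = v"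
  by (simp add: fps_value_def)

lemma fps_value_deriv:
  assumes "ereal \<bar>s\<bar> < fps_conv_radius X" "fps_value (fps_deriv X) s v"
  shows "(eval_fps X has_real_derivative v) (at s)"
  using has_field_derivative_eval_fps[of s X UNIV] assms by (simp add: fps_value_def)

lemma fps_value_deriv_exists:
  assumes "ereal \<bar>s\<bar> < fps_conv_radius X"
  shows "fps_value (fps_deriv X) s (eval_fps (fps_deriv X) s)"
  using assms fps_conv_radius_deriv[of X] by (auto simp: fps_value_def intro: less_le_trans)

text \<open>Uniqueness for a formal linear equation. It serves to check that an auxiliary series
  really is the reciprocal it stands for.\<close>

lemma fps_deriv_eq_mult_self_imp_0:
  fixes N g :: "real fps"
  assumes "fps_deriv N = g * N" "N $ 0 = 0"
  shows "N = 0"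
proof (rule fps_ext)
  fix j show "N $ j = 0 $ j"
  proof (induction j rule: less_induct)
    case (less j)
    show ?case
    proof (cases j)
      case 0
      then show ?thesis using assms(2) by simp
    next
      case (Suc l)
      have "fps_deriv N $ l = (\<Sum>i=0..l. g $ i * N $ (l - i))" unfolding assms(1) by (rule fps_mult_nth)
      also have "\<dots> = 0" by (rule sum.neutral) (use less Suc in auto)
      finally show ?thesis by (simp add: Suc)
    qed
  qed
qed

text \<open>With \<open>p = 2 q\<close>, \<open>n = p + 1\<close> and \<open>L = \<lambda>\<^sup>2\<close>, the function \<open>F(x) = \<rho>(|x|) f(x/|x|)\<close> solves the minimal
  surface system iff \<open>\<phi> = \<rho>/r\<close> and \<open>\<sigma> = \<rho>'\<close>, as functions of \<open>t = ln r\<close>, satisfy \<open>\<phi>' = \<sigma> - \<phi>\<close> and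
  \<open>\<sigma>' = slope_field \<phi> \<sigma>\<close>.\<close>

locale profile_ode =
  fixes q k :: nat and L :: real
  assumes q: "q \<ge> 1" and k: "k \<ge> 3" and L: "2 * real q * L = real k * (real k + 2 * real q)"
begin

definition p :: real where "p = 2 * real q"
definition n :: real where "n = p + 1"
definition \<kappa> :: real where "\<kappa> = real k - 1"

definition slope_field :: "real \<Rightarrow> real \<Rightarrow> real" where
  "slope_field x y = - ((y + p * (y - L * x) / (1 + L * x\<^sup>2)) * (1 + y\<^sup>2))"

lemma p_ge: "p \<ge> 2" using q by (simp add: p_def)

lemma \<kappa>_ge: "\<kappa> \<ge> 2" and k_eq: "real k = \<kappa> + 1"
  using k by (auto simp: \<kappa>_def)

lemma pL: "p * L = real k * (\<kappa> + n)"
  using L by (simp add: p_def n_def \<kappa>_def)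

lemma L_gt: "L > 1"
proof -
  have "p * 1 < p * L" unfolding pL using p_ge \<kappa>_ge by (simp add: n_def k_eq algebra_simps add_nonneg_pos add_pos_nonneg)
  then show ?thesis using p_ge by simp
qed

lemma D_pos: "1 + L * x\<^sup>2 > 0" "1 + L * x\<^sup>2 \<noteq> 0" "1 + L * x\<^sup>2 \<ge> 1"
proof -
  show 1: "1 + L * x\<^sup>2 \<ge> 1" using L_gt by simp
  then show "1 + L * x\<^sup>2 > 0" by linarith
  then show "1 + L * x\<^sup>2 \<noteq> 0" by linarith
qed

text \<open>The existence time depends only on the bound \<open>C\<close>. This uniformity is what
  allows the orbit to be continued in steps of fixed length.\<close>

lemma local_solution:
  assumes C: "C \<ge> 1"
  shows "\<exists>\<tau>>0. \<forall>a b. \<bar>a\<bar> \<le> C \<longrightarrow> \<bar>b\<bar> \<le> C \<longrightarrow> (\<exists>A B. fps_conv_radius A \<ge> ereal \<tau> \<and>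
      eval_fps A 0 = a \<and> eval_fps B 0 = b \<and>
      (\<forall>s. \<bar>s\<bar> < \<tau> \<longrightarrow> (eval_fps A has_real_derivative eval_fps B s - eval_fps A s) (at s) \<and>
        (eval_fps B has_real_derivative slope_field (eval_fps A s) (eval_fps B s)) (at s)))"
proof -
  \<comment> \<open>The unknown \<open>X 2\<close> stands for
    \<open>1 / (1 + L * \<phi>\<^sup>2)\<close> and makes the right-hand sides polynomial; its own
    equation is the derivative of that reciprocal. The constants below copy the structure of these
    polynomials, with a factor 8 for each product of series.\<close>
  define \<Phi> :: "(nat \<Rightarrow> real fps) \<Rightarrow> nat \<Rightarrow> real fps" where
    "\<Phi> X i = (if i = 0 then X 1 - X 0
       else if i = 1 then - ((X 1 + fps_const p * ((X 1 - fps_const L * X 0) * X 2)) * (1 + X 1 * X 1))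
       else - (fps_const (2 * L) * ((X 0 * (X 1 - X 0)) * (X 2 * X 2))))" for X i
  define K1 where "K1 = C + C"
  define K2 where "K2 = 8 * (C + \<bar>p\<bar> * (8 * (C + \<bar>L\<bar> * C) * C)) * (1 + 8 * C * C)"
  define K3 where "K3 = \<bar>2 * L\<bar> * (8 * (8 * C * (C + C)) * (8 * C * C))"
  define K where "K = K1 + K2 + K3"
  have Knn: "K1 \<ge> 0" "K2 \<ge> 0" "K3 \<ge> 0" using C by (auto simp: K1_def K2_def K3_def)
  have bdd: "fps_bounded K R m (\<Phi> X i)" if X: "\<And>i. fps_bounded C R m (X i)" and R: "R \<ge> 0" for R m X i
  proof -
    have C0: "C \<ge> 0" using C by simp
    have "fps_bounded K1 R m (X 1 - X 0)"
      unfolding K1_def by (intro fps_bounded_diff X)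
    moreover have "fps_bounded K2 R m (- ((X 1 + fps_const p * ((X 1 - fps_const L * X 0) * X 2)) * (1 + X 1 * X 1)))"
      unfolding K2_def using C0 R
      by (intro fps_bounded_uminus fps_bounded_mult fps_bounded_add fps_bounded_cmult fps_bounded_diff fps_bounded_1 X) auto
    moreover have "fps_bounded K3 R m (- (fps_const (2 * L) * ((X 0 * (X 1 - X 0)) * (X 2 * X 2))))"
      unfolding K3_def using C0 R
      by (intro fps_bounded_uminus fps_bounded_mult fps_bounded_cmult fps_bounded_diff X) auto
    ultimately show ?thesis
      using Knn R by (auto simp: \<Phi>_def K_def intro: fps_bounded_mono)
  qed
  define R where "R = 4 * K / C + 1"
  have R: "R > 0" "4 * K \<le> C * R" using C Knn by (auto simp: R_def K_def add_nonneg_pos field_simps)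
  show ?thesis
  proof (intro exI[of _ "1 / R"] conjI allI impI)
    show "1 / R > 0" using R by simp
    fix a b assume a: "\<bar>a\<bar> \<le> C" and b: "\<bar>b\<bar> \<le> C"
    define x0 where "x0 i = (if i = 0 then a else if i = 1 then b else 1 / (1 + L * a\<^sup>2))" for i :: nat
    have "\<exists>X. (\<forall>i. X i $ 0 = x0 i) \<and> (\<forall>i j. X i $ Suc j = (1 / (real j + 1)) * \<Phi> X i $ j)"
    proof (rule fps_system_exists)
      show "fps_agree j (\<Phi> X i) (\<Phi> Y i)" if "\<And>i. fps_agree j (X i) (Y i)" for X Y i j
        unfolding \<Phi>_def by (simp, intro conjI impI fps_agree_intros that)
    qed
    then obtain X where X0: "\<And>i. X i $ 0 = x0 i" and XS: "\<And>i j. X i $ Suc j = (1 / (real j + 1)) * \<Phi> X i $ j"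
      by blast
    have "1 / (1 + L * a\<^sup>2) \<le> 1" "1 / (1 + L * a\<^sup>2) > 0" using D_pos[of a] by simp_all
    then have "\<bar>1 / (1 + L * a\<^sup>2)\<bar> \<le> C" using C by linarith
    then have x0: "\<bar>x0 i\<bar> \<le> C" for i using a b by (simp add: x0_def)
    have "fps_bounded C R m (X i)" for m i
      by (rule fps_system_bounded[where c="\<lambda>i j. 1 / (real j + 1)" and \<Phi>=\<Phi> and K=K])
        (use X0 XS x0 C R bdd in auto)
    then have rad: "fps_conv_radius (X i) \<ge> ereal (1 / R)" for i
      using fps_bounded_imp_conv_radius[of C R "X i"] R by simp
    have dX: "fps_deriv (X i) = \<Phi> X i" for i
    proof (rule fps_ext)
      fix j
      have "real j + 1 \<noteq> 0" by linarith
      then show "fps_deriv (X i) $ j = \<Phi> X i $ j" by (simp add: XS add.commute)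
    qed
    define A B D where "A = X 0" and "B = X 1" and "D = X 2"
    have dA: "fps_deriv A = B - A" using dX[of 0] by (simp add: \<Phi>_def A_def B_def)
    have dB: "fps_deriv B = - ((B + fps_const p * ((B - fps_const L * A) * D)) * (1 + B * B))"
      using dX[of 1] by (simp add: \<Phi>_def A_def B_def D_def)
    have dD: "fps_deriv D = - (fps_const (2 * L) * ((A * (B - A)) * (D * D)))"
      using dX[of 2] by (simp add: \<Phi>_def A_def B_def D_def)
    \<comment> \<open>\<open>N\<close> measures how far \<open>D\<close> is from being the
      reciprocal. It solves a linear homogeneous equation with initial value 0.\<close>
    define N where "N = 1 - (1 + fps_const L * (A * A)) * D"
    have two: "fps_const (2 * L) = 2 * fps_const L" "fps_const (L * 2) = 2 * fps_const L"
      by (simp_all add: numeral_fps_const mult.commute)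
    have "fps_deriv N = - (fps_const (2 * L) * A * (B - A) * D) * N"
      unfolding N_def by (simp add: dA dD two algebra_simps)
    moreover have "N $ 0 = 0"
      using D_pos(2)[of a] by (simp add: N_def A_def D_def X0 x0_def power2_eq_square)
    ultimately have "N = 0" by (rule fps_deriv_eq_mult_self_imp_0)
    have ABrad: "fps_conv_radius A \<ge> ereal (1 / R)" "fps_conv_radius B \<ge> ereal (1 / R)" "fps_conv_radius D \<ge> ereal (1 / R)"
      using rad by (auto simp: A_def B_def D_def)
    show "\<exists>A B. fps_conv_radius A \<ge> ereal (1 / R) \<and> eval_fps A 0 = a \<and> eval_fps B 0 = b \<and>
      (\<forall>s. \<bar>s\<bar> < 1 / R \<longrightarrow> (eval_fps A has_real_derivative eval_fps B s - eval_fps A s) (at s) \<and>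
        (eval_fps B has_real_derivative slope_field (eval_fps A s) (eval_fps B s)) (at s))"
    proof (rule exI[of _ A], rule exI[of _ B], intro conjI allI impI)
      show "eval_fps A 0 = a" "eval_fps B 0 = b"
        using X0[of 0] X0[of 1] by (simp_all add: eval_fps_at_0 A_def B_def x0_def)
      fix s assume s: "\<bar>s\<bar> < 1 / R"
      then have sr: "ereal \<bar>s\<bar> < fps_conv_radius A" "ereal \<bar>s\<bar> < fps_conv_radius B" "ereal \<bar>s\<bar> < fps_conv_radius D"
        using ABrad by (meson ereal_less_eq(3) less_le_trans less_ereal.simps(1))+
      let ?a = "eval_fps A s" and ?b = "eval_fps B s" and ?d = "eval_fps D s"
      have v: "fps_value A s ?a" "fps_value B s ?b" "fps_value D s ?d" using sr by (auto simp: fps_value_def)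
      have "fps_value N s (1 - (1 + L * (?a * ?a)) * ?d)"
        unfolding N_def by (intro fps_value_intros v)
      moreover have "fps_value N s 0" using fps_value_const[of 0 s] \<open>N = 0\<close> by simp
      ultimately have "1 - (1 + L * (?a * ?a)) * ?d = 0" by (rule fps_value_unique)
      then have d: "?d = 1 / (1 + L * ?a\<^sup>2)" using D_pos[of ?a] by (simp add: field_simps power2_eq_square)
      show "(eval_fps A has_real_derivative ?b - ?a) (at s)"
        by (rule fps_value_deriv[OF sr(1)]) (unfold dA, intro fps_value_intros v)
      have "fps_value (fps_deriv B) s (- ((?b + p * ((?b - L * ?a) * ?d)) * (1 + ?b * ?b)))"
        unfolding dB by (intro fps_value_intros v)
      from fps_value_deriv[OF sr(2) this]
      show "(eval_fps B has_real_derivative slope_field ?a ?b) (at s)"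
        by (simp add: slope_field_def d power2_eq_square)
    qed fact
  qed
qed

text \<open>The origin is a saddle: its eigenvalues \<mu> satisfy (\<mu> + 1)(\<mu> + n) = p L, and
  \<kappa> = k - 1 is the positive one, with eigenvector (1, k). Substituting \<phi> = z A(z^2) and
  \<sigma> = z B(z^2) with z = exp(\<kappa> t) and w = z^2 gives a system in w with a regular
  singular point at 0, and its analytic solution is the unstable manifold.\<close>

lemma singular_solution:
  obtains A B \<delta> where "\<delta> > 0" "fps_conv_radius A \<ge> ereal \<delta>" "fps_conv_radius B \<ge> ereal \<delta>"
    "eval_fps A 0 = 1" "eval_fps B 0 = real k"
    "\<And>w. \<bar>w\<bar> < \<delta> \<Longrightarrow> 1 + L * w * (eval_fps A w)\<^sup>2 \<noteq> 0"
    "\<And>w. \<bar>w\<bar> < \<delta> \<Longrightarrow> \<exists>A'. (eval_fps A has_real_derivative A') (at w) \<and>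
        2 * \<kappa> * w * A' = eval_fps B w - real k * eval_fps A w"
    "\<And>w. \<bar>w\<bar> < \<delta> \<Longrightarrow> \<exists>B'. (eval_fps B has_real_derivative B') (at w) \<and>
        2 * \<kappa> * w * B' + \<kappa> * eval_fps B w = - (eval_fps B w + p * (eval_fps B w - L * eval_fps A w)
          / (1 + L * w * (eval_fps A w)\<^sup>2)) * (1 + w * (eval_fps B w)\<^sup>2)"
proof -
  \<comment> \<open>\<open>X 2\<close> stands for \<open>1 / (1 + L * w * A\<^sup>2)\<close>. The
    last branch is what remains of the second equation after its linear part, divided by
    \<open>w\<close>, once \<open>D = 1 - L * w * A\<^sup>2 * D\<close> has been inserted; it drives
    \<open>A\<close> and \<open>B\<close> alike.\<close>
  define \<Phi> :: "(nat \<Rightarrow> real fps) \<Rightarrow> nat \<Rightarrow> real fps" where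
    "\<Phi> X i = (if i = 2 then - (fps_const L * ((X 0 * X 0) * X 2))
       else fps_const (p * L) * (((X 0 * X 0) * X 2) * (X 1 - fps_const L * X 0))
         - (X 1 * X 1) * (X 1 + fps_const p * ((X 1 - fps_const L * X 0) * X 2)))" for X i
  define C where "C = real k"
  have C: "C \<ge> 1" using k by (simp add: C_def)
  define K1 where "K1 = \<bar>L\<bar> * (8 * (8 * C * C) * C)"
  define K2 where "K2 = \<bar>p * L\<bar> * (8 * (8 * (8 * C * C) * C) * (C + \<bar>L\<bar> * C))
    + 8 * (8 * C * C) * (C + \<bar>p\<bar> * (8 * (C + \<bar>L\<bar> * C) * C))"
  define K where "K = K1 + K2"
  have Knn: "K1 \<ge> 0" "K2 \<ge> 0" using C by (auto simp: K1_def K2_def)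
  have bdd: "fps_bounded K R m (\<Phi> X i)" if X: "\<And>i. fps_bounded C R m (X i)" and R: "R \<ge> 0" for R m X i
  proof -
    have C0: "C \<ge> 0" using C by simp
    have "fps_bounded K1 R m (- (fps_const L * ((X 0 * X 0) * X 2)))"
      unfolding K1_def using C0 R
      by (intro fps_bounded_uminus fps_bounded_mult fps_bounded_cmult X) auto
    moreover have "fps_bounded K2 R m (fps_const (p * L) * (((X 0 * X 0) * X 2) * (X 1 - fps_const L * X 0))
         - (X 1 * X 1) * (X 1 + fps_const p * ((X 1 - fps_const L * X 0) * X 2)))"
      unfolding K2_def using C0 R
      by (intro fps_bounded_diff fps_bounded_mult fps_bounded_add fps_bounded_cmult X) auto
    ultimately show ?thesis
      using Knn R by (auto simp: \<Phi>_def K_def intro: fps_bounded_mono)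
  qed
  define R where "R = 4 * K / C + 1"
  have R: "R > 0" "4 * K \<le> C * R" using C Knn by (auto simp: R_def K_def add_nonneg_pos field_simps)
  \<comment> \<open>At order j + 1 the linear part is a 2 x 2 system with determinant
    \<open>\<Delta> j\<close>, whose first equation makes the coefficient of \<open>B\<close> equal
    to \<open>m1 j\<close> times that of \<open>A\<close>. The identity
    \<open>p * L = real k * (\<kappa> + n)\<close> factors the determinant; it is at least
    \<open>m1 j\<close>, so there is no resonance and the recursion factors \<open>c\<close> are at
    most 1.\<close>
  define m1 where "m1 j = 2 * \<kappa> * real (Suc j) + real k" for j
  define \<Delta> where "\<Delta> j = m1 j * (2 * \<kappa> * real (Suc j) + \<kappa> + n) - p * L" for j
  have m1: "m1 j \<ge> 1" for j
  proof -
    have "2 * \<kappa> * real (Suc j) \<ge> 0" using \<kappa>_ge by simp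
    then show ?thesis using k unfolding m1_def by linarith
  qed
  have \<Delta>: "\<Delta> j \<ge> m1 j" for j
  proof -
    have "\<Delta> j = 2 * \<kappa> * real (Suc j) * (m1 j + (\<kappa> + n))"
      unfolding \<Delta>_def pL m1_def by (simp only: algebra_simps)
    moreover have "1 * (m1 j + 0) \<le> 2 * \<kappa> * real (Suc j) * (m1 j + (\<kappa> + n))"
    proof (rule mult_mono)
      have "1 * 1 \<le> (2 * \<kappa>) * real (Suc j)" using \<kappa>_ge by (intro mult_mono) auto
      then show "1 \<le> 2 * \<kappa> * real (Suc j)" by simp
    qed (use \<kappa>_ge p_ge m1[of j] in \<open>auto simp: n_def\<close>)
    ultimately show ?thesis by simp
  qed
  have \<Delta>0: "\<Delta> j > 0" for j using \<Delta>[of j] m1[of j] by linarith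
  define c where "c i j = (if i = 0 then 1 / \<Delta> j else if i = 1 then m1 j / \<Delta> j else 1)" for i j :: nat
  have c1: "\<bar>c i j\<bar> \<le> 1" for i j
    using \<Delta>[of j] m1[of j] \<Delta>0[of j] by (auto simp: c_def)
  define x0 where "x0 i = (if i = 1 then real k else 1)" for i :: nat
  have "\<exists>X. (\<forall>i. X i $ 0 = x0 i) \<and> (\<forall>i j. X i $ Suc j = c i j * \<Phi> X i $ j)"
  proof (rule fps_system_exists)
    show "fps_agree j (\<Phi> X i) (\<Phi> Y i)" if "\<And>i. fps_agree j (X i) (Y i)" for X Y i j
      unfolding \<Phi>_def by (simp, intro conjI impI fps_agree_intros that)
  qed
  then obtain X where X0: "\<And>i. X i $ 0 = x0 i" and XS: "\<And>i j. X i $ Suc j = c i j * \<Phi> X i $ j"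
    by blast
  have "fps_bounded C R m (X i)" for m i
    by (rule fps_system_bounded[where c=c and \<Phi>=\<Phi> and K=K])
      (use X0 XS c1 C R bdd in \<open>auto simp: x0_def C_def\<close>)
  then have rad: "fps_conv_radius (X i) \<ge> ereal (1 / R)" for i
    using fps_bounded_imp_conv_radius[of C R "X i"] R by simp
  define A B D where "A = X 0" and "B = X 1" and "D = X 2"
  define Rr where "Rr = fps_const (p * L) * (((A * A) * D) * (B - fps_const L * A))
         - (B * B) * (B + fps_const p * ((B - fps_const L * A) * D))"
  have Rr: "\<Phi> X 0 = Rr" "\<Phi> X 1 = Rr" by (simp_all add: \<Phi>_def Rr_def A_def B_def D_def)
  have eD: "D = 1 - fps_const L * (fps_X * ((A * A) * D))"
  proof (rule fps_ext)
    fix j show "D $ j = (1 - fps_const L * (fps_X * ((A * A) * D))) $ j"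
      using X0[of 2] XS[of 2] by (cases j) (auto simp: D_def x0_def c_def \<Phi>_def A_def)
  qed
  have eA: "fps_const (2 * \<kappa>) * (fps_X * fps_deriv A) = B - fps_const (real k) * A"
  proof (rule fps_ext)
    fix j show "(fps_const (2 * \<kappa>) * (fps_X * fps_deriv A)) $ j = (B - fps_const (real k) * A) $ j"
    proof (cases j)
      case 0
      then show ?thesis using X0[of 0] X0[of 1] by (simp add: A_def B_def x0_def)
    next
      case (Suc l)
      have "B $ Suc l = m1 l * A $ Suc l"
        using XS[of 0 l] XS[of 1 l] Rr by (simp add: A_def B_def c_def)
      then show ?thesis by (simp add: Suc m1_def algebra_simps)
    qed
  qed
  have eB: "fps_const (2 * \<kappa>) * (fps_X * fps_deriv B) + fps_const \<kappa> * B =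
    - (B + fps_const p * (B - fps_const L * A)) + fps_X * Rr"
  proof (rule fps_ext)
    fix j show "(fps_const (2 * \<kappa>) * (fps_X * fps_deriv B) + fps_const \<kappa> * B) $ j =
      (- (B + fps_const p * (B - fps_const L * A)) + fps_X * Rr) $ j"
    proof (cases j)
      case 0
      have "\<kappa> * real k = - real k - p * real k + p * L" unfolding pL by (simp add: n_def k_eq algebra_simps)
      then show ?thesis using 0 X0[of 0] X0[of 1] by (simp add: A_def B_def x0_def algebra_simps)
    next
      case (Suc l)
      define z where "z = Rr $ l / \<Delta> l"
      have a: "A $ Suc l = z" and b: "B $ Suc l = m1 l * z"
        using XS[of 0 l] XS[of 1 l] Rr by (simp_all add: A_def B_def c_def z_def)
      have "(2 * \<kappa> * real (Suc l) + \<kappa> + n) * B $ Suc l - p * L * A $ Suc l = \<Delta> l * z"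
        unfolding a b \<Delta>_def[of l] by (simp add: algebra_simps)
      also have "\<dots> = Rr $ l" using \<Delta>0[of l] by (simp add: z_def)
      finally show ?thesis by (simp add: Suc n_def algebra_simps)
    qed
  qed
  have AD: "\<bar>w\<bar> < 1 / R \<Longrightarrow> fps_value A w (eval_fps A w) \<and> fps_value B w (eval_fps B w) \<and> fps_value D w (eval_fps D w)" for w
    unfolding fps_value_def A_def B_def D_def using rad
    by (meson ereal_less_eq(3) less_le_trans less_ereal.simps(1))
  have dval: "eval_fps D w * (1 + L * w * (eval_fps A w)\<^sup>2) = 1" if w: "\<bar>w\<bar> < 1 / R" for w
  proof -
    have v: "fps_value A w (eval_fps A w)" "fps_value D w (eval_fps D w)" using AD[OF w] by auto
    have "fps_value (1 - fps_const L * (fps_X * ((A * A) * D))) w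
        (1 - L * (w * ((eval_fps A w * eval_fps A w) * eval_fps D w)))"
      by (intro fps_value_intros v)
    from fps_value_unique[OF this[folded eD] v(2)] show ?thesis
      by (simp add: power2_eq_square algebra_simps)
  qed
  show ?thesis
  proof (rule that[of "1 / R" A B])
    show "1 / R > 0" using R by simp
    show "fps_conv_radius A \<ge> ereal (1 / R)" "fps_conv_radius B \<ge> ereal (1 / R)"
      using rad by (auto simp: A_def B_def)
    show "eval_fps A 0 = 1" "eval_fps B 0 = real k"
      using X0[of 0] X0[of 1] by (simp_all add: eval_fps_at_0 A_def B_def x0_def)
    fix w assume w: "\<bar>w\<bar> < 1 / R"
    let ?a = "eval_fps A w" and ?b = "eval_fps B w" and ?d = "eval_fps D w"
    have v: "fps_value A w ?a" "fps_value B w ?b" "fps_value D w ?d" using AD[OF w] by auto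
    show ne: "1 + L * w * ?a\<^sup>2 \<noteq> 0" using dval[OF w] by auto
    have d: "?d = 1 / (1 + L * w * ?a\<^sup>2)" using dval[OF w] ne by (simp add: field_simps)
    have sr: "ereal \<bar>w\<bar> < fps_conv_radius A" "ereal \<bar>w\<bar> < fps_conv_radius B" using v by (auto simp: fps_value_def)
    show "\<exists>A'. (eval_fps A has_real_derivative A') (at w) \<and> 2 * \<kappa> * w * A' = ?b - real k * ?a"
    proof (intro exI conjI)
      let ?A' = "eval_fps (fps_deriv A) w"
      have v': "fps_value (fps_deriv A) w ?A'" by (rule fps_value_deriv_exists[OF sr(1)])
      show "(eval_fps A has_real_derivative ?A') (at w)" by (rule fps_value_deriv[OF sr(1) v'])
      have "fps_value (fps_const (2 * \<kappa>) * (fps_X * fps_deriv A)) w ((2 * \<kappa>) * (w * ?A'))"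
        by (intro fps_value_intros v')
      moreover have "fps_value (B - fps_const (real k) * A) w (?b - real k * ?a)"
        by (intro fps_value_intros v)
      ultimately show "2 * \<kappa> * w * ?A' = ?b - real k * ?a"
        unfolding eA using fps_value_unique by fastforce
    qed
    show "\<exists>B'. (eval_fps B has_real_derivative B') (at w) \<and>
        2 * \<kappa> * w * B' + \<kappa> * ?b = - (?b + p * (?b - L * ?a) / (1 + L * w * ?a\<^sup>2)) * (1 + w * ?b\<^sup>2)"
    proof (intro exI conjI)
      let ?B' = "eval_fps (fps_deriv B) w"
      have v': "fps_value (fps_deriv B) w ?B'" by (rule fps_value_deriv_exists[OF sr(2)])
      show "(eval_fps B has_real_derivative ?B') (at w)" by (rule fps_value_deriv[OF sr(2) v'])
      have "fps_value (fps_const (2 * \<kappa>) * (fps_X * fps_deriv B) + fps_const \<kappa> * B) w ((2 * \<kappa>) * (w * ?B') + \<kappa> * ?b)"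
        by (intro fps_value_intros v' v)
      moreover have "fps_value (- (B + fps_const p * (B - fps_const L * A)) + fps_X * Rr) w
        (- (?b + p * (?b - L * ?a)) + w * ((p * L) * (((?a * ?a) * ?d) * (?b - L * ?a))
         - (?b * ?b) * (?b + p * ((?b - L * ?a) * ?d))))"
        unfolding Rr_def by (intro fps_value_intros v)
      ultimately have "(2 * \<kappa>) * (w * ?B') + \<kappa> * ?b =
        - (?b + p * (?b - L * ?a)) + w * ((p * L) * (((?a * ?a) * ?d) * (?b - L * ?a))
         - (?b * ?b) * (?b + p * ((?b - L * ?a) * ?d)))"
        unfolding eB using fps_value_unique by blast
      also have "\<dots> = - (?b + p * (?b - L * ?a) * (1 - L * w * ?a\<^sup>2 * ?d)) - w * ?b\<^sup>2 * (?b + p * (?b - L * ?a) * ?d)"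
        by (simp add: algebra_simps power2_eq_square)
      also have "1 - L * w * ?a\<^sup>2 * ?d = ?d" using dval[OF w] by (simp add: algebra_simps)
      also have "- (?b + p * (?b - L * ?a) * ?d) - w * ?b\<^sup>2 * (?b + p * (?b - L * ?a) * ?d)
        = - (?b + p * (?b - L * ?a) * ?d) * (1 + w * ?b\<^sup>2)" by (simp add: algebra_simps)
      finally show "2 * \<kappa> * w * ?B' + \<kappa> * ?b = - (?b + p * (?b - L * ?a) / (1 + L * w * ?a\<^sup>2)) * (1 + w * ?b\<^sup>2)"
        by (simp add: d)
    qed
  qed
qed

end

section \<open>The phase portrait\<close>

lemma first_zero:
  fixes g :: "real \<Rightarrow> real"
  assumes cont: "continuous_on {s..u} g" and "s \<le> u" "g s > 0" "g u \<le> 0"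
  obtains t where "s < t" "t \<le> u" "g t = 0" "\<And>v. s \<le> v \<Longrightarrow> v < t \<Longrightarrow> g v > 0"
proof -
  define Z where "Z = {s..u} \<inter> g -` {..0}"
  have cl: "closed Z" unfolding Z_def by (rule continuous_closed_preimage[OF cont]) auto
  have ne: "Z \<noteq> {}" "bdd_below Z" using assms by (auto simp: Z_def bdd_below_def)
  define t where "t = Inf Z"
  have tZ: "t \<in> Z" unfolding t_def by (rule closed_contains_Inf[OF ne cl])
  have before: "g v > 0" if "s \<le> v" "v < t" for v
  proof (rule ccontr)
    assume "\<not> g v > 0"
    then have "v \<in> Z" using that tZ by (auto simp: Z_def)
    then have "t \<le> v" unfolding t_def by (rule cInf_lower[OF _ ne(2)])
    then show False using that by simp
  qed
  have st: "s \<le> t" "t \<le> u" "g t \<le> 0" using tZ by (auto simp: Z_def)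
  have "\<exists>v\<ge>s. v \<le> t \<and> g v = 0"
    by (rule IVT2') (use assms st in \<open>auto intro: continuous_on_subset[OF cont]\<close>)
  then have "g t = 0" using before by (metis less_irrefl order_le_less)
  then show ?thesis using that[of t] st before assms(3) by (metis less_irrefl order_le_less)
qed

text \<open>At its first zero \<open>g\<close> comes down from positive values, which a strictly
  positive derivative excludes. The premise \<open>in_pos\<close> may use positivity up to that
  time; this closes arguments with coupled signs.\<close>

lemma barrier:
  fixes g g' :: "real \<Rightarrow> real"
  assumes d: "\<And>t. s \<le> t \<Longrightarrow> t \<le> u \<Longrightarrow> (g has_real_derivative g' t) (at t)"
    and su: "s \<le> u" and "g s > 0"
    and in_pos: "\<And>t. s < t \<Longrightarrow> t \<le> u \<Longrightarrow> g t = 0 \<Longrightarrow> (\<And>v. s \<le> v \<Longrightarrow> v < t \<Longrightarrow> g v > 0) \<Longrightarrow> g' t > 0"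
  shows "g u > 0"
proof (rule ccontr)
  assume "\<not> g u > 0"
  have "continuous_on {s..u} g"
    by (intro continuous_at_imp_continuous_on ballI DERIV_isCont[OF d]) auto
  then obtain t where t: "s < t" "t \<le> u" "g t = 0" "\<And>v. s \<le> v \<Longrightarrow> v < t \<Longrightarrow> g v > 0"
    using first_zero[of s u g] su \<open>g s > 0\<close> \<open>\<not> g u > 0\<close> by (metis not_less)
  have "g' t > 0" by (rule in_pos[OF t])
  then obtain e where e: "e > 0" "\<And>h. h > 0 \<Longrightarrow> h < e \<Longrightarrow> g (t - h) < g t"
    using DERIV_pos_inc_left[OF d[of t]] t by auto
  define h where "h = min (e / 2) (t - s)"
  have "h > 0" "h < e" "s \<le> t - h" using e t by (auto simp: h_def)
  then show False using e(2)[of h] t(3) t(4)[of "t - h"] by simp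
qed

text \<open>Boundedness is included because Lipschitz constants of products need it. The class is
  closed under sums, products and reciprocals of functions that are at least 1, the operations from
  which \<open>slope_field\<close> is built.\<close>

definition lip_on_square :: "real \<Rightarrow> (real \<times> real \<Rightarrow> real) \<Rightarrow> bool" where
  "lip_on_square C f \<longleftrightarrow> (\<exists>M K. M \<ge> 0 \<and> K \<ge> 0 \<and> (\<forall>x y x' y'. \<bar>x\<bar> \<le> C \<longrightarrow> \<bar>y\<bar> \<le> C \<longrightarrow> \<bar>x'\<bar> \<le> C \<longrightarrow> \<bar>y'\<bar> \<le> C \<longrightarrow>
      \<bar>f (x, y)\<bar> \<le> M \<and> \<bar>f (x, y) - f (x', y')\<bar> \<le> K * (\<bar>x - x'\<bar> + \<bar>y - y'\<bar>)))"

lemma lip_const: "lip_on_square C (\<lambda>_. c)"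
  unfolding lip_on_square_def by (rule exI[of _ "\<bar>c\<bar>"], rule exI[of _ 0]) auto

lemma lip_fst: "lip_on_square C fst"
  unfolding lip_on_square_def by (rule exI[of _ "\<bar>C\<bar>"], rule exI[of _ 1]) auto

lemma lip_snd: "lip_on_square C snd"
  unfolding lip_on_square_def by (rule exI[of _ "\<bar>C\<bar>"], rule exI[of _ 1]) auto

lemma lip_add:
  assumes "lip_on_square C f" "lip_on_square C g"
  shows "lip_on_square C (\<lambda>z. f z + g z)"
proof -
  obtain M K where f: "M \<ge> 0" "K \<ge> 0" "\<And>x y x' y'. \<bar>x\<bar> \<le> C \<Longrightarrow> \<bar>y\<bar> \<le> C \<Longrightarrow> \<bar>x'\<bar> \<le> C \<Longrightarrow> \<bar>y'\<bar> \<le> C \<Longrightarrow>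
      \<bar>f (x, y)\<bar> \<le> M \<and> \<bar>f (x, y) - f (x', y')\<bar> \<le> K * (\<bar>x - x'\<bar> + \<bar>y - y'\<bar>)"
    using assms(1) unfolding lip_on_square_def by blast
  obtain M' K' where g: "M' \<ge> 0" "K' \<ge> 0" "\<And>x y x' y'. \<bar>x\<bar> \<le> C \<Longrightarrow> \<bar>y\<bar> \<le> C \<Longrightarrow> \<bar>x'\<bar> \<le> C \<Longrightarrow> \<bar>y'\<bar> \<le> C \<Longrightarrow>
      \<bar>g (x, y)\<bar> \<le> M' \<and> \<bar>g (x, y) - g (x', y')\<bar> \<le> K' * (\<bar>x - x'\<bar> + \<bar>y - y'\<bar>)"
    using assms(2) unfolding lip_on_square_def by blast
  show ?thesis
    unfolding lip_on_square_def
  proof (rule exI[of _ "M + M'"], rule exI[of _ "K + K'"], intro conjI allI impI)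
    fix x y x' y' assume h: "\<bar>x\<bar> \<le> C" "\<bar>y\<bar> \<le> C" "\<bar>x'\<bar> \<le> C" "\<bar>y'\<bar> \<le> C"
    note f' = f(3)[OF h] and g' = g(3)[OF h]
    show "\<bar>f (x, y) + g (x, y)\<bar> \<le> M + M'" using f' g' by linarith
    have "(K + K') * (\<bar>x - x'\<bar> + \<bar>y - y'\<bar>) = K * (\<bar>x - x'\<bar> + \<bar>y - y'\<bar>) + K' * (\<bar>x - x'\<bar> + \<bar>y - y'\<bar>)"
      by (simp add: algebra_simps)
    then show "\<bar>f (x, y) + g (x, y) - (f (x', y') + g (x', y'))\<bar> \<le> (K + K') * (\<bar>x - x'\<bar> + \<bar>y - y'\<bar>)"
      using f' g' by linarith
  qed (use f g in auto)
qed

lemma lip_mult: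
  assumes "lip_on_square C f" "lip_on_square C g"
  shows "lip_on_square C (\<lambda>z. f z * g z)"
proof -
  obtain M K where f: "M \<ge> 0" "K \<ge> 0" "\<And>x y x' y'. \<bar>x\<bar> \<le> C \<Longrightarrow> \<bar>y\<bar> \<le> C \<Longrightarrow> \<bar>x'\<bar> \<le> C \<Longrightarrow> \<bar>y'\<bar> \<le> C \<Longrightarrow>
      \<bar>f (x, y)\<bar> \<le> M \<and> \<bar>f (x, y) - f (x', y')\<bar> \<le> K * (\<bar>x - x'\<bar> + \<bar>y - y'\<bar>)"
    using assms(1) unfolding lip_on_square_def by blast
  obtain M' K' where g: "M' \<ge> 0" "K' \<ge> 0" "\<And>x y x' y'. \<bar>x\<bar> \<le> C \<Longrightarrow> \<bar>y\<bar> \<le> C \<Longrightarrow> \<bar>x'\<bar> \<le> C \<Longrightarrow> \<bar>y'\<bar> \<le> C \<Longrightarrow>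
      \<bar>g (x, y)\<bar> \<le> M' \<and> \<bar>g (x, y) - g (x', y')\<bar> \<le> K' * (\<bar>x - x'\<bar> + \<bar>y - y'\<bar>)"
    using assms(2) unfolding lip_on_square_def by blast
  show ?thesis
    unfolding lip_on_square_def
  proof (rule exI[of _ "M * M'"], rule exI[of _ "M * K' + M' * K"], intro conjI allI impI)
    fix x y x' y' assume h: "\<bar>x\<bar> \<le> C" "\<bar>y\<bar> \<le> C" "\<bar>x'\<bar> \<le> C" "\<bar>y'\<bar> \<le> C"
    note f' = f(3)[OF h] and g' = g(3)[OF h] and g'' = g(3)[OF h(3,4) h(3,4)]
    show "\<bar>f (x, y) * g (x, y)\<bar> \<le> M * M'" unfolding abs_mult using f' g' f g by (intro mult_mono) auto
    let ?d = "\<bar>x - x'\<bar> + \<bar>y - y'\<bar>"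
    have "f (x, y) * g (x, y) - f (x', y') * g (x', y') =
      f (x, y) * (g (x, y) - g (x', y')) + g (x', y') * (f (x, y) - f (x', y'))" by (simp add: algebra_simps)
    then have "\<bar>f (x, y) * g (x, y) - f (x', y') * g (x', y')\<bar> \<le>
      \<bar>f (x, y)\<bar> * \<bar>g (x, y) - g (x', y')\<bar> + \<bar>g (x', y')\<bar> * \<bar>f (x, y) - f (x', y')\<bar>"
      unfolding abs_mult[symmetric] by (simp only: abs_triangle_ineq)
    also have "\<dots> \<le> M * (K' * ?d) + M' * (K * ?d)"
      using f' g' g'' f g by (intro add_mono mult_mono) auto
    finally show "\<bar>f (x, y) * g (x, y) - f (x', y') * g (x', y')\<bar> \<le> (M * K' + M' * K) * ?d"
      by (simp add: algebra_simps)
  qed (use f g in auto)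
qed

lemma lip_inverse:
  assumes "lip_on_square C f" "\<And>z. f z \<ge> 1"
  shows "lip_on_square C (\<lambda>z. inverse (f z))"
proof -
  obtain M K where f: "M \<ge> 0" "K \<ge> 0" "\<And>x y x' y'. \<bar>x\<bar> \<le> C \<Longrightarrow> \<bar>y\<bar> \<le> C \<Longrightarrow> \<bar>x'\<bar> \<le> C \<Longrightarrow> \<bar>y'\<bar> \<le> C \<Longrightarrow>
      \<bar>f (x, y)\<bar> \<le> M \<and> \<bar>f (x, y) - f (x', y')\<bar> \<le> K * (\<bar>x - x'\<bar> + \<bar>y - y'\<bar>)"
    using assms(1) unfolding lip_on_square_def by blast
  have pos: "f z > 0" for z using assms(2)[of z] by linarith
  have i1: "inverse (f z) \<le> 1" "inverse (f z) > 0" for z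
    using assms(2)[of z] pos[of z] by (auto simp: inverse_le_1_iff)
  show ?thesis
    unfolding lip_on_square_def
  proof (rule exI[of _ 1], rule exI[of _ K], intro conjI allI impI)
    fix x y x' y' assume h: "\<bar>x\<bar> \<le> C" "\<bar>y\<bar> \<le> C" "\<bar>x'\<bar> \<le> C" "\<bar>y'\<bar> \<le> C"
    show "\<bar>inverse (f (x, y))\<bar> \<le> 1" using i1[of "(x, y)"] by simp
    have "\<bar>inverse (f (x, y)) - inverse (f (x', y'))\<bar> =
        \<bar>f (x, y) - f (x', y')\<bar> * (inverse (f (x, y)) * inverse (f (x', y')))"
      using pos[of "(x, y)"] pos[of "(x', y')"]
      by (simp add: inverse_diff_inverse less_imp_neq[THEN not_sym] abs_mult)
    also have "\<dots> \<le> (K * (\<bar>x - x'\<bar> + \<bar>y - y'\<bar>)) * (1 * 1)"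
      using f(3)[OF h] i1 by (intro mult_mono) (auto intro: less_imp_le mult_nonneg_nonneg)
    finally show "\<bar>inverse (f (x, y)) - inverse (f (x', y'))\<bar> \<le> K * (\<bar>x - x'\<bar> + \<bar>y - y'\<bar>)" by simp
  qed (use f in auto)
qed

section \<open>Uniqueness, the orbit leaving the origin, and a priori bounds\<close>

context profile_ode
begin

definition sol :: "real set \<Rightarrow> (real \<Rightarrow> real) \<Rightarrow> (real \<Rightarrow> real) \<Rightarrow> bool" where
  "sol I \<phi> \<sigma> \<longleftrightarrow> (\<forall>t\<in>I. (\<phi> has_real_derivative \<sigma> t - \<phi> t) (at t) \<and>
     (\<sigma> has_real_derivative slope_field (\<phi> t) (\<sigma> t)) (at t))"

lemma sol_subset: "sol I \<phi> \<sigma> \<Longrightarrow> J \<subseteq> I \<Longrightarrow> sol J \<phi> \<sigma>"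
  by (auto simp: sol_def)

lemma sol_cong:
  assumes "sol I \<phi> \<sigma>" "open I" "\<And>t. t \<in> I \<Longrightarrow> \<phi>' t = \<phi> t" "\<And>t. t \<in> I \<Longrightarrow> \<sigma>' t = \<sigma> t"
  shows "sol I \<phi>' \<sigma>'"
  unfolding sol_def
proof (intro ballI conjI)
  fix t assume t: "t \<in> I"
  then have d: "(\<phi> has_real_derivative \<sigma> t - \<phi> t) (at t)" "(\<sigma> has_real_derivative slope_field (\<phi> t) (\<sigma> t)) (at t)"
    using assms(1) by (auto simp: sol_def)
  have "(\<phi>' has_real_derivative \<sigma> t - \<phi> t) (at t)"
    by (rule has_field_derivative_transform_within_open[OF d(1) assms(2) t]) (simp add: assms(3))
  then show "(\<phi>' has_real_derivative \<sigma>' t - \<phi>' t) (at t)" by (simp add: assms(3,4)[OF t])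
  have "(\<sigma>' has_real_derivative slope_field (\<phi> t) (\<sigma> t)) (at t)"
    by (rule has_field_derivative_transform_within_open[OF d(2) assms(2) t]) (simp add: assms(4))
  then show "(\<sigma>' has_real_derivative slope_field (\<phi>' t) (\<sigma>' t)) (at t)" by (simp add: assms(3,4)[OF t])
qed

lemma sol_shift:
  assumes "sol I \<phi> \<sigma>" "\<And>t. t \<in> J \<Longrightarrow> t + c \<in> I"
  shows "sol J (\<lambda>t. \<phi> (t + c)) (\<lambda>t. \<sigma> (t + c))"
  using assms DERIV_shift by (fastforce simp: sol_def)

lemma slope_field_lipschitz:
  obtains K where "K \<ge> 0" "\<And>x y x' y'. \<bar>x\<bar> \<le> C \<Longrightarrow> \<bar>y\<bar> \<le> C \<Longrightarrow> \<bar>x'\<bar> \<le> C \<Longrightarrow> \<bar>y'\<bar> \<le> C \<Longrightarrow>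
    \<bar>slope_field x y - slope_field x' y'\<bar> \<le> K * (\<bar>x - x'\<bar> + \<bar>y - y'\<bar>)"
proof -
  define f where "f z = (- 1) * ((snd z + p * ((snd z + (- L) * fst z) * inverse (1 + L * (fst z * fst z)))) * (1 + snd z * snd z))"
    for z :: "real \<times> real"
  have "lip_on_square C f"
    unfolding f_def by (intro lip_mult lip_add lip_inverse lip_const lip_fst lip_snd)
      (use D_pos(3) in \<open>simp add: power2_eq_square\<close>)
  moreover have "f (x, y) = slope_field x y" for x y
    by (simp add: f_def slope_field_def divide_inverse power2_eq_square)
  ultimately show ?thesis using that unfolding lip_on_square_def by metis
qed

text \<open>Gronwall's argument: on the compact interval between \<open>ti\<close> and
  \<open>t\<close> the squared distance satisfies |e'| \<le> H e, so \<open>e\<close> times a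
  suitable exponential cannot grow away from \<open>ti\<close>, forwards or backwards.\<close>

lemma sol_unique:
  assumes 1: "sol {a<..<b} \<phi> \<sigma>" and 2: "sol {a<..<b} \<phi>' \<sigma>'"
    and ti: "ti \<in> {a<..<b}" and eq: "\<phi> ti = \<phi>' ti" "\<sigma> ti = \<sigma>' ti" and t: "t \<in> {a<..<b}"
  shows "\<phi> t = \<phi>' t \<and> \<sigma> t = \<sigma>' t"
proof -
  define J where "J = {min t ti..max t ti}"
  have J: "J \<subseteq> {a<..<b}" using t ti by (auto simp: J_def)
  have d: "(\<phi> has_real_derivative \<sigma> s - \<phi> s) (at s)" "(\<sigma> has_real_derivative slope_field (\<phi> s) (\<sigma> s)) (at s)"
    "(\<phi>' has_real_derivative \<sigma>' s - \<phi>' s) (at s)" "(\<sigma>' has_real_derivative slope_field (\<phi>' s) (\<sigma>' s)) (at s)"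
    if "s \<in> J" for s using 1 2 J that by (auto simp: sol_def)
  have cont: "continuous_on J \<phi>" "continuous_on J \<sigma>" "continuous_on J \<phi>'" "continuous_on J \<sigma>'"
    using d by (auto intro!: continuous_at_imp_continuous_on DERIV_isCont)
  have "\<exists>C. \<forall>s\<in>J. \<bar>f s\<bar> \<le> C" if "continuous_on J f" for f :: "real \<Rightarrow> real"
    using compact_imp_bounded[OF compact_continuous_image[OF that]] by (auto simp: J_def bounded_iff)
  then obtain C1 C2 C3 C4 where Cs: "\<And>s. s \<in> J \<Longrightarrow> \<bar>\<phi> s\<bar> \<le> C1" "\<And>s. s \<in> J \<Longrightarrow> \<bar>\<sigma> s\<bar> \<le> C2"
    "\<And>s. s \<in> J \<Longrightarrow> \<bar>\<phi>' s\<bar> \<le> C3" "\<And>s. s \<in> J \<Longrightarrow> \<bar>\<sigma>' s\<bar> \<le> C4"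
    using cont by metis
  define C where "C = max (max C1 C2) (max C3 C4)"
  have C: "\<bar>\<phi> s\<bar> \<le> C" "\<bar>\<sigma> s\<bar> \<le> C" "\<bar>\<phi>' s\<bar> \<le> C" "\<bar>\<sigma>' s\<bar> \<le> C" if "s \<in> J" for s
    using Cs[OF that] by (auto simp: C_def)
  obtain K where K: "K \<ge> 0" "\<And>x y x' y'. \<bar>x\<bar> \<le> C \<Longrightarrow> \<bar>y\<bar> \<le> C \<Longrightarrow> \<bar>x'\<bar> \<le> C \<Longrightarrow> \<bar>y'\<bar> \<le> C \<Longrightarrow>
    \<bar>slope_field x y - slope_field x' y'\<bar> \<le> K * (\<bar>x - x'\<bar> + \<bar>y - y'\<bar>)"
    using slope_field_lipschitz[of C] by blast
  define e where "e s = (\<phi> s - \<phi>' s)\<^sup>2 + (\<sigma> s - \<sigma>' s)\<^sup>2" for s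
  define e' where "e' s = 2 * (\<phi> s - \<phi>' s) * ((\<sigma> s - \<phi> s) - (\<sigma>' s - \<phi>' s)) +
     2 * (\<sigma> s - \<sigma>' s) * (slope_field (\<phi> s) (\<sigma> s) - slope_field (\<phi>' s) (\<sigma>' s))" for s
  have de: "(e has_real_derivative e' s) (at s)" if "s \<in> J" for s
    unfolding e_def[abs_def] by (rule derivative_eq_intros d[OF that] refl)+ (simp add: e'_def algebra_simps)
  define H where "H = 4 + 4 * K"
  have e'_le: "\<bar>e' s\<bar> \<le> H * e s" if s: "s \<in> J" for s
  proof -
    define u v where "u = \<bar>\<phi> s - \<phi>' s\<bar>" and "v = \<bar>\<sigma> s - \<sigma>' s\<bar>"
    have uv: "u \<ge> 0" "v \<ge> 0" "e s = u\<^sup>2 + v\<^sup>2" by (auto simp: u_def v_def e_def)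
    have "\<bar>e' s\<bar> \<le> \<bar>2 * (\<phi> s - \<phi>' s) * ((\<sigma> s - \<phi> s) - (\<sigma>' s - \<phi>' s))\<bar> +
        \<bar>2 * (\<sigma> s - \<sigma>' s) * (slope_field (\<phi> s) (\<sigma> s) - slope_field (\<phi>' s) (\<sigma>' s))\<bar>"
      unfolding e'_def by (rule abs_triangle_ineq)
    also have "\<dots> = 2 * u * \<bar>(\<sigma> s - \<phi> s) - (\<sigma>' s - \<phi>' s)\<bar> + 2 * v * \<bar>slope_field (\<phi> s) (\<sigma> s) - slope_field (\<phi>' s) (\<sigma>' s)\<bar>"
      unfolding u_def v_def by (simp only: abs_mult abs_numeral)
    also have "\<dots> \<le> 2 * u * (u + v) + 2 * v * (K * (u + v))"
      using K(2)[OF C[OF s]] uv by (intro add_mono mult_left_mono) (auto simp: u_def v_def)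
    also have "\<dots> \<le> H * (u\<^sup>2 + v\<^sup>2)"
    proof -
      have "2 * (u * v) \<le> u\<^sup>2 + v\<^sup>2" using sum_squares_bound[of u v] by simp
      moreover have "K * (2 * (u * v)) \<le> K * (u\<^sup>2 + v\<^sup>2)" using K(1) calculation by (rule mult_left_mono[rotated])
      moreover have "K * u\<^sup>2 \<ge> 0" "K * v\<^sup>2 \<ge> 0" "u\<^sup>2 \<ge> 0" "v\<^sup>2 \<ge> 0" using K(1) by auto
      moreover have "2 * u * (u + v) + 2 * v * (K * (u + v)) = 2 * u\<^sup>2 + 2 * (u * v) + K * (2 * (u * v)) + 2 * (K * v\<^sup>2)"
        "H * (u\<^sup>2 + v\<^sup>2) = 4 * u\<^sup>2 + 4 * v\<^sup>2 + 4 * (K * u\<^sup>2) + 4 * (K * v\<^sup>2)"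
        "K * (u\<^sup>2 + v\<^sup>2) = K * u\<^sup>2 + K * v\<^sup>2"
        by (simp_all add: H_def algebra_simps power2_eq_square)
      ultimately show ?thesis by linarith
    qed
    finally show ?thesis using uv by simp
  qed
  have "e t \<le> 0"
  proof (cases "ti \<le> t")
    case True
    have "e t * exp (- H * t) \<le> e ti * exp (- H * ti)"
    proof (rule DERIV_nonpos_imp_nonincreasing[OF True])
      fix s assume s: "ti \<le> s" "s \<le> t"
      then have sJ: "s \<in> J" by (auto simp: J_def)
      have "((\<lambda>s. e s * exp (- H * s)) has_real_derivative (e' s - H * e s) * exp (- H * s)) (at s)"
        by (rule derivative_eq_intros de[OF sJ] refl | simp add: algebra_simps)+
      moreover have "(e' s - H * e s) * exp (- H * s) \<le> 0"
        using e'_le[OF sJ] by (intro mult_nonpos_nonneg) auto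
      ultimately show "\<exists>y. ((\<lambda>s. e s * exp (- H * s)) has_real_derivative y) (at s) \<and> y \<le> 0" by blast
    qed
    moreover have "e ti = 0" using eq by (simp add: e_def)
    ultimately show ?thesis by (simp add: mult_le_0_iff)
  next
    case False
    then have tt: "t \<le> ti" by simp
    have "e t * exp (H * t) \<le> e ti * exp (H * ti)"
    proof (rule DERIV_nonneg_imp_nondecreasing[OF tt])
      fix s assume s: "t \<le> s" "s \<le> ti"
      then have sJ: "s \<in> J" by (auto simp: J_def)
      have "((\<lambda>s. e s * exp (H * s)) has_real_derivative (e' s + H * e s) * exp (H * s)) (at s)"
        by (rule derivative_eq_intros de[OF sJ] refl | simp add: algebra_simps)+
      moreover have "(e' s + H * e s) * exp (H * s) \<ge> 0"
        using e'_le[OF sJ] by (intro mult_nonneg_nonneg) auto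
      ultimately show "\<exists>y. ((\<lambda>s. e s * exp (H * s)) has_real_derivative y) (at s) \<and> y \<ge> 0" by blast
    qed
    moreover have "e ti = 0" using eq by (simp add: e_def)
    ultimately show ?thesis by (simp add: mult_le_0_iff)
  qed
  then have "(\<phi> t - \<phi>' t)\<^sup>2 = 0 \<and> (\<sigma> t - \<sigma>' t)\<^sup>2 = 0"
    unfolding e_def by (metis add_nonneg_eq_0_iff add_nonneg_nonneg order_antisym zero_le_power2)
  then show ?thesis by simp
qed

text \<open>This is the branch of the unstable manifold of the saddle in the positive quadrant.
  \<delta> is cut down until \<open>A\<close> and \<open>B\<close>, close to 1 and k, are positive,
  and \<open>T0\<close> is the time at which w = exp(2 \<kappa> t) reaches \<delta>.\<close>

lemma germ:
  "\<exists>\<delta> A T0 \<phi> \<sigma>. \<delta> > 0 \<and> fps_conv_radius A \<ge> ereal \<delta> \<and> eval_fps A 0 = 1 \<and>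
    exp (2 * \<kappa> * T0) = \<delta> \<and>
    (\<forall>t<T0. \<phi> t = exp (\<kappa> * t) * eval_fps A (exp (2 * \<kappa> * t))) \<and>
    sol {..<T0} \<phi> \<sigma> \<and> (\<forall>t<T0. \<phi> t > 0 \<and> \<sigma> t > 0) \<and>
    (\<phi> \<longlongrightarrow> 0) at_bot \<and> (\<sigma> \<longlongrightarrow> 0) at_bot"
proof (rule singular_solution)
  fix A B :: "real fps" and d :: real
  assume AB: "d > 0" "fps_conv_radius A \<ge> ereal d" "fps_conv_radius B \<ge> ereal d"
    "eval_fps A 0 = 1" "eval_fps B 0 = real k"
    "\<And>w. \<bar>w\<bar> < d \<Longrightarrow> 1 + L * w * (eval_fps A w)\<^sup>2 \<noteq> 0"
    "\<And>w. \<bar>w\<bar> < d \<Longrightarrow> \<exists>A'. (eval_fps A has_real_derivative A') (at w) \<and>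
        2 * \<kappa> * w * A' = eval_fps B w - real k * eval_fps A w"
    "\<And>w. \<bar>w\<bar> < d \<Longrightarrow> \<exists>B'. (eval_fps B has_real_derivative B') (at w) \<and>
        2 * \<kappa> * w * B' + \<kappa> * eval_fps B w = - (eval_fps B w + p * (eval_fps B w - L * eval_fps A w)
          / (1 + L * w * (eval_fps A w)\<^sup>2)) * (1 + w * (eval_fps B w)\<^sup>2)"
  have cA: "isCont (eval_fps A) 0" and cB: "isCont (eval_fps B) 0"
    using AB(7)[of 0] AB(8)[of 0] AB(1) by (auto intro: DERIV_isCont)
  have "(eval_fps A \<longlongrightarrow> eval_fps A 0) (nhds 0)" "(eval_fps B \<longlongrightarrow> eval_fps B 0) (nhds 0)"
    using cA cB unfolding isCont_def
    by (simp_all add: tendsto_at_iff_tendsto_nhds[of "eval_fps A"] tendsto_at_iff_tendsto_nhds[of "eval_fps B"])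
  then have "eventually (\<lambda>w. eval_fps A w > 0) (nhds 0)" "eventually (\<lambda>w. eval_fps B w > 0) (nhds 0)"
    using AB(4,5) k by (auto intro: order_tendstoD(1))
  then have "eventually (\<lambda>w. eval_fps A w > 0 \<and> eval_fps B w > 0) (nhds 0)" by (rule eventually_conj)
  then obtain d' where d': "d' > 0" "\<And>w. \<bar>w\<bar> < d' \<Longrightarrow> eval_fps A w > 0 \<and> eval_fps B w > 0"
    by (auto simp: eventually_nhds_metric dist_real_def)
  define \<delta> where "\<delta> = min d d'"
  have \<delta>: "\<delta> > 0" "\<delta> \<le> d" "\<delta> \<le> d'" using AB(1) d' by (auto simp: \<delta>_def)
  define T0 where "T0 = ln \<delta> / (2 * \<kappa>)"
  have T0: "exp (2 * \<kappa> * T0) = \<delta>" using \<delta> \<kappa>_ge by (simp add: T0_def)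
  define w where "w t = exp (2 * \<kappa> * t)" for t
  define \<phi> where "\<phi> t = exp (\<kappa> * t) * eval_fps A (w t)" for t
  define \<sigma> where "\<sigma> t = exp (\<kappa> * t) * eval_fps B (w t)" for t
  have wT: "w t < \<delta>" "\<bar>w t\<bar> < d" "\<bar>w t\<bar> < d'" if "t < T0" for t
  proof -
    have "2 * \<kappa> * t < 2 * \<kappa> * T0" using that \<kappa>_ge by simp
    then have "w t < exp (2 * \<kappa> * T0)" unfolding w_def by (rule exp_less_mono)
    then have 1: "w t < \<delta>" unfolding T0 .
    have 2: "w t > 0" by (simp add: w_def)
    show "w t < \<delta>" "\<bar>w t\<bar> < d" "\<bar>w t\<bar> < d'" using 1 2 \<delta> by auto
  qed
  have ww: "w t = (exp (\<kappa> * t))\<^sup>2" for t by (simp add: w_def power2_eq_square flip: exp_add)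
  have dw: "(w has_real_derivative 2 * \<kappa> * w t) (at t)" for t
    unfolding w_def by (rule derivative_eq_intros refl | simp)+
  have solu: "sol {..<T0} \<phi> \<sigma>"
    unfolding sol_def
  proof (intro ballI conjI)
    fix t assume "t \<in> {..<T0}"
    then have t: "t < T0" by simp
    define z where "z = exp (\<kappa> * t)"
    let ?a = "eval_fps A (w t)" and ?b = "eval_fps B (w t)"
    obtain A' where A': "(eval_fps A has_real_derivative A') (at (w t))"
        "2 * \<kappa> * w t * A' = ?b - real k * ?a" using AB(7)[OF wT(2)[OF t]] by blast
    obtain B' where B': "(eval_fps B has_real_derivative B') (at (w t))"
        "2 * \<kappa> * w t * B' + \<kappa> * ?b = - (?b + p * (?b - L * ?a) / (1 + L * w t * ?a\<^sup>2)) * (1 + w t * ?b\<^sup>2)"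
      using AB(8)[OF wT(2)[OF t]] by blast
    have de: "((\<lambda>t. exp (\<kappa> * t)) has_real_derivative \<kappa> * z) (at t)"
      unfolding z_def by (rule derivative_eq_intros refl | simp)+
    have "(\<phi> has_real_derivative \<kappa> * z * ?a + (A' * (2 * \<kappa> * w t)) * z) (at t)"
      unfolding \<phi>_def z_def by (rule DERIV_mult[OF de[unfolded z_def] DERIV_chain2[OF A'(1) dw]])
    also have "\<kappa> * z * ?a + (A' * (2 * \<kappa> * w t)) * z = z * (\<kappa> * ?a + 2 * \<kappa> * w t * A')" by (simp add: algebra_simps)
    also have "\<dots> = \<sigma> t - \<phi> t" unfolding A'(2) by (simp add: \<phi>_def \<sigma>_def z_def k_eq algebra_simps)
    finally show "(\<phi> has_real_derivative \<sigma> t - \<phi> t) (at t)" .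
    have "(\<sigma> has_real_derivative \<kappa> * z * ?b + (B' * (2 * \<kappa> * w t)) * z) (at t)"
      unfolding \<sigma>_def z_def by (rule DERIV_mult[OF de[unfolded z_def] DERIV_chain2[OF B'(1) dw]])
    also have "\<kappa> * z * ?b + (B' * (2 * \<kappa> * w t)) * z = z * (2 * \<kappa> * w t * B' + \<kappa> * ?b)" by (simp add: algebra_simps)
    also have "\<dots> = - ((z * ?b + p * (z * ?b - L * (z * ?a)) / (1 + L * (z * ?a)\<^sup>2)) * (1 + (z * ?b)\<^sup>2))"
    proof -
      have e1: "1 + L * (z * ?a)\<^sup>2 = 1 + L * w t * ?a\<^sup>2" "1 + (z * ?b)\<^sup>2 = 1 + w t * ?b\<^sup>2"
        by (simp_all add: ww z_def power_mult_distrib)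
      have "z * ?b - L * (z * ?a) = z * (?b - L * ?a)" by (simp add: algebra_simps)
      then show ?thesis unfolding B'(2) e1 by (simp add: algebra_simps)
    qed
    also have "\<dots> = slope_field (\<phi> t) (\<sigma> t)" by (simp add: slope_field_def \<phi>_def \<sigma>_def z_def)
    finally show "(\<sigma> has_real_derivative slope_field (\<phi> t) (\<sigma> t)) (at t)" .
  qed
  have posi: "\<phi> t > 0 \<and> \<sigma> t > 0" if "t < T0" for t
    using d'(2)[OF wT(3)[OF that]] by (simp add: \<phi>_def \<sigma>_def)
  have z0: "((\<lambda>t. exp (c * t)) \<longlongrightarrow> 0) at_bot" if "c > 0" for c :: real
    by (rule filterlim_compose[OF exp_at_bot]) (rule filterlim_tendsto_pos_mult_at_bot[OF tendsto_const that filterlim_ident])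
  have w0: "(w \<longlongrightarrow> 0) at_bot" unfolding w_def by (rule z0) (use \<kappa>_ge in simp)
  have "((\<lambda>t. exp (\<kappa> * t) * eval_fps A (w t)) \<longlongrightarrow> 0 * eval_fps A 0) at_bot"
    by (intro tendsto_mult z0 isCont_tendsto_compose[OF cA w0]) (use \<kappa>_ge in simp)
  then have lim1: "(\<phi> \<longlongrightarrow> 0) at_bot" by (simp add: \<phi>_def[abs_def])
  have "((\<lambda>t. exp (\<kappa> * t) * eval_fps B (w t)) \<longlongrightarrow> 0 * eval_fps B 0) at_bot"
    by (intro tendsto_mult z0 isCont_tendsto_compose[OF cB w0]) (use \<kappa>_ge in simp)
  then have lim2: "(\<sigma> \<longlongrightarrow> 0) at_bot" by (simp add: \<sigma>_def[abs_def])
  have rad: "fps_conv_radius A \<ge> ereal \<delta>" using AB(2) \<delta>(2) by (meson ereal_less_eq(3) order_trans)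
  show ?thesis
    by (rule exI[of _ \<delta>], rule exI[of _ A], rule exI[of _ T0], rule exI[of _ \<phi>], rule exI[of _ \<sigma>])
      (use \<delta>(1) T0 AB(4) solu posi lim1 lim2 rad in \<open>simp add: \<phi>_def w_def\<close>)
qed

text \<open>While \<sigma> \<ge> 0 the function exp(t) \<phi>(t) does not decrease, its derivative
  being exp(t) \<sigma>(t). At a first zero of \<sigma> the field equals p L \<phi> / (1 + L
  \<phi>^2) > 0. So neither sign can be lost first.\<close>

lemma sol_positive:
  assumes sol: "sol {..<T} \<phi> \<sigma>" and pos: "\<forall>t<T0. \<phi> t > 0 \<and> \<sigma> t > 0" and t: "t < T"
  shows "\<phi> t > 0" "\<sigma> t > 0"
proof -
  define s where "s = min t (T0 - 1)"
  have s: "s \<le> t" "\<phi> s > 0" "\<sigma> s > 0" using pos[rule_format, of s] by (auto simp: s_def)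
  have d: "(\<phi> has_real_derivative \<sigma> v - \<phi> v) (at v)" "(\<sigma> has_real_derivative slope_field (\<phi> v) (\<sigma> v)) (at v)"
    if "v \<le> t" for v using sol that t by (auto simp: sol_def)
  have phi: "\<phi> u > 0" if u: "s \<le> u" "u \<le> t" and nn: "\<And>v. s \<le> v \<Longrightarrow> v \<le> u \<Longrightarrow> \<sigma> v \<ge> 0" for u
  proof -
    have "exp s * \<phi> s \<le> exp u * \<phi> u"
    proof (rule DERIV_nonneg_imp_nondecreasing[OF u(1)])
      fix v assume v: "s \<le> v" "v \<le> u"
      have "((\<lambda>v. exp v * \<phi> v) has_real_derivative exp v * \<sigma> v) (at v)"
        by (rule derivative_eq_intros d refl | use v u in \<open>simp add: algebra_simps\<close>)+
      then show "\<exists>y. ((\<lambda>v. exp v * \<phi> v) has_real_derivative y) (at v) \<and> 0 \<le> y"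
        using nn[OF v] by (auto intro!: exI)
    qed
    moreover have "exp s * \<phi> s > 0" using s by simp
    ultimately have "exp u * \<phi> u > 0" by linarith
    then show ?thesis by (simp add: zero_less_mult_iff)
  qed
  have sigma: "\<sigma> u > 0" if u: "s \<le> u" "u \<le> t" for u
  proof (rule barrier[where g=\<sigma> and g'="\<lambda>v. slope_field (\<phi> v) (\<sigma> v)" and s=s])
    fix v assume v: "s < v" "v \<le> u" "\<sigma> v = 0" "\<And>w. s \<le> w \<Longrightarrow> w < v \<Longrightarrow> \<sigma> w > 0"
    have "\<sigma> w \<ge> 0" if "s \<le> w" "w \<le> v" for w using v(3) v(4)[of w] that by (cases "w = v") auto
    then have "\<phi> v > 0" using phi[of v] v u by auto
    moreover have "p > 0" "L > 0" using p_ge L_gt by auto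
    ultimately show "slope_field (\<phi> v) (\<sigma> v) > 0"
      unfolding slope_field_def v(3) using D_pos(1)[of "\<phi> v"] by simp
  qed (use s u d in auto)
  show "\<sigma> t > 0" using sigma[of t] s by simp
  show "\<phi> t > 0" by (rule phi) (use s sigma in \<open>auto intro: less_imp_le\<close>)
qed

text \<open>The logarithm of the conserved-energy-like quantity \<open>w(\<alpha>) / sqrt (1 + (d\<alpha>/ds)\<^sup>2)\<close> of the geodesic
  \<open>\<alpha> = \<alpha>(s)\<close>, in logarithmic polar coordinates, that the profile curve \<open>(r, \<rho>)\<close> is for the weight
  \<open>r^(n-p) (r\<^sup>2 + L \<rho>\<^sup>2)^(p/2) = e^(n s) w(\<alpha>)\<close>; the dilation factor makes it increase.\<close>

definition lyapunov :: "real \<Rightarrow> real \<Rightarrow> real" where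
  "lyapunov x y = real q * ln (1 + L * x\<^sup>2) - (real q + 1) * ln (1 + x\<^sup>2) + ln (1 + x * y) - ln (1 + y\<^sup>2) / 2"

lemma lyapunov_deriv:
  assumes \<phi>: "(\<phi> has_real_derivative \<sigma> t - \<phi> t) (at t)"
    and \<sigma>: "(\<sigma> has_real_derivative slope_field (\<phi> t) (\<sigma> t)) (at t)"
    and pos: "\<phi> t > 0" "\<sigma> t > 0"
  shows "((\<lambda>t. lyapunov (\<phi> t) (\<sigma> t)) has_real_derivative
    (n + 1) * (\<sigma> t - \<phi> t)\<^sup>2 / ((1 + (\<phi> t)\<^sup>2) * (1 + \<phi> t * \<sigma> t))) (at t)"
proof -
  define x y s where "x = \<phi> t" and "y = \<sigma> t" and "s = slope_field x y"
  define D W Q S where "D = 1 + L * x\<^sup>2" and "W = 1 + x * y" and "Q = 1 + x\<^sup>2" and "S = 1 + y\<^sup>2"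
  have xy: "x > 0" "y > 0" using pos by (auto simp: x_def y_def)
  have nz: "D > 0" "W > 0" "Q > 0" "S > 0" using D_pos(1)[of x] xy
    by (auto simp: D_def W_def Q_def S_def intro: add_pos_nonneg add_pos_pos)
  have "((\<lambda>t. lyapunov (\<phi> t) (\<sigma> t)) has_real_derivative
      (real q * (2 * L * x * (y - x) / D) - (real q + 1) * (2 * x * (y - x) / Q) + ((y - x) * y + x * s) / W - y * s / S)) (at t)"
  proof -
    have "((\<lambda>t. 1 + L * (\<phi> t)\<^sup>2) has_real_derivative 2 * L * x * (y - x)) (at t)"
      "((\<lambda>t. 1 + (\<phi> t)\<^sup>2) has_real_derivative 2 * x * (y - x)) (at t)"
      "((\<lambda>t. 1 + \<phi> t * \<sigma> t) has_real_derivative (y - x) * y + x * s) (at t)"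
      "((\<lambda>t. 1 + (\<sigma> t)\<^sup>2) has_real_derivative 2 * y * s) (at t)"
      by (auto intro!: derivative_eq_intros \<phi> \<sigma> simp: x_def y_def s_def)
    note ds = this
    have l: "((\<lambda>t. ln (g t)) has_real_derivative g' / g t) (at t)"
      if "(g has_real_derivative g') (at t)" "g t > 0" for g g'
      using DERIV_chain2[OF DERIV_ln[OF that(2)] that(1)] by (simp add: divide_inverse mult.commute)
    have "((\<lambda>t. lyapunov (\<phi> t) (\<sigma> t)) has_real_derivative
      (real q * (2 * L * x * (y - x) / (1 + L * (\<phi> t)\<^sup>2)) - (real q + 1) * (2 * x * (y - x) / (1 + (\<phi> t)\<^sup>2))
        + ((y - x) * y + x * s) / (1 + \<phi> t * \<sigma> t) - (2 * y * s / (1 + (\<sigma> t)\<^sup>2)) / 2)) (at t)"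
      unfolding lyapunov_def
      by (intro DERIV_add DERIV_diff DERIV_cmult DERIV_cdivide l ds)
        (use nz in \<open>simp_all add: D_def W_def Q_def S_def x_def y_def\<close>)
    then have "((\<lambda>t. lyapunov (\<phi> t) (\<sigma> t)) has_real_derivative
      (real q * (2 * L * x * (y - x) / D) - (real q + 1) * (2 * x * (y - x) / Q)
        + ((y - x) * y + x * s) / W - (2 * y * s / S) / 2)) (at t)"
      by (simp only: D_def W_def Q_def S_def x_def y_def)
    moreover have "(2 * y * s / S) / 2 = y * s / S" by simp
    ultimately show ?thesis by simp
  qed
  also have "real q * (2 * L * x * (y - x) / D) - (real q + 1) * (2 * x * (y - x) / Q) + ((y - x) * y + x * s) / W - y * s / S
      = (n + 1) * (y - x)\<^sup>2 / (Q * W)"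
  proof -
    \<comment> \<open>\<open>B\<close> is the field without its factor -(1 + y^2). The two terms
      with \<open>s\<close> collapse to B (y - x)/W, and clearing denominators with \<open>D\<close>
      and \<open>W\<close> then leaves y - x as a common factor everywhere.\<close>
    define B where "B = y + p * (y - L * x) / D"
    have s: "s = - (B * S)" by (simp add: s_def slope_field_def B_def D_def S_def)
    have "x * s / W - y * s / S = B * (y * W - x * S) / W"
      unfolding s using nz by (simp add: field_simps)
    also have "y * W - x * S = y - x" by (simp add: W_def S_def power2_eq_square algebra_simps)
    finally have 1: "x * s / W - y * s / S = B * (y - x) / W" .
    have BW: "p * L * x * W + (y + B) * D = (p + 2) * y * D"
    proof -
      have "B * D = y * D + p * (y - L * x)" using nz by (simp add: B_def field_simps)
      then show ?thesis by (simp add: distrib_right D_def W_def algebra_simps power2_eq_square)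
    qed
    have "p * L * x / D + (y + B) / W = (p * L * x * W + (y + B) * D) / (D * W)"
      using nz by (simp add: field_simps)
    also have "\<dots> = (p + 2) * y / W" unfolding BW using nz by simp
    finally have 2: "p * L * x / D + (y + B) / W = (p + 2) * y / W" .
    have "(p + 2) * y / W - (p + 2) * x / Q = (p + 2) * (y * Q - x * W) / (Q * W)"
      using nz by (simp add: field_simps)
    also have "y * Q - x * W = y - x" by (simp add: W_def Q_def power2_eq_square algebra_simps)
    finally have 3: "(p + 2) * y / W - (p + 2) * x / Q = (p + 2) * (y - x) / (Q * W)" .
    have "real q * (2 * L * x * (y - x) / D) - (real q + 1) * (2 * x * (y - x) / Q) + ((y - x) * y + x * s) / W - y * s / S
      = (p * L * x * (y - x) / D) - (p + 2) * x * (y - x) / Q + (y - x) * y / W + (x * s / W - y * s / S)"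
      by (simp add: p_def add_divide_distrib diff_divide_distrib algebra_simps)
    also have "\<dots> = (y - x) * ((p * L * x / D + (y + B) / W) - (p + 2) * x / Q)"
      unfolding 1 by (simp add: add_divide_distrib diff_divide_distrib algebra_simps)
    also have "\<dots> = (n + 1) * (y - x)\<^sup>2 / (Q * W)"
      unfolding 2 3 by (simp add: n_def power2_eq_square algebra_simps)
    finally show ?thesis .
  qed
  finally show ?thesis by (simp add: x_def y_def Q_def W_def)
qed

text \<open>The Cauchy-Schwarz inequality (1 + x y)^2 \<le> (1 + x^2)(1 + y^2) removes
  \<open>y\<close>, and 1 + L x^2 \<le> L (1 + x^2) handles the weight. What remains is that twice
  the Lyapunov function is at most p ln L - ln (1 + x^2).\<close>

lemma lyapunov_nonneg_bound:
  assumes "x > 0" "y > 0" "lyapunov x y \<ge> 0"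
  shows "x \<le> exp (p * ln L)"
proof -
  have xy: "1 + x * y > 0" "1 + x\<^sup>2 > 0" "1 + y\<^sup>2 > 0" using assms by (auto intro: add_pos_nonneg add_pos_pos)
  have "(1 + x * y)\<^sup>2 \<le> (1 + x\<^sup>2) * (1 + y\<^sup>2)"
    using sum_squares_bound[of x y] by (simp add: power2_eq_square algebra_simps)
  then have "ln ((1 + x * y)\<^sup>2) \<le> ln ((1 + x\<^sup>2) * (1 + y\<^sup>2))" using xy by (subst ln_le_cancel_iff) auto
  then have 1: "2 * ln (1 + x * y) \<le> ln (1 + x\<^sup>2) + ln (1 + y\<^sup>2)"
    using xy by (simp add: ln_mult ln_realpow)
  have "1 + L * x\<^sup>2 \<le> L * (1 + x\<^sup>2)" using L_gt by (simp add: algebra_simps)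
  then have "ln (1 + L * x\<^sup>2) \<le> ln (L * (1 + x\<^sup>2))" using D_pos(1)[of x] L_gt xy by (subst ln_le_cancel_iff) auto
  also have "\<dots> = ln L + ln (1 + x\<^sup>2)" using L_gt xy by (simp add: ln_mult)
  finally have 2: "p * ln (1 + L * x\<^sup>2) \<le> p * (ln L + ln (1 + x\<^sup>2))" using p_ge by (intro mult_left_mono) auto
  have "0 \<le> 2 * lyapunov x y" using assms by simp
  also have "\<dots> = p * ln (1 + L * x\<^sup>2) - (p + 2) * ln (1 + x\<^sup>2) + 2 * ln (1 + x * y) - ln (1 + y\<^sup>2)"
    by (simp add: lyapunov_def p_def algebra_simps)
  also have "\<dots> \<le> p * (ln L + ln (1 + x\<^sup>2)) - (p + 2) * ln (1 + x\<^sup>2) + ln (1 + x\<^sup>2)" using 1 2 by linarith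
  also have "\<dots> = p * ln L - ln (1 + x\<^sup>2)" by (simp add: algebra_simps)
  finally have "ln (1 + x\<^sup>2) \<le> p * ln L" by simp
  then have le: "1 + x\<^sup>2 \<le> exp (p * ln L)" using xy by (metis exp_le_cancel_iff exp_ln)
  have "x \<le> 1 + x\<^sup>2"
  proof (cases "x \<le> 1")
    case True then show ?thesis by (smt (verit) zero_le_power2)
  next
    case False
    then have "x * 1 \<le> x * x" by (intro mult_left_mono) auto
    then show ?thesis by (simp add: power2_eq_square)
  qed
  then show ?thesis using le by linarith
qed

text \<open>The Lyapunov function tends to 0 in the distant past and never decreases, so it is
  nonnegative and bounds \<phi>. Where \<sigma> exceeds L \<phi> the field is negative, so \<sigma>
  cannot cross a level above its starting value and above L times the bound for \<phi>.\<close>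

lemma sol_bounded:
  assumes sol: "sol {..<T} \<phi> \<sigma>" and pos: "\<forall>t<T0. \<phi> t > 0 \<and> \<sigma> t > 0"
    and lim: "(\<phi> \<longlongrightarrow> 0) at_bot" "(\<sigma> \<longlongrightarrow> 0) at_bot"
    and s: "s < T0" "s \<le> t" and t: "t < T"
  shows "\<phi> t \<le> exp (p * ln L)" "\<sigma> t < max (\<sigma> s) (L * exp (p * ln L)) + 1"
proof -
  have d: "(\<phi> has_real_derivative \<sigma> v - \<phi> v) (at v)" "(\<sigma> has_real_derivative slope_field (\<phi> v) (\<sigma> v)) (at v)"
    if "v < T" for v using sol that by (auto simp: sol_def)
  note sp = sol_positive[OF sol pos]
  have "lyapunov (\<phi> v) (\<sigma> v) \<le> lyapunov (\<phi> u) (\<sigma> u)" if "v \<le> u" "u < T" for u v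
  proof (rule DERIV_nonneg_imp_nondecreasing[OF that(1)])
    fix w assume w: "v \<le> w" "w \<le> u"
    then have wT: "w < T" using that by simp
    show "\<exists>y. ((\<lambda>t. lyapunov (\<phi> t) (\<sigma> t)) has_real_derivative y) (at w) \<and> 0 \<le> y"
      using lyapunov_deriv[OF d[OF wT] sp[OF wT]] sp[OF wT] p_ge
      by (intro exI conjI) (auto simp: n_def intro!: divide_nonneg_nonneg mult_nonneg_nonneg add_nonneg_nonneg)
  qed
  moreover have "((\<lambda>v. lyapunov (\<phi> v) (\<sigma> v)) \<longlongrightarrow>
      real q * ln (1 + L * 0\<^sup>2) - (real q + 1) * ln (1 + 0\<^sup>2) + ln (1 + 0 * 0) - ln (1 + 0\<^sup>2) / 2) at_bot"
    unfolding lyapunov_def by (intro tendsto_intros lim) auto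
  then have l0: "((\<lambda>v. lyapunov (\<phi> v) (\<sigma> v)) \<longlongrightarrow> 0) at_bot" by simp
  ultimately have nn: "0 \<le> lyapunov (\<phi> u) (\<sigma> u)" if "u < T" for u
    using that by (intro tendsto_upperbound[OF l0]) (auto simp: eventually_at_bot_linorder)
  have ph: "\<phi> u \<le> exp (p * ln L)" if "u < T" for u
    by (rule lyapunov_nonneg_bound[OF sp[OF that] nn[OF that]])
  show "\<phi> t \<le> exp (p * ln L)" by (rule ph[OF t])
  let ?m = "max (\<sigma> s) (L * exp (p * ln L)) + 1"
  have "?m - \<sigma> t > 0"
  proof (rule barrier[where g="\<lambda>v. ?m - \<sigma> v" and g'="\<lambda>v. - slope_field (\<phi> v) (\<sigma> v)" and s=s])
    show "((\<lambda>v. ?m - \<sigma> v) has_real_derivative - slope_field (\<phi> v) (\<sigma> v)) (at v)" if "s \<le> v" "v \<le> t" for v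
      by (rule derivative_eq_intros d refl | use that t in simp)+
    fix v assume v: "s < v" "v \<le> t" "?m - \<sigma> v = 0"
    then have vT: "v < T" using t by simp
    have "L * \<phi> v \<le> L * exp (p * ln L)" using ph[OF vT] L_gt by simp
    then have "\<sigma> v - L * \<phi> v > 0" using v(3) by linarith
    then have "p * (\<sigma> v - L * \<phi> v) / (1 + L * (\<phi> v)\<^sup>2) > 0" using p_ge D_pos(1) by simp
    moreover have "\<sigma> v > 0" "1 + (\<sigma> v)\<^sup>2 > 0" using sp(2)[OF vT] by (auto intro: add_pos_nonneg)
    ultimately show "- slope_field (\<phi> v) (\<sigma> v) > 0" unfolding slope_field_def by (simp add: add_pos_pos)
  qed (use s in auto)
  then show "\<sigma> t < ?m" by simp
qed

end

section \<open>Global existence and oscillation\<close>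

lemma mono_bounded_convergent:
  fixes f :: "real \<Rightarrow> real"
  assumes mono: "\<And>s t. T \<le> s \<Longrightarrow> s \<le> t \<Longrightarrow> f s \<le> f t" and bdd: "\<And>t. T \<le> t \<Longrightarrow> f t \<le> C"
  shows "\<exists>l. (f \<longlongrightarrow> l) at_top"
proof -
  define l where "l = Sup (f ` {T..})"
  have b: "bdd_above (f ` {T..})" using bdd by (auto simp: bdd_above_def)
  have "(f \<longlongrightarrow> l) at_top"
  proof (rule order_tendstoI)
    fix a assume "a < l"
    then obtain t where t: "T \<le> t" "a < f t"
      unfolding l_def using less_cSup_iff[OF _ b] by auto
    then show "eventually (\<lambda>t. a < f t) at_top"
      unfolding eventually_at_top_linorder by (meson mono less_le_trans)
  next
    fix a assume a: "l < a"
    have "f t \<le> l" if "T \<le> t" for t unfolding l_def by (rule cSup_upper[OF _ b]) (use that in auto)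
    then show "eventually (\<lambda>t. f t < a) at_top"
      unfolding eventually_at_top_linorder using a by (meson le_less_trans)
  qed
  then show ?thesis by blast
qed

text \<open>Were |g| at least e at a late time, the Lipschitz bound would keep it above e/2 on an
  interval of fixed length h, over which f would change by h e/2, contrary to its convergence. In
  \<open>h\<close>, the denominator uses |K| + 1 to stay positive.\<close>

lemma barbalat:
  fixes f g :: "real \<Rightarrow> real"
  assumes lim: "(f \<longlongrightarrow> l) at_top" and d: "\<And>t. T \<le> t \<Longrightarrow> (f has_real_derivative g t) (at t)"
    and lip: "\<And>s t. T \<le> s \<Longrightarrow> T \<le> t \<Longrightarrow> \<bar>g s - g t\<bar> \<le> K * \<bar>s - t\<bar>"
  shows "(g \<longlongrightarrow> 0) at_top"
proof (rule tendstoI)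
  fix e :: real assume e: "e > 0"
  define h where "h = e / (2 * (\<bar>K\<bar> + 1))"
  have h: "h > 0" "\<bar>K\<bar> * h < e / 2" using e by (auto simp: h_def field_simps add_pos_nonneg)
  have "eventually (\<lambda>t. \<bar>f t - l\<bar> < h * e / 4) at_top"
    using tendstoD[OF lim, of "h * e / 4"] h e by (simp add: dist_real_def)
  then obtain T1 where T1: "\<And>t. t \<ge> T1 \<Longrightarrow> \<bar>f t - l\<bar> < h * e / 4" by (auto simp: eventually_at_top_linorder)
  have "\<bar>g t\<bar> < e" if t: "t \<ge> max T T1" for t
  proof -
    obtain \<xi> where \<xi>: "t < \<xi>" "\<xi> < t + h" "f (t + h) - f t = (t + h - t) * g \<xi>"
      using MVT2[of t "t + h" f g] d t h by auto
    have "\<bar>f (t + h) - f t\<bar> < h * e / 2" using T1[of t] T1[of "t + h"] t h by linarith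
    then have "h * \<bar>g \<xi>\<bar> < h * (e / 2)" using \<xi>(3) h by (simp add: abs_mult)
    then have 1: "\<bar>g \<xi>\<bar> < e / 2" using h by simp
    have "\<bar>g t - g \<xi>\<bar> \<le> K * \<bar>t - \<xi>\<bar>" using lip[of t \<xi>] t \<xi> by simp
    also have "\<dots> \<le> \<bar>K\<bar> * h" using \<xi> by (intro mult_mono) auto
    finally show ?thesis using 1 h by linarith
  qed
  then show "eventually (\<lambda>t. dist (g t) 0 < e) at_top"
    by (auto simp: eventually_at_top_linorder intro!: exI[of _ "max T T1"])
qed

lemma derivative_bound_lipschitz:
  fixes f g :: "real \<Rightarrow> real"
  assumes d: "\<And>t. T \<le> t \<Longrightarrow> (f has_real_derivative g t) (at t)" and b: "\<And>t. T \<le> t \<Longrightarrow> \<bar>g t\<bar> \<le> K"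
    and "T \<le> s" "T \<le> t"
  shows "\<bar>f s - f t\<bar> \<le> K * \<bar>s - t\<bar>"
proof -
  have *: "\<bar>f v - f u\<bar> \<le> K * (v - u)" if uv: "T \<le> u" "u < v" for u v
  proof -
    obtain \<xi> where \<xi>: "u < \<xi>" "\<xi> < v" "f v - f u = (v - u) * g \<xi>"
      using MVT2[of u v f g] d uv by auto
    have "\<bar>f v - f u\<bar> = (v - u) * \<bar>g \<xi>\<bar>" using \<xi>(3) uv by (simp add: abs_mult)
    also have "\<dots> \<le> (v - u) * K" using b[of \<xi>] \<xi> uv by (intro mult_left_mono) auto
    finally show ?thesis by (simp add: mult.commute)
  qed
  consider "s < t" | "s = t" | "t < s" by linarith
  then show ?thesis
  proof cases
    case 1
    then show ?thesis using *[of s t] assms by (simp add: abs_minus_commute)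
  next
    case 3
    then show ?thesis using *[of t s] assms by simp
  qed simp
qed

section \<open>Continuation to all times and crossings of the equilibrium value\<close>

context profile_ode
begin

lemma local_sol:
  assumes "C \<ge> 1"
  obtains \<tau> where "\<tau> > 0"
    "\<forall>a b t0. \<bar>a\<bar> \<le> C \<longrightarrow> \<bar>b\<bar> \<le> C \<longrightarrow> (\<exists>A B. fps_conv_radius A \<ge> ereal \<tau> \<and>
       eval_fps A 0 = a \<and> eval_fps B 0 = b \<and>
       sol {t0 - \<tau><..<t0 + \<tau>} (\<lambda>t. eval_fps A (t - t0)) (\<lambda>t. eval_fps B (t - t0)))"
proof -
  obtain \<tau> where \<tau>: "\<tau> > 0" "\<forall>a b. \<bar>a\<bar> \<le> C \<longrightarrow> \<bar>b\<bar> \<le> C \<longrightarrow> (\<exists>A B. fps_conv_radius A \<ge> ereal \<tau> \<and>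
      eval_fps A 0 = a \<and> eval_fps B 0 = b \<and>
      (\<forall>s. \<bar>s\<bar> < \<tau> \<longrightarrow> (eval_fps A has_real_derivative eval_fps B s - eval_fps A s) (at s) \<and>
        (eval_fps B has_real_derivative slope_field (eval_fps A s) (eval_fps B s)) (at s)))"
    using local_solution[OF assms] by blast
  have "\<exists>A B. fps_conv_radius A \<ge> ereal \<tau> \<and> eval_fps A 0 = a \<and> eval_fps B 0 = b \<and>
       sol {t0 - \<tau><..<t0 + \<tau>} (\<lambda>t. eval_fps A (t - t0)) (\<lambda>t. eval_fps B (t - t0))"
    if ab: "\<bar>a\<bar> \<le> C" "\<bar>b\<bar> \<le> C" for a b t0
  proof -
    obtain A B where AB: "fps_conv_radius A \<ge> ereal \<tau>" "eval_fps A 0 = a" "eval_fps B 0 = b"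
      "\<forall>s. \<bar>s\<bar> < \<tau> \<longrightarrow> (eval_fps A has_real_derivative eval_fps B s - eval_fps A s) (at s) \<and>
        (eval_fps B has_real_derivative slope_field (eval_fps A s) (eval_fps B s)) (at s)"
      using \<tau>(2) ab by blast
    have "sol {-\<tau><..<\<tau>} (eval_fps A) (eval_fps B)" using AB(4) by (auto simp: sol_def abs_less_iff)
    then have "sol {t0 - \<tau><..<t0 + \<tau>} (\<lambda>t. eval_fps A (t + (- t0))) (\<lambda>t. eval_fps B (t + (- t0)))"
      by (rule sol_shift) auto
    then show ?thesis using AB by auto
  qed
  then show ?thesis using that \<tau>(1) by blast
qed

text \<open>The power series solution with the same data at \<open>t0\<close> coincides with the
  given one by uniqueness.\<close>

lemma sol_analytic:
  assumes "sol UNIV \<phi> \<sigma>"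
  shows "\<exists>A. (\<lambda>s. \<phi> (t0 + s)) has_fps_expansion A"
proof -
  define C where "C = max 1 (max \<bar>\<phi> t0\<bar> \<bar>\<sigma> t0\<bar>)"
  have C: "C \<ge> 1" "\<bar>\<phi> t0\<bar> \<le> C" "\<bar>\<sigma> t0\<bar> \<le> C" by (auto simp: C_def)
  obtain \<tau> where \<tau>: "\<tau> > 0" "\<forall>a b t0. \<bar>a\<bar> \<le> C \<longrightarrow> \<bar>b\<bar> \<le> C \<longrightarrow> (\<exists>A B. fps_conv_radius A \<ge> ereal \<tau> \<and>
       eval_fps A 0 = a \<and> eval_fps B 0 = b \<and>
       sol {t0 - \<tau><..<t0 + \<tau>} (\<lambda>t. eval_fps A (t - t0)) (\<lambda>t. eval_fps B (t - t0)))"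
    using local_sol[OF C(1)] .
  obtain A B where AB: "fps_conv_radius A \<ge> ereal \<tau>" "eval_fps A 0 = \<phi> t0" "eval_fps B 0 = \<sigma> t0"
    "sol {t0 - \<tau><..<t0 + \<tau>} (\<lambda>t. eval_fps A (t - t0)) (\<lambda>t. eval_fps B (t - t0))"
    using \<tau>(2) C by blast
  have "eval_fps A s = \<phi> (t0 + s)" if "\<bar>s\<bar> < \<tau>" for s
    using sol_unique[OF AB(4) sol_subset[OF assms], of t0 "t0 + s"] that \<tau>(1) AB(2,3)
    by (auto simp: abs_less_iff)
  then have "eventually (\<lambda>s. eval_fps A s = \<phi> (t0 + s)) (nhds 0)"
    using \<tau>(1) by (auto simp: eventually_nhds_metric dist_real_def)
  moreover have "fps_conv_radius A > 0"
    by (rule less_le_trans[OF _ AB(1)]) (use \<tau>(1) in auto)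
  ultimately show ?thesis by (auto simp: has_fps_expansion_def)
qed

text \<open>The bound \<open>C\<close> holds on every extension of the germ, so each extension can
  be prolonged by the same amount. Uniqueness makes the extensions agree, and they are glued by
  evaluating at each time an extension that reaches it.\<close>

lemma global_solution:
  "\<exists>\<delta> A T0 \<phi> \<sigma> C. \<delta> > 0 \<and> fps_conv_radius A \<ge> ereal \<delta> \<and> eval_fps A 0 = 1 \<and>
    exp (2 * \<kappa> * T0) = \<delta> \<and>
    (\<forall>t<T0. \<phi> t = exp (\<kappa> * t) * eval_fps A (exp (2 * \<kappa> * t))) \<and>
    sol UNIV \<phi> \<sigma> \<and> (\<forall>t. \<phi> t > 0 \<and> \<sigma> t > 0) \<and> (\<forall>t\<ge>T0. \<phi> t \<le> C \<and> \<sigma> t \<le> C)"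
proof -
  obtain \<delta> A T0 \<phi>0 \<sigma>0 where g: "\<delta> > 0" "fps_conv_radius A \<ge> ereal \<delta>" "eval_fps A 0 = 1"
    "exp (2 * \<kappa> * T0) = \<delta>" "\<forall>t<T0. \<phi>0 t = exp (\<kappa> * t) * eval_fps A (exp (2 * \<kappa> * t))"
    "sol {..<T0} \<phi>0 \<sigma>0" "\<forall>t<T0. \<phi>0 t > 0 \<and> \<sigma>0 t > 0"
    "(\<phi>0 \<longlongrightarrow> 0) at_bot" "(\<sigma>0 \<longlongrightarrow> 0) at_bot"
    using germ by blast
  define s where "s = T0 - 1"
  define C where "C = max 1 (max (exp (p * ln L)) (max (\<sigma>0 s) (L * exp (p * ln L)) + 1))"
  have C: "C \<ge> 1" by (simp add: C_def)
  obtain \<tau>0 where \<tau>0: "\<tau>0 > 0" "\<forall>a b t0. \<bar>a\<bar> \<le> C \<longrightarrow> \<bar>b\<bar> \<le> C \<longrightarrow> (\<exists>A B. fps_conv_radius A \<ge> ereal \<tau>0 \<and>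
       eval_fps A 0 = a \<and> eval_fps B 0 = b \<and>
       sol {t0 - \<tau>0<..<t0 + \<tau>0} (\<lambda>t. eval_fps A (t - t0)) (\<lambda>t. eval_fps B (t - t0)))"
    using local_sol[OF C] .
  define \<tau> where "\<tau> = min \<tau>0 1"
  have \<tau>: "\<tau> > 0" "\<tau> \<le> 1" "\<tau> \<le> \<tau>0" using \<tau>0(1) by (auto simp: \<tau>_def)
  define ext where "ext T \<phi> \<sigma> \<longleftrightarrow> sol {..<T} \<phi> \<sigma> \<and> (\<forall>t<T0. \<phi> t = \<phi>0 t \<and> \<sigma> t = \<sigma>0 t)" for T \<phi> \<sigma>
  have ext_bounds: "0 < \<phi> t \<and> 0 < \<sigma> t \<and> (s \<le> t \<longrightarrow> \<phi> t \<le> C \<and> \<sigma> t \<le> C)"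
    if e: "ext T \<phi> \<sigma>" and t: "t < T" for T \<phi> \<sigma> t
  proof -
    have sl: "sol {..<T} \<phi> \<sigma>" and pos: "\<forall>t<T0. \<phi> t > 0 \<and> \<sigma> t > 0"
      using e g(7) by (auto simp: ext_def)
    have ev: "eventually (\<lambda>t. \<phi>0 t = \<phi> t) at_bot" "eventually (\<lambda>t. \<sigma>0 t = \<sigma> t) at_bot"
      using e by (auto simp: ext_def eventually_at_bot_dense intro!: exI[of _ T0])
    have lim: "(\<phi> \<longlongrightarrow> 0) at_bot" "(\<sigma> \<longlongrightarrow> 0) at_bot"
      using g(8,9) tendsto_cong[OF ev(1)] tendsto_cong[OF ev(2)] by auto
    have s0: "s < T0" "\<sigma> s = \<sigma>0 s" using e by (auto simp: ext_def s_def)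
    show ?thesis
      using sol_positive[OF sl pos t] sol_bounded[OF sl pos lim s0(1) _ t] s0(2) by (fastforce simp: C_def)
  qed
  have step: "\<exists>\<phi>' \<sigma>'. ext (T + \<tau> / 2) \<phi>' \<sigma>'" if e: "ext T \<phi> \<sigma>" and T: "T0 \<le> T" for T \<phi> \<sigma>
  proof -
    \<comment> \<open>The restart lies strictly before \<open>T\<close> because the solution is
      known only on an open half line; the local solution still reaches beyond
      \<open>T + \<tau> / 2\<close>. The condition \<tau> \<le> 1 keeps \<open>c\<close> above
      \<open>s\<close>, where the bounds hold.\<close>
    define c where "c = T - \<tau> / 4"
    have c: "c < T" "s \<le> c" using \<tau> T by (auto simp: c_def s_def)
    have "\<bar>\<phi> c\<bar> \<le> C" "\<bar>\<sigma> c\<bar> \<le> C" using ext_bounds[OF e c(1)] c(2) by auto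
    then obtain A B where AB: "eval_fps A 0 = \<phi> c" "eval_fps B 0 = \<sigma> c"
      "sol {c - \<tau>0<..<c + \<tau>0} (\<lambda>t. eval_fps A (t - c)) (\<lambda>t. eval_fps B (t - c))"
      using \<tau>0(2) by blast
    define a b where "a t = eval_fps A (t - c)" and "b t = eval_fps B (t - c)" for t
    have ab: "sol {c - \<tau><..<c + \<tau>} a b"
      unfolding a_def b_def by (rule sol_subset[OF AB(3)]) (use \<tau> in auto)
    have sl: "sol {..<T} \<phi> \<sigma>" using e by (simp add: ext_def)
    have eq: "\<phi> t = a t \<and> \<sigma> t = b t" if "c - \<tau> < t" "t < T" for t
    proof (rule sol_unique[where a="c - \<tau>" and b=T and \<phi>=\<phi> and \<sigma>=\<sigma> and \<phi>'=a and \<sigma>'=b and t=t and ti=c])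
      show "sol {c - \<tau><..<T} \<phi> \<sigma>" by (rule sol_subset[OF sl]) auto
      show "sol {c - \<tau><..<T} a b" by (rule sol_subset[OF ab]) (use \<tau> in \<open>auto simp: c_def\<close>)
    qed (use that c \<tau> AB(1,2) in \<open>auto simp: a_def b_def\<close>)
    define \<phi>' \<sigma>' where "\<phi>' t = (if t < T then \<phi> t else a t)" and "\<sigma>' t = (if t < T then \<sigma> t else b t)" for t
    have 1: "sol {..<T} \<phi>' \<sigma>'" by (rule sol_cong[OF sl]) (auto simp: \<phi>'_def \<sigma>'_def)
    have 2: "sol {c - \<tau><..<c + \<tau>} \<phi>' \<sigma>'" by (rule sol_cong[OF ab]) (use eq in \<open>auto simp: \<phi>'_def \<sigma>'_def\<close>)
    have "{..<T + \<tau> / 2} \<subseteq> {..<T} \<union> {c - \<tau><..<c + \<tau>}" using \<tau> by (auto simp: c_def)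
    then have "sol {..<T + \<tau> / 2} \<phi>' \<sigma>'" using 1 2 unfolding sol_def by blast
    then have "ext (T + \<tau> / 2) \<phi>' \<sigma>'" using e T by (auto simp: ext_def \<phi>'_def \<sigma>'_def)
    then show ?thesis by blast
  qed
  define TT where "TT i = T0 + real i * (\<tau> / 2)" for i :: nat
  have "\<exists>\<phi> \<sigma>. ext (TT i) \<phi> \<sigma>" for i
  proof (induction i)
    case 0
    have "ext T0 \<phi>0 \<sigma>0" using g(6) by (simp add: ext_def)
    then show ?case by (auto simp: TT_def)
  next
    case (Suc i)
    then obtain \<phi> \<sigma> where "ext (TT i) \<phi> \<sigma>" by blast
    moreover have "T0 \<le> TT i" using \<tau> by (simp add: TT_def)
    moreover have "TT (Suc i) = TT i + \<tau> / 2" by (simp add: TT_def algebra_simps)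
    ultimately show ?case using step by metis
  qed
  then obtain \<Phi> \<Sigma> where ex: "\<And>i. ext (TT i) (\<Phi> i) (\<Sigma> i)" by metis
  have cons: "\<Phi> i t = \<Phi> j t \<and> \<Sigma> i t = \<Sigma> j t" if t: "t < TT i" "t < TT j" for i j t
  proof -
    define u where "u = min t T0 - 1"
    have u: "u < T0" "u < t" by (auto simp: u_def)
    show ?thesis
    proof (rule sol_unique[where a="u - 1" and b="min (TT i) (TT j)" and \<phi>="\<Phi> i" and \<sigma>="\<Sigma> i"
          and \<phi>'="\<Phi> j" and \<sigma>'="\<Sigma> j" and t=t and ti=u])
      show "sol {u - 1<..<min (TT i) (TT j)} (\<Phi> i) (\<Sigma> i)" "sol {u - 1<..<min (TT i) (TT j)} (\<Phi> j) (\<Sigma> j)"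
        using ex[of i] ex[of j] unfolding ext_def by (auto elim!: sol_subset)
    qed (use ex[of i] ex[of j] u t in \<open>auto simp: ext_def\<close>)
  qed
  have "\<exists>i. t < TT i" for t
  proof -
    obtain i :: nat where "(t - T0) / (\<tau> / 2) < real i" using reals_Archimedean2 by blast
    then have "t - T0 < real i * (\<tau> / 2)" using \<tau> by (simp add: pos_divide_less_eq)
    then have "t < TT i" by (simp add: TT_def)
    then show ?thesis by blast
  qed
  then obtain N where N: "\<And>t. t < TT (N t)" by metis
  define \<phi> \<sigma> where "\<phi> t = \<Phi> (N t) t" and "\<sigma> t = \<Sigma> (N t) t" for t
  have "sol {..<TT (N t)} \<phi> \<sigma>" for t
  proof (rule sol_cong[of _ "\<Phi> (N t)" "\<Sigma> (N t)"])
    show "sol {..<TT (N t)} (\<Phi> (N t)) (\<Sigma> (N t))" using ex[of "N t"] unfolding ext_def by blast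
    fix v assume "v \<in> {..<TT (N t)}"
    then have "\<Phi> (N v) v = \<Phi> (N t) v \<and> \<Sigma> (N v) v = \<Sigma> (N t) v" by (intro cons N) auto
    then show "\<phi> v = \<Phi> (N t) v" "\<sigma> v = \<Sigma> (N t) v" unfolding \<phi>_def \<sigma>_def by blast+
  qed simp
  then have sl: "sol UNIV \<phi> \<sigma>" using N unfolding sol_def by blast
  have bounds: "0 < \<phi> t \<and> 0 < \<sigma> t \<and> (s \<le> t \<longrightarrow> \<phi> t \<le> C \<and> \<sigma> t \<le> C)" for t
    unfolding \<phi>_def \<sigma>_def by (rule ext_bounds[OF ex N])
  have init: "\<forall>t<T0. \<phi> t = exp (\<kappa> * t) * eval_fps A (exp (2 * \<kappa> * t))"
  proof (intro allI impI)
    fix t assume t: "t < T0"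
    have "\<Phi> (N t) t = \<phi>0 t" using ex[of "N t"] t unfolding ext_def by blast
    then show "\<phi> t = exp (\<kappa> * t) * eval_fps A (exp (2 * \<kappa> * t))" using g(5) t by (simp add: \<phi>_def)
  qed
  show ?thesis
    by (rule exI[of _ \<delta>], rule exI[of _ A], rule exI[of _ T0], rule exI[of _ \<phi>], rule exI[of _ \<sigma>], rule exI[of _ C])
      (use g(1-4) init sl bounds in \<open>simp add: s_def\<close>)
qed

text \<open>As long as \<open>\<phi> \<noteq> x0\<close>, the quotient \<open>u = (\<sigma> - \<phi>)/(\<phi> - x0)\<close> solves a Riccati equation
  \<open>u' = - (u\<^sup>2 + a u + b)\<close>. At the equilibrium its discriminant is negative, so \<open>arctan u\<close> would
  eventually decrease at a linear rate.\<close>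

lemma oscillation:
  assumes sl: "sol UNIV \<phi> \<sigma>" and pos: "\<And>t. \<phi> t > 0" "\<And>t. \<sigma> t > 0"
    and bdd: "\<And>t. t \<ge> T0 \<Longrightarrow> \<phi> t \<le> C" "\<And>t. t \<ge> T0 \<Longrightarrow> \<sigma> t \<le> C"
    and x0: "x0 > 0" "1 + L * x0\<^sup>2 = p * (L - 1)"
    and disc: "(1 + (1 + x0\<^sup>2) * (1 + p / (1 + L * x0\<^sup>2)))\<^sup>2 < 4 * ((1 + x0\<^sup>2) * (L * x0 * (x0 + x0)) / (1 + L * x0\<^sup>2))"
  shows "infinite {t. \<phi> t = x0}"
proof
  assume "finite {t. \<phi> t = x0}"
  then have "bdd_above {t. \<phi> t = x0}" by (rule bdd_above_finite)
  then obtain M where M: "\<And>t. \<phi> t = x0 \<Longrightarrow> t \<le> M" by (auto simp: bdd_above_def)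
  define T' where "T' = M + 1"
  have T': "\<phi> t \<noteq> x0" if "t \<ge> T'" for t using M[of t] that by (auto simp: T'_def)
  define T where "T = max T' T0"
  have T: "\<phi> t \<noteq> x0" "\<phi> t \<le> C" "\<sigma> t \<le> C" if "t \<ge> T" for t using T' bdd that by (auto simp: T_def)
  have d: "(\<phi> has_real_derivative \<sigma> t - \<phi> t) (at t)" "(\<sigma> has_real_derivative slope_field (\<phi> t) (\<sigma> t)) (at t)" for t
    using sl by (auto simp: sol_def)
  have cont: "continuous_on S \<phi>" for S by (intro continuous_at_imp_continuous_on ballI DERIV_isCont[OF d(1)])
  \<comment> \<open>For z = \<phi> - x0 the system is a damped oscillator z'' + a z' + b z = 0 whose
    coefficients depend on the point; \<open>sf\<close> is this decomposition. The assumption on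
    \<open>x0\<close> says that the field vanishes at (x0, x0).\<close>
  define a where "a x y = 1 + (1 + y\<^sup>2) * (1 + p / (1 + L * x\<^sup>2))" for x y
  define b where "b x y = (1 + y\<^sup>2) * (L * x * (x + x0)) / (1 + L * x\<^sup>2)" for x y
  have sf: "slope_field x y = (y - x) - a x y * (y - x) - b x y * (x - x0)" for x y
  proof -
    define D where "D = 1 + L * x\<^sup>2"
    have D: "D \<noteq> 0" using D_pos by (simp add: D_def)
    have "x * D - p * (L - 1) * x = L * x * (x + x0) * (x - x0)"
      unfolding x0(2)[symmetric] D_def by (simp add: algebra_simps power2_eq_square)
    then have e: "x - p * (L - 1) * x / D = L * x * (x + x0) * (x - x0) / D" using D by (simp add: field_simps)
    have "y + p * (y - L * x) / D = (1 + p / D) * (y - x) + (x - p * (L - 1) * x / D)"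
      using D by (simp add: field_simps)
    then have "slope_field x y = - (((1 + p / D) * (y - x) + L * x * (x + x0) * (x - x0) / D) * (1 + y\<^sup>2))"
      unfolding slope_field_def D_def[symmetric] e by simp
    also have "\<dots> = (y - x) - a x y * (y - x) - b x y * (x - x0)"
      unfolding a_def b_def D_def[symmetric] using D by (simp add: field_simps)
    finally show ?thesis .
  qed
  have b_pos: "b (\<phi> t) (\<sigma> t) > 0" for t
    using pos[of t] x0(1) L_gt D_pos(1)[of "\<phi> t"] by (auto simp: b_def intro!: divide_pos_pos mult_pos_pos add_pos_pos add_pos_nonneg)
  define u where "u t = (\<sigma> t - \<phi> t) / (\<phi> t - x0)" for t
  have du: "(u has_real_derivative - ((u t)\<^sup>2 + a (\<phi> t) (\<sigma> t) * u t + b (\<phi> t) (\<sigma> t))) (at t)" if t: "t \<ge> T" for t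
  proof -
    define z w where "z = \<phi> t - x0" and "w = \<sigma> t - \<phi> t"
    have nz: "z \<noteq> 0" using T(1)[OF t] by (simp add: z_def)
    have ds: "(u has_real_derivative ((slope_field (\<phi> t) (\<sigma> t) - w) * z - w * w) / (z * z)) (at t)"
      unfolding u_def[abs_def] z_def w_def
      by (rule DERIV_divide) (use T(1)[OF t] in \<open>auto intro!: derivative_eq_intros d\<close>)
    have "((slope_field (\<phi> t) (\<sigma> t) - w) * z - w * w) / (z * z) = - ((w / z)\<^sup>2 + a (\<phi> t) (\<sigma> t) * (w / z) + b (\<phi> t) (\<sigma> t))"
      unfolding sf z_def[symmetric] w_def[symmetric] using nz by (simp add: field_simps power2_eq_square)
    then show ?thesis using ds by (simp add: u_def z_def w_def)
  qed
  have xs: "(\<forall>t\<ge>T. \<phi> t > x0) \<or> (\<forall>t\<ge>T. \<phi> t < x0)"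
  proof (rule ccontr)
    assume "\<not> ?thesis"
    then obtain t1 t2 where t: "t1 \<ge> T" "\<phi> t1 < x0" "t2 \<ge> T" "\<phi> t2 > x0" using T(1) by (metis linorder_neqE_linordered_idom)
    have "\<exists>t. T \<le> t \<and> \<phi> t = x0"
    proof (cases "t1 \<le> t2")
      case True
      then obtain x where "t1 \<le> x" "\<phi> x = x0" using IVT'[of \<phi> t1 x0 t2, OF _ _ True cont] t by auto
      then show ?thesis using t by (intro exI[of _ x]) auto
    next
      case False
      then have le: "t2 \<le> t1" by simp
      then obtain x where "t2 \<le> x" "\<phi> x = x0" using IVT2'[of \<phi> t1 x0 t2, OF _ _ le cont] t by auto
      then show ?thesis using t by (intro exI[of _ x]) auto
    qed
    then show False using T(1) by blast
  qed
  \<comment> \<open>At a zero of \<open>u\<close> one has u' = -b < 0, so once negative,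
    \<open>u\<close> stays negative. Its sign is thus eventually constant, which makes \<phi>
    eventually monotone.\<close>
  have "\<exists>T1\<ge>T. (\<forall>t\<ge>T1. u t \<ge> 0) \<or> (\<forall>t\<ge>T1. u t \<le> 0)"
  proof (cases "\<exists>T1\<ge>T. u T1 < 0")
    case True
    then obtain T1 where T1: "T1 \<ge> T" "u T1 < 0" by blast
    have "- u t > 0" if "t \<ge> T1" for t
    proof (rule barrier[where g="\<lambda>t. - u t" and g'="\<lambda>t. (u t)\<^sup>2 + a (\<phi> t) (\<sigma> t) * u t + b (\<phi> t) (\<sigma> t)" and s=T1])
      show "((\<lambda>t. - u t) has_real_derivative (u v)\<^sup>2 + a (\<phi> v) (\<sigma> v) * u v + b (\<phi> v) (\<sigma> v)) (at v)" if "T1 \<le> v" for v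
        by (rule DERIV_cong[OF DERIV_minus[OF du[of v]]]) (use that T1 in auto)
    qed (use that T1 b_pos in auto)
    then show ?thesis using T1 by (intro exI[of _ T1]) (auto intro: less_imp_le)
  next
    case False
    then show ?thesis by (intro exI[of _ T]) (auto simp: not_less)
  qed
  then obtain T1 where T1: "T1 \<ge> T" "(\<forall>t\<ge>T1. u t \<ge> 0) \<or> (\<forall>t\<ge>T1. u t \<le> 0)" by blast
  have psi: "\<sigma> t - \<phi> t = u t * (\<phi> t - x0)" if "t \<ge> T" for t using T(1)[OF that] by (simp add: u_def)
  have psign: "(\<forall>t\<ge>T1. \<sigma> t - \<phi> t \<ge> 0) \<or> (\<forall>t\<ge>T1. \<sigma> t - \<phi> t \<le> 0)"
  proof -
    have x: "(\<forall>t\<ge>T1. \<phi> t - x0 \<ge> 0) \<or> (\<forall>t\<ge>T1. \<phi> t - x0 \<le> 0)"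
      using xs T1(1) by (metis diff_ge_0_iff_ge diff_le_0_iff_le less_imp_le order_trans)
    have p: "\<sigma> t - \<phi> t = u t * (\<phi> t - x0)" if "t \<ge> T1" for t using psi T1(1) that by simp
    from T1(2) x show ?thesis
      by (elim disjE) (auto simp: p intro: mult_nonneg_nonneg mult_nonneg_nonpos mult_nonpos_nonneg mult_nonpos_nonpos)
  qed
  have "\<exists>l. (\<phi> \<longlongrightarrow> l) at_top"
    using psign
  proof
    assume h: "\<forall>t\<ge>T1. \<sigma> t - \<phi> t \<ge> 0"
    show ?thesis
    proof (rule mono_bounded_convergent)
      show "\<phi> s \<le> \<phi> t" if "T1 \<le> s" "s \<le> t" for s t
        by (rule DERIV_nonneg_imp_nondecreasing[OF that(2)]) (use d(1) h that in \<open>meson order_trans\<close>)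
      show "\<phi> t \<le> C" if "T1 \<le> t" for t using T(2) T1(1) that by simp
    qed
  next
    assume h: "\<forall>t\<ge>T1. \<sigma> t - \<phi> t \<le> 0"
    have "\<exists>l. ((\<lambda>t. - \<phi> t) \<longlongrightarrow> l) at_top"
    proof (rule mono_bounded_convergent)
      have "\<phi> t \<le> \<phi> s" if "T1 \<le> s" "s \<le> t" for s t
        by (rule DERIV_nonpos_imp_nonincreasing[OF that(2)]) (use d(1) h that in \<open>meson order_trans\<close>)
      then show "- \<phi> s \<le> - \<phi> t" if "T1 \<le> s" "s \<le> t" for s t using that by simp
      show "- \<phi> t \<le> 0" for t using pos(1)[of t] by simp
    qed
    then show ?thesis using tendsto_minus_cancel_left by blast
  qed
  then obtain l where l: "(\<phi> \<longlongrightarrow> l) at_top" by blast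
  have l0: "l \<ge> 0" by (rule tendsto_lowerbound[OF l]) (use pos(1) in \<open>auto intro: always_eventually less_imp_le\<close>)
  obtain K where K: "K \<ge> 0" "\<And>x y x' y'. \<bar>x\<bar> \<le> C \<Longrightarrow> \<bar>y\<bar> \<le> C \<Longrightarrow> \<bar>x'\<bar> \<le> C \<Longrightarrow> \<bar>y'\<bar> \<le> C \<Longrightarrow>
    \<bar>slope_field x y - slope_field x' y'\<bar> \<le> K * (\<bar>x - x'\<bar> + \<bar>y - y'\<bar>)"
    using slope_field_lipschitz[of C] by blast
  have absC: "\<bar>\<phi> t\<bar> \<le> C" "\<bar>\<sigma> t\<bar> \<le> C" if "t \<ge> T" for t using pos[of t] T(2,3)[OF that] by auto
  have C0: "C \<ge> 0" using absC[of T] by linarith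
  have sfb: "\<bar>slope_field (\<phi> t) (\<sigma> t)\<bar> \<le> K * (2 * C)" if "t \<ge> T" for t
  proof -
    have "\<bar>slope_field (\<phi> t) (\<sigma> t) - slope_field 0 0\<bar> \<le> K * (\<bar>\<phi> t - 0\<bar> + \<bar>\<sigma> t - 0\<bar>)"
      by (rule K(2)) (use absC[OF that] C0 in auto)
    also have "\<dots> \<le> K * (2 * C)" using absC[OF that] K(1) by (intro mult_left_mono) auto
    finally show ?thesis by (simp add: slope_field_def)
  qed
  have lip1: "\<bar>\<phi> s - \<phi> t\<bar> \<le> (2 * C) * \<bar>s - t\<bar>" if "T \<le> s" "T \<le> t" for s t
  proof (rule derivative_bound_lipschitz[OF d(1) _ that])
    fix v assume "T \<le> v"
    then show "\<bar>\<sigma> v - \<phi> v\<bar> \<le> 2 * C" using absC[of v] by linarith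
  qed
  have lip2: "\<bar>\<sigma> s - \<sigma> t\<bar> \<le> (K * (2 * C)) * \<bar>s - t\<bar>" if "T \<le> s" "T \<le> t" for s t
    by (rule derivative_bound_lipschitz[OF d(2) sfb that])
  \<comment> \<open>Barbalat's lemma is applied to \<phi> and then, since \<sigma> has the same
    limit, to \<sigma>. Hence the field vanishes at the limit point.\<close>
  have psi0: "((\<lambda>t. \<sigma> t - \<phi> t) \<longlongrightarrow> 0) at_top"
  proof (rule barbalat[OF l d(1)])
    fix s t assume st: "T \<le> s" "T \<le> t"
    have "\<bar>\<sigma> s - \<phi> s - (\<sigma> t - \<phi> t)\<bar> \<le> \<bar>\<sigma> s - \<sigma> t\<bar> + \<bar>\<phi> s - \<phi> t\<bar>" by linarith
    also have "\<dots> \<le> (K * (2 * C)) * \<bar>s - t\<bar> + (2 * C) * \<bar>s - t\<bar>" using lip1[OF st] lip2[OF st] by linarith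
    finally show "\<bar>\<sigma> s - \<phi> s - (\<sigma> t - \<phi> t)\<bar> \<le> (K * (2 * C) + 2 * C) * \<bar>s - t\<bar>" by (simp add: algebra_simps)
  qed
  have ls: "(\<sigma> \<longlongrightarrow> l) at_top" using tendsto_add[OF l psi0] by simp
  have sf0: "((\<lambda>t. slope_field (\<phi> t) (\<sigma> t)) \<longlongrightarrow> 0) at_top"
  proof (rule barbalat[OF ls d(2)])
    fix s t assume st: "T \<le> s" "T \<le> t"
    have "\<bar>slope_field (\<phi> s) (\<sigma> s) - slope_field (\<phi> t) (\<sigma> t)\<bar> \<le> K * (\<bar>\<phi> s - \<phi> t\<bar> + \<bar>\<sigma> s - \<sigma> t\<bar>)"
      by (rule K(2)) (use absC st in auto)
    also have "\<dots> \<le> K * ((2 * C) * \<bar>s - t\<bar> + (K * (2 * C)) * \<bar>s - t\<bar>)"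
      using lip1[OF st] lip2[OF st] K(1) by (intro mult_left_mono add_mono) auto
    finally show "\<bar>slope_field (\<phi> s) (\<sigma> s) - slope_field (\<phi> t) (\<sigma> t)\<bar> \<le> (K * (2 * C + K * (2 * C))) * \<bar>s - t\<bar>"
      by (simp add: algebra_simps)
  qed
  have la: "((\<lambda>t. a (\<phi> t) (\<sigma> t)) \<longlongrightarrow> a l l) at_top"
    unfolding a_def by (intro tendsto_intros l ls) (use D_pos(2) in auto)
  have lb: "((\<lambda>t. b (\<phi> t) (\<sigma> t)) \<longlongrightarrow> b l l) at_top"
    unfolding b_def by (intro tendsto_intros l ls) (use D_pos(2) in auto)
  have "((\<lambda>t. slope_field (\<phi> t) (\<sigma> t)) \<longlongrightarrow> 0 - a l l * 0 - b l l * (l - x0)) at_top"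
    unfolding sf by (intro tendsto_intros psi0 la lb l)
  then have "b l l * (l - x0) = 0" using tendsto_unique[OF _ sf0] by fastforce
  moreover have "l + x0 > 0" "1 + l\<^sup>2 > 0" using l0 x0(1) by (auto intro: add_pos_nonneg)
  ultimately have "l = 0 \<or> l = x0" using L_gt D_pos(2)[of l] by (auto simp: b_def)
  \<comment> \<open>A positive nondecreasing \<phi> cannot tend to 0. If \<phi> decreases to 0, then
    eventually \<phi> < x0 and \<sigma> \<le> \<phi>, which makes the field nonnegative; so \<sigma>
    does not decrease and cannot tend to 0 either.\<close>
  moreover have "l \<noteq> 0"
  proof
    assume "l = 0"
    from psign show False
    proof
      assume h: "\<forall>t\<ge>T1. \<sigma> t - \<phi> t \<ge> 0"
      have "\<phi> T1 \<le> \<phi> t" if "T1 \<le> t" for t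
        by (rule DERIV_nonneg_imp_nondecreasing[OF that]) (use d(1) h that in \<open>meson order_trans\<close>)
      then have "\<phi> T1 \<le> l" by (intro tendsto_lowerbound[OF l]) (auto simp: eventually_at_top_linorder)
      then show False using pos(1)[of T1] \<open>l = 0\<close> by simp
    next
      assume h: "\<forall>t\<ge>T1. \<sigma> t - \<phi> t \<le> 0"
      have "eventually (\<lambda>t. \<phi> t < x0) at_top" using order_tendstoD(2)[OF l, of x0] x0(1) \<open>l = 0\<close> by simp
      then obtain T2 where T2: "\<And>t. t \<ge> T2 \<Longrightarrow> \<phi> t < x0" by (auto simp: eventually_at_top_linorder)
      define T3 where "T3 = max T1 T2"
      have inc: "slope_field (\<phi> t) (\<sigma> t) \<ge> 0" if "t \<ge> T3" for t
      proof -
        have "\<sigma> t - \<phi> t \<le> 0" "\<phi> t - x0 \<le> 0" using h T2[of t] that by (auto simp: T3_def)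
        moreover have "a (\<phi> t) (\<sigma> t) - 1 \<ge> 0"
          using p_ge D_pos(1)[of "\<phi> t"] by (simp add: a_def add_nonneg_nonneg)
        ultimately have "(a (\<phi> t) (\<sigma> t) - 1) * (\<sigma> t - \<phi> t) \<le> 0" "b (\<phi> t) (\<sigma> t) * (\<phi> t - x0) \<le> 0"
          using b_pos[of t] by (auto intro: mult_nonneg_nonpos)
        moreover have "slope_field (\<phi> t) (\<sigma> t) = - ((a (\<phi> t) (\<sigma> t) - 1) * (\<sigma> t - \<phi> t)) - b (\<phi> t) (\<sigma> t) * (\<phi> t - x0)"
          unfolding sf by (simp add: algebra_simps)
        ultimately show ?thesis by linarith
      qed
      have "\<sigma> T3 \<le> \<sigma> t" if "T3 \<le> t" for t
        by (rule DERIV_nonneg_imp_nondecreasing[OF that]) (use d(2) inc in meson)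
      then have "\<sigma> T3 \<le> l" by (intro tendsto_lowerbound[OF ls]) (auto simp: eventually_at_top_linorder)
      then show False using pos(2)[of T3] \<open>l = 0\<close> by simp
    qed
  qed
  ultimately have lx: "l = x0" by blast
  define a0 b0 where "a0 = a x0 x0" and "b0 = b x0 x0"
  have disc': "a0\<^sup>2 < 4 * b0" using disc by (simp add: a0_def b0_def a_def b_def)
  \<comment> \<open>The strict discriminant inequality leaves room for a small c > 0: u^2 + a u + b
    - c (1 + u^2) still has negative discriminant near the equilibrium, so eventually u' \<le> - c
    (1 + u^2).\<close>
  have "((\<lambda>c. 4 * ((1 - c) * (b0 - c)) - a0\<^sup>2) \<longlongrightarrow> 4 * ((1 - 0) * (b0 - 0)) - a0\<^sup>2) (at_right 0)"
    by (intro tendsto_intros)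
  then have "eventually (\<lambda>c. 4 * ((1 - c) * (b0 - c)) - a0\<^sup>2 > 0) (at_right 0)"
    using disc' by (intro order_tendstoD(1)) auto
  moreover have "eventually (\<lambda>c. c < 1) (at_right (0::real))"
    by (rule eventually_at_rightI[of 0 1]) auto
  moreover have "eventually (\<lambda>c. c > 0) (at_right (0::real))" by (rule eventually_at_right_less)
  ultimately have "eventually (\<lambda>c. 4 * ((1 - c) * (b0 - c)) - a0\<^sup>2 > 0 \<and> c < 1 \<and> c > 0) (at_right 0)"
    by (intro eventually_conj)
  then have "\<exists>c. 4 * ((1 - c) * (b0 - c)) - a0\<^sup>2 > 0 \<and> c < 1 \<and> c > 0"
    by (rule eventually_happens'[OF trivial_limit_at_right_real])
  then obtain c where c: "4 * ((1 - c) * (b0 - c)) - a0\<^sup>2 > 0" "c < 1" "c > 0" by blast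
  have "((\<lambda>t. 4 * ((1 - c) * (b (\<phi> t) (\<sigma> t) - c)) - (a (\<phi> t) (\<sigma> t))\<^sup>2) \<longlongrightarrow> 4 * ((1 - c) * (b0 - c)) - a0\<^sup>2) at_top"
    unfolding a0_def b0_def using la lb lx by (intro tendsto_intros) auto
  then have "eventually (\<lambda>t. 4 * ((1 - c) * (b (\<phi> t) (\<sigma> t) - c)) - (a (\<phi> t) (\<sigma> t))\<^sup>2 > 0) at_top"
    by (rule order_tendstoD(1)) (rule c(1))
  then obtain T2 where T2: "\<And>t. t \<ge> T2 \<Longrightarrow> 4 * ((1 - c) * (b (\<phi> t) (\<sigma> t) - c)) - (a (\<phi> t) (\<sigma> t))\<^sup>2 > 0"
    by (auto simp: eventually_at_top_linorder)
  define T3 where "T3 = max T T2"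
  have quad: "(u t)\<^sup>2 + a (\<phi> t) (\<sigma> t) * u t + b (\<phi> t) (\<sigma> t) \<ge> c * (1 + (u t)\<^sup>2)" if "t \<ge> T3" for t
  proof -
    define A B v where "A = a (\<phi> t) (\<sigma> t)" and "B = b (\<phi> t) (\<sigma> t)" and "v = u t"
    have "4 * (1 - c) * ((1 - c) * v\<^sup>2 + A * v + (B - c)) = (2 * (1 - c) * v + A)\<^sup>2 + (4 * ((1 - c) * (B - c)) - A\<^sup>2)"
      by (simp add: algebra_simps power2_eq_square)
    moreover have "4 * ((1 - c) * (B - c)) - A\<^sup>2 > 0" using T2[of t] that by (simp add: T3_def A_def B_def)
    ultimately have "4 * (1 - c) * ((1 - c) * v\<^sup>2 + A * v + (B - c)) > 0" by (simp add: add_nonneg_pos)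
    then have "(1 - c) * v\<^sup>2 + A * v + (B - c) > 0" using c(2) by (simp add: zero_less_mult_iff)
    then show ?thesis by (simp add: A_def B_def v_def algebra_simps)
  qed
  define g where "g t = arctan (u t) + c * t" for t
  \<comment> \<open>During a time 4/c the function arctan u would fall by at least 4, more than the
    length \<pi> of its range.\<close>
  define h where "h = 4 / c"
  have "g (T3 + h) \<le> g T3"
  proof (rule DERIV_nonpos_imp_nonincreasing[where f=g and a=T3 and b="T3 + h"])
    show "T3 \<le> T3 + h" using c by (simp add: h_def)
    fix t assume t: "T3 \<le> t" "t \<le> T3 + h"
    define Qd where "Qd = (u t)\<^sup>2 + a (\<phi> t) (\<sigma> t) * u t + b (\<phi> t) (\<sigma> t)"
    have u: "(u has_real_derivative - Qd) (at t)" unfolding Qd_def by (rule du) (use t in \<open>simp add: T3_def\<close>)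
    have "(g has_real_derivative inverse (1 + (u t)\<^sup>2) * (- Qd) + c) (at t)"
      unfolding g_def[abs_def]
      by (rule DERIV_add[OF DERIV_chain2[OF DERIV_arctan u]]) (auto intro!: derivative_eq_intros)
    moreover have "inverse (1 + (u t)\<^sup>2) * (- Qd) + c \<le> 0"
    proof -
      have pos1: "1 + (u t)\<^sup>2 > 0" by (simp add: add_pos_nonneg)
      have "c * (1 + (u t)\<^sup>2) \<le> Qd" using quad[OF t(1)] by (simp add: Qd_def)
      then have "c \<le> Qd / (1 + (u t)\<^sup>2)" using pos1 by (simp add: pos_le_divide_eq)
      then show ?thesis by (simp add: divide_inverse mult.commute)
    qed
    ultimately show "\<exists>y. (g has_real_derivative y) (at t) \<and> y \<le> 0" by blast
  qed
  then have "arctan (u (T3 + h)) + 4 \<le> arctan (u T3)" using c by (simp add: g_def h_def algebra_simps)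
  then show False using arctan_bounded[of "u (T3 + h)"] arctan_bounded[of "u T3"] pi_less_4 by linarith
qed

end

section \<open>Analyticity of compositions with power series\<close>

no_notation Infinite_Set_Sum.abs_summable_on (infix "abs'_summable'_on" 50)

definition multi_indices :: "('a::euclidean_space \<Rightarrow> nat) set" where
  "multi_indices = (Basis \<rightarrow>\<^sub>E UNIV)"

definition mdeg :: "('a::euclidean_space \<Rightarrow> nat) \<Rightarrow> nat" where
  "mdeg \<alpha> = (\<Sum>b\<in>Basis. \<alpha> b)"

definition monomial :: "'a::euclidean_space \<Rightarrow> ('a \<Rightarrow> nat) \<Rightarrow> real" where
  "monomial h \<alpha> = (\<Prod>b\<in>Basis. (h \<bullet> b) ^ \<alpha> b)"

text \<open>A cube instead of a ball, because bounding each coordinate by \<open>r\<close> is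
  exactly what bounds every monomial by \<open>r ^ mdeg \<alpha>\<close>.\<close>

definition cube_at :: "'a::euclidean_space \<Rightarrow> real \<Rightarrow> 'a set" where
  "cube_at a r = {x. \<forall>b\<in>Basis. \<bar>(x - a) \<bullet> b\<bar> \<le> r}"

text \<open>\<open>f\<close> is given on a cube of half side \<open>r\<close> by a power series whose \<open>r\<close>-weighted \<open>\<ell>\<^sup>1\<close>-norm is at most
  \<open>B\<close>; these norms are submultiplicative.\<close>

definition power_series_on :: "'a::euclidean_space \<Rightarrow> real \<Rightarrow> real \<Rightarrow> ('a \<Rightarrow> 'b::euclidean_space) \<Rightarrow> bool" where
  "power_series_on a r B f \<longleftrightarrow> r > 0 \<and> (\<exists>c.
     (\<lambda>\<alpha>. norm (c \<alpha>) * r ^ mdeg \<alpha>) summable_on multi_indices \<and>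
     infsum (\<lambda>\<alpha>. norm (c \<alpha>) * r ^ mdeg \<alpha>) multi_indices \<le> B \<and>
     (\<forall>x\<in>cube_at a r. ((\<lambda>\<alpha>. monomial (x - a) \<alpha> *\<^sub>R c \<alpha>) has_sum f x) multi_indices))"

lemma abs_monomial_le:
  assumes "x \<in> cube_at a r"
  shows "\<bar>monomial (x - a) \<alpha>\<bar> \<le> r ^ mdeg \<alpha>"
proof -
  have "\<bar>monomial (x - a) \<alpha>\<bar> = (\<Prod>b\<in>Basis. \<bar>(x - a) \<bullet> b\<bar> ^ \<alpha> b)"
    by (simp add: monomial_def abs_prod power_abs)
  also have "\<dots> \<le> (\<Prod>b\<in>Basis. r ^ \<alpha> b)"
    by (rule prod_mono) (use assms in \<open>auto simp: cube_at_def intro!: power_mono\<close>)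
  also have "\<dots> = r ^ mdeg \<alpha>" by (simp add: mdeg_def power_sum)
  finally show ?thesis .
qed

text \<open>Products and compositions produce sums over a larger index set \<open>Z\<close>, where
  \<pi> gives the multi-index of a term. Summability of the weighted norms allows the terms over
  each multi-index to be collected, and by the triangle inequality the total norm does not
  increase.\<close>

lemma power_series_on_regroup:
  fixes k :: "'z \<Rightarrow> 'b::euclidean_space" and \<pi> :: "'z \<Rightarrow> 'a::euclidean_space \<Rightarrow> nat"
  assumes r: "r > 0" and \<pi>: "\<And>z. z \<in> Z \<Longrightarrow> \<pi> z \<in> multi_indices"
    and w: "((\<lambda>z. norm (k z) * r ^ mdeg (\<pi> z)) has_sum W) Z" "W \<le> B"
    and f: "\<And>x. x \<in> cube_at a r \<Longrightarrow> ((\<lambda>z. monomial (x - a) (\<pi> z) *\<^sub>R k z) has_sum f x) Z"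
  shows "power_series_on a r B f"
proof -
  define Fb where "Fb \<gamma> = {z \<in> Z. \<pi> z = \<gamma>}" for \<gamma>
  define e where "e \<gamma> = infsum k (Fb \<gamma>)" for \<gamma>
  have bij: "bij_betw snd (Sigma multi_indices Fb) Z"
    using \<pi> by (force simp: bij_betw_def inj_on_def Fb_def image_iff)
  have lift: "((\<lambda>p. g (snd p)) has_sum S) (Sigma multi_indices Fb)" if "(g has_sum S) Z"
    for g :: "'z \<Rightarrow> 'c::{comm_monoid_add,topological_space}" and S
    using has_sum_reindex_bij_betw[OF bij, of g S] that by simp
  let ?w = "\<lambda>z. norm (k z) * r ^ mdeg (\<pi> z)"
  have wF: "?w summable_on Fb \<gamma>" for \<gamma>
    by (rule summable_on_subset_banach[OF has_sum_imp_summable[OF w(1)]]) (auto simp: Fb_def)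
  have kF: "k abs_summable_on Fb \<gamma>" for \<gamma>
  proof -
    have "((\<lambda>z. (1 / r ^ mdeg \<gamma>) * ?w z) has_sum (1 / r ^ mdeg \<gamma>) * infsum ?w (Fb \<gamma>)) (Fb \<gamma>)"
      by (intro has_sum_cmult_right has_sum_infsum wF)
    then have "((\<lambda>z. norm (k z)) has_sum (1 / r ^ mdeg \<gamma>) * infsum ?w (Fb \<gamma>)) (Fb \<gamma>)"
      by (rule has_sum_cong[THEN iffD1, rotated]) (use r in \<open>auto simp: Fb_def\<close>)
    then show ?thesis by (rule has_sum_imp_summable)
  qed
  have kh: "(k has_sum e \<gamma>) (Fb \<gamma>)" for \<gamma>
    unfolding e_def by (rule has_sum_infsum[OF abs_summable_summable[OF kF]])
  have WI: "((\<lambda>\<gamma>. infsum ?w (Fb \<gamma>)) has_sum W) multi_indices"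
    by (rule has_sum_Sigma[OF isUCont_plus lift[OF w(1)]]) (simp add: has_sum_infsum[OF wF])
  have le: "norm (e \<gamma>) * r ^ mdeg \<gamma> \<le> infsum ?w (Fb \<gamma>)" for \<gamma>
  proof -
    have "norm (e \<gamma>) * r ^ mdeg \<gamma> \<le> infsum (\<lambda>z. norm (k z)) (Fb \<gamma>) * r ^ mdeg \<gamma>"
      unfolding e_def using r by (intro mult_right_mono norm_infsum_bound kF) auto
    also have "\<dots> = infsum ?w (Fb \<gamma>)"
    proof -
      have "((\<lambda>z. norm (k z) * r ^ mdeg \<gamma>) has_sum infsum (\<lambda>z. norm (k z)) (Fb \<gamma>) * r ^ mdeg \<gamma>) (Fb \<gamma>)"
        by (intro has_sum_cmult_left has_sum_infsum kF)
      then have "(?w has_sum infsum (\<lambda>z. norm (k z)) (Fb \<gamma>) * r ^ mdeg \<gamma>) (Fb \<gamma>)"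
        by (rule has_sum_cong[THEN iffD1, rotated]) (auto simp: Fb_def)
      then show ?thesis by (rule infsumI[symmetric])
    qed
    finally show ?thesis .
  qed
  have sm: "(\<lambda>\<gamma>. norm (e \<gamma>) * r ^ mdeg \<gamma>) summable_on multi_indices"
  proof -
    have "(\<lambda>\<gamma>. norm (e \<gamma>) * r ^ mdeg \<gamma>) abs_summable_on multi_indices"
    proof (rule Infinite_Sum.abs_summable_on_comparison_test)
      show "(\<lambda>\<gamma>. infsum ?w (Fb \<gamma>)) abs_summable_on multi_indices"
        by (rule summable_on_iff_abs_summable_on_real[THEN iffD1, OF has_sum_imp_summable[OF WI]])
      show "norm (norm (e \<gamma>) * r ^ mdeg \<gamma>) \<le> norm (infsum ?w (Fb \<gamma>))" for \<gamma>
        using le[of \<gamma>] r by simp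
    qed
    then show ?thesis by (rule summable_on_iff_abs_summable_on_real[THEN iffD2])
  qed
  have "infsum (\<lambda>\<gamma>. norm (e \<gamma>) * r ^ mdeg \<gamma>) multi_indices \<le> infsum (\<lambda>\<gamma>. infsum ?w (Fb \<gamma>)) multi_indices"
    by (rule infsum_mono[OF sm has_sum_imp_summable[OF WI] le])
  also have "\<dots> \<le> B" using w(2) infsumI[OF WI] by simp
  finally have nb: "infsum (\<lambda>\<gamma>. norm (e \<gamma>) * r ^ mdeg \<gamma>) multi_indices \<le> B" .
  have "((\<lambda>\<gamma>. monomial (x - a) \<gamma> *\<^sub>R e \<gamma>) has_sum f x) multi_indices" if x: "x \<in> cube_at a r" for x
  proof (rule has_sum_Sigma[OF isUCont_plus lift[OF f[OF x]]])
    fix \<gamma> :: "'a \<Rightarrow> nat"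
    have "((\<lambda>z. monomial (x - a) \<gamma> *\<^sub>R k z) has_sum monomial (x - a) \<gamma> *\<^sub>R e \<gamma>) (Fb \<gamma>)"
      by (rule has_sum_scaleR[OF kh])
    then show "((\<lambda>z. monomial (x - a) (\<pi> (snd (\<gamma>, z))) *\<^sub>R k (snd (\<gamma>, z))) has_sum monomial (x - a) \<gamma> *\<^sub>R e \<gamma>) (Fb \<gamma>)"
      by (rule has_sum_cong[THEN iffD1, rotated]) (auto simp: Fb_def)
  qed
  then show ?thesis using r sm nb unfolding power_series_on_def by blast
qed

lemma power_series_onE:
  assumes "power_series_on a r B f"
  obtains c W where "r > 0" "((\<lambda>\<alpha>. norm (c \<alpha>) * r ^ mdeg \<alpha>) has_sum W) multi_indices" "W \<le> B" "0 \<le> W"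
    "\<forall>x\<in>cube_at a r. ((\<lambda>\<alpha>. monomial (x - a) \<alpha> *\<^sub>R c \<alpha>) has_sum f x) multi_indices"
    "\<forall>x\<in>cube_at a r. norm (f x) \<le> W"
proof -
  obtain c where c: "r > 0" "(\<lambda>\<alpha>. norm (c \<alpha>) * r ^ mdeg \<alpha>) summable_on multi_indices"
    "infsum (\<lambda>\<alpha>. norm (c \<alpha>) * r ^ mdeg \<alpha>) multi_indices \<le> B"
    "\<forall>x\<in>cube_at a r. ((\<lambda>\<alpha>. monomial (x - a) \<alpha> *\<^sub>R c \<alpha>) has_sum f x) multi_indices"
    using assms unfolding power_series_on_def by blast
  define W where "W = infsum (\<lambda>\<alpha>. norm (c \<alpha>) * r ^ mdeg \<alpha>) multi_indices"
  have W: "((\<lambda>\<alpha>. norm (c \<alpha>) * r ^ mdeg \<alpha>) has_sum W) multi_indices" unfolding W_def by (rule has_sum_infsum[OF c(2)])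
  have W0: "0 \<le> W" unfolding W_def by (rule infsum_nonneg) (use c(1) in auto)
  have "norm (f x) \<le> W" if x: "x \<in> cube_at a r" for x
  proof -
    have ab: "(\<lambda>\<alpha>. monomial (x - a) \<alpha> *\<^sub>R c \<alpha>) abs_summable_on multi_indices"
    proof (rule Infinite_Sum.abs_summable_on_comparison_test)
      show "(\<lambda>\<alpha>. norm (c \<alpha>) * r ^ mdeg \<alpha>) abs_summable_on multi_indices"
        by (rule summable_on_iff_abs_summable_on_real[THEN iffD1, OF c(2)])
      show "norm (monomial (x - a) \<alpha> *\<^sub>R c \<alpha>) \<le> norm (norm (c \<alpha>) * r ^ mdeg \<alpha>)" for \<alpha>
        using mult_right_mono[OF abs_monomial_le[OF x, of \<alpha>], of "norm (c \<alpha>)"] c(1) by (simp add: mult.commute)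
    qed
    have "norm (f x) \<le> infsum (\<lambda>\<alpha>. norm (monomial (x - a) \<alpha> *\<^sub>R c \<alpha>)) multi_indices"
      using norm_infsum_bound[OF ab] infsumI[OF c(4)[rule_format, OF x]] by simp
    also have "\<dots> \<le> W" unfolding W_def
    proof (rule infsum_mono[OF ab c(2)])
      show "norm (monomial (x - a) \<alpha> *\<^sub>R c \<alpha>) \<le> norm (c \<alpha>) * r ^ mdeg \<alpha>" for \<alpha>
        using mult_right_mono[OF abs_monomial_le[OF x, of \<alpha>], of "norm (c \<alpha>)"] by (simp add: mult.commute)
    qed
    finally show ?thesis .
  qed
  then show ?thesis using that c(1,3,4) W W0 unfolding W_def[symmetric] by blast
qed

lemma power_series_on_monomial:
  assumes "r > 0" "\<gamma> \<in> multi_indices"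
  shows "power_series_on a r (norm v * r ^ mdeg \<gamma>) (\<lambda>x. monomial (x - a) \<gamma> *\<^sub>R v)"
proof (rule power_series_on_regroup[where Z="{()}" and \<pi>="\<lambda>_. \<gamma>" and k="\<lambda>_. v" and W="norm v * r ^ mdeg \<gamma>"])
  have "((\<lambda>z. norm v * r ^ mdeg \<gamma>) has_sum (\<Sum>z\<in>{()}. norm v * r ^ mdeg \<gamma>)) {()}" by (rule has_sum_finite) simp
  then show "((\<lambda>z. norm v * r ^ mdeg \<gamma>) has_sum norm v * r ^ mdeg \<gamma>) {()}" by simp
  fix x
  have "((\<lambda>z. monomial (x - a) \<gamma> *\<^sub>R v) has_sum (\<Sum>z\<in>{()}. monomial (x - a) \<gamma> *\<^sub>R v)) {()}" by (rule has_sum_finite) simp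
  then show "((\<lambda>z. monomial (x - a) \<gamma> *\<^sub>R v) has_sum monomial (x - a) \<gamma> *\<^sub>R v) {()}" by simp
qed (use assms in auto)

lemma power_series_on_const: "r > 0 \<Longrightarrow> power_series_on a r (norm v) (\<lambda>x. v)"
  using power_series_on_monomial[of r "restrict (\<lambda>_. 0) Basis" a v]
  by (simp add: multi_indices_def monomial_def mdeg_def)

lemma power_series_on_coordinate:
  assumes "r > 0" "b \<in> Basis"
  shows "power_series_on a r r (\<lambda>x. (x - a) \<bullet> b)"
proof -
  define \<gamma> where "\<gamma> = restrict (\<lambda>i. if i = b then 1 else 0 :: nat) Basis"
  have "monomial (x - a) \<gamma> = (x - a) \<bullet> b" for x
  proof -
    have "monomial (x - a) \<gamma> = (\<Prod>i\<in>Basis. if i = b then (x - a) \<bullet> i else 1)"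
      unfolding monomial_def by (rule prod.cong) (auto simp: \<gamma>_def)
    then show ?thesis using assms by simp
  qed
  moreover have "mdeg \<gamma> = 1"
  proof -
    have "mdeg \<gamma> = (\<Sum>i\<in>Basis. if i = b then 1 else 0)"
      unfolding mdeg_def by (rule sum.cong) (auto simp: \<gamma>_def)
    then show ?thesis using assms by simp
  qed
  moreover have "\<gamma> \<in> multi_indices" by (simp add: \<gamma>_def multi_indices_def)
  ultimately show ?thesis using power_series_on_monomial[of r \<gamma> a "1::real"] assms by simp
qed

lemma power_series_on_add:
  assumes "power_series_on a r B f" "power_series_on a r B' g"
  shows "power_series_on a r (B + B') (\<lambda>x. f x + g x)"
proof -
  obtain c W where c: "r > 0" "((\<lambda>\<alpha>. norm (c \<alpha>) * r ^ mdeg \<alpha>) has_sum W) multi_indices" "W \<le> B"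
    "\<forall>x\<in>cube_at a r. ((\<lambda>\<alpha>. monomial (x - a) \<alpha> *\<^sub>R c \<alpha>) has_sum f x) multi_indices"
    using assms(1) by (rule power_series_onE)
  obtain d W' where d: "((\<lambda>\<alpha>. norm (d \<alpha>) * r ^ mdeg \<alpha>) has_sum W') multi_indices" "W' \<le> B'"
    "\<forall>x\<in>cube_at a r. ((\<lambda>\<alpha>. monomial (x - a) \<alpha> *\<^sub>R d \<alpha>) has_sum g x) multi_indices"
    using assms(2) by (rule power_series_onE)
  have sum: "((\<lambda>\<alpha>. norm (c \<alpha>) * r ^ mdeg \<alpha> + norm (d \<alpha>) * r ^ mdeg \<alpha>) has_sum W + W') multi_indices"
    by (rule has_sum_add[OF c(2) d(1)])
  have le: "norm (c \<alpha> + d \<alpha>) * r ^ mdeg \<alpha> \<le> norm (c \<alpha>) * r ^ mdeg \<alpha> + norm (d \<alpha>) * r ^ mdeg \<alpha>" for \<alpha>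
    using mult_right_mono[OF norm_triangle_ineq[of "c \<alpha>" "d \<alpha>"], of "r ^ mdeg \<alpha>"] c(1) by (simp add: algebra_simps)
  have sm: "(\<lambda>\<alpha>. norm (c \<alpha> + d \<alpha>) * r ^ mdeg \<alpha>) summable_on multi_indices"
  proof -
    have "(\<lambda>\<alpha>. norm (c \<alpha> + d \<alpha>) * r ^ mdeg \<alpha>) abs_summable_on multi_indices"
    proof (rule Infinite_Sum.abs_summable_on_comparison_test)
      show "(\<lambda>\<alpha>. norm (c \<alpha>) * r ^ mdeg \<alpha> + norm (d \<alpha>) * r ^ mdeg \<alpha>) abs_summable_on multi_indices"
        by (rule summable_on_iff_abs_summable_on_real[THEN iffD1, OF has_sum_imp_summable[OF sum]])
      show "norm (norm (c \<alpha> + d \<alpha>) * r ^ mdeg \<alpha>) \<le> norm (norm (c \<alpha>) * r ^ mdeg \<alpha> + norm (d \<alpha>) * r ^ mdeg \<alpha>)" for \<alpha>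
        using le[of \<alpha>] c(1) by simp
    qed
    then show ?thesis by (rule summable_on_iff_abs_summable_on_real[THEN iffD2])
  qed
  have "infsum (\<lambda>\<alpha>. norm (c \<alpha> + d \<alpha>) * r ^ mdeg \<alpha>) multi_indices \<le> B + B'"
    using infsum_mono[OF sm has_sum_imp_summable[OF sum] le] infsumI[OF sum] c(3) d(2) by simp
  moreover have "((\<lambda>\<alpha>. monomial (x - a) \<alpha> *\<^sub>R (c \<alpha> + d \<alpha>)) has_sum f x + g x) multi_indices"
    if "x \<in> cube_at a r" for x
    unfolding scaleR_add_right using c(4) d(3) that by (intro has_sum_add) auto
  ultimately show ?thesis using c(1) sm unfolding power_series_on_def
    by (intro conjI exI[of _ "\<lambda>\<alpha>. c \<alpha> + d \<alpha>"] ballI)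
qed

text \<open>The Cauchy product before regrouping: the weights of a pair of terms multiply because
  degrees add, so the double sum of weights is the product of the two norms.\<close>

lemma power_series_on_scaleR:
  fixes f :: "'a::euclidean_space \<Rightarrow> real" and g :: "'a \<Rightarrow> 'b::euclidean_space"
  assumes "power_series_on a r B f" "power_series_on a r B' g"
  shows "power_series_on a r (B * B') (\<lambda>x. f x *\<^sub>R g x)"
proof -
  let ?I = "multi_indices :: ('a \<Rightarrow> nat) set"
  obtain c W where c: "r > 0" "((\<lambda>\<alpha>. norm (c \<alpha>) * r ^ mdeg \<alpha>) has_sum W) ?I" "W \<le> B" "0 \<le> W"
    "\<forall>x\<in>cube_at a r. ((\<lambda>\<alpha>. monomial (x - a) \<alpha> *\<^sub>R c \<alpha>) has_sum f x) ?I"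
    using assms(1) by (rule power_series_onE)
  obtain d W' where d: "((\<lambda>\<alpha>. norm (d \<alpha>) * r ^ mdeg \<alpha>) has_sum W') ?I" "W' \<le> B'" "0 \<le> W'"
    "\<forall>x\<in>cube_at a r. ((\<lambda>\<alpha>. monomial (x - a) \<alpha> *\<^sub>R d \<alpha>) has_sum g x) ?I"
    using assms(2) by (rule power_series_onE)
  define \<pi> where "\<pi> z = restrict (\<lambda>b. fst z b + snd z b) Basis" for z :: "('a \<Rightarrow> nat) \<times> ('a \<Rightarrow> nat)"
  define k where "k z = c (fst z) *\<^sub>R d (snd z)" for z
  define w where "w z = (norm (c (fst z)) * r ^ mdeg (fst z)) * (norm (d (snd z)) * r ^ mdeg (snd z))" for z
  have deg: "mdeg (\<pi> z) = mdeg (fst z) + mdeg (snd z)" for z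
    by (simp add: mdeg_def \<pi>_def sum.distrib)
  have mon: "monomial h (\<pi> z) = monomial h (fst z) * monomial h (snd z)" for h z
    by (simp add: monomial_def \<pi>_def power_add prod.distrib)
  have w0: "w z \<ge> 0" for z using c(1) by (simp add: w_def)
  have inner: "((\<lambda>\<beta>. w (\<alpha>, \<beta>)) has_sum (norm (c \<alpha>) * r ^ mdeg \<alpha>) * W') ?I" for \<alpha>
    unfolding w_def fst_conv snd_conv by (rule has_sum_cmult_right[OF d(1)])
  have ab: "w abs_summable_on (?I \<times> ?I)"
    unfolding Infinite_Sum.abs_summable_on_Sigma_iff
  proof (intro conjI ballI)
    show "(\<lambda>\<beta>. w (\<alpha>, \<beta>)) abs_summable_on ?I" for \<alpha>
      by (rule summable_on_iff_abs_summable_on_real[THEN iffD1, OF has_sum_imp_summable[OF inner]])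
    have "infsum (\<lambda>\<beta>. norm (w (\<alpha>, \<beta>))) ?I = (norm (c \<alpha>) * r ^ mdeg \<alpha>) * W'" for \<alpha>
      using infsumI[OF inner[of \<alpha>]] w0 by (simp add: abs_of_nonneg)
    moreover have "(\<lambda>\<alpha>. (norm (c \<alpha>) * r ^ mdeg \<alpha>) * W') abs_summable_on ?I"
      by (rule summable_on_iff_abs_summable_on_real[THEN iffD1, OF has_sum_imp_summable[OF has_sum_cmult_left[OF c(2), of W']]])
    ultimately show "(\<lambda>\<alpha>. infsum (\<lambda>\<beta>. norm (w (\<alpha>, \<beta>))) ?I) abs_summable_on ?I" by simp
  qed
  have wsum: "(w has_sum W * W') (?I \<times> ?I)"
  proof -
    have s: "(w has_sum infsum w (?I \<times> ?I)) (?I \<times> ?I)" by (rule has_sum_infsum[OF abs_summable_summable[OF ab]])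
    have "((\<lambda>\<alpha>. (norm (c \<alpha>) * r ^ mdeg \<alpha>) * W') has_sum infsum w (?I \<times> ?I)) ?I"
      by (rule has_sum_Sigma[OF isUCont_plus s inner])
    with has_sum_cmult_left[OF c(2), of W'] have "infsum w (?I \<times> ?I) = W * W'" using has_sum_unique by blast
    then show ?thesis using s by simp
  qed
  show ?thesis
  proof (rule power_series_on_regroup[where Z="?I \<times> ?I" and \<pi>=\<pi> and k=k and W="W * W'"])
    show "\<pi> z \<in> ?I" for z by (simp add: \<pi>_def multi_indices_def)
    show "((\<lambda>z. norm (k z) * r ^ mdeg (\<pi> z)) has_sum W * W') (?I \<times> ?I)"
      by (rule has_sum_cong[THEN iffD1, OF _ wsum]) (simp add: w_def k_def deg power_add)
    show "W * W' \<le> B * B'" using c(3,4) d(2,3) by (intro mult_mono) auto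
    fix x assume x: "x \<in> cube_at a r"
    define m where "m z = monomial (x - a) (\<pi> z) *\<^sub>R k z" for z
    have mi: "((\<lambda>\<beta>. m (\<alpha>, \<beta>)) has_sum (monomial (x - a) \<alpha> * c \<alpha>) *\<^sub>R g x) ?I" for \<alpha>
    proof -
      have "((\<lambda>\<beta>. (monomial (x - a) \<alpha> * c \<alpha>) *\<^sub>R (monomial (x - a) \<beta> *\<^sub>R d \<beta>)) has_sum (monomial (x - a) \<alpha> * c \<alpha>) *\<^sub>R g x) ?I"
        by (rule has_sum_scaleR) (use d(4) x in auto)
      then show ?thesis by (simp add: m_def mon k_def mult_ac)
    qed
    have "m abs_summable_on (?I \<times> ?I)"
    proof (rule Infinite_Sum.abs_summable_on_comparison_test[OF ab])
      fix z
      have "\<bar>monomial (x - a) (\<pi> z)\<bar> * norm (k z) \<le> r ^ mdeg (\<pi> z) * norm (k z)"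
        by (rule mult_right_mono[OF abs_monomial_le[OF x]]) simp
      then have "norm (m z) \<le> w z" by (simp add: m_def w_def k_def deg power_add abs_mult mult_ac)
      then show "norm (m z) \<le> norm (w z)" using w0[of z] by simp
    qed
    then have s: "(m has_sum infsum m (?I \<times> ?I)) (?I \<times> ?I)" by (rule has_sum_infsum[OF abs_summable_summable])
    have "((\<lambda>\<alpha>. (monomial (x - a) \<alpha> * c \<alpha>) *\<^sub>R g x) has_sum infsum m (?I \<times> ?I)) ?I"
      by (rule has_sum_Sigma[OF isUCont_plus s mi])
    moreover have "((\<lambda>\<alpha>. (monomial (x - a) \<alpha> * c \<alpha>) *\<^sub>R g x) has_sum f x *\<^sub>R g x) ?I"
      using has_sum_bounded_linear[OF bounded_linear_scaleR_left[of "g x"] c(5)[rule_format, OF x]] by simp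
    ultimately have "infsum m (?I \<times> ?I) = f x *\<^sub>R g x" by (rule has_sum_unique)
    then show "((\<lambda>z. monomial (x - a) (\<pi> z) *\<^sub>R k z) has_sum f x *\<^sub>R g x) (?I \<times> ?I)"
      using s by (simp add: m_def[abs_def])
  qed (use c(1) in auto)
qed

lemma power_series_on_power:
  fixes f :: "'a::euclidean_space \<Rightarrow> real"
  assumes "power_series_on a r B f"
  shows "power_series_on a r (B ^ n) (\<lambda>x. f x ^ n)"
proof (induction n)
  case 0
  have "r > 0" using assms by (simp add: power_series_on_def)
  then show ?case using power_series_on_const[of r a "1::real"] by simp
next
  case (Suc n)
  then show ?case using power_series_on_scaleR[OF assms Suc] by simp
qed

text \<open>By submultiplicativity the norm of f^n is at most B^n, and \<open>B\<close> lies below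
  the convergence radius of \<open>A\<close>. So the terms of all powers are absolutely summable
  over pairs of an exponent and a multi-index, and may be rearranged.\<close>

lemma power_series_on_compose:
  fixes f :: "'a::euclidean_space \<Rightarrow> real"
  assumes f: "power_series_on a r B f" and B: "B \<ge> 0" "ereal B < fps_conv_radius A"
  shows "\<exists>B'. power_series_on a r B' (\<lambda>x. eval_fps A (f x))"
proof -
  let ?I = "multi_indices :: ('a \<Rightarrow> nat) set"
  have r: "r > 0" using f by (simp add: power_series_on_def)
  define S where "S n cW \<longleftrightarrow> ((\<lambda>\<alpha>. norm (fst cW \<alpha>) * r ^ mdeg \<alpha>) has_sum snd cW) ?I \<and> snd cW \<le> B ^ n \<and> 0 \<le> snd cW \<and>
      (\<forall>x\<in>cube_at a r. ((\<lambda>\<alpha>. monomial (x - a) \<alpha> *\<^sub>R fst cW \<alpha>) has_sum f x ^ n) ?I)"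
    for n and cW :: "(('a \<Rightarrow> nat) \<Rightarrow> real) \<times> real"
  have "\<exists>cW. S n cW" for n
  proof -
    obtain c W where "((\<lambda>\<alpha>. norm (c \<alpha>) * r ^ mdeg \<alpha>) has_sum W) ?I" "W \<le> B ^ n" "0 \<le> W"
      "\<forall>x\<in>cube_at a r. ((\<lambda>\<alpha>. monomial (x - a) \<alpha> *\<^sub>R c \<alpha>) has_sum f x ^ n) ?I"
      using power_series_on_power[OF f, of n] by (rule power_series_onE)
    then have "S n (c, W)" by (simp only: S_def fst_conv snd_conv)
    then show ?thesis by blast
  qed
  then obtain cW where cW: "\<And>n. S n (cW n)" by metis
  define c where "c n = fst (cW n)" for n
  define W where "W n = snd (cW n)" for n
  have c: "\<And>n. ((\<lambda>\<alpha>. norm (c n \<alpha>) * r ^ mdeg \<alpha>) has_sum W n) ?I"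
    "\<And>n. W n \<le> B ^ n" "\<And>n. 0 \<le> W n"
    "\<And>n x. x \<in> cube_at a r \<Longrightarrow> ((\<lambda>\<alpha>. monomial (x - a) \<alpha> *\<^sub>R c n \<alpha>) has_sum f x ^ n) ?I"
    using cW unfolding S_def c_def W_def by blast+
  have sA: "summable (\<lambda>n. norm (fps_nth A n * B ^ n))"
    using abs_summable_in_conv_radius[of B "fps_nth A"] B by (simp add: fps_conv_radius_def)
  define k where "k z = fps_nth A (fst z) * c (fst z) (snd z)" for z
  define w where "w z = norm (fps_nth A (fst z)) * (norm (c (fst z) (snd z)) * r ^ mdeg (snd z))" for z
  have w0: "w z \<ge> 0" for z using r by (simp add: w_def)
  have inner: "((\<lambda>\<alpha>. w (n, \<alpha>)) has_sum norm (fps_nth A n) * W n) ?I" for n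
    unfolding w_def fst_conv snd_conv by (rule has_sum_cmult_right[OF c(1)])
  have sW: "(\<lambda>n. norm (fps_nth A n) * W n) abs_summable_on UNIV"
  proof (rule Infinite_Sum.abs_summable_on_comparison_test)
    have "(\<lambda>n. norm (fps_nth A n * B ^ n)) summable_on UNIV"
      by (rule norm_summable_imp_summable_on) (use sA in simp)
    then show "(\<lambda>n. fps_nth A n * B ^ n) abs_summable_on UNIV" .
    show "norm (norm (fps_nth A n) * W n) \<le> norm (fps_nth A n * B ^ n)" for n
      using mult_left_mono[OF c(2)[of n], of "norm (fps_nth A n)"] c(3)[of n] B(1) by (simp add: abs_mult)
  qed
  have ab: "w abs_summable_on (UNIV \<times> ?I)"
    unfolding Infinite_Sum.abs_summable_on_Sigma_iff
  proof (intro conjI ballI)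
    show "(\<lambda>\<alpha>. w (n, \<alpha>)) abs_summable_on ?I" for n
      by (rule summable_on_iff_abs_summable_on_real[THEN iffD1, OF has_sum_imp_summable[OF inner]])
    have "infsum (\<lambda>\<alpha>. norm (w (n, \<alpha>))) ?I = norm (fps_nth A n) * W n" for n
      using infsumI[OF inner[of n]] w0 by (simp add: abs_of_nonneg)
    then show "(\<lambda>n. infsum (\<lambda>\<alpha>. norm (w (n, \<alpha>))) ?I) abs_summable_on UNIV" using sW by simp
  qed
  define B' where "B' = infsum w (UNIV \<times> ?I)"
  have wsum: "(w has_sum B') (UNIV \<times> ?I)" unfolding B'_def by (rule has_sum_infsum[OF abs_summable_summable[OF ab]])
  have "power_series_on a r B' (\<lambda>x. eval_fps A (f x))"
  proof (rule power_series_on_regroup[where Z="UNIV \<times> ?I" and \<pi>=snd and k=k and W=B'])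
    show "((\<lambda>z. norm (k z) * r ^ mdeg (snd z)) has_sum B') (UNIV \<times> ?I)"
      by (rule has_sum_cong[THEN iffD1, OF _ wsum]) (simp add: w_def k_def abs_mult)
    fix x assume x: "x \<in> cube_at a r"
    define m where "m z = monomial (x - a) (snd z) *\<^sub>R k z" for z
    have mi: "((\<lambda>\<alpha>. m (n, \<alpha>)) has_sum fps_nth A n * f x ^ n) ?I" for n
    proof -
      have "((\<lambda>\<alpha>. fps_nth A n * (monomial (x - a) \<alpha> *\<^sub>R c n \<alpha>)) has_sum fps_nth A n * f x ^ n) ?I"
        by (rule has_sum_cmult_right[OF c(4)[OF x]])
      then show ?thesis by (simp add: m_def k_def mult_ac)
    qed
    have "m abs_summable_on (UNIV \<times> ?I)"
    proof (rule Infinite_Sum.abs_summable_on_comparison_test[OF ab])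
      fix z
      have "\<bar>monomial (x - a) (snd z)\<bar> * norm (k z) \<le> r ^ mdeg (snd z) * norm (k z)"
        by (rule mult_right_mono[OF abs_monomial_le[OF x]]) simp
      then have "norm (m z) \<le> w z" by (simp add: m_def w_def k_def abs_mult mult_ac)
      then show "norm (m z) \<le> norm (w z)" using w0[of z] by simp
    qed
    then have s: "(m has_sum infsum m (UNIV \<times> ?I)) (UNIV \<times> ?I)" by (rule has_sum_infsum[OF abs_summable_summable])
    have "((\<lambda>n. fps_nth A n * f x ^ n) has_sum infsum m (UNIV \<times> ?I)) UNIV"
      by (rule has_sum_Sigma[OF isUCont_plus s mi])
    then have "(\<lambda>n. fps_nth A n * f x ^ n) sums infsum m (UNIV \<times> ?I)" by (rule has_sum_imp_sums)
    then have "infsum m (UNIV \<times> ?I) = eval_fps A (f x)" by (simp add: eval_fps_def sums_iff)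
    then show "((\<lambda>z. monomial (x - a) (snd z) *\<^sub>R k z) has_sum eval_fps A (f x)) (UNIV \<times> ?I)"
      using s by (simp add: m_def[abs_def])
  qed (use r in auto)
  then show ?thesis by blast
qed

lemma mdeg_eq_0: "\<alpha> \<in> multi_indices \<Longrightarrow> mdeg \<alpha> = 0 \<longleftrightarrow> \<alpha> = restrict (\<lambda>_. 0) Basis"
  by (auto simp: mdeg_def multi_indices_def PiE_def extensional_def fun_eq_iff)

text \<open>A term of degree d scales by (r'/r)^d. If \<open>f\<close> vanishes at the centre there
  is no term of degree 0, so the norm shrinks at least by r'/r; the composition lemma needs norms
  that can be made arbitrarily small.\<close>

lemma power_series_on_shrink:
  assumes f: "power_series_on a r B f" and r': "0 < r'" "r' \<le> r"
  shows "power_series_on a r' B f"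
    and "f a = 0 \<Longrightarrow> power_series_on a r' ((r' / r) * B) f"
proof -
  let ?I = "multi_indices :: ('a \<Rightarrow> nat) set"
  obtain c W where c: "r > 0" "((\<lambda>\<alpha>. norm (c \<alpha>) * r ^ mdeg \<alpha>) has_sum W) ?I" "W \<le> B" "0 \<le> W"
    "\<forall>x\<in>cube_at a r. ((\<lambda>\<alpha>. monomial (x - a) \<alpha> *\<^sub>R c \<alpha>) has_sum f x) ?I"
    using f by (rule power_series_onE)
  have sub: "cube_at a r' \<subseteq> cube_at a r" using r' by (auto simp: cube_at_def)
  have gen: "power_series_on a r' (s * B) f" if s: "s \<ge> 0"
    and le: "\<And>\<alpha>. \<alpha> \<in> ?I \<Longrightarrow> norm (c \<alpha>) * r' ^ mdeg \<alpha> \<le> s * (norm (c \<alpha>) * r ^ mdeg \<alpha>)" for s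
  proof -
    have sum: "((\<lambda>\<alpha>. s * (norm (c \<alpha>) * r ^ mdeg \<alpha>)) has_sum s * W) ?I" by (rule has_sum_cmult_right[OF c(2)])
    have sm: "(\<lambda>\<alpha>. norm (c \<alpha>) * r' ^ mdeg \<alpha>) summable_on ?I"
    proof -
      have "(\<lambda>\<alpha>. norm (c \<alpha>) * r' ^ mdeg \<alpha>) abs_summable_on ?I"
      proof (rule Infinite_Sum.abs_summable_on_comparison_test)
        show "(\<lambda>\<alpha>. s * (norm (c \<alpha>) * r ^ mdeg \<alpha>)) abs_summable_on ?I"
          by (rule summable_on_iff_abs_summable_on_real[THEN iffD1, OF has_sum_imp_summable[OF sum]])
        fix \<alpha> assume "\<alpha> \<in> ?I"
        have "0 \<le> norm (c \<alpha>) * r' ^ mdeg \<alpha>" using r' by simp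
        then show "norm (norm (c \<alpha>) * r' ^ mdeg \<alpha>) \<le> norm (s * (norm (c \<alpha>) * r ^ mdeg \<alpha>))"
          using le[OF \<open>\<alpha> \<in> ?I\<close>] by (simp only: real_norm_def)
      qed
      then show ?thesis by (rule summable_on_iff_abs_summable_on_real[THEN iffD2])
    qed
    have "infsum (\<lambda>\<alpha>. norm (c \<alpha>) * r' ^ mdeg \<alpha>) ?I \<le> s * W"
      using infsum_mono[OF sm has_sum_imp_summable[OF sum] le] infsumI[OF sum] by simp
    also have "\<dots> \<le> s * B" using s c(3) by (intro mult_left_mono) auto
    finally show ?thesis unfolding power_series_on_def using r'(1) sm c(5) sub by blast
  qed
  have "power_series_on a r' (1 * B) f"
    by (rule gen) (use r' in \<open>auto intro!: mult_left_mono power_mono\<close>)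
  then show "power_series_on a r' B f" by simp
  show "power_series_on a r' ((r' / r) * B) f" if fa: "f a = 0"
  proof (rule gen)
    show "0 \<le> r' / r" using r' c(1) by simp
    let ?z = "restrict (\<lambda>_. 0) Basis :: 'a \<Rightarrow> nat"
    have zI: "?z \<in> ?I" by (simp add: multi_indices_def)
    have "c ?z = 0"
    proof -
      have a: "a \<in> cube_at a r" using c(1) by (simp add: cube_at_def)
      have m: "monomial (a - a) \<alpha> *\<^sub>R c \<alpha> = 0" if "\<alpha> \<in> ?I - {?z}" for \<alpha>
      proof -
        have "mdeg \<alpha> \<noteq> 0" using that mdeg_eq_0[of \<alpha>] by auto
        then obtain b where "b \<in> Basis" "\<alpha> b \<noteq> 0" by (auto simp: mdeg_def)
        then have "monomial (a - a) \<alpha> = 0" by (auto simp: monomial_def)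
        then show ?thesis by simp
      qed
      have "((\<lambda>\<alpha>. monomial (a - a) \<alpha> *\<^sub>R c \<alpha>) has_sum (\<Sum>\<alpha>\<in>{?z}. monomial (a - a) \<alpha> *\<^sub>R c \<alpha>)) ?I"
        by (rule has_sum_cong_neutral[THEN iffD1, OF _ _ _ has_sum_finite[of "{?z}"]]) (use m zI in auto)
      moreover have "((\<lambda>\<alpha>. monomial (a - a) \<alpha> *\<^sub>R c \<alpha>) has_sum 0) ?I" using c(5) a fa by metis
      ultimately have "(\<Sum>\<alpha>\<in>{?z}. monomial (a - a) \<alpha> *\<^sub>R c \<alpha>) = 0" by (rule has_sum_unique)
      then show ?thesis by (simp add: monomial_def)
    qed
    fix \<alpha> assume \<alpha>: "\<alpha> \<in> ?I"
    show "norm (c \<alpha>) * r' ^ mdeg \<alpha> \<le> (r' / r) * (norm (c \<alpha>) * r ^ mdeg \<alpha>)"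
    proof (cases "mdeg \<alpha>")
      case 0
      then have "c \<alpha> = 0" using \<open>c ?z = 0\<close> mdeg_eq_0[OF \<alpha>] by simp
      then show ?thesis by simp
    next
      case (Suc j)
      have "r' ^ mdeg \<alpha> \<le> r' * r ^ j" unfolding Suc using r' by (auto intro!: mult_left_mono power_mono)
      also have "\<dots> = (r' / r) * r ^ mdeg \<alpha>" unfolding Suc using c(1) by simp
      finally have "norm (c \<alpha>) * r' ^ mdeg \<alpha> \<le> norm (c \<alpha>) * ((r' / r) * r ^ mdeg \<alpha>)"
        by (rule mult_left_mono) simp
      then show ?thesis by (simp only: mult_ac)
    qed
  qed
qed

section \<open>Analyticity at a point\<close>

definition analytic_at_pt :: "'a::euclidean_space \<Rightarrow> ('a \<Rightarrow> 'b::euclidean_space) \<Rightarrow> bool" where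
  "analytic_at_pt a f \<longleftrightarrow> (\<exists>r B. power_series_on a r B f)"

lemma analytic_at_pt_const: "analytic_at_pt a (\<lambda>x. v)"
  using power_series_on_const[of 1 a v] unfolding analytic_at_pt_def by (metis zero_less_one)

lemma analytic_at_pt_common:
  assumes "analytic_at_pt a f" "analytic_at_pt a g"
  obtains r B B' where "power_series_on a r B f" "power_series_on a r B' g"
proof -
  obtain r B r' B' where *: "power_series_on a r B f" "power_series_on a r' B' g"
    using assms by (auto simp: analytic_at_pt_def)
  then have "0 < min r r'" by (simp add: power_series_on_def)
  then show ?thesis
    using that power_series_on_shrink(1)[OF *(1), of "min r r'"] power_series_on_shrink(1)[OF *(2), of "min r r'"] by auto
qed

lemma analytic_at_pt_add: "analytic_at_pt a f \<Longrightarrow> analytic_at_pt a g \<Longrightarrow> analytic_at_pt a (\<lambda>x. f x + g x)"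
  by (erule (1) analytic_at_pt_common) (auto simp: analytic_at_pt_def dest: power_series_on_add)

lemma analytic_at_pt_scaleR: "analytic_at_pt a f \<Longrightarrow> analytic_at_pt a g \<Longrightarrow> analytic_at_pt a (\<lambda>x. f x *\<^sub>R g x)"
  by (erule (1) analytic_at_pt_common) (auto simp: analytic_at_pt_def dest: power_series_on_scaleR)

lemma analytic_at_pt_mult:
  fixes f g :: "'a::euclidean_space \<Rightarrow> real"
  shows "analytic_at_pt a f \<Longrightarrow> analytic_at_pt a g \<Longrightarrow> analytic_at_pt a (\<lambda>x. f x * g x)"
  using analytic_at_pt_scaleR[of a f g] by simp

lemma analytic_at_pt_sum: "(\<And>i. i \<in> J \<Longrightarrow> analytic_at_pt a (f i)) \<Longrightarrow> analytic_at_pt a (\<lambda>x. \<Sum>i\<in>J. f i x)"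
  by (induction J rule: infinite_finite_induct) (auto intro: analytic_at_pt_const analytic_at_pt_add)

lemma analytic_at_pt_power:
  fixes f :: "'a::euclidean_space \<Rightarrow> real"
  shows "analytic_at_pt a f \<Longrightarrow> analytic_at_pt a (\<lambda>x. f x ^ n)"
  by (induction n) (auto intro: analytic_at_pt_const analytic_at_pt_mult)

lemma analytic_at_pt_coordinate:
  assumes "b \<in> Basis"
  shows "analytic_at_pt a (\<lambda>x. x \<bullet> b)"
proof -
  have "analytic_at_pt a (\<lambda>x. (x - a) \<bullet> b)"
    using power_series_on_coordinate[of 1 b a] assms unfolding analytic_at_pt_def by (metis zero_less_one)
  from analytic_at_pt_add[OF this analytic_at_pt_const[of a "a \<bullet> b"]]
  show ?thesis by (simp add: inner_diff_left)
qed

lemma analytic_at_pt_inner_self: "analytic_at_pt a (\<lambda>x::'a::euclidean_space. x \<bullet> x)"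
proof -
  have "(\<lambda>x::'a. x \<bullet> x) = (\<lambda>x. \<Sum>b\<in>Basis. (x \<bullet> b) * (x \<bullet> b))" by (rule ext) (rule euclidean_inner)
  moreover have "analytic_at_pt a (\<lambda>x::'a. \<Sum>b\<in>Basis. (x \<bullet> b) * (x \<bullet> b))"
    by (intro analytic_at_pt_sum analytic_at_pt_mult analytic_at_pt_coordinate)
  ultimately show ?thesis by metis
qed

lemma analytic_at_pt_real_polynomial:
  assumes "real_polynomial_function (f :: 'a::euclidean_space \<Rightarrow> real)"
  shows "analytic_at_pt a f"
  using assms
proof (induction rule: real_polynomial_function.induct)
  case (linear f)
  have "f = (\<lambda>x. \<Sum>b\<in>Basis. (x \<bullet> b) * f b)"
  proof
    fix x
    have l: "linear f" using linear by (rule bounded_linear.linear)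
    have "f x = f (\<Sum>b\<in>Basis. (x \<bullet> b) *\<^sub>R b)" by (simp add: euclidean_representation)
    also have "\<dots> = (\<Sum>b\<in>Basis. (x \<bullet> b) * f b)" by (simp add: linear_sum[OF l] linear_cmul[OF l])
    finally show "f x = (\<Sum>b\<in>Basis. (x \<bullet> b) * f b)" .
  qed
  moreover have "analytic_at_pt a (\<lambda>x. \<Sum>b\<in>Basis. (x \<bullet> b) * f b)"
    by (intro analytic_at_pt_sum analytic_at_pt_mult analytic_at_pt_coordinate analytic_at_pt_const)
  ultimately show ?case by metis
qed (auto intro: analytic_at_pt_const analytic_at_pt_add analytic_at_pt_mult)

lemma analytic_at_pt_cong:
  assumes "analytic_at_pt a f" "eventually (\<lambda>x. f x = g x) (nhds a)"
  shows "analytic_at_pt a g"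
proof -
  obtain r B where f: "power_series_on a r B f" using assms(1) by (auto simp: analytic_at_pt_def)
  have r: "r > 0" using f by (simp add: power_series_on_def)
  obtain d where d: "d > 0" "\<And>x. dist x a < d \<Longrightarrow> f x = g x" using assms(2) by (auto simp: eventually_nhds_metric)
  \<comment> \<open>The cube then lies in the ball of radius \<open>d\<close>: the norm is at most
    the sum of the coordinates, hence at most half of \<open>d\<close>.\<close>
  define r' where "r' = min r (d / (2 * real DIM('a)))"
  have r': "0 < r'" "r' \<le> r" using r d by (auto simp: r'_def)
  have "f x = g x" if x: "x \<in> cube_at a r'" for x
  proof (rule d(2))
    have "norm (x - a) \<le> (\<Sum>b\<in>Basis. \<bar>(x - a) \<bullet> b\<bar>)" by (rule norm_le_l1)
    also have "\<dots> \<le> (\<Sum>b\<in>(Basis::'a set). r')" using x by (intro sum_mono) (auto simp: cube_at_def)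
    also have "\<dots> = real DIM('a) * r'" by simp
    also have "\<dots> \<le> real DIM('a) * (d / (2 * real DIM('a)))" unfolding r'_def by (intro mult_left_mono) auto
    also have "\<dots> < d" using d by simp
    finally show "dist x a < d" by (simp add: dist_norm)
  qed
  then have "power_series_on a r' B g"
    using power_series_on_shrink(1)[OF f r'] unfolding power_series_on_def by (simp cong: ball_cong)
  then show ?thesis by (auto simp: analytic_at_pt_def)
qed

text \<open>After recentring, f - f a vanishes at \<open>a\<close>. Shrinking the cube brings its
  norm below \<open>e\<close>, which is smaller than both the convergence radius of \<open>A\<close>
  and the distance up to which \<open>A\<close> represents \<open>g\<close>.\<close>

lemma analytic_at_pt_compose:
  fixes f :: "'a::euclidean_space \<Rightarrow> real"
  assumes f: "analytic_at_pt a f" and g: "(\<lambda>s. g (f a + s)) has_fps_expansion A"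
  shows "analytic_at_pt a (\<lambda>x. g (f x))"
proof -
  have "analytic_at_pt a (\<lambda>x. f x + (- f a))" by (rule analytic_at_pt_add[OF f analytic_at_pt_const])
  then obtain r B where rB: "power_series_on a r B (\<lambda>x. f x + (- f a))" by (auto simp: analytic_at_pt_def)
  have r: "r > 0" using rB by (simp add: power_series_on_def)
  obtain c W where "W \<le> B" "0 \<le> W" using rB by (rule power_series_onE)
  then have B: "B \<ge> 0" by simp
  have A: "fps_conv_radius A > 0" "eventually (\<lambda>s. eval_fps A s = g (f a + s)) (nhds 0)"
    using g by (auto simp: has_fps_expansion_def)
  obtain d where d: "d > 0" "\<And>s. \<bar>s\<bar> < d \<Longrightarrow> eval_fps A s = g (f a + s)"
    using A(2) by (auto simp: eventually_nhds_metric dist_real_def)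
  obtain R where R: "0 < R" "ereal R < fps_conv_radius A" using ereal_dense2[OF A(1)] by (auto simp: zero_ereal_def)
  define e where "e = min R (d / 2)"
  have e: "e > 0" "ereal e < fps_conv_radius A" "e < d"
  proof -
    show "e > 0" "e < d" using R d by (auto simp: e_def)
    have "ereal e \<le> ereal R" by (simp add: e_def)
    then show "ereal e < fps_conv_radius A" using R(2) by (rule le_less_trans)
  qed
  define r' where "r' = min r (r * e / (B + 1))"
  have r': "0 < r'" "r' \<le> r" using r e B by (auto simp: r'_def intro!: divide_pos_pos)
  have "(r' / r) * B \<le> e"
  proof -
    have "r' \<le> r * e / (B + 1)" by (simp add: r'_def)
    then have "r' / r \<le> e / (B + 1)" using r B by (simp add: field_simps)
    then have "(r' / r) * B \<le> (e / (B + 1)) * B" using B by (rule mult_right_mono)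
    also have "\<dots> = e * (B / (B + 1))" by simp
    also have "\<dots> \<le> e * 1" using e B by (intro mult_left_mono) auto
    finally show ?thesis by simp
  qed
  moreover have psr: "power_series_on a r' ((r' / r) * B) (\<lambda>x. f x + (- f a))"
    by (rule power_series_on_shrink(2)[OF rB r']) simp
  ultimately have ps: "power_series_on a r' e (\<lambda>x. f x + (- f a))"
    unfolding power_series_on_def by (meson order_trans)
  obtain B' where B': "power_series_on a r' B' (\<lambda>x. eval_fps A (f x + (- f a)))"
    using power_series_on_compose[OF ps _ e(2)] e(1) by auto
  have "eval_fps A (f x + (- f a)) = g (f x)" if "x \<in> cube_at a r'" for x
  proof -
    have "\<bar>f x - f a\<bar> \<le> e" using ps by (rule power_series_onE) (use that in force)
    then show ?thesis using d(2)[of "f x - f a"] e(3) by simp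
  qed
  then have "power_series_on a r' B' (\<lambda>x. g (f x))"
    using B' unfolding power_series_on_def by (simp cong: ball_cong)
  then show ?thesis by (auto simp: analytic_at_pt_def)
qed

lemma analytic_at_pt_imp_real_analytic_on:
  assumes "open U" "\<And>a. a \<in> U \<Longrightarrow> analytic_at_pt a f"
  shows "real_analytic_on U f"
  unfolding real_analytic_on_def
proof
  fix a assume a: "a \<in> U"
  obtain r B where "power_series_on a r B f" using assms(2)[OF a] by (auto simp: analytic_at_pt_def)
  then obtain c where c: "r > 0" "\<forall>x\<in>cube_at a r. ((\<lambda>\<alpha>. monomial (x - a) \<alpha> *\<^sub>R c \<alpha>) has_sum f x) multi_indices"
    by (rule power_series_onE)
  obtain e where e: "e > 0" "ball a e \<subseteq> U" using assms(1) a openE by blast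
  have "x \<in> cube_at a r" if "x \<in> ball a (min r e)" for x
  proof -
    have "norm (x - a) < r" using that by (simp add: dist_norm norm_minus_commute)
    then show ?thesis unfolding cube_at_def using Basis_le_norm[of _ "x - a"] by force
  qed
  then show "\<exists>r>0. \<exists>c. ball a r \<subseteq> U \<and> (\<forall>x\<in>ball a r.
      ((\<lambda>\<alpha>. (\<Prod>b\<in>Basis. ((x - a) \<bullet> b) ^ \<alpha> b) *\<^sub>R c \<alpha>) has_sum f x) (Basis \<rightarrow>\<^sub>E UNIV))"
    using c e unfolding monomial_def multi_indices_def
    by (intro exI[of _ "min r e"] conjI exI[of _ c]) auto
qed

section \<open>Profile functions and the Dirichlet problem\<close>

lemma Ck_on_Un: "Ck_on k U f \<Longrightarrow> Ck_on k V f \<Longrightarrow> open U \<Longrightarrow> open V \<Longrightarrow> Ck_on k (U \<union> V) f"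
  by (induction k arbitrary: f) (auto intro: continuous_on_open_Un)

lemma Cinf_Un: "Cinf U f \<Longrightarrow> Cinf V f \<Longrightarrow> Cinf (U \<union> V) f"
  by (simp add: Cinf_def Ck_on_Un open_Un)

text \<open>The series is that of ln y + ln (1 + s/y). Evaluating it only for |s| < y/2 is enough
  for a local expansion and permits comparison with a geometric series of ratio 1/2.\<close>

lemma has_fps_expansion_ln_shift:
  assumes "y > (0::real)"
  shows "\<exists>A. (\<lambda>s. ln (y + s)) has_fps_expansion A"
proof -
  define A where "A = Abs_fps (\<lambda>n. if n = 0 then ln y else (-1) ^ (n - 1) / (real n * y ^ n))"
  have bound: "\<bar>fps_nth A (Suc n)\<bar> \<le> 1 / y ^ Suc n" for n
  proof -
    have "\<bar>fps_nth A (Suc n)\<bar> = 1 / (real (Suc n) * y ^ Suc n)"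
      using assms by (simp add: A_def abs_mult power_abs)
    also have "\<dots> \<le> 1 / (1 * y ^ Suc n)"
      using assms by (intro divide_left_mono mult_right_mono mult_pos_pos) auto
    finally show ?thesis by simp
  qed
  have "summable (\<lambda>n. fps_nth A (Suc n) * (y / 2) ^ Suc n)"
  proof (rule summable_comparison_test')
    show "summable (\<lambda>n. (1 / 2 :: real) ^ Suc n)" by (simp add: summable_Suc_iff summable_geometric)
    fix n :: nat
    have "\<bar>fps_nth A (Suc n)\<bar> * (y / 2) ^ Suc n \<le> (1 / y ^ Suc n) * (y / 2) ^ Suc n"
      using assms bound[of n] by (intro mult_right_mono) auto
    also have "\<dots> = (1 / 2) ^ Suc n" using assms by (simp add: power_divide)
    finally show "norm (fps_nth A (Suc n) * (y / 2) ^ Suc n) \<le> (1 / 2) ^ Suc n"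
      using assms by (simp add: abs_mult power_abs)
  qed
  then have "summable (\<lambda>n. fps_nth A n * (y / 2) ^ n)" by (subst (asm) summable_Suc_iff)
  from conv_radius_geI[OF this] have R: "fps_conv_radius A \<ge> ereal (y / 2)"
    using assms by (simp add: fps_conv_radius_def)
  have "eval_fps A s = ln (y + s)" if s: "\<bar>s\<bar> < y / 2" for s
  proof -
    have "ereal (norm s) < fps_conv_radius A"
      by (rule less_le_trans[OF _ R]) (use s in simp)
    then have sm: "summable (\<lambda>n. fps_nth A n * s ^ n)" by (rule summable_fps)
    have "1 + s / y > 0" "1 + s / y < 2" using s assms by (auto simp: field_simps abs_if split: if_splits)
    then have "ln (1 + s / y) = (\<Sum>n. (-1) ^ n * (1 / real (n + 1)) * (1 + s / y - 1) ^ Suc n)"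
      by (rule ln_series)
    also have "\<dots> = (\<Sum>n. fps_nth A (Suc n) * s ^ Suc n)"
      by (rule suminf_cong) (simp add: A_def power_divide)
    also have "\<dots> = eval_fps A s - ln y"
      using suminf_split_head[OF sm] by (simp add: eval_fps_def A_def)
    finally have "eval_fps A s = ln y + ln (1 + s / y)" by simp
    also have "\<dots> = ln (y * (1 + s / y))" using assms \<open>1 + s / y > 0\<close> by (simp add: ln_mult)
    also have "y * (1 + s / y) = y + s" using assms by (simp add: field_simps)
    finally show ?thesis .
  qed
  then have "eventually (\<lambda>s. eval_fps A s = ln (y + s)) (nhds 0)"
    using assms by (auto simp: eventually_nhds_metric dist_real_def intro!: exI[of _ "y / 2"])
  moreover have "fps_conv_radius A > 0" using R assms by (auto intro: less_le_trans[rotated])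
  ultimately show ?thesis by (auto simp: has_fps_expansion_def)
qed

lemma has_fps_expansion_exp_shift: "(\<lambda>s. exp (y + s :: real)) has_fps_expansion fps_const (exp y) * fps_exp 1"
proof -
  have "(\<lambda>s. exp y * exp (1 * s :: real)) has_fps_expansion fps_const (exp y) * fps_exp 1"
    by (intro has_fps_expansion_cmult_left has_fps_expansion_exp)
  then show ?thesis by (simp add: exp_add)
qed

lemma Cinf_ln: "Cinf {0<..} (ln :: real \<Rightarrow> real)"
  by (rule Cinf_locally_power_series) (auto intro: has_fps_expansion_ln_shift)

lemma Cinf_exp: "Cinf UNIV (exp :: real \<Rightarrow> real)"
  by (rule Cinf_locally_power_series) (auto intro: has_fps_expansion_exp_shift)

lemma Cinf_eval_fps:
  assumes "fps_conv_radius A \<ge> ereal \<delta>"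
  shows "Cinf {-\<delta><..<\<delta>} (eval_fps A :: real \<Rightarrow> real)"
proof -
  define g where "g k = eval_fps ((fps_deriv ^^ k) A)" for k
  have R: "fps_conv_radius ((fps_deriv ^^ k) A) \<ge> ereal \<delta>" for k
    by (induction k) (use assms fps_conv_radius_deriv order_trans in auto)
  have "Cinf {-\<delta><..<\<delta>} (g 0)"
  proof (rule Cinf_has_real_derivative)
    fix k x assume x: "x \<in> {-\<delta><..<\<delta>}"
    have "ereal (norm x) < fps_conv_radius ((fps_deriv ^^ k) A)"
      by (rule less_le_trans[OF _ R[of k]]) (use x in \<open>auto simp: abs_less_iff\<close>)
    from has_field_derivative_eval_fps[OF this, of UNIV]
    show "(g k has_real_derivative g (Suc k) x) (at x)" by (simp add: g_def)
  qed simp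
  then show ?thesis by (simp add: g_def)
qed

lemma Cinf_real_derivatives:
  fixes G :: "real \<Rightarrow> real"
  assumes "Cinf V G"
  obtains G1 G2 where "\<And>y. y \<in> V \<Longrightarrow> (G has_real_derivative G1 y) (at y)"
    "\<And>y. y \<in> V \<Longrightarrow> (G1 has_real_derivative G2 y) (at y)"
proof -
  have *: "(H has_real_derivative dd H y 1) (at y)" if H: "Cinf V H" and y: "y \<in> V" for H y
  proof -
    have "dd H y = (\<lambda>h. dd H y 1 * h)"
    proof
      fix h :: real
      have "dd H y (h *\<^sub>R 1) = h *\<^sub>R dd H y 1" by (rule linear_cmul[OF linear_dd[OF H y]])
      then show "dd H y h = dd H y 1 * h" by (simp add: mult.commute)
    qed
    then show ?thesis using dd_deriv[OF H y] by (simp add: has_field_derivative_def)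
  qed
  show ?thesis
    by (rule that[of "\<lambda>y. dd G y 1" "\<lambda>y. dd (\<lambda>y. dd G y 1) y 1"])
      (auto intro: * assms dd_Cinf)
qed

section \<open>Rescaled profile functions\<close>

context profile_ode
begin

text \<open>For each time \<tau> with \<phi>(\<tau>) = x0, shifting time by \<tau> is a dilation of
  the profile curve that moves the crossing to r = 1. \<open>G \<tau>\<close> is determined by r^k
  G(r^2) = r \<phi>(ln r + \<tau>); its value at 0 remembers \<tau>.\<close>

lemma profile_functions:
  assumes x0: "x0 > 0" "1 + L * x0\<^sup>2 = p * (L - 1)"
    and disc: "(1 + (1 + x0\<^sup>2) * (1 + p / (1 + L * x0\<^sup>2)))\<^sup>2 < 4 * ((1 + x0\<^sup>2) * (L * x0 * (x0 + x0)) / (1 + L * x0\<^sup>2))"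
  shows "\<exists>J G. infinite J \<and> (\<forall>\<tau>\<in>J. G \<tau> 1 = x0 \<and> G \<tau> 0 = exp (\<kappa> * \<tau>) \<and>
    (\<forall>a::'a::euclidean_space. analytic_at_pt a (\<lambda>x. G \<tau> (x \<bullet> x))) \<and>
    (\<exists>V G1 G2. {0..} \<subseteq> V \<and> Cinf V (G \<tau>) \<and>
      (\<forall>y\<in>V. (G \<tau> has_real_derivative G1 y) (at y) \<and> (G1 has_real_derivative G2 y) (at y)) \<and>
      (\<forall>r \<rho> \<rho>1 \<rho>2. 0 < r \<longrightarrow> \<rho> = r ^ k * G \<tau> (r\<^sup>2) \<longrightarrow>
        \<rho>1 = real k * r ^ (k - 1) * G \<tau> (r\<^sup>2) + 2 * r ^ (k + 1) * G1 (r\<^sup>2) \<longrightarrow>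
        \<rho>2 = real k * (real k - 1) * r ^ (k - 2) * G \<tau> (r\<^sup>2) + (4 * real k + 2) * r ^ k * G1 (r\<^sup>2)
          + 4 * r ^ (k + 2) * G2 (r\<^sup>2) \<longrightarrow>
        \<rho>2 / (1 + \<rho>1\<^sup>2) + \<rho>1 / r + p * (\<rho>1 / r - L * \<rho> / r\<^sup>2) / (1 + L * (\<rho> / r)\<^sup>2) = 0)))"
  (is "\<exists>J G. infinite J \<and> (\<forall>\<tau>\<in>J. ?Q G \<tau>)")
proof -
  obtain \<delta> A T0 \<phi> \<sigma> C where g: "\<delta> > 0" "fps_conv_radius A \<ge> ereal \<delta>" "eval_fps A 0 = 1"
    "exp (2 * \<kappa> * T0) = \<delta>" "\<forall>t<T0. \<phi> t = exp (\<kappa> * t) * eval_fps A (exp (2 * \<kappa> * t))"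
    "sol UNIV \<phi> \<sigma>" "\<forall>t. \<phi> t > 0 \<and> \<sigma> t > 0" "\<forall>t\<ge>T0. \<phi> t \<le> C \<and> \<sigma> t \<le> C"
    using global_solution by blast
  define J where "J = {t. \<phi> t = x0}"
  have J: "infinite J" unfolding J_def
    by (rule oscillation[OF g(6) _ _ _ _ x0 disc, of T0 C]) (use g(7,8) in auto)
  have A: "fps_conv_radius A > 0" by (rule less_le_trans[OF _ g(2)]) (use g(1) in auto)
  have expA: "(\<lambda>s. eval_fps A (0 + s)) has_fps_expansion A"
    using A by (simp add: eval_fps_has_fps_expansion)
  define m where "m = k - 1"
  have m: "m > 0" "real m = \<kappa>" "k = Suc m" using k by (auto simp: m_def \<kappa>_def of_nat_diff)
  define e where "e \<tau> = exp (\<kappa> * \<tau>)" for \<tau>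
  \<comment> \<open>\<open>out\<close> is the formula for y > 0, and \<open>inn\<close> is its power
    series form near 0, which also makes sense for y \<le> 0. Using \<open>inn\<close> there extends
    \<open>G\<close> smoothly across 0, so that ordinary two-sided derivatives exist at the
    origin.\<close>
  define inn where "inn \<tau> y = e \<tau> * eval_fps A ((e \<tau>)\<^sup>2 * y ^ m)" for \<tau> y
  define out where "out \<tau> y = \<phi> (ln y * (1 / 2) + \<tau>) * exp (ln y * (- \<kappa> / 2))" for \<tau> y
  define G where "G \<tau> y = (if y \<le> 0 then inn \<tau> y else out \<tau> y)" for \<tau> y
  have d: "(\<phi> has_real_derivative \<sigma> t - \<phi> t) (at t)" "(\<sigma> has_real_derivative slope_field (\<phi> t) (\<sigma> t)) (at t)" for t
    using g(6) by (auto simp: sol_def)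
  have "G \<tau> 1 = x0 \<and> G \<tau> 0 = exp (\<kappa> * \<tau>) \<and>
    (\<forall>a::'a::euclidean_space. analytic_at_pt a (\<lambda>x. G \<tau> (x \<bullet> x))) \<and>
    (\<exists>V G1 G2. {0..} \<subseteq> V \<and> Cinf V (G \<tau>) \<and>
      (\<forall>y\<in>V. (G \<tau> has_real_derivative G1 y) (at y) \<and> (G1 has_real_derivative G2 y) (at y)) \<and>
      (\<forall>r \<rho> \<rho>1 \<rho>2. 0 < r \<longrightarrow> \<rho> = r ^ k * G \<tau> (r\<^sup>2) \<longrightarrow>
        \<rho>1 = real k * r ^ (k - 1) * G \<tau> (r\<^sup>2) + 2 * r ^ (k + 1) * G1 (r\<^sup>2) \<longrightarrow>
        \<rho>2 = real k * (real k - 1) * r ^ (k - 2) * G \<tau> (r\<^sup>2) + (4 * real k + 2) * r ^ k * G1 (r\<^sup>2)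
          + 4 * r ^ (k + 2) * G2 (r\<^sup>2) \<longrightarrow>
        \<rho>2 / (1 + \<rho>1\<^sup>2) + \<rho>1 / r + p * (\<rho>1 / r - L * \<rho> / r\<^sup>2) / (1 + L * (\<rho> / r)\<^sup>2) = 0))"
    if \<tau>: "\<tau> \<in> J" for \<tau>
  proof (intro conjI allI)
    show "G \<tau> 1 = x0" using \<tau> by (simp add: G_def out_def J_def)
    show "G \<tau> 0 = exp (\<kappa> * \<tau>)" using m(1) g(3) by (simp add: G_def inn_def e_def zero_power)
    have "continuous_on UNIV (\<lambda>y. (e \<tau>)\<^sup>2 * y ^ m)" by (intro continuous_intros)
    then have "isCont (\<lambda>y. (e \<tau>)\<^sup>2 * y ^ m) 0" by (simp add: continuous_on_eq_continuous_at)
    then obtain \<eta> where \<eta>: "\<eta> > 0" "\<And>y. \<bar>y\<bar> < \<eta> \<Longrightarrow> \<bar>(e \<tau>)\<^sup>2 * y ^ m\<bar> < \<delta>"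
      using m(1) g(1) by (auto simp: continuous_at_eps_delta zero_power)
    \<comment> \<open>For small positive \<open>y\<close> the time ln(y)/2 + \<tau> lies before
      \<open>T0\<close>, where \<phi> is given by the germ, and the exponential factors
      cancel.\<close>
    have Ginn: "G \<tau> y = inn \<tau> y" if y: "\<bar>y\<bar> < \<eta>" for y
    proof (cases "y \<le> 0")
      case True
      then show ?thesis by (simp add: G_def)
    next
      case False
      define t where "t = ln y * (1 / 2) + \<tau>"
      have ym: "y ^ m = exp (\<kappa> * ln y)" using False by (simp add: m(2)[symmetric] exp_of_nat_mult)
      have z2: "exp (2 * \<kappa> * t) = (e \<tau>)\<^sup>2 * y ^ m"
        unfolding ym e_def t_def power2_eq_square exp_add[symmetric] by (simp add: algebra_simps)
      have "exp (2 * \<kappa> * t) < exp (2 * \<kappa> * T0)" unfolding z2 g(4) using \<eta>(2)[OF y] by simp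
      then have "t < T0" using \<kappa>_ge by simp
      then have "\<phi> t = exp (\<kappa> * t) * eval_fps A ((e \<tau>)\<^sup>2 * y ^ m)" using g(5) z2 by simp
      moreover have "exp (\<kappa> * t) * exp (ln y * (- \<kappa> / 2)) = e \<tau>"
        unfolding e_def t_def exp_add[symmetric] by (simp add: algebra_simps)
      ultimately show ?thesis using False by (simp add: G_def out_def inn_def t_def mult_ac)
    qed
    have "analytic_at_pt a (\<lambda>x. G \<tau> (x \<bullet> x))" for a :: 'a
    proof (cases "a = 0")
      case True
      have "analytic_at_pt a (\<lambda>x. e \<tau> * eval_fps A ((e \<tau>)\<^sup>2 * (x \<bullet> x) ^ m))"
      proof (intro analytic_at_pt_mult analytic_at_pt_const)
        show "analytic_at_pt a (\<lambda>x. eval_fps A ((e \<tau>)\<^sup>2 * (x \<bullet> x) ^ m))"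
          by (rule analytic_at_pt_compose[where A=A])
            (use expA True m(1) in \<open>auto intro!: analytic_at_pt_mult analytic_at_pt_power analytic_at_pt_const
                analytic_at_pt_inner_self simp: zero_power\<close>)
      qed
      moreover have "eventually (\<lambda>x. e \<tau> * eval_fps A ((e \<tau>)\<^sup>2 * (x \<bullet> x) ^ m) = G \<tau> (x \<bullet> x)) (nhds a)"
      proof -
        have "((\<lambda>x. x \<bullet> x) \<longlongrightarrow> a \<bullet> a) (nhds a)"
          by (rule tendsto_inner[OF filterlim_ident filterlim_ident])
        then have "eventually (\<lambda>x. x \<bullet> x < \<eta>) (nhds a)" using \<eta>(1) True by (intro order_tendstoD(2)) auto
        then show ?thesis by eventually_elim (simp add: Ginn inn_def)
      qed
      ultimately show ?thesis by (rule analytic_at_pt_cong)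
    next
      case False
      then have aa: "a \<bullet> a > 0" by simp
      obtain Al where Al: "(\<lambda>s. ln (a \<bullet> a + s)) has_fps_expansion Al" using has_fps_expansion_ln_shift[OF aa] by blast
      have l: "analytic_at_pt a (\<lambda>x. ln (x \<bullet> x))" by (rule analytic_at_pt_compose[OF analytic_at_pt_inner_self Al])
      obtain Ap where Ap: "(\<lambda>s. \<phi> ((ln (a \<bullet> a) * (1 / 2) + \<tau>) + s)) has_fps_expansion Ap"
        using sol_analytic[OF g(6)] by blast
      have "analytic_at_pt a (\<lambda>x. \<phi> (ln (x \<bullet> x) * (1 / 2) + \<tau>))"
        by (rule analytic_at_pt_compose[OF analytic_at_pt_add[OF analytic_at_pt_mult[OF l analytic_at_pt_const] analytic_at_pt_const] Ap])
      moreover have "analytic_at_pt a (\<lambda>x. exp (ln (x \<bullet> x) * (- \<kappa> / 2)))"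
        by (rule analytic_at_pt_compose[OF analytic_at_pt_mult[OF l analytic_at_pt_const] has_fps_expansion_exp_shift])
      ultimately have "analytic_at_pt a (\<lambda>x. out \<tau> (x \<bullet> x))" unfolding out_def by (rule analytic_at_pt_mult)
      moreover have "eventually (\<lambda>x. out \<tau> (x \<bullet> x) = G \<tau> (x \<bullet> x)) (nhds a)"
      proof -
        have "eventually (\<lambda>x. x \<noteq> 0) (nhds a)" using False by (rule t1_space_nhds)
        then show ?thesis
        proof eventually_elim
          case (elim x)
          then have "x \<bullet> x > 0" by simp
          then show ?case by (simp add: G_def del: inner_gt_zero_iff)
        qed
      qed
      ultimately show ?thesis by (rule analytic_at_pt_cong)
    qed
    then show "analytic_at_pt a (\<lambda>x. G \<tau> (x \<bullet> x))" for a :: 'a .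
    define V where "V = {-\<eta><..}"
    have GV: "Cinf V (G \<tau>)"
    proof -
      have o: "open {-\<eta><..<\<eta>}" "open {0::real<..}" by auto
      have pw: "Cinf {-\<eta><..<\<eta>} (\<lambda>y. (e \<tau>)\<^sup>2 * y ^ m)"
        by (intro Cinf_mult[OF Cinf_const[OF o(1)]] Cinf_power Cinf_id o(1))
      have "Cinf {-\<eta><..<\<eta>} (inn \<tau>)" unfolding inn_def
        by (rule Cinf_mult[OF Cinf_const[OF o(1)] Cinf_compose[OF pw Cinf_eval_fps[OF g(2)]]])
          (use \<eta>(2) in \<open>force simp: abs_less_iff\<close>)
      then have 1: "Cinf {-\<eta><..<\<eta>} (G \<tau>)"
        by (rule Cinf_cong[THEN iffD1, rotated]) (use Ginn in \<open>auto simp: abs_less_iff\<close>)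
      have \<phi>: "Cinf UNIV \<phi>" by (rule Cinf_locally_power_series[OF open_UNIV sol_analytic[OF g(6)]])
      have "Cinf {0<..} (out \<tau>)" unfolding out_def
        by (rule Cinf_mult[OF Cinf_compose[OF Cinf_add[OF Cinf_mult[OF Cinf_ln Cinf_const[OF o(2)]] Cinf_const[OF o(2)]] \<phi>]
              Cinf_compose[OF Cinf_mult[OF Cinf_ln Cinf_const[OF o(2)]] Cinf_exp]]) auto
      then have 2: "Cinf {0<..} (G \<tau>)"
        by (rule Cinf_cong[THEN iffD1, rotated]) (auto simp: G_def)
      have "V = {-\<eta><..<\<eta>} \<union> {0<..}" using \<eta>(1) by (auto simp: V_def)
      then show ?thesis using Cinf_Un[OF 1 2] by simp
    qed
    obtain G1 G2 where G12: "\<And>y. y \<in> V \<Longrightarrow> (G \<tau> has_real_derivative G1 y) (at y)"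
      "\<And>y. y \<in> V \<Longrightarrow> (G1 has_real_derivative G2 y) (at y)"
      by (rule Cinf_real_derivatives[OF GV]) blast
    have V0: "{0..} \<subseteq> V" using \<eta>(1) by (auto simp: V_def)
    define t where "t r = ln r + \<tau>" for r :: real
    have dt: "(t has_real_derivative 1 / r) (at r)" if "r > 0" for r
      unfolding t_def[abs_def] using that by (auto intro!: derivative_eq_intros)
    have rG: "r ^ k * G \<tau> (r\<^sup>2) = r * \<phi> (t r)" if r: "r > 0" for r
    proof -
      have ln2: "ln (r\<^sup>2) = 2 * ln r" using r by (simp add: ln_realpow)
      have "r ^ m = exp (\<kappa> * ln r)" using r by (simp add: m(2)[symmetric] exp_of_nat_mult)
      then have "r ^ m * exp (- (\<kappa> * ln r)) = 1" by (simp add: exp_minus_inverse)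
      moreover have "G \<tau> (r\<^sup>2) = \<phi> (t r) * exp (- (\<kappa> * ln r))"
        using r by (simp add: G_def out_def ln2 t_def mult.commute)
      ultimately show ?thesis by (simp add: m(3))
    qed
    have r2V: "r\<^sup>2 \<in> V" for r :: real using V0 by auto
    have dG: "((\<lambda>r. G \<tau> (r\<^sup>2)) has_real_derivative G1 (r\<^sup>2) * (2 * r)) (at r)"
      "((\<lambda>r. G1 (r\<^sup>2)) has_real_derivative G2 (r\<^sup>2) * (2 * r)) (at r)" for r
    proof -
      have sq: "((\<lambda>r::real. r\<^sup>2) has_real_derivative 2 * r) (at r)" by (auto intro!: derivative_eq_intros)
      show "((\<lambda>r. G \<tau> (r\<^sup>2)) has_real_derivative G1 (r\<^sup>2) * (2 * r)) (at r)"
        by (rule DERIV_chain2[OF G12(1)[OF r2V] sq])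
      show "((\<lambda>r. G1 (r\<^sup>2)) has_real_derivative G2 (r\<^sup>2) * (2 * r)) (at r)"
        by (rule DERIV_chain2[OF G12(2)[OF r2V] sq])
    qed
    obtain j where j: "k = Suc (Suc j)" using that[of "k - 2"] k by simp
    \<comment> \<open>The derivatives of \<rho> are computed twice, through \<open>G\<close> as the
      graph computation wants them and through the planar system; uniqueness of derivatives
      identifies the results.\<close>
    define R1 where "R1 r = real k * r ^ (k - 1) * G \<tau> (r\<^sup>2) + 2 * r ^ (k + 1) * G1 (r\<^sup>2)" for r
    have R1: "R1 r = \<sigma> (t r)" if r: "r > 0" for r
    proof -
      have "((\<lambda>r. r ^ k * G \<tau> (r\<^sup>2)) has_real_derivative R1 r) (at r)"
        by (rule DERIV_cong[OF DERIV_mult[OF DERIV_power[OF DERIV_ident] dG(1)]]) (simp add: R1_def j algebra_simps)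
      then have 1: "((\<lambda>r. r * \<phi> (t r)) has_real_derivative R1 r) (at r)"
        by (rule has_field_derivative_transform_within_open[of _ _ _ "{0<..}"]) (use r rG in auto)
      have "((\<lambda>r. r * \<phi> (t r)) has_real_derivative \<sigma> (t r)) (at r)"
        by (rule DERIV_cong[OF DERIV_mult[OF DERIV_ident DERIV_chain2[OF d(1) dt[OF r]]]]) (use r in \<open>simp add: field_simps\<close>)
      then show ?thesis using DERIV_unique[OF 1] by simp
    qed
    define R2 where "R2 r = real k * (real k - 1) * r ^ (k - 2) * G \<tau> (r\<^sup>2) + (4 * real k + 2) * r ^ k * G1 (r\<^sup>2)
          + 4 * r ^ (k + 2) * G2 (r\<^sup>2)" for r
    have R2: "R2 r = slope_field (\<phi> (t r)) (\<sigma> (t r)) / r" if r: "r > 0" for r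
    proof -
      have "(R1 has_real_derivative R2 r) (at r)"
        unfolding R1_def[abs_def]
        by (rule DERIV_cong[OF DERIV_add[OF DERIV_mult[OF DERIV_cmult[OF DERIV_power[OF DERIV_ident]] dG(1)]
              DERIV_mult[OF DERIV_cmult[OF DERIV_power[OF DERIV_ident]] dG(2)]]]) (simp add: R2_def j algebra_simps power2_eq_square)
      then have 1: "((\<lambda>r. \<sigma> (t r)) has_real_derivative R2 r) (at r)"
        by (rule has_field_derivative_transform_within_open[of _ _ _ "{0<..}"]) (use r R1 in auto)
      have "((\<lambda>r. \<sigma> (t r)) has_real_derivative slope_field (\<phi> (t r)) (\<sigma> (t r)) * (1 / r)) (at r)"
        by (rule DERIV_chain2[OF d(2) dt[OF r]])
      then show ?thesis using DERIV_unique[OF 1] by simp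
    qed
    have ode: "\<rho>2 / (1 + \<rho>1\<^sup>2) + \<rho>1 / r + p * (\<rho>1 / r - L * \<rho> / r\<^sup>2) / (1 + L * (\<rho> / r)\<^sup>2) = 0"
      if r: "0 < r" and \<rho>: "\<rho> = r ^ k * G \<tau> (r\<^sup>2)" and \<rho>1: "\<rho>1 = R1 r" and \<rho>2: "\<rho>2 = R2 r" for r \<rho> \<rho>1 \<rho>2
    proof -
      define x y where "x = \<phi> (t r)" and "y = \<sigma> (t r)"
      have e1: "\<rho> = r * x" "\<rho>1 = y" "\<rho>2 = slope_field x y / r"
        using rG[OF r] R1[OF r] R2[OF r] \<rho> \<rho>1 \<rho>2 by (auto simp: x_def y_def)
      have y1: "1 + y\<^sup>2 \<noteq> 0" using add_pos_nonneg[of 1 "y\<^sup>2"] by simp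
      have "slope_field x y / (1 + y\<^sup>2) = - (y + p * (y - L * x) / (1 + L * x\<^sup>2))"
        using y1 by (simp add: slope_field_def)
      moreover have "\<rho>2 / (1 + \<rho>1\<^sup>2) = slope_field x y / (1 + y\<^sup>2) / r" unfolding e1 by simp
      moreover have "\<rho>1 / r - L * \<rho> / r\<^sup>2 = (y - L * x) / r" "\<rho> / r = x"
        unfolding e1 using r by (simp_all add: field_simps power2_eq_square)
      ultimately have "\<rho>2 / (1 + \<rho>1\<^sup>2) + \<rho>1 / r + p * (\<rho>1 / r - L * \<rho> / r\<^sup>2) / (1 + L * (\<rho> / r)\<^sup>2) =
        - (y + p * (y - L * x) / (1 + L * x\<^sup>2)) / r + y / r + p * ((y - L * x) / r) / (1 + L * x\<^sup>2)"
        using e1(2) by simp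
      also have "\<dots> = 0"
      proof -
        have eq: "p * ((y - L * x) / r) / (1 + L * x\<^sup>2) = p * (y - L * x) / (1 + L * x\<^sup>2) / r"
          by (simp add: mult.commute)
        have "- (y + a) / r + y / r + a / r = 0" for a by (simp add: divide_inverse algebra_simps)
        then show ?thesis unfolding eq .
      qed
      finally show ?thesis .
    qed
    show "\<exists>V G1 G2. {0..} \<subseteq> V \<and> Cinf V (G \<tau>) \<and>
      (\<forall>y\<in>V. (G \<tau> has_real_derivative G1 y) (at y) \<and> (G1 has_real_derivative G2 y) (at y)) \<and>
      (\<forall>r \<rho> \<rho>1 \<rho>2. 0 < r \<longrightarrow> \<rho> = r ^ k * G \<tau> (r\<^sup>2) \<longrightarrow>
        \<rho>1 = real k * r ^ (k - 1) * G \<tau> (r\<^sup>2) + 2 * r ^ (k + 1) * G1 (r\<^sup>2) \<longrightarrow>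
        \<rho>2 = real k * (real k - 1) * r ^ (k - 2) * G \<tau> (r\<^sup>2) + (4 * real k + 2) * r ^ k * G1 (r\<^sup>2)
          + 4 * r ^ (k + 2) * G2 (r\<^sup>2) \<longrightarrow>
        \<rho>2 / (1 + \<rho>1\<^sup>2) + \<rho>1 / r + p * (\<rho>1 / r - L * \<rho> / r\<^sup>2) / (1 + L * (\<rho> / r)\<^sup>2) = 0)"
      by (rule exI[of _ V], rule exI[of _ G1], rule exI[of _ G2], intro conjI V0 GV ballI allI impI G12)
        (use ode in \<open>simp_all only: R1_def R2_def\<close>)
  qed
  then have "\<forall>\<tau>\<in>J. ?Q G \<tau>" by (rule ballI)
  with J show ?thesis by (intro exI[of _ J] exI[of _ G] conjI)
qed

end

section \<open>Infinitely many solutions of the Dirichlet problem\<close>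

theorem corollary3p6:
  fixes f :: "'a::euclidean_space \<Rightarrow> 'b::euclidean_space"
    and n m p k :: nat
    and lambda \<phi>\<^sub>0 :: real
  assumes dim_domain: "DIM('a) = n + 1"
    and dim_target: "DIM('b) = m + 1"
    and type: "LOMSE_of_type n p k f"
    and cases: "(n = 3 \<and> p = 2 \<and> k \<ge> 4) \<or> (n = 5 \<and> p = 4 \<and> k \<ge> 6)"
    and lambda: "lambda > 0" "lambda\<^sup>2 = real k * (real k + real n - 1) / real p"
    and \<phi>\<^sub>0: "\<phi>\<^sub>0 = sqrt ((real p - real n * inverse (lambda\<^sup>2)) / (real n - real p))"
  shows "infinite (analytic_Dirichlet_solutions (\<lambda>x. \<phi>\<^sub>0 *\<^sub>R f x))"
proof -
  define q where "q = p div 2"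
  define L where "L = lambda\<^sup>2"
  have k3: "k \<ge> 3" using cases by auto
  have pq: "real p = 2 * real q" "q \<ge> 1" "real n = real p + 1" "p > 0" using cases by (auto simp: q_def)
  have pL: "real p * L = real k * (real k + real p)" using lambda(2) pq by (simp add: L_def)
  interpret ode: profile_ode q k L
    by unfold_locales (use k3 pq pL in auto)
  have op: "ode.p = real p" by (simp add: ode.p_def pq(1))
  have kp: "real k * (real k + real p) \<ge> (if p = 2 then 24 else 60)"
  proof -
    have "real k * (real k + real p) \<ge> (if p = 2 then 4 else 6) * ((if p = 2 then 4 else 6) + real p)"
      using cases by (intro mult_mono add_mono) auto
    then show ?thesis using cases by auto
  qed
  have L0: "L > 1" by (rule ode.L_gt)
  have \<phi>sq: "\<phi>\<^sub>0\<^sup>2 = real p - real n / L" and \<phi>pos: "\<phi>\<^sub>0 > 0"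
  proof -
    have "real n < real p * L" unfolding pL using kp cases by auto
    then have "real p - real n / L > 0" using L0 by (simp add: field_simps)
    moreover have "(real p - real n * inverse (lambda\<^sup>2)) / (real n - real p) = real p - real n / L"
      using pq by (simp add: L_def divide_inverse)
    ultimately show "\<phi>\<^sub>0\<^sup>2 = real p - real n / L" "\<phi>\<^sub>0 > 0" using \<phi>\<^sub>0 by simp_all
  qed
  have L\<phi>: "L * \<phi>\<^sub>0\<^sup>2 = real p * L - real n" unfolding \<phi>sq using L0 by (simp add: field_simps)
  \<comment> \<open>This is the equilibrium condition: for x > 0 the field vanishes at (x, x)
    exactly when 1 + L x^2 = p (L - 1).\<close>
  have D: "1 + L * \<phi>\<^sub>0\<^sup>2 = ode.p * (L - 1)" unfolding L\<phi> op using pq by (simp add: algebra_simps)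
  have disc: "(1 + (1 + \<phi>\<^sub>0\<^sup>2) * (1 + ode.p / (1 + L * \<phi>\<^sub>0\<^sup>2)))\<^sup>2 <
      4 * ((1 + \<phi>\<^sub>0\<^sup>2) * (L * \<phi>\<^sub>0 * (\<phi>\<^sub>0 + \<phi>\<^sub>0)) / (1 + L * \<phi>\<^sub>0\<^sup>2))"
  proof -
    have q1: "1 + \<phi>\<^sub>0\<^sup>2 = real n * (L - 1) / L" unfolding \<phi>sq using L0 pq(3) by (simp add: field_simps)
    have q2: "1 + ode.p / (1 + L * \<phi>\<^sub>0\<^sup>2) = L / (L - 1)"
      unfolding D using L0 pq(4) by (simp add: op field_simps)
    have l: "(1 + \<phi>\<^sub>0\<^sup>2) * (1 + ode.p / (1 + L * \<phi>\<^sub>0\<^sup>2)) = real n"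
      unfolding q1 q2 using L0 by simp
    have "L * \<phi>\<^sub>0 * (\<phi>\<^sub>0 + \<phi>\<^sub>0) = 2 * (L * \<phi>\<^sub>0\<^sup>2)" by (simp add: power2_eq_square)
    then have "(1 + \<phi>\<^sub>0\<^sup>2) * (L * \<phi>\<^sub>0 * (\<phi>\<^sub>0 + \<phi>\<^sub>0)) / (1 + L * \<phi>\<^sub>0\<^sup>2) =
        (real n * (L - 1) / L) * (2 * (real p * L - real n)) / (real p * (L - 1))"
      unfolding q1 by (simp only: L\<phi> D[unfolded L\<phi>] op)
    also have "\<dots> = 2 * real n * (real p * L - real n) / (real p * L)" using L0 pq(4) by (simp add: field_simps)
    also have "\<dots> = 2 * real n * (1 - real n / (real p * L))" using L0 pq(4) by (simp add: field_simps)
    finally have r: "(1 + \<phi>\<^sub>0\<^sup>2) * (L * \<phi>\<^sub>0 * (\<phi>\<^sub>0 + \<phi>\<^sub>0)) / (1 + L * \<phi>\<^sub>0\<^sup>2) =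
        2 * real n * (1 - real n / (real p * L))" .
    \<comment> \<open>The damping coefficient at the equilibrium is 1 + n and the restoring one 2 n
      (1 - n/(p L)). With the lower bounds 24 and 60 for p L the inequalities are 16 < 21 and 36 <
      110/3.\<close>
    have "(1 + real n)\<^sup>2 < 4 * (2 * real n * (1 - real n / (real p * L)))"
      using cases
    proof
      assume c: "n = 3 \<and> p = 2 \<and> k \<ge> 4"
      then have "real p * L \<ge> 24" unfolding pL using kp by simp
      then have "3 / (real p * L) \<le> 1 / 8" by (simp add: pos_divide_le_eq)
      then show ?thesis using c by simp
    next
      assume c: "n = 5 \<and> p = 4 \<and> k \<ge> 6"
      then have "real p * L \<ge> 60" unfolding pL using kp by simp
      then have "5 / (real p * L) \<le> 1 / 12" by (simp add: pos_divide_le_eq)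
      then show ?thesis using c by simp
    qed
    then show ?thesis unfolding l r .
  qed
  obtain J G where J: "infinite J" and G: "\<forall>\<tau>\<in>J. G \<tau> 1 = \<phi>\<^sub>0 \<and> G \<tau> 0 = exp (ode.\<kappa> * \<tau>) \<and>
    (\<forall>a::'a. analytic_at_pt a (\<lambda>x. G \<tau> (x \<bullet> x))) \<and>
    (\<exists>V G1 G2. {0..} \<subseteq> V \<and> Cinf V (G \<tau>) \<and>
      (\<forall>y\<in>V. (G \<tau> has_real_derivative G1 y) (at y) \<and> (G1 has_real_derivative G2 y) (at y)) \<and>
      (\<forall>r \<rho> \<rho>1 \<rho>2. 0 < r \<longrightarrow> \<rho> = r ^ k * G \<tau> (r\<^sup>2) \<longrightarrow>
        \<rho>1 = real k * r ^ (k - 1) * G \<tau> (r\<^sup>2) + 2 * r ^ (k + 1) * G1 (r\<^sup>2) \<longrightarrow>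
        \<rho>2 = real k * (real k - 1) * r ^ (k - 2) * G \<tau> (r\<^sup>2) + (4 * real k + 2) * r ^ k * G1 (r\<^sup>2)
          + 4 * r ^ (k + 2) * G2 (r\<^sup>2) \<longrightarrow>
        \<rho>2 / (1 + \<rho>1\<^sup>2) + \<rho>1 / r + ode.p * (\<rho>1 / r - L * \<rho> / r\<^sup>2) / (1 + L * (\<rho> / r)\<^sup>2) = 0))"
    using ode.profile_functions[OF \<phi>pos D disc, where ?'a='a] by blast
  obtain P where P: "homogeneous_sphere_map P k" and fP: "\<And>x. x \<in> sphere 0 1 \<Longrightarrow> f x = P x"
    and poly: "\<And>b. b \<in> Basis \<Longrightarrow> real_polynomial_function (\<lambda>x. P x \<bullet> b)"
    using LOMSE_of_type_polynomial[OF type k3] by blast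
  interpret hsm: homogeneous_sphere_map P k by fact
  \<comment> \<open>The value \<open>undefined\<close> outside the closed ball is what membership in
    \<open>extensional\<close> demands.\<close>
  define F where "F \<tau> x = (if x \<in> cball 0 1 then G \<tau> (x \<bullet> x) *\<^sub>R P x else undefined)" for \<tau> and x :: 'a
  have "F \<tau> \<in> analytic_Dirichlet_solutions (\<lambda>x. \<phi>\<^sub>0 *\<^sub>R f x)" if \<tau>: "\<tau> \<in> J" for \<tau>
  proof -
    obtain V G1 G2 where V: "{0..} \<subseteq> V" "Cinf V (G \<tau>)"
      and dG: "\<And>y. y \<in> V \<Longrightarrow> (G \<tau> has_real_derivative G1 y) (at y)" "\<And>y. y \<in> V \<Longrightarrow> (G1 has_real_derivative G2 y) (at y)"
      and de: "\<And>r \<rho> \<rho>1 \<rho>2. 0 < r \<Longrightarrow> \<rho> = r ^ k * G \<tau> (r\<^sup>2) \<Longrightarrow>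
        \<rho>1 = real k * r ^ (k - 1) * G \<tau> (r\<^sup>2) + 2 * r ^ (k + 1) * G1 (r\<^sup>2) \<Longrightarrow>
        \<rho>2 = real k * (real k - 1) * r ^ (k - 2) * G \<tau> (r\<^sup>2) + (4 * real k + 2) * r ^ k * G1 (r\<^sup>2)
          + 4 * r ^ (k + 2) * G2 (r\<^sup>2) \<Longrightarrow>
        \<rho>2 / (1 + \<rho>1\<^sup>2) + \<rho>1 / r + ode.p * (\<rho>1 / r - L * \<rho> / r\<^sup>2) / (1 + L * (\<rho> / r)\<^sup>2) = 0"
      using bspec[OF G \<tau>] by blast
    have G1: "G \<tau> 1 = \<phi>\<^sub>0" and an: "\<And>a::'a. analytic_at_pt a (\<lambda>x. G \<tau> (x \<bullet> x))"
      using bspec[OF G \<tau>] by blast+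
    have xx: "x \<bullet> x \<in> V" for x :: 'a using V(1) by auto
    have "F \<tau> \<in> extensional (cball 0 1)" by (auto simp: F_def extensional_def)
    moreover have "continuous_on (cball 0 1) (F \<tau>)"
    proof -
      have "isCont (\<lambda>x. G \<tau> (x \<bullet> x) *\<^sub>R P x) x" for x
      proof (rule continuous_scaleR)
        have "isCont (\<lambda>x. x \<bullet> x) x" by (intro continuous_intros)
        then show "isCont (\<lambda>x. G \<tau> (x \<bullet> x)) x" by (rule isCont_o2) (rule DERIV_isCont[OF dG(1)[OF xx]])
        show "isCont P x" by (rule has_derivative_continuous[OF dd_deriv[OF hsm.P UNIV_I]])
      qed
      then have "continuous_on (cball 0 1) (\<lambda>x. G \<tau> (x \<bullet> x) *\<^sub>R P x)" by (simp add: continuous_at_imp_continuous_on)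
      then show ?thesis by (rule continuous_on_cong[THEN iffD1, rotated 2]) (auto simp: F_def)
    qed
    moreover have "real_analytic_on (ball 0 1) (F \<tau>)"
    proof (rule analytic_at_pt_imp_real_analytic_on)
      fix a :: 'a assume a: "a \<in> ball 0 1"
      have "P = (\<lambda>x. \<Sum>b\<in>Basis. (P x \<bullet> b) *\<^sub>R b)" by (simp add: euclidean_representation)
      moreover have "analytic_at_pt a (\<lambda>x. \<Sum>b\<in>Basis. (P x \<bullet> b) *\<^sub>R b)"
        by (intro analytic_at_pt_sum analytic_at_pt_scaleR analytic_at_pt_const analytic_at_pt_real_polynomial poly)
      ultimately have "analytic_at_pt a P" by simp
      then have "analytic_at_pt a (\<lambda>x. G \<tau> (x \<bullet> x) *\<^sub>R P x)" by (intro analytic_at_pt_scaleR an)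
      moreover have "eventually (\<lambda>x. G \<tau> (x \<bullet> x) *\<^sub>R P x = F \<tau> x) (nhds a)"
        by (rule eventually_mono[OF eventually_nhds_in_open[OF open_ball a]]) (auto simp: F_def)
      ultimately show "analytic_at_pt a (F \<tau>)" by (rule analytic_at_pt_cong)
    qed simp
    moreover have "F \<tau> x = \<phi>\<^sub>0 *\<^sub>R f x" if "x \<in> sphere 0 1" for x
      using that fP[OF that] G1 by (simp add: F_def dot_square_norm)
    moreover have "minimal_submanifold (UNIV :: ('a \<times> 'b) set) ((\<lambda>x. (x, F \<tau> x)) ` ball 0 1)"
    proof -
      have "minimal_submanifold UNIV ((\<lambda>x. (x, G \<tau> (x \<bullet> x) *\<^sub>R P x)) ` ball 0 1)"
      proof (rule hsm.minimal_radial_graph[where n=n and p=p])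
        show "\<exists>B C. adapted_frame P n p k x B C" if "x \<in> sphere 0 1" for x
          using LOMSE_of_type_frame[OF type pq(4) P fP that] by blast
        show "{0..<1} \<subseteq> V" using V(1) by auto
        fix r \<rho> \<rho>1 \<rho>2 :: real
        assume r: "0 < r" "r < 1" "\<rho> = r ^ k * G \<tau> (r\<^sup>2)"
          "\<rho>1 = real k * r ^ (k - 1) * G \<tau> (r\<^sup>2) + 2 * r ^ (k + 1) * G1 (r\<^sup>2)"
          "\<rho>2 = real k * (real k - 1) * r ^ (k - 2) * G \<tau> (r\<^sup>2) + (4 * real k + 2) * r ^ k * G1 (r\<^sup>2)
          + 4 * r ^ (k + 2) * G2 (r\<^sup>2)"
        have Leq: "real k * (real k + real n - 1) / real p = L" using lambda(2) by (simp add: L_def)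
        have "real n - real p = 1" using pq(3) by simp
        then show "\<rho>2 / (1 + \<rho>1\<^sup>2) + (real n - real p) * (\<rho>1 / r) +
            real p * (\<rho>1 / r - real k * (real k + real n - 1) / real p * \<rho> / r\<^sup>2) /
            (1 + real k * (real k + real n - 1) / real p * (\<rho> / r)\<^sup>2) = 0"
          unfolding Leq unfolding op[symmetric] using de[OF r(1,3,4,5)] by simp
      qed (use pq(4) V(2) dG in auto)
      moreover have "(\<lambda>x. (x, G \<tau> (x \<bullet> x) *\<^sub>R P x)) ` ball 0 1 = (\<lambda>x. (x, F \<tau> x)) ` ball 0 1"
        by (rule image_cong) (auto simp: F_def)
      ultimately show ?thesis by simp
    qed
    ultimately show ?thesis unfolding analytic_Dirichlet_solutions_def by blast
  qed
  then have sub: "F ` J \<subseteq> analytic_Dirichlet_solutions (\<lambda>x. \<phi>\<^sub>0 *\<^sub>R f x)" by (rule image_subsetI)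
  \<comment> \<open>\<open>P\<close> vanishes only at the origin, so equal maps have equal functions
    \<open>G\<close> on the open unit interval. Their limits exp(\<kappa> \<tau>) at 0 then
    coincide, and \<kappa> is nonzero.\<close>
  have inj: "inj_on F J"
  proof (rule inj_onI)
    fix \<tau> \<tau>' assume \<tau>: "\<tau> \<in> J" "\<tau>' \<in> J" and eq: "F \<tau> = F \<tau>'"
    have cont: "isCont (G s) 0" if "s \<in> J" for s
    proof -
      obtain V G1 where "{0..} \<subseteq> V" "\<forall>y\<in>V. (G s has_real_derivative G1 y) (at y)"
        using bspec[OF G \<open>s \<in> J\<close>] by blast
      then have "(G s has_real_derivative G1 0) (at 0)" by auto
      then show ?thesis by (rule DERIV_isCont)
    qed
    obtain e :: 'a where e: "e \<in> Basis" using nonempty_Basis by blast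
    have Geq: "G \<tau> (r\<^sup>2) = G \<tau>' (r\<^sup>2)" if r: "0 < r" "r < 1" for r
    proof -
      have x: "r *\<^sub>R e \<in> cball 0 1" using r e by simp
      have "P (r *\<^sub>R e) \<bullet> P (r *\<^sub>R e) \<noteq> 0" unfolding hsm.inner_P using r e by simp
      then have "P (r *\<^sub>R e) \<noteq> 0" by auto
      moreover have "F \<tau> (r *\<^sub>R e) = F \<tau>' (r *\<^sub>R e)" using eq by simp
      ultimately show ?thesis using x e by (simp add: F_def power2_eq_square inner_Basis)
    qed
    have lim: "((\<lambda>r. G s (r\<^sup>2)) \<longlongrightarrow> exp (ode.\<kappa> * s)) (at_right 0)" if s: "s \<in> J" for s
    proof -
      have "((\<lambda>r::real. r\<^sup>2) \<longlongrightarrow> 0\<^sup>2) (at_right 0)" by (intro tendsto_intros)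
      then have "((\<lambda>r. G s (r\<^sup>2)) \<longlongrightarrow> G s 0) (at_right 0)"
        by (intro isCont_tendsto_compose[OF cont[OF s]]) simp
      then show ?thesis using bspec[OF G s] by simp
    qed
    have "eventually (\<lambda>r. G \<tau> (r\<^sup>2) = G \<tau>' (r\<^sup>2)) (at_right 0)"
      by (rule eventually_at_rightI[of 0 1]) (auto intro: Geq)
    then have "((\<lambda>r. G \<tau>' (r\<^sup>2)) \<longlongrightarrow> exp (ode.\<kappa> * \<tau>)) (at_right 0)"
      by (rule tendsto_cong[THEN iffD1, OF _ lim[OF \<tau>(1)]])
    then have "exp (ode.\<kappa> * \<tau>) = exp (ode.\<kappa> * \<tau>')"
      by (rule tendsto_unique[OF trivial_limit_at_right_real _ lim[OF \<tau>(2)]])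
    then have "ode.\<kappa> * \<tau> = ode.\<kappa> * \<tau>'" by (rule exp_inj_iff[THEN iffD1])
    moreover have "ode.\<kappa> \<noteq> 0" using ode.\<kappa>_ge by linarith
    ultimately show "\<tau> = \<tau>'" by (rule mult_left_cancel[THEN iffD1, rotated])
  qed
  show ?thesis
  proof
    assume "finite (analytic_Dirichlet_solutions (\<lambda>x. \<phi>\<^sub>0 *\<^sub>R f x))"
    then have "finite (F ` J)" by (rule finite_subset[OF sub])
    then have "finite J" by (rule finite_imageD[OF _ inj])
    with J show False by contradiction
  qed
qed

end
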